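(* Let $T>0$ and consider the Cauchy problem $$\partial_t\rho+\partial_\theta(\rho u)=0,\qquad (\theta,\Omega)\in\mathbb T\times\mathbb R,\ t>0,$$ $$\partial_t(\rho u)+\partial_\theta(\rho u^2)=\frac1m\left(-\rho u+\rho\Omega+K\rho\int_{\mathbb T\times\mathbb R}\sin(\theta_*-\theta)\rho(\theta_*,\Omega_*,t)g(\Omega_* )\,d\theta_*d\Omega_*\right),$$ with initial data $(\rho,u)|_{t=0}=(\rho_0,u_0)$ satisfying $$\|\rho_0\|_{H^2_g}+\|\rho_0\|_{L^\infty}+\|u_0\|_{H^3_g}+\|\partial_\theta u_0\|_{L^\infty}<N\ \text{ for some } N>0,\qquad \rho_0>0\ \text{ in }\mathbb T\times\mathbb R.$$ Then the following hold. (i) (Subcritical region) If $1\ge4Km$ and $$\partial_\theta u_0(\theta,\Omega)\ge\frac{-1-\sqrt{1-4Km}}{2m}\qquad\text{for all }(\theta,\Omega)\in\mathbb T\times\mathbb R,$$ then the system has a global solution $(\rho,u)\in\mathcal C([0,T);H^2_g(\mathbb T\times\mathbb R))\times\mathcal C([0,T);H^3_g(\mathbb T\times\mathbb R))$. (ii) (Supercritical region) If there exists $(\theta_*,\Omega_* )$ such that $$\partial_\theta u_0(\theta_*,\Omega_* )<\frac{-1-\sqrt{1+4Km}}{2m},$$ then the solution blows up in finite time.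
   Context: $\mathbb T=\mathbb R/(2\pi\mathbb Z)$; $m>0$, $K>0$ are fixed constants. $g=g(\Omega)\ge0$ is a fixed distribution function with $\int_{\mathbb R}g\,d\Omega=1$ and $\int_{\mathbb R}\Omega^2g\,d\Omega<\infty$. The initial density satisfies $\int_{\mathbb T}\rho_0(\theta,\Omega)\,d\theta=1$ for $\Omega\in\mathbb R$. $\|f\|_{L^2_g}=\left(\int_{\mathbb T\times\mathbb R}f^2(\theta,\Omega)g(\Omega)\,d\theta d\Omega\right)^{1/2}$, and $H^s_g$ is the $s$-th order $L^2_g$ Sobolev space, with norm built from the $L^2_g$ norms of $\partial_\theta^kf$, $0\le k\le s$. $L^\infty$ is the usual unweighted space. "The solution" in (ii) is the unique local strong solution with $\rho\in\mathcal C([0,T_0];H^2_g)\cap L^\infty$, $u\in\mathcal C([0,T_0];H^3_g)$, $\partial_\theta u\in L^\infty$. *)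

theory Defs
  imports "HOL-Analysis.Analysis"
begin

text \<open>
  A function on the cylinder (circle times line) is a curried function of the angle
  \<open>\<theta>\<close> and the natural frequency \<open>\<Omega>\<close> that is \<open>2\<pi>\<close>-periodic in \<open>\<theta>\<close>. A time-dependent
  one takes the time as its first argument.

  The equations contain no \<open>\<Omega>\<close>-derivative, and the pointwise hypotheses on the data
  concern individual values of \<open>\<Omega>\<close>. Functions are therefore not identified
  when they agree almost everywhere: all pointwise requirements, including boundedness and the
  equations themselves, are imposed for every \<open>\<Omega>\<close>.
\<close>

definition torus :: "real measure" where
  "torus = restrict_space lborel {0..<2 * pi}"

definition cyl :: "(real \<times> real) measure" where
  "cyl = torus \<Otimes>\<^sub>M lborel"

definition dtheta :: "(real \<Rightarrow> real \<Rightarrow> real) \<Rightarrow> real \<Rightarrow> real \<Rightarrow> real" where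
  "dtheta f = (\<lambda>\<theta> \<Omega>. deriv (\<lambda>x. f x \<Omega>) \<theta>)"

definition theta_periodic :: "(real \<Rightarrow> real \<Rightarrow> real) \<Rightarrow> bool" where
  "theta_periodic f \<longleftrightarrow> (\<forall>\<theta> \<Omega>. f (\<theta> + 2 * pi) \<Omega> = f \<theta> \<Omega>)"

definition theta_C :: "nat \<Rightarrow> (real \<Rightarrow> real \<Rightarrow> real) \<Rightarrow> bool" where
  "theta_C k f \<longleftrightarrow> (\<forall>\<Omega>.
     (\<forall>j<k. \<forall>\<theta>. (\<lambda>x. (dtheta ^^ j) f x \<Omega>) differentiable (at \<theta>)) \<and>
     continuous_on UNIV (\<lambda>x. (dtheta ^^ k) f x \<Omega>))"

definition cyl_measurable :: "(real \<Rightarrow> real \<Rightarrow> real) \<Rightarrow> bool" where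
  "cyl_measurable f \<longleftrightarrow> (\<lambda>(\<theta>, \<Omega>). f \<theta> \<Omega>) \<in> borel_measurable borel"

definition L2g :: "(real \<Rightarrow> real) \<Rightarrow> (real \<Rightarrow> real \<Rightarrow> real) set" where
  "L2g g = {f. cyl_measurable f \<and> integrable cyl (\<lambda>(\<theta>, \<Omega>). (f \<theta> \<Omega>)\<^sup>2 * g \<Omega>)}"

definition L2g_norm :: "(real \<Rightarrow> real) \<Rightarrow> (real \<Rightarrow> real \<Rightarrow> real) \<Rightarrow> real" where
  "L2g_norm g f = sqrt (\<integral>(\<theta>, \<Omega>). (f \<theta> \<Omega>)\<^sup>2 * g \<Omega> \<partial>cyl)"

definition smooth_periodic :: "(real \<Rightarrow> real) \<Rightarrow> bool" where
  "smooth_periodic \<phi> \<longleftrightarrow>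
     (\<forall>x. \<phi> (x + 2 * pi) = \<phi> x) \<and> (\<forall>j x. (deriv ^^ j) \<phi> differentiable (at x))"

text \<open>
  The distributional derivative of order \<open>k\<close> in \<open>\<theta>\<close>, tested against products of a smooth
  function on the circle and a bounded Borel function of \<open>\<Omega>\<close>. The weight does not depend on
  \<open>\<theta>\<close>, so it commutes with the derivative; the product with the weight is integrable, whereas
  an element of the weighted space itself need not be locally integrable where \<open>g\<close>
  degenerates.
\<close>

definition weak_dtheta ::
    "(real \<Rightarrow> real) \<Rightarrow> nat \<Rightarrow> (real \<Rightarrow> real \<Rightarrow> real) \<Rightarrow> (real \<Rightarrow> real \<Rightarrow> real) \<Rightarrow> bool" where
  "weak_dtheta g k f h \<longleftrightarrow> f \<in> L2g g \<and> h \<in> L2g g \<and>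
     (\<forall>\<phi> \<psi>. smooth_periodic \<phi> \<longrightarrow> \<psi> \<in> borel_measurable borel \<longrightarrow> bounded (range \<psi>) \<longrightarrow>
        (\<integral>(\<theta>, \<Omega>). f \<theta> \<Omega> * (deriv ^^ k) \<phi> \<theta> * \<psi> \<Omega> * g \<Omega> \<partial>cyl)
        = (-1) ^ k * (\<integral>(\<theta>, \<Omega>). h \<theta> \<Omega> * \<phi> \<theta> * \<psi> \<Omega> * g \<Omega> \<partial>cyl))"

text \<open>
  The Sobolev space, for \<open>s \<ge> 1\<close>. Its elements are represented by functions that are of class
  \<open>C\<^sup>s\<^sup>-\<^sup>1\<close> in \<open>\<theta>\<close> for every \<open>\<Omega>\<close>. By the one-dimensional Sobolev embedding
  such a representative always exists for almost every \<open>\<Omega>\<close> with \<open>g \<Omega> > 0\<close>; at the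
  remaining \<open>\<Omega>\<close>, which the norm does not see, the condition is what gives
  \<open>\<partial>\<^sub>\<theta> u\<close> and the equations a pointwise meaning.
\<close>

definition Hg :: "(real \<Rightarrow> real) \<Rightarrow> nat \<Rightarrow> (real \<Rightarrow> real \<Rightarrow> real) set" where
  "Hg g s = {f. theta_periodic f \<and> cyl_measurable f \<and> theta_C (s - 1) f \<and>
     (\<forall>k\<le>s. \<exists>h. weak_dtheta g k f h)}"

text \<open>The choice is immaterial: weak derivatives agree almost everywhere for the weight.\<close>

definition Hg_norm :: "(real \<Rightarrow> real) \<Rightarrow> nat \<Rightarrow> (real \<Rightarrow> real \<Rightarrow> real) \<Rightarrow> real" where
  "Hg_norm g s f = sqrt (\<Sum>k\<le>s. (L2g_norm g (SOME h. weak_dtheta g k f h))\<^sup>2)"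

text \<open>
  The supremum is taken over all points, in accordance with the convention stated at the
  beginning; it does not involve the weight.
\<close>

definition Linf :: "(real \<Rightarrow> real \<Rightarrow> real) set" where
  "Linf = {f. cyl_measurable f \<and> (\<exists>M. \<forall>\<theta> \<Omega>. \<bar>f \<theta> \<Omega>\<bar> \<le> M)}"

definition Linf_norm :: "(real \<Rightarrow> real \<Rightarrow> real) \<Rightarrow> real" where
  "Linf_norm f = (SUP (\<theta>, \<Omega>). \<bar>f \<theta> \<Omega>\<bar>)"

definition state_space ::
    "(real \<Rightarrow> real) \<Rightarrow> ((real \<Rightarrow> real \<Rightarrow> real) \<times> (real \<Rightarrow> real \<Rightarrow> real)) set" where
  "state_space g = {(\<rho>, u). \<rho> \<in> Hg g 2 \<and> \<rho> \<in> Linf \<and> u \<in> Hg g 3 \<and> dtheta u \<in> Linf}"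

definition state_norm ::
    "(real \<Rightarrow> real) \<Rightarrow> (real \<Rightarrow> real \<Rightarrow> real) \<Rightarrow> (real \<Rightarrow> real \<Rightarrow> real) \<Rightarrow> real" where
  "state_norm g \<rho> u = Hg_norm g 2 \<rho> + Linf_norm \<rho> + Hg_norm g 3 u + Linf_norm (dtheta u)"

definition continuous_in_Hg ::
    "(real \<Rightarrow> real) \<Rightarrow> nat \<Rightarrow> real \<Rightarrow> (real \<Rightarrow> real \<Rightarrow> real \<Rightarrow> real) \<Rightarrow> bool" where
  "continuous_in_Hg g s T f \<longleftrightarrow> (\<forall>t\<in>{0..<T}. f t \<in> Hg g s \<and>
     ((\<lambda>r. Hg_norm g s (\<lambda>\<theta> \<Omega>. f r \<theta> \<Omega> - f t \<theta> \<Omega>)) \<longlongrightarrow> 0) (at t within {0..<T}))"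

definition locally_Linf :: "real \<Rightarrow> (real \<Rightarrow> real \<Rightarrow> real \<Rightarrow> real) \<Rightarrow> bool" where
  "locally_Linf T f \<longleftrightarrow> (\<forall>t\<in>{0..<T}. f t \<in> Linf) \<and>
     (\<forall>t\<in>{0..<T}. \<exists>M. \<forall>r\<in>{0..t}. \<forall>\<theta> \<Omega>. \<bar>f r \<theta> \<Omega>\<bar> \<le> M)"

definition pointwise_regular :: "real \<Rightarrow> (real \<Rightarrow> real \<Rightarrow> real \<Rightarrow> real) \<Rightarrow> bool" where
  "pointwise_regular T f \<longleftrightarrow> (\<forall>\<Omega>.
     continuous_on ({0..<T} \<times> UNIV) (\<lambda>(t, \<theta>). f t \<theta> \<Omega>) \<and>
     continuous_on ({0..<T} \<times> UNIV) (\<lambda>(t, \<theta>). dtheta (f t) \<theta> \<Omega>) \<and>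
     (\<forall>t\<in>{0<..<T}. \<forall>\<theta>. (\<lambda>r. f r \<theta> \<Omega>) differentiable (at t)))"

definition continuity_eq ::
    "real \<Rightarrow> (real \<Rightarrow> real \<Rightarrow> real \<Rightarrow> real) \<Rightarrow> (real \<Rightarrow> real \<Rightarrow> real \<Rightarrow> real) \<Rightarrow> bool" where
  "continuity_eq T \<rho> u \<longleftrightarrow> (\<forall>t\<in>{0<..<T}. \<forall>\<theta> \<Omega>.
     deriv (\<lambda>r. \<rho> r \<theta> \<Omega>) t + dtheta (\<lambda>x w. \<rho> t x w * u t x w) \<theta> \<Omega> = 0)"

definition momentum_eq ::
    "(real \<Rightarrow> real) \<Rightarrow> real \<Rightarrow> real \<Rightarrow> real \<Rightarrow>
     (real \<Rightarrow> real \<Rightarrow> real \<Rightarrow> real) \<Rightarrow> (real \<Rightarrow> real \<Rightarrow> real \<Rightarrow> real) \<Rightarrow> bool" where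
  "momentum_eq g m K T \<rho> u \<longleftrightarrow> (\<forall>t\<in>{0<..<T}. \<forall>\<theta> \<Omega>.
     deriv (\<lambda>r. \<rho> r \<theta> \<Omega> * u r \<theta> \<Omega>) t
       + dtheta (\<lambda>x w. \<rho> t x w * (u t x w)\<^sup>2) \<theta> \<Omega>
     = 1 / m * (- \<rho> t \<theta> \<Omega> * u t \<theta> \<Omega> + \<rho> t \<theta> \<Omega> * \<Omega>
         + K * \<rho> t \<theta> \<Omega> *
             (\<integral>(\<theta>', \<Omega>'). sin (\<theta>' - \<theta>) * \<rho> t \<theta>' \<Omega>' * g \<Omega>' \<partial>cyl)))"

text \<open>Strong solutions on the half-open interval from \<open>0\<close> to \<open>T\<close>.\<close>

definition strong_solution ::
    "(real \<Rightarrow> real) \<Rightarrow> real \<Rightarrow> real \<Rightarrow> (real \<Rightarrow> real \<Rightarrow> real) \<Rightarrow> (real \<Rightarrow> real \<Rightarrow> real) \<Rightarrow> real \<Rightarrow>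
     (real \<Rightarrow> real \<Rightarrow> real \<Rightarrow> real) \<Rightarrow> (real \<Rightarrow> real \<Rightarrow> real \<Rightarrow> real) \<Rightarrow> bool" where
  "strong_solution g m K \<rho>0 u0 T \<rho> u \<longleftrightarrow>
     \<rho> 0 = \<rho>0 \<and> u 0 = u0 \<and>
     continuous_in_Hg g 2 T \<rho> \<and> continuous_in_Hg g 3 T u \<and>
     locally_Linf T \<rho> \<and> locally_Linf T (\<lambda>t. dtheta (u t)) \<and>
     pointwise_regular T \<rho> \<and> pointwise_regular T u \<and>
     continuity_eq T \<rho> u \<and> momentum_eq g m K T \<rho> u"

text \<open>
  The strong solution with the given data exists up to a finite time, is unique (any strong
  solution agrees with it on the common interval of existence), and its norm diverges there.
\<close>

definition solution_blows_up ::
    "(real \<Rightarrow> real) \<Rightarrow> real \<Rightarrow> real \<Rightarrow> (real \<Rightarrow> real \<Rightarrow> real) \<Rightarrow> (real \<Rightarrow> real \<Rightarrow> real) \<Rightarrow> bool" where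
  "solution_blows_up g m K \<rho>0 u0 \<longleftrightarrow> (\<exists>Tb>0. \<exists>\<rho> u.
     strong_solution g m K \<rho>0 u0 Tb \<rho> u \<and>
     (\<forall>T>0. \<forall>\<rho>' u'. strong_solution g m K \<rho>0 u0 T \<rho>' u' \<longrightarrow>
        (\<forall>t. 0 \<le> t \<and> t < min T Tb \<longrightarrow> \<rho>' t = \<rho> t \<and> u' t = u t)) \<and>
     filterlim (\<lambda>t. state_norm g (\<rho> t) (u t)) at_top (at_left Tb))"

end

theory Submission imports Defs begin

text \<open>
  The equations are solved along characteristics. With \<open>z = \<integral> e\<^sup>i\<^sup>\<theta> \<rho> g\<close> the interaction
  term is \<open>K Im (z e\<^sup>-\<^sup>i\<^sup>\<theta>)\<close>, so for a given \<open>z\<close> the characteristics solve a second-order equation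
  whose solutions depend smoothly on the starting point, and conservation of mass turns the definition of \<open>z\<close>
  into a causal fixed-point equation that has exactly one solution, for all times. The solution is then
  \<open>u (t, X) = V\<close>, \<open>\<rho> (t, X) = \<rho>\<^sub>0 / J\<close> with \<open>J = \<partial>X / \<partial>\<theta>\<close>, as long as \<open>J\<close> stays
  bounded away from zero; its \<open>\<theta>\<close>-derivatives are affine in the highest derivatives of the data, and the lower-order
  products are controlled by the interpolation inequality \<open>\<integral> f'\<^sup>4 \<le> 9 \<parallel>f\<parallel>\<^sup>2 \<integral> f''\<^sup>2\<close>.

  Along characteristics \<open>m J'' + J' + K a J = 0\<close> with \<open>\<bar>a\<bar> \<le> 1\<close>. Comparison with \<open>a = 1\<close> keeps \<open>J\<close>
  positive for subcritical data, comparison with \<open>a = - 1\<close> makes it vanish in finite time for supercritical data.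
  A bound on \<open>\<partial>\<^sub>\<theta> u = J' / J\<close> would keep \<open>J\<close> away from zero for a further fixed time, so it must diverge.
\<close>

section \<open>Damped second-order equations\<close>

text \<open>The mean field is computed over the starting points of the characteristics, with weight
  \<open>rho0 * g\<close>, so it makes sense even after characteristics have crossed. This separates
  the two difficulties: the field is found once, for all times and all data, and the solution
  persists as long as \<open>J\<close> has a positive lower bound that is uniform on the whole
  cylinder. No compactness supports uniformity in the frequency; it comes from linearised equations
  whose coefficients are bounded by the mean field alone, so that only the bound on the first
  derivative of \<open>u0\<close> enters. The velocity itself may be unbounded in the frequency, so
  the weighted estimates are made relative to the majorant \<open>S\<close>, whose square is
  integrable for the weight. Top-order derivatives exist only almost everywhere, and only for almost
  every frequency with \<open>g > 0\<close>; they are treated as Lebesgue densities on slices, tied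
  to the weak derivatives by a countable family of tests. For uniqueness, an arbitrary strong
  solution is shown to carry a field solving the same fixed-point equation; positivity of its
  density comes first, since the momentum equation has to be divided by it.\<close>

lemma gronwall_exp:
  fixes N N' :: "real \<Rightarrow> real"
  assumes cont: "continuous_on {0..T} N"
    and der: "\<And>t. 0 < t \<Longrightarrow> t < T \<Longrightarrow> (N has_real_derivative N' t) (at t)"
    and le: "\<And>t. 0 < t \<Longrightarrow> t < T \<Longrightarrow> N' t \<le> c * N t + q * exp (l * t)"
    and l: "c < l" and q: "q \<ge> 0" and N0: "N 0 \<ge> 0" and t: "t \<in> {0..T}"
  shows "N t \<le> (N 0 + q / (l - c)) * exp (l * t)"
proof -
  \<comment> \<open>Integrating factor, minus the primitive of the forcing it picks up; the
    inequality for \<open>N'\<close> makes this nonincreasing. As the forcing grows faster than the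
    homogeneous part, its effect is a multiple \<open>q / (l - c)\<close> of
    \<open>exp (l * t)\<close>.\<close>
  define M where "M t = exp (- c * t) * N t - q / (l - c) * exp ((l - c) * t)" for t
  have "M 0 \<ge> M t"
  proof (rule DERIV_nonpos_imp_decreasing_open[of 0 t M])
    show "0 \<le> t" using t by simp
    have "continuous_on {0..t} N" using cont t by (auto intro: continuous_on_subset)
    then show "continuous_on {0..t} M" unfolding M_def by (intro continuous_intros)
    fix s assume s: "0 < s" "s < t"
    have eq: "exp (- (c * s)) * exp (l * s) = exp ((l - c) * s)"
      by (simp add: exp_add[symmetric] algebra_simps)
    have "(M has_real_derivative (exp (- c * s) * (N' s - c * N s) - q * exp ((l - c) * s))) (at s)"
    proof -
      have "(M has_real_derivative (exp (- c * s) * N' s + (- c * exp (- c * s)) * N s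
          - q / (l - c) * ((l - c) * exp ((l - c) * s)))) (at s)"
        unfolding M_def using s t by (auto intro!: derivative_eq_intros der)
      note D = this
      have *: "q / (l - c) * ((l - c) * exp ((l - c) * s)) = q * exp ((l - c) * s)"
        using l by simp
      from D[unfolded *] show ?thesis by (simp add: right_diff_distrib mult_ac)
    qed
    moreover have "exp (- c * s) * (N' s - c * N s) \<le> exp (- c * s) * (q * exp (l * s))"
      using le[of s] s t by (intro mult_left_mono) auto
    ultimately show "\<exists>y. DERIV M s :> y \<and> y \<le> 0"
      using eq by (intro exI[of _ "exp (- c * s) * (N' s - c * N s) - q * exp ((l - c) * s)"])
        (auto simp: algebra_simps)
  qed
  then have *: "exp (- c * t) * N t \<le> N 0 - q / (l - c) + q / (l - c) * exp ((l - c) * t)"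
    by (simp add: M_def)
  have "N t = exp (c * t) * (exp (- c * t) * N t)"
    by (simp add: exp_minus)
  also have "\<dots> \<le> exp (c * t) * (N 0 - q / (l - c) + q / (l - c) * exp ((l - c) * t))"
    using * by (intro mult_left_mono) auto
  also have "\<dots> = exp (c * t) * (N 0 - q / (l - c)) + q / (l - c) * (exp (c * t) * exp ((l - c) * t))"
    by (simp add: algebra_simps)
  also have "exp (c * t) * exp ((l - c) * t) = exp (l * t)"
    by (simp add: exp_add[symmetric] algebra_simps)
  also have "exp (c * t) * (N 0 - q / (l - c)) \<le> exp (c * t) * N 0"
    using l q by (intro mult_left_mono) auto
  also have "\<dots> \<le> exp (l * t) * N 0"
    using l t N0 by (intro mult_right_mono) (auto intro: mult_right_mono)
  finally show ?thesis by (simp add: algebra_simps)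
qed

section \<open>Fixed points of causal maps on the half-line\<close>

lemma continuous_on_half_line:
  fixes x :: "real \<Rightarrow> 'a::metric_space"
  assumes "\<And>T. T \<ge> 0 \<Longrightarrow> continuous_on {0..T} x"
  shows "continuous_on {0..} x"
proof (clarsimp simp: continuous_on_eq_continuous_within)
  fix t :: real assume "t \<ge> 0"
  then have "continuous (at t within {0..t+1}) x"
    using assms[of "t+1"] by (simp add: continuous_on_eq_continuous_within)
  moreover have "at t within {0..t+1} = at t within {0..}"
    by (rule at_within_nhd[of _ "{..<t+1}"]) auto
  ultimately show "continuous (at t within {0..}) x" by simp
qed

text \<open>Banach iteration in the distance weighted by \<open>exp (l * t)\<close>. Since
  \<open>contr\<close> looks only at times up to \<open>t\<close>, the ratio 1/2 holds on every
  interval \<open>{0..T}\<close> with the same \<open>l\<close>, even for functions unbounded on the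
  half-line; convergence is locally uniform.\<close>

lemma causal_fixed_point:
  fixes G :: "(real \<Rightarrow> 'a::banach) \<Rightarrow> real \<Rightarrow> 'a"
  assumes S: "closed S" "s0 \<in> S" and l: "l \<ge> 0"
    and cont: "\<And>x. continuous_on {0..} x \<Longrightarrow> (\<And>t. t \<ge> 0 \<Longrightarrow> x t \<in> S) \<Longrightarrow>
        continuous_on {0..} (G x) \<and> (\<forall>t\<ge>0. G x t \<in> S)"
    and contr: "\<And>x y t d. continuous_on {0..} x \<Longrightarrow> (\<And>t. t \<ge> 0 \<Longrightarrow> x t \<in> S) \<Longrightarrow>
        continuous_on {0..} y \<Longrightarrow> (\<And>t. t \<ge> 0 \<Longrightarrow> y t \<in> S) \<Longrightarrow> 0 \<le> t \<Longrightarrow> 0 \<le> d \<Longrightarrow>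
        (\<And>s. s \<in> {0..t} \<Longrightarrow> dist (x s) (y s) \<le> d * exp (l * s)) \<Longrightarrow>
        dist (G x t) (G y t) \<le> d / 2 * exp (l * t)"
  shows "\<exists>x. continuous_on {0..} x \<and> (\<forall>t\<ge>0. x t \<in> S \<and> G x t = x t)"
proof -
  define X where "X n = (G ^^ n) (\<lambda>_. s0)" for n
  have X_Suc: "X (Suc n) = G (X n)" for n by (simp add: X_def)
  have X: "continuous_on {0..} (X n) \<and> (\<forall>t\<ge>0. X n t \<in> S)" for n
    by (induction n) (use S cont X_Suc in \<open>auto simp: X_def\<close>)
  \<comment> \<open>Written as a telescoping series, the limit is one function on the half-line,
    fixed before any interval is chosen.\<close>
  define x where "x t = X 0 t + (\<Sum>k. X (Suc k) t - X k t)" for t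
  have conv: "\<exists>D\<ge>0. (\<forall>n. \<forall>t\<in>{0..T}. dist (X n t) (X (Suc n) t) \<le> D / 2 ^ n * exp (l * t))
      \<and> uniform_limit {0..T} X x sequentially" if T: "T \<ge> 0" for T
  proof -
    have "continuous_on {0..T} (\<lambda>t. dist (X 0 t) (X 1 t))"
      by (intro continuous_intros; rule continuous_on_subset[OF conjunct1[OF X]]) auto
    from compact_continuous_image[OF this] have "bounded ((\<lambda>t. dist (X 0 t) (X 1 t)) ` {0..T})"
      by (simp add: compact_imp_bounded)
    then obtain D where D: "D > 0" "\<And>t. t \<in> {0..T} \<Longrightarrow> dist (X 0 t) (X 1 t) \<le> D"
      unfolding bounded_pos by fastforce
    have step: "dist (X n t) (X (Suc n) t) \<le> D / 2 ^ n * exp (l * t)" if "t \<in> {0..T}" for n t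
      using that
    proof (induction n arbitrary: t)
      case 0
      have "D * 1 \<le> D * exp (l * t)" using D 0 l by (intro mult_left_mono) auto
      then show ?case using D(2)[of t] 0 by simp
    next
      case (Suc n)
      have "dist (G (X n) t) (G (X (Suc n)) t) \<le> (D / 2 ^ n) / 2 * exp (l * t)"
      proof (rule contr)
        fix s assume "s \<in> {0..t}"
        then show "dist (X n s) (X (Suc n) s) \<le> D / 2 ^ n * exp (l * s)"
          using Suc.prems by (intro Suc.IH) auto
      qed (use Suc.prems X D in auto)
      then show ?case by (simp add: X_Suc field_simps)
    qed
    have "uniform_limit {0..T} (\<lambda>n t. \<Sum>k<n. X (Suc k) t - X k t)
        (\<lambda>t. \<Sum>k. X (Suc k) t - X k t) sequentially"
    proof (rule Weierstrass_m_test)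
      show "summable (\<lambda>k. D * exp (l * T) * (1 / 2) ^ k)"
        by (intro summable_mult summable_geometric) auto
      fix k t assume t: "t \<in> {0..T}"
      have "norm (X (Suc k) t - X k t) \<le> D / 2 ^ k * exp (l * t)"
        using step[OF t, of k] by (simp add: dist_norm norm_minus_commute)
      also have "\<dots> \<le> D / 2 ^ k * exp (l * T)"
        using t D l by (intro mult_left_mono) (auto intro: mult_left_mono)
      finally show "norm (X (Suc k) t - X k t) \<le> D * exp (l * T) * (1 / 2) ^ k"
        by (simp add: field_simps)
    qed
    then have "uniform_limit {0..T} (\<lambda>n t. X 0 t + (\<Sum>k<n. X (Suc k) t - X k t)) x sequentially"
      unfolding x_def by (intro uniform_limit_intros)
    moreover have "X 0 t + (\<Sum>k<n. X (Suc k) t - X k t) = X n t" for n t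
      using sum_lessThan_telescope[of "\<lambda>k. X k t" n] by simp
    ultimately show ?thesis using step D(1) by (intro exI[of _ D]) auto
  qed
  have cx: "continuous_on {0..} x"
  proof (rule continuous_on_half_line)
    fix T :: real assume "T \<ge> 0"
    from conv[OF this] have "uniform_limit {0..T} X x sequentially" by auto
    moreover have "continuous_on {0..T} (X n)" for n
      by (rule continuous_on_subset[OF conjunct1[OF X]]) auto
    ultimately show "continuous_on {0..T} x"
      by (intro uniform_limit_theorem[where F = sequentially and f = X] always_eventually) auto
  qed
  have lim: "(\<lambda>n. X n t) \<longlonglongrightarrow> x t" if "t \<ge> 0" for t
    using conv[of t] that by (auto intro: tendsto_uniform_limitI)
  have xS: "x t \<in> S" if "t \<ge> 0" for t
    using closed_sequentially[OF S(1) _ lim[OF that]] X that by blast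
  have "G x t = x t" if t: "t \<ge> 0" for t
  proof -
    have "(\<lambda>n. X (Suc n) t) \<longlonglongrightarrow> G x t"
    proof (rule metric_LIMSEQ_I)
      fix e :: real assume e: "e > 0"
      \<comment> \<open>Dividing out the weight at \<open>t\<close>: closeness \<open>e'\<close> up
        to time \<open>t\<close> becomes, after one use of \<open>contr\<close>, a distance of at
        most \<open>e / 2\<close>.\<close>
      define e' where "e' = e / exp (l * t)"
      have e': "e' > 0" using e by (simp add: e'_def)
      from conv[OF t] have "uniform_limit {0..t} X x sequentially" by auto
      from uniform_limitD[OF this e'] obtain M where
        M: "\<And>n s. n \<ge> M \<Longrightarrow> s \<in> {0..t} \<Longrightarrow> dist (X n s) (x s) < e'"
        unfolding eventually_sequentially by blast
      have "dist (X (Suc n) t) (G x t) < e" if n: "n \<ge> M" for n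
      proof -
        have "dist (G (X n) t) (G x t) \<le> e' / 2 * exp (l * t)"
        proof (rule contr)
          fix s assume s: "s \<in> {0..t}"
          have "e' * 1 \<le> e' * exp (l * s)" using e' s l by (intro mult_left_mono) auto
          then show "dist (X n s) (x s) \<le> e' * exp (l * s)" using M[OF n s] by simp
        qed (use X cx xS t e' in auto)
        then show ?thesis using e by (simp add: X_Suc e'_def)
      qed
      then show "\<exists>M. \<forall>n\<ge>M. dist (X (Suc n) t) (G x t) < e" by blast
    qed
    then show ?thesis using LIMSEQ_Suc[OF lim[OF t]] by (rule LIMSEQ_unique)
  qed
  with cx xS show ?thesis by blast
qed

text \<open>First-order form of \<open>m * y'' + y' = f\<close> with \<open>w = y'\<close>. The
  forcing is a function of time alone; a nonlinear equation is expressed by inserting the solution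
  into it, so that differences and multiples of solutions are again of this form.\<close>

definition so_sol :: "real \<Rightarrow> real \<Rightarrow> (real \<Rightarrow> real) \<Rightarrow> (real \<Rightarrow> real) \<Rightarrow> (real \<Rightarrow> real) \<Rightarrow> bool" where
  "so_sol m T f y w \<longleftrightarrow> continuous_on {0..T} y \<and> continuous_on {0..T} w \<and>
     (\<forall>t. 0 < t \<longrightarrow> t < T \<longrightarrow> (y has_real_derivative w t) (at t) \<and>
        (w has_real_derivative (f t - w t) / m) (at t))"

lemma so_sol_diff:
  "so_sol m T f y w \<Longrightarrow> so_sol m T f' y' w' \<Longrightarrow>
   so_sol m T (\<lambda>t. f t - f' t) (\<lambda>t. y t - y' t) (\<lambda>t. w t - w' t)"
  unfolding so_sol_def
  by (auto intro!: continuous_intros derivative_eq_intros simp: diff_divide_distrib)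

lemma so_sol_add:
  "so_sol m T f y w \<Longrightarrow> so_sol m T f' y' w' \<Longrightarrow>
   so_sol m T (\<lambda>t. f t + f' t) (\<lambda>t. y t + y' t) (\<lambda>t. w t + w' t)"
  unfolding so_sol_def
  by (auto intro!: continuous_intros derivative_eq_intros simp: diff_divide_distrib add_divide_distrib)

lemma so_sol_scale:
  "so_sol m T f y w \<Longrightarrow> so_sol m T (\<lambda>t. a * f t) (\<lambda>t. a * y t) (\<lambda>t. a * w t)"
  unfolding so_sol_def
  by (auto intro!: continuous_intros derivative_eq_intros simp: diff_divide_distrib algebra_simps)

lemma so_sol_cong:
  assumes "so_sol m T f y w" "\<And>t. 0 < t \<Longrightarrow> t < T \<Longrightarrow> f t = f' t"
  shows "so_sol m T f' y w"
  using assms unfolding so_sol_def by auto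

text \<open>Exponential rate of \<open>y^2 + w^2\<close>: the 1 bounds \<open>2 * y * w\<close>,
  \<open>L / m\<close> the Lipschitz part of the forcing, and \<open>1 / m\<close> one half of the
  Young split of its inhomogeneous part. The damping has the good sign and is dropped.\<close>

definition so_rate :: "real \<Rightarrow> real \<Rightarrow> real" where "so_rate m L = 1 + (L + 1) / m"

text \<open>Energy method. The inhomogeneity may grow like \<open>exp (l * t)\<close> because the
  fixed-point argument measures differences with that weight; the denominator, large for large
  \<open>l\<close>, is the source of the contraction.\<close>

lemma so_energy:
  assumes m: "m > 0" and L: "L \<ge> 0" and sol: "so_sol m T f y w"
    and f: "\<And>t. 0 < t \<Longrightarrow> t < T \<Longrightarrow> \<bar>f t\<bar> \<le> L * \<bar>y t\<bar> + D * exp (l * t)"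
    and l: "so_rate m L < 2 * l" and t: "t \<in> {0..T}"
  shows "(y t)\<^sup>2 + (w t)\<^sup>2 \<le> ((y 0)\<^sup>2 + (w 0)\<^sup>2 + D\<^sup>2 / m / (2 * l - so_rate m L)) * exp (2 * l * t)"
proof (rule gronwall_exp[where N = "\<lambda>t. (y t)\<^sup>2 + (w t)\<^sup>2" and c = "so_rate m L" and T = T
      and N' = "\<lambda>t. 2 * y t * w t + 2 * w t * ((f t - w t) / m)"])
  show "continuous_on {0..T} (\<lambda>t. (y t)\<^sup>2 + (w t)\<^sup>2)"
    using sol unfolding so_sol_def by (intro continuous_intros) auto
  fix t assume t: "0 < t" "t < T"
  show "((\<lambda>t. (y t)\<^sup>2 + (w t)\<^sup>2) has_real_derivative 2 * y t * w t + 2 * w t * ((f t - w t) / m)) (at t)"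
    using sol t unfolding so_sol_def by (auto intro!: derivative_eq_intros)
  let ?D = "D * exp (l * t)"
  have "2 * w t * f t \<le> 2 * (\<bar>w t\<bar> * \<bar>f t\<bar>)"
    using abs_ge_self[of "w t * f t"] by (simp add: abs_mult)
  also have "\<dots> \<le> 2 * (\<bar>w t\<bar> * (L * \<bar>y t\<bar> + ?D))"
    using f[OF t] by (intro mult_left_mono) auto
  also have "\<dots> = L * (2 * \<bar>w t\<bar> * \<bar>y t\<bar>) + 2 * \<bar>w t\<bar> * ?D" by (simp add: algebra_simps)
  also have "\<dots> \<le> L * ((y t)\<^sup>2 + (w t)\<^sup>2) + ((w t)\<^sup>2 + ?D\<^sup>2)"
  proof (intro add_mono mult_left_mono L)
    show "2 * \<bar>w t\<bar> * \<bar>y t\<bar> \<le> (y t)\<^sup>2 + (w t)\<^sup>2"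
      using sum_squares_bound[of "\<bar>w t\<bar>" "\<bar>y t\<bar>"] by simp
    show "2 * \<bar>w t\<bar> * ?D \<le> (w t)\<^sup>2 + ?D\<^sup>2"
      using sum_squares_bound[of "\<bar>w t\<bar>" ?D] by simp
  qed
  finally have "2 * w t * (f t - w t) \<le> L * ((y t)\<^sup>2 + (w t)\<^sup>2) + ((w t)\<^sup>2 + ?D\<^sup>2)"
  proof -
    assume *: "2 * w t * f t \<le> L * ((y t)\<^sup>2 + (w t)\<^sup>2) + ((w t)\<^sup>2 + ?D\<^sup>2)"
    have "2 * w t * (f t - w t) = 2 * w t * f t - 2 * (w t)\<^sup>2"
      by (simp add: algebra_simps power2_eq_square)
    with * zero_le_power2[of "w t"] show ?thesis by linarith
  qed
  then have "2 * w t * (f t - w t) \<le> (L + 1) * ((y t)\<^sup>2 + (w t)\<^sup>2) + ?D\<^sup>2"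
    using zero_le_power2[of "y t"] unfolding distrib_right mult_1 by linarith
  then have "2 * w t * ((f t - w t) / m) \<le> ((L + 1) * ((y t)\<^sup>2 + (w t)\<^sup>2) + ?D\<^sup>2) / m"
    using m by (simp add: divide_right_mono)
  note A = this
  have B: "2 * y t * w t \<le> (y t)\<^sup>2 + (w t)\<^sup>2" using sum_squares_bound[of "y t" "w t"] by simp
  have "?D\<^sup>2 = D\<^sup>2 * exp (2 * l * t)"
    by (simp add: power_mult_distrib power2_eq_square mult_exp_exp[symmetric] exp_add[symmetric])
  from add_mono[OF B A[unfolded this]] have "2 * y t * w t + 2 * w t * ((f t - w t) / m)
      \<le> ((y t)\<^sup>2 + (w t)\<^sup>2) + ((L + 1) * ((y t)\<^sup>2 + (w t)\<^sup>2) + D\<^sup>2 * exp (2 * l * t)) / m"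
    .
  also have "\<dots> = so_rate m L * ((y t)\<^sup>2 + (w t)\<^sup>2) + D\<^sup>2 / m * exp (2 * l * t)"
    by (simp add: so_rate_def add_divide_distrib distrib_right)
  finally show "2 * y t * w t + 2 * w t * ((f t - w t) / m)
      \<le> so_rate m L * ((y t)\<^sup>2 + (w t)\<^sup>2) + D\<^sup>2 / m * exp (2 * l * t)" .
qed (use assms in auto)

text \<open>The case \<open>2 * l - so_rate m L = 1\<close> of \<open>so_energy\<close>, which
  removes the denominator; the factor \<open>1 + 1 / m\<close> absorbs the term
  \<open>D^2 / m\<close>.\<close>

definition so_const :: "real \<Rightarrow> real \<Rightarrow> real \<Rightarrow> real" where
  "so_const m L T = (1 + 1 / m) * exp ((so_rate m L + 1) * T)"

lemma so_const_pos: "m > 0 \<Longrightarrow> so_const m L T > 0"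
  by (simp add: so_const_def add_pos_pos)

lemma so_bound:
  assumes m: "m > 0" and L: "L \<ge> 0" and D: "D \<ge> 0" and sol: "so_sol m T f y w"
    and f: "\<And>t. 0 < t \<Longrightarrow> t < T \<Longrightarrow> \<bar>f t\<bar> \<le> L * \<bar>y t\<bar> + D" and t: "t \<in> {0..T}"
  shows "(y t)\<^sup>2 + (w t)\<^sup>2 \<le> so_const m L T * ((y 0)\<^sup>2 + (w 0)\<^sup>2 + D\<^sup>2)"
proof -
  define l where "l = (so_rate m L + 1) / 2"
  have r: "so_rate m L \<ge> 1" using m L by (simp add: so_rate_def)
  have "(y t)\<^sup>2 + (w t)\<^sup>2 \<le> ((y 0)\<^sup>2 + (w 0)\<^sup>2 + D\<^sup>2 / m / (2 * l - so_rate m L)) * exp (2 * l * t)"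
  proof (rule so_energy[OF m L sol _ _ t])
    fix s assume s: "0 < s" "s < T"
    have "D * 1 \<le> D * exp (l * s)" using D r s by (intro mult_left_mono) (auto simp: l_def)
    then show "\<bar>f s\<bar> \<le> L * \<bar>y s\<bar> + D * exp (l * s)" using f[OF s] by linarith
  qed (simp add: l_def)
  also have "\<dots> = ((y 0)\<^sup>2 + (w 0)\<^sup>2 + D\<^sup>2 / m) * exp ((so_rate m L + 1) * t)"
    by (simp add: l_def add_divide_distrib algebra_simps)
  also have "\<dots> \<le> ((1 + 1 / m) * ((y 0)\<^sup>2 + (w 0)\<^sup>2 + D\<^sup>2)) * exp ((so_rate m L + 1) * T)"
  proof (intro mult_mono)
    have "D\<^sup>2 / m \<le> ((y 0)\<^sup>2 + (w 0)\<^sup>2 + D\<^sup>2) / m"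
      using m by (intro divide_right_mono) auto
    then have "(y 0)\<^sup>2 + (w 0)\<^sup>2 + D\<^sup>2 / m \<le> ((y 0)\<^sup>2 + (w 0)\<^sup>2 + D\<^sup>2) + ((y 0)\<^sup>2 + (w 0)\<^sup>2 + D\<^sup>2) / m"
      using zero_le_power2[of D] by linarith
    then show "(y 0)\<^sup>2 + (w 0)\<^sup>2 + D\<^sup>2 / m \<le> (1 + 1 / m) * ((y 0)\<^sup>2 + (w 0)\<^sup>2 + D\<^sup>2)"
      unfolding distrib_right mult_1 times_divide_eq_left .
    show "exp ((so_rate m L + 1) * t) \<le> exp ((so_rate m L + 1) * T)"
      using t r by (auto intro!: mult_left_mono)
  qed (use m in auto)
  finally show ?thesis by (simp add: so_const_def algebra_simps)
qed

lemma so_unique: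
  assumes m: "m > 0" and L: "L \<ge> 0" and sol: "so_sol m T f y w" "so_sol m T f' y' w'"
    and f: "\<And>t. 0 < t \<Longrightarrow> t < T \<Longrightarrow> \<bar>f t - f' t\<bar> \<le> L * \<bar>y t - y' t\<bar>"
    and init: "y 0 = y' 0" "w 0 = w' 0" and t: "t \<in> {0..T}"
  shows "y t = y' t \<and> w t = w' t"
proof -
  have "(y t - y' t)\<^sup>2 + (w t - w' t)\<^sup>2 \<le> so_const m L T * ((y 0 - y' 0)\<^sup>2 + (w 0 - w' 0)\<^sup>2 + 0\<^sup>2)"
    using f by (intro so_bound[OF m L _ so_sol_diff[OF sol] _ t]) auto
  then have "(y t - y' t)\<^sup>2 + (w t - w' t)\<^sup>2 \<le> 0" using init by simp
  then show ?thesis by (simp add: sum_power2_le_zero_iff)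
qed

text \<open>Picard iteration for the pair of position and velocity. The solution is global because
  \<open>F\<close> is Lipschitz uniformly in time.\<close>

lemma so_exists:
  fixes F :: "real \<Rightarrow> real \<Rightarrow> real"
  assumes m: "m > 0" and L: "L \<ge> 0"
    and cont: "continuous_on ({0..} \<times> UNIV) (\<lambda>(t, y). F t y)"
    and lip: "\<And>t x y. t \<ge> 0 \<Longrightarrow> \<bar>F t x - F t y\<bar> \<le> L * \<bar>x - y\<bar>"
  shows "\<exists>y w. y 0 = y0 \<and> w 0 = w0 \<and> (\<forall>T. so_sol m T (\<lambda>t. F t (y t)) y w)"
proof -
  define h where "h x s = (snd (x s), (F s (fst (x s)) - snd (x s)) / m)" for x and s :: real
  define G where "G x t = (y0, w0) + integral {0..t} (h x)" for x and t :: real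
  \<comment> \<open>Lipschitz constant of the first-order vector field in the product norm; with the
    weight \<open>exp (2 * L' * t)\<close> the integral operator has ratio 1/2.\<close>
  define L' where "L' = 1 + (L + 1) / m"
  have L': "L' > 0" using m L by (simp add: L'_def add_pos_nonneg)
  have ch: "continuous_on {0..} (h x)" if "continuous_on {0..} x" for x
  proof -
    have "continuous_on {0..} (\<lambda>s. (\<lambda>(t, y). F t y) (s, fst (x s)))"
      by (rule continuous_on_compose2[OF cont]) (auto intro!: continuous_intros that)
    then show ?thesis unfolding h_def using m by (auto intro!: continuous_intros that)
  qed
  have ch': "continuous_on {0..T} (h x)" if "continuous_on {0..} x" for x T
    using ch[OF that] by (rule continuous_on_subset) auto
  have int: "h x integrable_on {0..T}" if "continuous_on {0..} x" for x T
    using ch'[OF that] by (rule integrable_continuous_interval)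
  have hl: "dist (h x s) (h y s) \<le> L' * dist (x s) (y s)" if "s \<ge> 0" for x y s
  proof -
    have f: "\<bar>fst (x s) - fst (y s)\<bar> \<le> dist (x s) (y s)" "\<bar>snd (x s) - snd (y s)\<bar> \<le> dist (x s) (y s)"
      using dist_fst_le[of "x s" "y s"] dist_snd_le[of "x s" "y s"] by (auto simp: dist_real_def)
    have "dist (h x s) (h y s) \<le> \<bar>snd (x s) - snd (y s)\<bar>
        + \<bar>(F s (fst (x s)) - snd (x s)) / m - (F s (fst (y s)) - snd (y s)) / m\<bar>"
      unfolding dist_norm h_def diff_Pair
      using norm_Pair_le[of "snd (x s) - snd (y s)" "(F s (fst (x s)) - snd (x s)) / m - (F s (fst (y s)) - snd (y s)) / m"]
      by (simp only: real_norm_def)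
    also have "\<bar>(F s (fst (x s)) - snd (x s)) / m - (F s (fst (y s)) - snd (y s)) / m\<bar>
        = \<bar>(F s (fst (x s)) - F s (fst (y s))) - (snd (x s) - snd (y s))\<bar> / m"
      using m by (simp add: diff_divide_distrib[symmetric] abs_divide)
    also have "\<dots> \<le> (L * dist (x s) (y s) + dist (x s) (y s)) / m"
    proof (intro divide_right_mono)
      have "L * \<bar>fst (x s) - fst (y s)\<bar> \<le> L * dist (x s) (y s)" using f L by (intro mult_left_mono)
      then show "\<bar>(F s (fst (x s)) - F s (fst (y s))) - (snd (x s) - snd (y s))\<bar>
          \<le> L * dist (x s) (y s) + dist (x s) (y s)"
        using lip[OF that, of "fst (x s)" "fst (y s)"] f by linarith
    qed (use m in auto)
    finally show ?thesis using f by (simp add: L'_def algebra_simps add_divide_distrib)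
  qed
  have "\<exists>x. continuous_on {0..} x \<and> (\<forall>t\<ge>0. x t \<in> UNIV \<and> G x t = x t)"
  proof (rule causal_fixed_point[where l = "2 * L'"])
    fix x :: "real \<Rightarrow> real \<times> real" assume x: "continuous_on {0..} x"
    have "continuous_on {0..} (G x)"
      unfolding G_def
      by (rule continuous_on_half_line)
        (intro continuous_intros indefinite_integral_continuous_1 int[OF x])
    then show "continuous_on {0..} (G x) \<and> (\<forall>t\<ge>0. G x t \<in> UNIV)" by simp
  next
    fix x y :: "real \<Rightarrow> real \<times> real" and t d :: real
    assume x: "continuous_on {0..} x" and y: "continuous_on {0..} y" and t: "0 \<le> t" and d: "0 \<le> d"
      and le: "\<And>s. s \<in> {0..t} \<Longrightarrow> dist (x s) (y s) \<le> d * exp (2 * L' * s)"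
    have "((\<lambda>s. L' * d * exp (2 * L' * s)) has_integral
        (d / 2 * exp (2 * L' * t) - d / 2 * exp (2 * L' * 0))) {0..t}"
      using L' t by (intro fundamental_theorem_of_calculus)
        (auto intro!: derivative_eq_intros simp: has_real_derivative_iff_has_vector_derivative[symmetric])
    note hi = this
    have "dist (G x t) (G y t) = norm (integral {0..t} (\<lambda>s. h x s - h y s))"
      by (simp add: G_def dist_norm integral_diff int x y)
    also have "\<dots> \<le> integral {0..t} (\<lambda>s. L' * d * exp (2 * L' * s))"
    proof (rule integral_norm_bound_integral)
      show "(\<lambda>s. h x s - h y s) integrable_on {0..t}" by (intro integrable_diff int x y)
      show "(\<lambda>s. L' * d * exp (2 * L' * s)) integrable_on {0..t}" using hi by blast
      fix s assume s: "s \<in> {0..t}"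
      have "L' * dist (x s) (y s) \<le> L' * (d * exp (2 * L' * s))"
        using le[OF s] L' by (intro mult_left_mono) auto
      then show "norm (h x s - h y s) \<le> L' * d * exp (2 * L' * s)"
        using hl[of s x y] s by (simp add: dist_norm mult.assoc)
    qed
    also have "\<dots> = d / 2 * exp (2 * L' * t) - d / 2" using integral_unique[OF hi] by simp
    finally show "dist (G x t) (G y t) \<le> d / 2 * exp (2 * L' * t)" using d by simp
  qed (use L' in auto)
  then obtain x where x: "continuous_on {0..} x" and G: "\<And>t. t \<ge> 0 \<Longrightarrow> G x t = x t" by blast
  have dx: "(x has_vector_derivative h x t) (at t)" if t: "0 < t" for t
  proof -
    have "((\<lambda>u. integral {0..u} (h x)) has_vector_derivative h x t) (at t within {0..t+1})"
      using t by (intro integral_has_vector_derivative ch'[OF x]) auto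
    then have "((\<lambda>u. integral {0..u} (h x)) has_vector_derivative h x t) (at t)"
      using t by (simp add: at_within_Icc_at)
    then have "(G x has_vector_derivative h x t) (at t)"
      unfolding G_def by (auto intro!: derivative_eq_intros)
    then show ?thesis
      by (rule has_vector_derivative_transform_within_open[of _ _ _ "{0<..}"]) (use t G in auto)
  qed
  have "so_sol m T (\<lambda>t. F t (fst (x t))) (\<lambda>t. fst (x t)) (\<lambda>t. snd (x t))" for T
    unfolding so_sol_def
  proof (intro conjI allI impI)
    show "continuous_on {0..T} (\<lambda>t. fst (x t))" "continuous_on {0..T} (\<lambda>t. snd (x t))"
      using x by (auto intro!: continuous_intros intro: continuous_on_subset)
    fix t :: real assume t: "0 < t"
    show "((\<lambda>t. fst (x t)) has_real_derivative snd (x t)) (at t)"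
      using bounded_linear.has_vector_derivative[OF bounded_linear_fst dx[OF t]]
      by (simp add: has_real_derivative_iff_has_vector_derivative h_def)
    show "((\<lambda>t. snd (x t)) has_real_derivative (F t (fst (x t)) - snd (x t)) / m) (at t)"
      using bounded_linear.has_vector_derivative[OF bounded_linear_snd dx[OF t]]
      by (simp add: has_real_derivative_iff_has_vector_derivative h_def)
  qed
  moreover have "x 0 = (y0, w0)" using G[of 0] by (simp add: G_def)
  ultimately show ?thesis
    by (intro exI[of _ "\<lambda>t. fst (x t)"] exI[of _ "\<lambda>t. snd (x t)"]) auto
qed

text \<open>\<open>so_bound\<close> for the difference of two solutions: besides the Lipschitz part,
  the forcing contains only the change of \<open>F\<close> along the fixed trajectory of
  \<open>p0\<close>, which is small uniformly on \<open>{0..T}\<close> by compactness.\<close>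

lemma so_continuous:
  fixes F :: "'p::metric_space \<Rightarrow> real \<Rightarrow> real \<Rightarrow> real"
  assumes m: "m > 0" and L: "L \<ge> 0"
    and sol: "\<And>p T. so_sol m T (\<lambda>t. F p t (y p t)) (y p) (w p)"
    and lip: "\<And>p t a b. t \<ge> 0 \<Longrightarrow> \<bar>F p t a - F p t b\<bar> \<le> L * \<bar>a - b\<bar>"
    and cont: "continuous_on (UNIV \<times> {0..} \<times> UNIV) (\<lambda>(p, t, a). F p t a)"
    and init: "continuous_on UNIV (\<lambda>p. y p 0)" "continuous_on UNIV (\<lambda>p. w p 0)"
  shows "continuous_on (UNIV \<times> {0..}) (\<lambda>(p, t). y p t)" "continuous_on (UNIV \<times> {0..}) (\<lambda>(p, t). w p t)"
proof -
  have ev: "\<exists>d>0. \<forall>p. dist p p0 < d \<longrightarrow> (\<forall>t\<in>{0..T}. \<bar>y p t - y p0 t\<bar> \<le> e \<and> \<bar>w p t - w p0 t\<bar> \<le> e)"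
    if T: "T \<ge> 0" and e: "e > 0" for T e p0
  proof -
    define C where "C = so_const m L T"
    have C: "C > 0" using m by (simp add: C_def so_const_pos)
    \<comment> \<open>Three contributions of size \<open>e'^2\<close>, multiplied by
      \<open>C\<close>, have to add up to \<open>e^2\<close>.\<close>
    define e' where "e' = e / sqrt (3 * C)"
    have e': "e' > 0" using e C by (simp add: e'_def)
    have "continuous_on (UNIV \<times> {0..T}) (\<lambda>x. (\<lambda>(p, t, a). F p t a) (fst x, snd x, y p0 (snd x)))"
    proof (rule continuous_on_compose2[OF cont])
      have "continuous_on {0..T} (y p0)" using sol[of T p0] by (simp add: so_sol_def)
      then show "continuous_on (UNIV \<times> {0..T}) (\<lambda>x. (fst x, snd x, y p0 (snd x)))"
        by (intro continuous_intros) (auto intro!: continuous_on_compose2[of "{0..T}" "y p0"] continuous_intros)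
    qed auto
    from continuous_on_prod_compactE[OF this compact_Icc UNIV_I e', of p0] obtain X0 where
      X: "p0 \<in> X0" "open X0" "\<forall>p\<in>X0 \<inter> UNIV. \<forall>t\<in>{0..T}.
        dist ((\<lambda>x. (\<lambda>(p, t, a). F p t a) (fst x, snd x, y p0 (snd x))) (p, t))
          ((\<lambda>x. (\<lambda>(p, t, a). F p t a) (fst x, snd x, y p0 (snd x))) (p0, t)) \<le> e'"
      by blast
    then have X0: "p0 \<in> X0" "open X0" "\<And>p t. p \<in> X0 \<Longrightarrow> t \<in> {0..T} \<Longrightarrow> \<bar>F p t (y p0 t) - F p0 t (y p0 t)\<bar> \<le> e'"
      by (simp_all add: dist_real_def)
    obtain d1 where d1: "d1 > 0" "\<And>p. dist p p0 < d1 \<Longrightarrow> p \<in> X0"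
      using X0(1,2) unfolding open_dist by blast
    obtain d2 where d2: "d2 > 0" "\<And>p. dist p p0 < d2 \<Longrightarrow> \<bar>y p 0 - y p0 0\<bar> < e'"
      using init(1) e' unfolding continuous_on_iff dist_real_def by blast
    obtain d3 where d3: "d3 > 0" "\<And>p. dist p p0 < d3 \<Longrightarrow> \<bar>w p 0 - w p0 0\<bar> < e'"
      using init(2) e' unfolding continuous_on_iff dist_real_def by blast
    show ?thesis
    proof (intro exI[of _ "min d1 (min d2 d3)"] conjI allI impI ballI)
      fix p t assume p: "dist p p0 < min d1 (min d2 d3)" and t: "t \<in> {0..T}"
      have "(y p t - y p0 t)\<^sup>2 + (w p t - w p0 t)\<^sup>2
          \<le> C * ((y p 0 - y p0 0)\<^sup>2 + (w p 0 - w p0 0)\<^sup>2 + e'\<^sup>2)"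
        unfolding C_def
      proof (rule so_bound[OF m L _ so_sol_diff[OF sol sol] _ t])
        fix s assume s: "0 < s" "s < T"
        have "\<bar>F p s (y p s) - F p s (y p0 s)\<bar> \<le> L * \<bar>y p s - y p0 s\<bar>" using lip s by simp
        moreover have "\<bar>F p s (y p0 s) - F p0 s (y p0 s)\<bar> \<le> e'" using X0(3) d1 p s by simp
        ultimately show "\<bar>F p s (y p s) - F p0 s (y p0 s)\<bar> \<le> L * \<bar>y p s - y p0 s\<bar> + e'" by linarith
      qed (use e' in auto)
      also have "\<dots> \<le> C * (e'\<^sup>2 + e'\<^sup>2 + e'\<^sup>2)"
        using C d2(2)[of p] d3(2)[of p] p e' by (intro mult_left_mono add_mono) (auto simp: abs_le_square_iff[symmetric])
      also have "\<dots> = e\<^sup>2" using C by (simp add: e'_def power_divide)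
      finally have *: "(y p t - y p0 t)\<^sup>2 + (w p t - w p0 t)\<^sup>2 \<le> e\<^sup>2" .
      then have "(y p t - y p0 t)\<^sup>2 \<le> e\<^sup>2" "(w p t - w p0 t)\<^sup>2 \<le> e\<^sup>2"
        by (smt (verit) zero_le_power2)+
      then show "\<bar>y p t - y p0 t\<bar> \<le> e" "\<bar>w p t - w p0 t\<bar> \<le> e"
        using e by (auto simp: abs_le_square_iff[symmetric])
    qed (use d1 d2 d3 in auto)
  qed
  \<comment> \<open>Joint continuity follows from dependence on \<open>p\<close> that is uniform on
    a time interval reaching past \<open>t0\<close>, together with continuity in time of the single
    trajectory at \<open>p0\<close>.\<close>
  have gen: "continuous_on (UNIV \<times> {0..}) (\<lambda>(p, t). v p t)"
    if v: "\<And>p0 T e. T \<ge> 0 \<Longrightarrow> e > 0 \<Longrightarrow> \<exists>d>0. \<forall>p. dist p p0 < d \<longrightarrow> (\<forall>t\<in>{0..T}. \<bar>v p t - v p0 t\<bar> \<le> e)"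
      and vc: "\<And>p T. continuous_on {0..T} (v p)" for v :: "'p \<Rightarrow> real \<Rightarrow> real"
    unfolding continuous_on_iff
  proof (intro ballI allI impI)
    fix x0 :: "'p \<times> real" and e :: real assume x0: "x0 \<in> UNIV \<times> {0..}" and e: "e > 0"
    obtain p0 t0 where x0_eq: "x0 = (p0, t0)" by (cases x0)
    with x0 have t0: "t0 \<ge> 0" by simp
    obtain d1 where d1: "d1 > 0" "\<And>p t. dist p p0 < d1 \<Longrightarrow> t \<in> {0..t0+1} \<Longrightarrow> \<bar>v p t - v p0 t\<bar> \<le> e / 3"
      using v[of "t0+1" "e/3" p0] t0 e by auto
    obtain d2 where d2: "d2 > 0" "\<And>t. t \<in> {0..t0+1} \<Longrightarrow> dist t t0 < d2 \<Longrightarrow> dist (v p0 t) (v p0 t0) < e / 3"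
      using vc[of "t0+1" p0] t0 e unfolding continuous_on_iff by (metis atLeastAtMost_iff divide_pos_pos less_add_one less_imp_le zero_less_numeral)
    have "\<exists>d>0. \<forall>p t. 0 \<le> t \<longrightarrow> dist (p, t) (p0, t0) < d \<longrightarrow> dist (v p t) (v p0 t0) < e"
    proof (intro exI[of _ "min 1 (min d1 d2)"] conjI allI impI)
      fix p t assume t: "0 \<le> (t::real)" and d: "dist (p, t) (p0, t0) < min 1 (min d1 d2)"
      have dp: "dist p p0 < d1" and dt: "dist t t0 < min 1 d2"
        using d dist_fst_le[of "(p, t)" "(p0, t0)"] dist_snd_le[of "(p, t)" "(p0, t0)"] by auto
      then have t1: "t \<in> {0..t0+1}" using t by (auto simp: dist_real_def)
      have "\<bar>v p t - v p0 t\<bar> \<le> e / 3" "\<bar>v p0 t - v p0 t0\<bar> < e / 3"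
        using d1(2)[OF dp t1] d2(2)[OF t1] dt by (simp_all add: dist_real_def)
      then show "dist (v p t) (v p0 t0) < e"
        unfolding dist_real_def using e by linarith
    qed (use d1 d2 in auto)
    then show "\<exists>d>0. \<forall>x\<in>UNIV \<times> {0..}. dist x x0 < d \<longrightarrow>
        dist ((\<lambda>(p, t). v p t) x) ((\<lambda>(p, t). v p t) x0) < e"
      unfolding x0_eq by fastforce
  qed
  show "continuous_on (UNIV \<times> {0..}) (\<lambda>(p, t). y p t)"
  proof (rule gen)
    fix p0 :: 'p and T e :: real assume "T \<ge> 0" "e > 0"
    from ev[OF this, of p0] show "\<exists>d>0. \<forall>p. dist p p0 < d \<longrightarrow> (\<forall>t\<in>{0..T}. \<bar>y p t - y p0 t\<bar> \<le> e)" by blast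
  qed (use sol in \<open>simp add: so_sol_def\<close>)
  show "continuous_on (UNIV \<times> {0..}) (\<lambda>(p, t). w p t)"
  proof (rule gen)
    fix p0 :: 'p and T e :: real assume "T \<ge> 0" "e > 0"
    from ev[OF this, of p0] show "\<exists>d>0. \<forall>p. dist p p0 < d \<longrightarrow> (\<forall>t\<in>{0..T}. \<bar>w p t - w p0 t\<bar> \<le> e)" by blast
  qed (use sol in \<open>simp add: so_sol_def\<close>)
qed

text \<open>The error of the first-order expansion is itself a solution, with forcing controlled by
  \<open>rem\<close>; \<open>so_bound\<close> turns little-o smallness of the initial error and of
  the forcing into the same smallness at time \<open>t\<close>.\<close>

lemma so_param_deriv:
  fixes y w f :: "real \<Rightarrow> real \<Rightarrow> real"
  assumes m: "m > 0" and L: "L \<ge> 0"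
    and sol: "\<And>x. so_sol m T (f x) (y x) (w x)" and sol1: "so_sol m T f1 y1 w1"
    and init: "((\<lambda>x. y x 0) has_real_derivative y1 0) (at x0)"
      "((\<lambda>x. w x 0) has_real_derivative w1 0) (at x0)"
    and rem: "\<And>e. e > 0 \<Longrightarrow> \<exists>d>0. \<forall>x. \<bar>x - x0\<bar> < d \<longrightarrow> (\<forall>t. 0 < t \<longrightarrow> t < T \<longrightarrow>
        \<bar>f x t - f x0 t - (x - x0) * f1 t\<bar>
          \<le> L * \<bar>y x t - y x0 t - (x - x0) * y1 t\<bar> + e * \<bar>x - x0\<bar>)"
    and t: "t \<in> {0..T}"
  shows "((\<lambda>x. y x t) has_real_derivative y1 t) (at x0)" "((\<lambda>x. w x t) has_real_derivative w1 t) (at x0)"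
proof -
  define C where "C = so_const m L T"
  have C: "C > 0" using m by (simp add: C_def so_const_pos)
  have init': "\<exists>d>0. \<forall>x. \<bar>x - x0\<bar> < d \<longrightarrow> \<bar>v x - v x0 - (x - x0) * v'\<bar> \<le> e * \<bar>x - x0\<bar>"
    if "(v has_real_derivative v') (at x0)" "e > 0" for v v' e
    using that unfolding has_field_derivative_def has_derivative_at_alt by (auto simp: mult.commute)
  have key: "\<exists>d>0. \<forall>x. \<bar>x - x0\<bar> < d \<longrightarrow>
      \<bar>y x t - y x0 t - (x - x0) * y1 t\<bar> \<le> e * \<bar>x - x0\<bar> \<and>
      \<bar>w x t - w x0 t - (x - x0) * w1 t\<bar> \<le> e * \<bar>x - x0\<bar>" if e: "e > 0" for e
  proof -
    define e' where "e' = e / sqrt (3 * C)"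
    have e': "e' > 0" using e C by (simp add: e'_def)
    obtain d1 where d1: "d1 > 0" "\<And>x s. \<bar>x - x0\<bar> < d1 \<Longrightarrow> 0 < s \<Longrightarrow> s < T \<Longrightarrow>
        \<bar>f x s - f x0 s - (x - x0) * f1 s\<bar>
          \<le> L * \<bar>y x s - y x0 s - (x - x0) * y1 s\<bar> + e' * \<bar>x - x0\<bar>"
      using rem[OF e'] by blast
    obtain d2 where d2: "d2 > 0" "\<And>x. \<bar>x - x0\<bar> < d2 \<Longrightarrow> \<bar>y x 0 - y x0 0 - (x - x0) * y1 0\<bar> \<le> e' * \<bar>x - x0\<bar>"
      using init'[OF init(1) e'] by blast
    obtain d3 where d3: "d3 > 0" "\<And>x. \<bar>x - x0\<bar> < d3 \<Longrightarrow> \<bar>w x 0 - w x0 0 - (x - x0) * w1 0\<bar> \<le> e' * \<bar>x - x0\<bar>"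
      using init'[OF init(2) e'] by blast
    show ?thesis
    proof (intro exI[of _ "min d1 (min d2 d3)"] conjI allI impI)
      fix x assume x: "\<bar>x - x0\<bar> < min d1 (min d2 d3)"
      have "(y x t - y x0 t - (x - x0) * y1 t)\<^sup>2 + (w x t - w x0 t - (x - x0) * w1 t)\<^sup>2
          \<le> C * ((y x 0 - y x0 0 - (x - x0) * y1 0)\<^sup>2 + (w x 0 - w x0 0 - (x - x0) * w1 0)\<^sup>2
             + (e' * \<bar>x - x0\<bar>)\<^sup>2)"
        unfolding C_def using d1(2) x e'
        by (intro so_bound[OF m L _ so_sol_diff[OF so_sol_diff[OF sol sol] so_sol_scale[OF sol1]] _ t]) auto
      also have "\<dots> \<le> C * ((e' * \<bar>x - x0\<bar>)\<^sup>2 + (e' * \<bar>x - x0\<bar>)\<^sup>2 + (e' * \<bar>x - x0\<bar>)\<^sup>2)"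
        using C d2(2)[of x] d3(2)[of x] x e'
        by (intro mult_left_mono add_mono) (auto simp: abs_le_square_iff[symmetric])
      also have "\<dots> = (e * \<bar>x - x0\<bar>)\<^sup>2" using C by (simp add: e'_def power_divide power_mult_distrib)
      finally have *: "(y x t - y x0 t - (x - x0) * y1 t)\<^sup>2 + (w x t - w x0 t - (x - x0) * w1 t)\<^sup>2
          \<le> (e * \<bar>x - x0\<bar>)\<^sup>2" .
      then have "(y x t - y x0 t - (x - x0) * y1 t)\<^sup>2 \<le> (e * \<bar>x - x0\<bar>)\<^sup>2"
        "(w x t - w x0 t - (x - x0) * w1 t)\<^sup>2 \<le> (e * \<bar>x - x0\<bar>)\<^sup>2"
        by (smt (verit) zero_le_power2)+
      then show "\<bar>y x t - y x0 t - (x - x0) * y1 t\<bar> \<le> e * \<bar>x - x0\<bar>"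
        "\<bar>w x t - w x0 t - (x - x0) * w1 t\<bar> \<le> e * \<bar>x - x0\<bar>"
        using e unfolding abs_le_square_iff[symmetric] by (auto simp: abs_mult)
    qed (use d1 d2 d3 in auto)
  qed
  have "\<exists>d>0. \<forall>x. \<bar>x - x0\<bar> < d \<longrightarrow> \<bar>y x t - y x0 t - y1 t * (x - x0)\<bar> \<le> e * \<bar>x - x0\<bar>"
    "\<exists>d>0. \<forall>x. \<bar>x - x0\<bar> < d \<longrightarrow> \<bar>w x t - w x0 t - w1 t * (x - x0)\<bar> \<le> e * \<bar>x - x0\<bar>"
    if "e > 0" for e
    using key[OF that] by (simp_all only: mult.commute) blast+
  then show "((\<lambda>x. y x t) has_real_derivative y1 t) (at x0)" "((\<lambda>x. w x t) has_real_derivative w1 t) (at x0)"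
    unfolding has_field_derivative_def has_derivative_at_alt
    by (simp_all add: bounded_linear_mult_right)
qed

section \<open>Characteristics of a given mean field\<close>

text \<open>If \<open>z\<close> is the first Fourier moment of a density, \<open>Sf z x\<close> and
  \<open>Al z x\<close> are the integrals of \<open>sin (y - x)\<close> and
  \<open>cos (y - x)\<close> against it: the interaction force at \<open>x\<close> and minus its
  derivative in \<open>x\<close>.\<close>

definition Sf :: "complex \<Rightarrow> real \<Rightarrow> real" where "Sf z x = Im (z * cis (- x))"
definition Al :: "complex \<Rightarrow> real \<Rightarrow> real" where "Al z x = Re (z * cis (- x))"

lemma Sf_eq: "Sf z x = Im z * cos x - Re z * sin x"
  and Al_eq: "Al z x = Re z * cos x + Im z * sin x"
  by (simp_all add: Sf_def Al_def)

lemma Sf_le: "\<bar>Sf z x\<bar> \<le> norm z" and Al_le: "\<bar>Al z x\<bar> \<le> norm z"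
  using abs_Im_le_cmod[of "z * cis (- x)"] abs_Re_le_cmod[of "z * cis (- x)"]
  by (simp_all add: Sf_def Al_def norm_mult)

lemma DERIV_Sf: "(Sf z has_real_derivative - Al z x) (at x within A)"
  and DERIV_Al: "(Al z has_real_derivative Sf z x) (at x within A)"
  unfolding Sf_eq Al_eq by (auto intro!: derivative_eq_intros)

lemma Sf_periodic: "Sf z (x + 2 * pi) = Sf z x" and Al_periodic: "Al z (x + 2 * pi) = Al z x"
  by (simp_all add: Sf_eq Al_eq)

lemma Sf_lipschitz: "\<bar>Sf z x - Sf z y\<bar> \<le> norm z * \<bar>x - y\<bar>"
  using field_differentiable_bound[of UNIV "Sf z" "\<lambda>x. - Al z x" "norm z" x y] DERIV_Sf Al_le
  by simp

lemma Al_lipschitz: "\<bar>Al z x - Al z y\<bar> \<le> norm z * \<bar>x - y\<bar>"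
  using field_differentiable_bound[of UNIV "Al z" "Sf z" "norm z" x y] DERIV_Al Sf_le
  by simp

text \<open>Mean value theorem followed by the Lipschitz bound for \<open>Al\<close>; the factor 1/2
  of the sharp remainder is given up.\<close>

lemma Sf_taylor: "\<bar>Sf z x - Sf z y + Al z y * (x - y)\<bar> \<le> norm z * \<bar>x - y\<bar>\<^sup>2"
proof (cases "x = y")
  case False
  obtain c where c: "\<bar>c - y\<bar> \<le> \<bar>x - y\<bar>" "Sf z x - Sf z y = (x - y) * - Al z c"
  proof (cases "x < y")
    case True
    obtain c where "x < c" "c < y" "Sf z y - Sf z x = (y - x) * - Al z c"
      using MVT2[OF True, of "Sf z" "\<lambda>x. - Al z x"] DERIV_Sf by blast
    then show ?thesis using that[of c] by (simp add: algebra_simps)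
  next
    case False
    with \<open>x \<noteq> y\<close> have "y < x" by simp
    from MVT2[OF this, of "Sf z" "\<lambda>x. - Al z x"] DERIV_Sf
    obtain c where "y < c" "c < x" "Sf z x - Sf z y = (x - y) * - Al z c" by blast
    then show ?thesis using that[of c] by (simp add: algebra_simps)
  qed
  have "\<bar>Sf z x - Sf z y + Al z y * (x - y)\<bar> = \<bar>Al z y - Al z c\<bar> * \<bar>x - y\<bar>"
    unfolding c(2) abs_mult[symmetric] by (simp add: algebra_simps)
  also have "\<dots> \<le> (norm z * \<bar>x - y\<bar>) * \<bar>x - y\<bar>"
    using Al_lipschitz[of z y c] c(1)
    by (intro mult_right_mono order_trans[OF Al_lipschitz] mult_left_mono) auto
  finally show ?thesis by (simp add: power2_eq_square mult.assoc)
qed simp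

lemma continuous_on_Sf [continuous_intros]:
  fixes A :: "'a::t2_space set"
  shows "continuous_on A z \<Longrightarrow> continuous_on A x \<Longrightarrow> continuous_on A (\<lambda>t. Sf (z t) (x t))"
    and continuous_on_Al [continuous_intros]:
  "continuous_on A z \<Longrightarrow> continuous_on A x \<Longrightarrow> continuous_on A (\<lambda>t. Al (z t) (x t))"
  unfolding Sf_eq Al_eq by (auto intro!: continuous_intros)

text \<open>The choice is made separately for all data; regularity in the data is recovered
  afterwards from the estimates for differences of solutions.\<close>

definition so_solve :: "real \<Rightarrow> (real \<Rightarrow> real \<Rightarrow> real) \<Rightarrow> real \<Rightarrow> real \<Rightarrow> (real \<Rightarrow> real) \<times> (real \<Rightarrow> real)" where
  "so_solve m F y0 w0 = (SOME s. fst s 0 = y0 \<and> snd s 0 = w0 \<and>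
     (\<forall>T. so_sol m T (\<lambda>t. F t (fst s t)) (fst s) (snd s)))"

lemma so_solve:
  fixes F :: "real \<Rightarrow> real \<Rightarrow> real"
  assumes "m > 0" "L \<ge> 0" "continuous_on ({0..} \<times> UNIV) (\<lambda>(t, y). F t y)"
    "\<And>t x y. t \<ge> 0 \<Longrightarrow> \<bar>F t x - F t y\<bar> \<le> L * \<bar>x - y\<bar>"
  shows "fst (so_solve m F y0 w0) 0 = y0" "snd (so_solve m F y0 w0) 0 = w0"
    "so_sol m T (\<lambda>t. F t (fst (so_solve m F y0 w0) t)) (fst (so_solve m F y0 w0)) (snd (so_solve m F y0 w0))"
proof -
  obtain y w where "y 0 = y0" "w 0 = w0" "\<forall>T. so_sol m T (\<lambda>t. F t (y t)) y w"
    using so_exists[OF assms] by blast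
  then have "\<exists>s. fst s 0 = y0 \<and> snd s 0 = w0 \<and> (\<forall>T. so_sol m T (\<lambda>t. F t (fst s t)) (fst s) (snd s))"
    by (intro exI[of _ "(y, w)"]) simp
  from someI_ex[OF this]
  show "fst (so_solve m F y0 w0) 0 = y0" "snd (so_solve m F y0 w0) 0 = w0"
    "so_sol m T (\<lambda>t. F t (fst (so_solve m F y0 w0) t)) (fst (so_solve m F y0 w0)) (snd (so_solve m F y0 w0))"
    unfolding so_solve_def by blast+
qed

text \<open>A parameter consists of the initial position, the initial velocity, the frequency, and the
  first two \<open>\<theta>\<close>-derivatives of the initial velocity.\<close>

type_synonym par = "real \<times> real \<times> real \<times> real \<times> real"

abbreviation px :: "par \<Rightarrow> real" where "px p \<equiv> fst p"
abbreviation pv :: "par \<Rightarrow> real" where "pv p \<equiv> fst (snd p)"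
abbreviation pw :: "par \<Rightarrow> real" where "pw p \<equiv> fst (snd (snd p))"
abbreviation pa :: "par \<Rightarrow> real" where "pa p \<equiv> fst (snd (snd (snd p)))"
abbreviation pb :: "par \<Rightarrow> real" where "pb p \<equiv> snd (snd (snd (snd p)))"

abbreviation cont2 :: "('p::metric_space \<Rightarrow> real \<Rightarrow> real) \<Rightarrow> bool" where
  "cont2 f \<equiv> continuous_on (UNIV \<times> {0..}) (\<lambda>(p, t). f p t)"

lemma cont2_fst_snd: "cont2 f \<longleftrightarrow> continuous_on (UNIV \<times> {0..}) (\<lambda>x. f (fst x) (snd x))"
  by (simp add: case_prod_unfold)

lemma cont2_slice:
  assumes "cont2 f" shows "continuous_on {0..} (f p)"
proof -
  have "continuous_on {0..} (\<lambda>t. (\<lambda>(p, t). f p t) (p, t))"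
    by (rule continuous_on_compose2[OF assms]) (auto intro!: continuous_intros)
  then show ?thesis by simp
qed

lemma cont2_comp:
  assumes "cont2 f" and q: "continuous_on UNIV q"
  shows "cont2 (\<lambda>x t. f (q x) t)"
proof -
  have "continuous_on (UNIV \<times> {0..}) (\<lambda>x. (\<lambda>(p, t). f p t) (q (fst x), snd x))"
    by (rule continuous_on_compose2[OF assms(1)])
      (auto intro!: continuous_intros continuous_on_compose2[OF q])
  then show ?thesis by (simp add: case_prod_unfold)
qed

text \<open>Tube lemma: compactness of the time interval makes the neighbourhood of
  \<open>x0\<close> independent of \<open>t\<close>.\<close>

lemma cont2_uniform:
  fixes f :: "real \<Rightarrow> real \<Rightarrow> real"
  assumes f: "cont2 f" and e: "e > 0"
  shows "\<exists>d>0. \<forall>x. \<bar>x - x0\<bar> < d \<longrightarrow> (\<forall>t\<in>{0..T}. \<bar>f x t - f x0 t\<bar> \<le> e)"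
proof -
  have "continuous_on (UNIV \<times> {0..T}) (\<lambda>(p, t). f p t)"
    by (rule continuous_on_subset[OF f]) auto
  from continuous_on_prod_compactE[OF this compact_Icc UNIV_I e, of x0] obtain X0 where
    "x0 \<in> X0" "open X0" and 1: "\<forall>x\<in>X0 \<inter> UNIV. \<forall>t\<in>{0..T}.
      dist ((\<lambda>(p, t). f p t) (x, t)) ((\<lambda>(p, t). f p t) (x0, t)) \<le> e" by blast
  then obtain d where "d > 0" "\<And>x. \<bar>x - x0\<bar> < d \<Longrightarrow> x \<in> X0"
    unfolding open_dist dist_real_def by blast
  with 1 show ?thesis by (auto simp: dist_real_def)
qed

lemma cont2_bounded:
  assumes f: "cont2 f"
  shows "\<exists>M>0. \<forall>t\<in>{0..T}. \<bar>f x t\<bar> \<le> M"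
proof -
  have "continuous_on {0..T} (f x)"
    by (rule continuous_on_subset[OF cont2_slice[OF f]]) auto
  from compact_imp_bounded[OF compact_continuous_image[OF this compact_Icc]]
  show ?thesis unfolding bounded_pos by auto
qed

text \<open>Mean value inequality for \<open>f x t - x * f' x0 t\<close>, whose derivative is
  uniformly small near \<open>x0\<close> by \<open>cont2_uniform\<close>.\<close>

lemma cont2_diff_quot:
  fixes f f' :: "real \<Rightarrow> real \<Rightarrow> real"
  assumes d: "\<And>x t. t \<ge> 0 \<Longrightarrow> ((\<lambda>x. f x t) has_real_derivative f' x t) (at x)"
    and f': "cont2 f'" and e: "e > 0"
  shows "\<exists>d>0. \<forall>x. \<bar>x - x0\<bar> < d \<longrightarrow> (\<forall>t\<in>{0..T}. \<bar>f x t - f x0 t - (x - x0) * f' x0 t\<bar> \<le> e * \<bar>x - x0\<bar>)"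
proof -
  obtain d where d0: "d > 0" and dd: "\<And>x t. \<bar>x - x0\<bar> < d \<Longrightarrow> t \<in> {0..T} \<Longrightarrow> \<bar>f' x t - f' x0 t\<bar> \<le> e"
    using cont2_uniform[OF f' e] by blast
  show ?thesis
  proof (intro exI[of _ d] conjI d0 allI impI ballI)
    fix x t assume x: "\<bar>x - x0\<bar> < d" and t: "t \<in> {0..T}"
    have "norm ((f x t - x * f' x0 t) - (f x0 t - x0 * f' x0 t)) \<le> e * norm (x - x0)"
    proof (rule field_differentiable_bound[where S = "ball x0 d" and f' = "\<lambda>x. f' x t - f' x0 t"])
      fix y assume y: "y \<in> ball x0 d"
      then show "norm (f' y t - f' x0 t) \<le> e" using dd[of y t] t by (simp add: dist_real_def abs_minus_commute)
      show "((\<lambda>x. f x t - x * f' x0 t) has_real_derivative f' y t - f' x0 t) (at y within ball x0 d)"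
        using t by (auto intro!: derivative_eq_intros DERIV_subset[OF d])
    qed (use x d0 in \<open>auto simp: dist_real_def abs_minus_commute\<close>)
    then show "\<bar>f x t - f x0 t - (x - x0) * f' x0 t\<bar> \<le> e * \<bar>x - x0\<bar>"
      by (simp add: algebra_simps)
  qed
qed

text \<open>The field is arbitrary here, not yet a fixed point: the iterates of the mean-field map
  and the field of a competing solution have to be covered as well, the latter with a bound
  \<open>B\<close> possibly larger than 1.\<close>

locale flow =
  fixes m K B :: real and z :: "real \<Rightarrow> complex"
  assumes m: "m > 0" and K: "K > 0" and B: "B \<ge> 0"
    and z_cont: "continuous_on {0..} z" and z_le: "\<And>t. t \<ge> 0 \<Longrightarrow> norm (z t) \<le> B"
begin

definition XV :: "par \<Rightarrow> (real \<Rightarrow> real) \<times> (real \<Rightarrow> real)" where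
  "XV p = so_solve m (\<lambda>t y. pw p + K * Sf (z t) y) (px p) (pv p)"
definition X :: "par \<Rightarrow> real \<Rightarrow> real" where "X p = fst (XV p)"
definition V :: "par \<Rightarrow> real \<Rightarrow> real" where "V p = snd (XV p)"

definition al :: "par \<Rightarrow> real \<Rightarrow> real" where "al p t = Al (z t) (X p t)"
definition si :: "par \<Rightarrow> real \<Rightarrow> real" where "si p t = Sf (z t) (X p t)"

text \<open>Solutions of \<open>m * y'' + y' = - K * al * y + e\<close>, the characteristic equation
  linearised along the trajectory of \<open>p\<close>. The derivatives in the starting point solve
  it with sources of lower order.\<close>

definition lin :: "(par \<Rightarrow> real \<Rightarrow> real) \<Rightarrow> real \<Rightarrow> (par \<Rightarrow> real) \<Rightarrow> par \<Rightarrow> (real \<Rightarrow> real) \<times> (real \<Rightarrow> real)" where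
  "lin e y0 w0 p = so_solve m (\<lambda>t y. - K * al p t * y + e p t) y0 (w0 p)"

text \<open>With \<open>\<partial>\<close> the derivative in the starting point: \<open>J = \<partial>X\<close> and \<open>Y = \<partial>J\<close>. Splitting
  \<open>Y = P + Q b\<close>, with \<open>b\<close> the second derivative of the initial velocity, confines the one
  derivative that exists only almost everywhere to \<open>b\<close>; \<open>Q1 = \<partial>Q\<close> and \<open>P1 = \<partial>P\<close> exist everywhere.
  The second components \<open>W\<close>, \<open>Qd\<close>, \<open>Pd\<close>, ... are time derivatives.\<close>

definition J :: "par \<Rightarrow> real \<Rightarrow> real" where "J p = fst (lin (\<lambda>p t. 0) 1 pa p)"
definition W :: "par \<Rightarrow> real \<Rightarrow> real" where "W p = snd (lin (\<lambda>p t. 0) 1 pa p)"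
definition Q :: "par \<Rightarrow> real \<Rightarrow> real" where "Q p = fst (lin (\<lambda>p t. 0) 0 (\<lambda>p. 1) p)"
definition Qd :: "par \<Rightarrow> real \<Rightarrow> real" where "Qd p = snd (lin (\<lambda>p t. 0) 0 (\<lambda>p. 1) p)"
definition eP :: "par \<Rightarrow> real \<Rightarrow> real" where "eP p t = - K * si p t * (J p t)\<^sup>2"
definition P :: "par \<Rightarrow> real \<Rightarrow> real" where "P p = fst (lin eP 0 (\<lambda>p. 0) p)"
definition Pd :: "par \<Rightarrow> real \<Rightarrow> real" where "Pd p = snd (lin eP 0 (\<lambda>p. 0) p)"
definition Y :: "par \<Rightarrow> real \<Rightarrow> real" where "Y p t = P p t + Q p t * pb p"
definition Yd :: "par \<Rightarrow> real \<Rightarrow> real" where "Yd p t = Pd p t + Qd p t * pb p"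
definition eQ1 :: "par \<Rightarrow> real \<Rightarrow> real" where "eQ1 p t = - K * si p t * J p t * Q p t"
definition Q1 :: "par \<Rightarrow> real \<Rightarrow> real" where "Q1 p = fst (lin eQ1 0 (\<lambda>p. 0) p)"
definition Q1d :: "par \<Rightarrow> real \<Rightarrow> real" where "Q1d p = snd (lin eQ1 0 (\<lambda>p. 0) p)"
text \<open>The derivative of \<open>eP\<close> in the starting point, as \<open>si\<close> has
  derivative \<open>- al * J\<close> and \<open>J\<close> has derivative \<open>Y\<close>. Through
  \<open>Y\<close> it involves \<open>pb\<close>, so \<open>P1\<close> and \<open>P1d\<close> can be
  bounded only linearly in \<open>pb\<close>.\<close>

definition eP' :: "par \<Rightarrow> real \<Rightarrow> real" where
  "eP' p t = K * al p t * (J p t) ^ 3 - 2 * K * si p t * J p t * Y p t"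
definition eP1 :: "par \<Rightarrow> real \<Rightarrow> real" where "eP1 p t = - K * si p t * J p t * P p t + eP' p t"
definition P1 :: "par \<Rightarrow> real \<Rightarrow> real" where "P1 p = fst (lin eP1 0 (\<lambda>p. 0) p)"
definition P1d :: "par \<Rightarrow> real \<Rightarrow> real" where "P1d p = snd (lin eP1 0 (\<lambda>p. 0) p)"

lemma KB: "K * B \<ge> 0" using K B by simp

lemma al_le: "t \<ge> 0 \<Longrightarrow> \<bar>al p t\<bar> \<le> B" and si_le: "t \<ge> 0 \<Longrightarrow> \<bar>si p t\<bar> \<le> B"
  using Al_le[of "z t" "X p t"] Sf_le[of "z t" "X p t"] z_le[of t] by (simp_all add: al_def si_def)

lemma zS_cont: "continuous_on ({0..} \<times> UNIV) (\<lambda>(t, y). w + K * Sf (z t) y)"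
  unfolding case_prod_unfold
  by (intro continuous_intros continuous_on_compose2[OF z_cont]) auto

lemma zS_lip: "t \<ge> 0 \<Longrightarrow> \<bar>(w + K * Sf (z t) a) - (w + K * Sf (z t) b)\<bar> \<le> K * B * \<bar>a - b\<bar>"
proof -
  assume t: "t \<ge> 0"
  have "\<bar>(w + K * Sf (z t) a) - (w + K * Sf (z t) b)\<bar> = K * \<bar>Sf (z t) a - Sf (z t) b\<bar>"
    using K by (simp add: right_diff_distrib[symmetric] abs_mult)
  also have "\<dots> \<le> K * (B * \<bar>a - b\<bar>)"
    using K by (intro mult_left_mono order_trans[OF Sf_lipschitz] mult_right_mono z_le t) auto
  finally show ?thesis by simp
qed

lemma X_sol: "so_sol m T (\<lambda>t. pw p + K * Sf (z t) (X p t)) (X p) (V p)"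
  and X_0 [simp]: "X p 0 = px p" and V_0 [simp]: "V p 0 = pv p"
  using so_solve[OF m KB zS_cont zS_lip, where ?y0.0 = "px p" and ?w0.0 = "pv p"]
  unfolding X_def V_def XV_def by auto

lemma X_cont: "cont2 X" and V_cont: "cont2 V"
proof -
  have c: "continuous_on (UNIV \<times> {0..} \<times> UNIV) (\<lambda>(p, t, a). pw p + K * Sf (z t) a)"
    unfolding case_prod_unfold
    by (intro continuous_intros continuous_on_compose2[OF z_cont]) auto
  show "cont2 X" "cont2 V"
    by (rule so_continuous[OF m KB X_sol zS_lip c], simp_all only: X_0 V_0; intro continuous_intros)+
qed

lemma al_cont: "cont2 al" and si_cont: "cont2 si"
  unfolding al_def si_def case_prod_unfold
  using X_cont unfolding case_prod_unfold
  by (auto intro!: continuous_intros continuous_on_compose2[OF z_cont])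

lemma lin_lip: "t \<ge> 0 \<Longrightarrow> \<bar>(- K * al p t * a + c) - (- K * al p t * b + c)\<bar> \<le> K * B * \<bar>a - b\<bar>"
proof -
  assume t: "t \<ge> 0"
  have "\<bar>(- K * al p t * a + c) - (- K * al p t * b + c)\<bar> = \<bar>- K * al p t * (a - b)\<bar>"
    by (simp add: algebra_simps)
  also have "\<dots> = K * (\<bar>al p t\<bar> * \<bar>a - b\<bar>)" using K by (simp add: abs_mult)
  also have "\<dots> \<le> K * (B * \<bar>a - b\<bar>)"
    using K by (intro mult_left_mono mult_right_mono al_le t) auto
  finally show ?thesis by simp
qed

context
  fixes e :: "par \<Rightarrow> real \<Rightarrow> real" and y0 :: real and w0 :: "par \<Rightarrow> real"
  assumes e: "cont2 e" and w0: "continuous_on UNIV w0"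
begin

lemma lin_sol:
  "fst (lin e y0 w0 p) 0 = y0" "snd (lin e y0 w0 p) 0 = w0 p"
  "so_sol m T (\<lambda>t. - K * al p t * fst (lin e y0 w0 p) t + e p t) (fst (lin e y0 w0 p)) (snd (lin e y0 w0 p))"
proof -
  have "continuous_on ({0..} \<times> UNIV) (\<lambda>(t, y). - K * al p t * y + e p t)"
    unfolding case_prod_unfold
    by (intro continuous_intros continuous_on_compose2[OF cont2_slice[OF al_cont]]
        continuous_on_compose2[OF cont2_slice[OF e]]) auto
  note s = so_solve[OF m KB this lin_lip]
  show "fst (lin e y0 w0 p) 0 = y0" "snd (lin e y0 w0 p) 0 = w0 p"
    "so_sol m T (\<lambda>t. - K * al p t * fst (lin e y0 w0 p) t + e p t) (fst (lin e y0 w0 p)) (snd (lin e y0 w0 p))"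
    unfolding lin_def using s by auto
qed

lemma lin_cont: "cont2 (\<lambda>p. fst (lin e y0 w0 p))" "cont2 (\<lambda>p. snd (lin e y0 w0 p))"
proof -
  have "continuous_on (UNIV \<times> {0..} \<times> UNIV) (\<lambda>x. al (fst x) (fst (snd x)))"
    "continuous_on (UNIV \<times> {0..} \<times> UNIV) (\<lambda>x. e (fst x) (fst (snd x)))"
    by (rule continuous_on_compose2[OF al_cont[unfolded cont2_fst_snd], of _ "\<lambda>x. (fst x, fst (snd x))", simplified fst_conv snd_conv]
        continuous_on_compose2[OF e[unfolded cont2_fst_snd], of _ "\<lambda>x. (fst x, fst (snd x))", simplified fst_conv snd_conv];
        auto intro!: continuous_intros)+
  then have c: "continuous_on (UNIV \<times> {0..} \<times> UNIV) (\<lambda>(p, t, a). - K * al p t * a + e p t)"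
    unfolding case_prod_unfold by (intro continuous_intros)
  show "cont2 (\<lambda>p. fst (lin e y0 w0 p))" "cont2 (\<lambda>p. snd (lin e y0 w0 p))"
    using so_continuous[OF m KB lin_sol(3) lin_lip c] lin_sol(1,2) w0
    by (auto intro!: continuous_intros)
qed

end

lemma J_sol: "so_sol m T (\<lambda>t. - K * al p t * J p t) (J p) (W p)"
  and J_0 [simp]: "J p 0 = 1" and W_0 [simp]: "W p 0 = pa p" and J_cont: "cont2 J" and W_cont: "cont2 W"
proof -
  have 1: "cont2 (\<lambda>(p::par) t. 0)" "continuous_on UNIV pa" by (auto intro!: continuous_intros)
  show "so_sol m T (\<lambda>t. - K * al p t * J p t) (J p) (W p)" "J p 0 = 1" "W p 0 = pa p" "cont2 J" "cont2 W"
    using lin_sol[OF 1] lin_cont[OF 1] unfolding J_def W_def by auto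
qed

lemma Q_sol: "so_sol m T (\<lambda>t. - K * al p t * Q p t) (Q p) (Qd p)"
  and Q_0 [simp]: "Q p 0 = 0" and Qd_0 [simp]: "Qd p 0 = 1" and Q_cont: "cont2 Q" and Qd_cont: "cont2 Qd"
proof -
  have 1: "cont2 (\<lambda>(p::par) t. 0)" "continuous_on UNIV (\<lambda>p::par. 1::real)" by (auto intro!: continuous_intros)
  show "so_sol m T (\<lambda>t. - K * al p t * Q p t) (Q p) (Qd p)" "Q p 0 = 0" "Qd p 0 = 1" "cont2 Q" "cont2 Qd"
    using lin_sol[OF 1] lin_cont[OF 1] unfolding Q_def Qd_def by auto
qed

lemma P_sol: "so_sol m T (\<lambda>t. - K * al p t * P p t + eP p t) (P p) (Pd p)"
  and P_0 [simp]: "P p 0 = 0" and Pd_0 [simp]: "Pd p 0 = 0" and P_cont: "cont2 P" and Pd_cont: "cont2 Pd"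
proof -
  have 0: "cont2 eP" unfolding eP_def
    using si_cont J_cont unfolding case_prod_unfold by (auto intro!: continuous_intros)
  have 1: "continuous_on UNIV (\<lambda>p::par. 0::real)" by (auto intro!: continuous_intros)
  show "so_sol m T (\<lambda>t. - K * al p t * P p t + eP p t) (P p) (Pd p)" "P p 0 = 0" "Pd p 0 = 0" "cont2 P" "cont2 Pd"
    using lin_sol[OF 0 1] lin_cont[OF 0 1] unfolding P_def Pd_def by auto
qed

lemma Q1_sol: "so_sol m T (\<lambda>t. - K * al p t * Q1 p t + eQ1 p t) (Q1 p) (Q1d p)"
  and Q1_0 [simp]: "Q1 p 0 = 0" and Q1d_0 [simp]: "Q1d p 0 = 0" and Q1_cont: "cont2 Q1" and Q1d_cont: "cont2 Q1d"
proof -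
  have 0: "cont2 eQ1" unfolding eQ1_def
    using si_cont J_cont Q_cont unfolding case_prod_unfold by (auto intro!: continuous_intros)
  have 1: "continuous_on UNIV (\<lambda>p::par. 0::real)" by (auto intro!: continuous_intros)
  show "so_sol m T (\<lambda>t. - K * al p t * Q1 p t + eQ1 p t) (Q1 p) (Q1d p)" "Q1 p 0 = 0" "Q1d p 0 = 0" "cont2 Q1" "cont2 Q1d"
    using lin_sol[OF 0 1] lin_cont[OF 0 1] unfolding Q1_def Q1d_def by auto
qed

lemma Y_cont: "cont2 Y" and Yd_cont: "cont2 Yd"
  unfolding Y_def Yd_def using P_cont Q_cont Pd_cont Qd_cont unfolding case_prod_unfold
  by (auto intro!: continuous_intros)

lemma eP'_cont: "cont2 eP'"
  unfolding eP'_def using al_cont si_cont J_cont Y_cont unfolding case_prod_unfold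
  by (auto intro!: continuous_intros)

lemma P1_sol: "so_sol m T (\<lambda>t. - K * al p t * P1 p t + eP1 p t) (P1 p) (P1d p)"
  and P1_0 [simp]: "P1 p 0 = 0" and P1d_0 [simp]: "P1d p 0 = 0" and P1_cont: "cont2 P1" and P1d_cont: "cont2 P1d"
proof -
  have 0: "cont2 eP1" unfolding eP1_def
    using si_cont J_cont P_cont eP'_cont unfolding case_prod_unfold by (auto intro!: continuous_intros)
  have 1: "continuous_on UNIV (\<lambda>p::par. 0::real)" by (auto intro!: continuous_intros)
  show "so_sol m T (\<lambda>t. - K * al p t * P1 p t + eP1 p t) (P1 p) (P1d p)" "P1 p 0 = 0" "P1d p 0 = 0" "cont2 P1" "cont2 P1d"
    using lin_sol[OF 0 1] lin_cont[OF 0 1] unfolding P1_def P1d_def by auto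
qed

text \<open>Superposition: \<open>Q\<close> starts from position 0 with velocity 1, so
  \<open>Q * pb\<close> carries the initial velocity \<open>pb\<close> and no source, while
  \<open>P\<close> carries the source with zero data.\<close>

lemma Y_sol: "so_sol m T (\<lambda>t. - K * al p t * Y p t + eP p t) (Y p) (Yd p)"
  using so_sol_add[OF P_sol so_sol_scale[OF Q_sol, where a = "pb p"]]
  unfolding Y_def[abs_def] Yd_def[abs_def]
  by (auto simp: algebra_simps elim!: so_sol_cong)

lemma time_deriv:
  assumes "t > 0"
  shows "(X p has_real_derivative V p t) (at t)"
    "(V p has_real_derivative (pw p + K * Sf (z t) (X p t) - V p t) / m) (at t)"
    "(J p has_real_derivative W p t) (at t)"
    "(W p has_real_derivative (- K * al p t * J p t - W p t) / m) (at t)"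
  using X_sol[of "t + 1" p] J_sol[of "t + 1" p] assms unfolding so_sol_def by auto

lemma abs4: "\<bar>- u - v - w + q\<bar> \<le> \<bar>u\<bar> + \<bar>v\<bar> + \<bar>w\<bar> + \<bar>q\<bar>" for u v w q :: real
  by linarith

text \<open>Differentiating the equation in the parameter produces the extra term
  \<open>- K * A' * y\<close>, which joins the source; this explains the right-hand side in
  \<open>sol1\<close>.\<close>

lemma lin_param_deriv:
  fixes A A' E E' y w :: "real \<Rightarrow> real \<Rightarrow> real"
  assumes dA: "\<And>x t. t \<ge> 0 \<Longrightarrow> ((\<lambda>x. A x t) has_real_derivative A' x t) (at x)" and cA': "cont2 A'"
    and A_le: "\<And>x t. t \<ge> 0 \<Longrightarrow> \<bar>A x t\<bar> \<le> B"
    and dE: "\<And>x t. t \<ge> 0 \<Longrightarrow> ((\<lambda>x. E x t) has_real_derivative E' x t) (at x)" and cE': "cont2 E'"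
    and sol: "\<And>x T. so_sol m T (\<lambda>t. - K * A x t * y x t + E x t) (y x) (w x)" and cy: "cont2 y"
    and sol1: "\<And>T. so_sol m T (\<lambda>t. - K * A x0 t * y1 t + (E' x0 t - K * A' x0 t * y x0 t)) y1 w1"
    and init: "((\<lambda>x. y x 0) has_real_derivative y1 0) (at x0)"
      "((\<lambda>x. w x 0) has_real_derivative w1 0) (at x0)"
    and t: "t \<ge> 0"
  shows "((\<lambda>x. y x t) has_real_derivative y1 t) (at x0)" "((\<lambda>x. w x t) has_real_derivative w1 t) (at x0)"
proof -
  have rem: "\<exists>d>0. \<forall>x. \<bar>x - x0\<bar> < d \<longrightarrow> (\<forall>s. 0 < s \<longrightarrow> s < t \<longrightarrow>
      \<bar>(- K * A x s * y x s + E x s) - (- K * A x0 s * y x0 s + E x0 s)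
        - (x - x0) * (- K * A x0 s * y1 s + (E' x0 s - K * A' x0 s * y x0 s))\<bar>
      \<le> K * B * \<bar>y x s - y x0 s - (x - x0) * y1 s\<bar> + e * \<bar>x - x0\<bar>)" if e: "e > 0" for e
  proof -
    obtain My where My: "My > 0" "\<And>s. s \<in> {0..t} \<Longrightarrow> \<bar>y x0 s\<bar> \<le> My"
      using cont2_bounded[OF cy, of t x0] by blast
    obtain MA where MA: "MA > 0" "\<And>s. s \<in> {0..t} \<Longrightarrow> \<bar>A' x0 s\<bar> \<le> MA"
      using cont2_bounded[OF cA', of t x0] by blast
    obtain d1 where d1: "d1 > 0" "\<And>x s. \<bar>x - x0\<bar> < d1 \<Longrightarrow> s \<in> {0..t} \<Longrightarrow>
        \<bar>y x s - y x0 s\<bar> \<le> min 1 (e / (3 * K * MA))"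
      using cont2_uniform[OF cy, of "min 1 (e / (3 * K * MA))" x0 t] e K MA by auto
    obtain d2 where d2: "d2 > 0" "\<And>x s. \<bar>x - x0\<bar> < d2 \<Longrightarrow> s \<in> {0..t} \<Longrightarrow>
        \<bar>A x s - A x0 s - (x - x0) * A' x0 s\<bar> \<le> e / (3 * K * (My + 1)) * \<bar>x - x0\<bar>"
      using cont2_diff_quot[OF dA cA', of "e / (3 * K * (My + 1))" x0 t] e K My by auto
    obtain d3 where d3: "d3 > 0" "\<And>x s. \<bar>x - x0\<bar> < d3 \<Longrightarrow> s \<in> {0..t} \<Longrightarrow>
        \<bar>E x s - E x0 s - (x - x0) * E' x0 s\<bar> \<le> e / 3 * \<bar>x - x0\<bar>"
      using cont2_diff_quot[OF dE cE', of "e / 3" x0 t] e by auto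
    show ?thesis
    proof (intro exI[of _ "min d1 (min d2 d3)"] conjI allI impI)
      fix x s assume x: "\<bar>x - x0\<bar> < min d1 (min d2 d3)" and s: "0 < s" "s < t"
      let ?r = "y x s - y x0 s - (x - x0) * y1 s"
      let ?dA = "A x s - A x0 s - (x - x0) * A' x0 s"
      let ?dE = "E x s - E x0 s - (x - x0) * E' x0 s"
      \<comment> \<open>The expansion error splits into a Lipschitz part in \<open>?r\<close>, the
        Taylor remainder of \<open>A\<close> times \<open>y\<close>, a product of two first-order
        increments, and the Taylor remainder of \<open>E\<close>. Each of the last three is given a
        third of \<open>e\<close>.\<close>
      have eq: "(- K * A x s * y x s + E x s) - (- K * A x0 s * y x0 s + E x0 s)
        - (x - x0) * (- K * A x0 s * y1 s + (E' x0 s - K * A' x0 s * y x0 s))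
        = - (K * A x0 s * ?r) - K * (?dA * y x s) - K * ((x - x0) * A' x0 s * (y x s - y x0 s)) + ?dE"
        by (simp add: algebra_simps)
      have A1: "\<bar>K * A x0 s * ?r\<bar> \<le> K * B * \<bar>?r\<bar>"
        using K A_le[of s x0] s by (auto simp: abs_mult intro!: mult_right_mono)
      have A2: "\<bar>K * (?dA * y x s)\<bar> \<le> e / 3 * \<bar>x - x0\<bar>"
      proof -
        have "\<bar>y x s\<bar> \<le> My + 1" using d1(2)[of x s] My(2)[of s] x s by auto
        then have "\<bar>?dA\<bar> * \<bar>y x s\<bar> \<le> (e / (3 * K * (My + 1)) * \<bar>x - x0\<bar>) * (My + 1)"
          using d2(2)[of x s] x s e K My by (intro mult_mono) auto
        also have "\<dots> = e / (3 * K) * \<bar>x - x0\<bar>" using My by simp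
        finally have "K * (\<bar>?dA\<bar> * \<bar>y x s\<bar>) \<le> K * (e / (3 * K) * \<bar>x - x0\<bar>)"
          using K by (intro mult_left_mono) auto
        then show ?thesis using K by (simp add: abs_mult)
      qed
      have A3: "\<bar>K * ((x - x0) * A' x0 s * (y x s - y x0 s))\<bar> \<le> e / 3 * \<bar>x - x0\<bar>"
      proof -
        have "\<bar>A' x0 s\<bar> * \<bar>y x s - y x0 s\<bar> \<le> MA * (e / (3 * K * MA))"
          using d1(2)[of x s] MA(2)[of s] x s MA(1) by (intro mult_mono) auto
        also have "\<dots> = e / (3 * K)" using MA by simp
        finally have "K * \<bar>x - x0\<bar> * (\<bar>A' x0 s\<bar> * \<bar>y x s - y x0 s\<bar>) \<le> K * \<bar>x - x0\<bar> * (e / (3 * K))"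
          using K by (intro mult_left_mono) auto
        also have "K * \<bar>x - x0\<bar> * (e / (3 * K)) = e / 3 * \<bar>x - x0\<bar>" using K by simp
        finally have *: "K * \<bar>x - x0\<bar> * (\<bar>A' x0 s\<bar> * \<bar>y x s - y x0 s\<bar>) \<le> e / 3 * \<bar>x - x0\<bar>" .
        have "\<bar>K * ((x - x0) * A' x0 s * (y x s - y x0 s))\<bar> = K * \<bar>x - x0\<bar> * (\<bar>A' x0 s\<bar> * \<bar>y x s - y x0 s\<bar>)"
          using K by (simp add: abs_mult)
        with * show ?thesis by (simp only:)
      qed
      have A4: "\<bar>?dE\<bar> \<le> e / 3 * \<bar>x - x0\<bar>" using d3(2)[of x s] x s by auto
      show "\<bar>(- K * A x s * y x s + E x s) - (- K * A x0 s * y x0 s + E x0 s)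
        - (x - x0) * (- K * A x0 s * y1 s + (E' x0 s - K * A' x0 s * y x0 s))\<bar>
        \<le> K * B * \<bar>?r\<bar> + e * \<bar>x - x0\<bar>" 
        unfolding eq
        by (rule order_trans[OF order_trans[OF abs4 add_mono[OF add_mono[OF add_mono[OF A1 A2] A3] A4]]]) simp
    qed (use d1 d2 d3 in auto)
  qed
  show "((\<lambda>x. y x t) has_real_derivative y1 t) (at x0)" "((\<lambda>x. w x t) has_real_derivative w1 t) (at x0)"
    using so_param_deriv[OF m KB sol sol1 init rem, of t] t by auto
qed

end

text \<open>A curve in parameter space at fixed frequency \<open>om\<close>: the starting point
  runs, and \<open>a\<close>, \<open>a1\<close>, \<open>a2\<close> are the initial velocity and its
  derivatives. As \<open>a2\<close> is merely continuous, \<open>Y\<close> cannot be differentiated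
  as a whole, but \<open>P\<close> and \<open>Q\<close> can.\<close>

locale flow_path = flow +
  fixes a a1 a2 :: "real \<Rightarrow> real" and om :: real
  assumes da: "\<And>x. (a has_real_derivative a1 x) (at x)"
    and da1: "\<And>x. (a1 has_real_derivative a2 x) (at x)"
    and ca2: "continuous_on UNIV a2"
begin

definition path :: "real \<Rightarrow> par" where "path x = (x, a x, om, a1 x, a2 x)"

lemma path_sel [simp]: "px (path x) = x" "pv (path x) = a x" "pw (path x) = om"
  "pa (path x) = a1 x" "pb (path x) = a2 x"
  by (simp_all add: path_def)

lemma path_cont: "continuous_on UNIV path"
proof -
  have "continuous_on UNIV a" "continuous_on UNIV a1"
    using da da1 by (meson DERIV_continuous continuous_at_imp_continuous_on)+
  then show ?thesis unfolding path_def[abs_def] using ca2 by (intro continuous_intros)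
qed

text \<open>The equation for \<open>X\<close> is nonlinear, so the quadratic remainder of
  \<open>Sf_taylor\<close> has to be absorbed; one part of it goes into the Lipschitz term, whence
  the constant \<open>2 * (K * B)\<close>.\<close>

lemma X_deriv: "t \<ge> 0 \<Longrightarrow> ((\<lambda>x. X (path x) t) has_real_derivative J (path x0) t) (at x0)"
  and V_deriv: "t \<ge> 0 \<Longrightarrow> ((\<lambda>x. V (path x) t) has_real_derivative W (path x0) t) (at x0)"
proof -
  have rem: "\<exists>d>0. \<forall>x. \<bar>x - x0\<bar> < d \<longrightarrow> (\<forall>s. 0 < s \<longrightarrow> s < t \<longrightarrow>
      \<bar>(om + K * Sf (z s) (X (path x) s)) - (om + K * Sf (z s) (X (path x0) s))
        - (x - x0) * (- K * al (path x0) s * J (path x0) s)\<bar>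
      \<le> 2 * (K * B) * \<bar>X (path x) s - X (path x0) s - (x - x0) * J (path x0) s\<bar> + e * \<bar>x - x0\<bar>)"
    if e: "e > 0" for e t
  proof -
    obtain MJ where MJ: "MJ > 0" "\<And>s. s \<in> {0..t} \<Longrightarrow> \<bar>J (path x0) s\<bar> \<le> MJ"
      using cont2_bounded[OF J_cont, of t "path x0"] by blast
    \<comment> \<open>The bound 1 lets the part containing \<open>?r\<close> go into the Lipschitz
      term; the other bound makes what is left at most \<open>e\<close> times the increment of
      \<open>x\<close>.\<close>
    define h where "h = min 1 (e / ((K * B + 1) * MJ))"
    have h: "h > 0" using e MJ KB by (simp add: h_def)
    obtain d where d: "d > 0" "\<And>x s. \<bar>x - x0\<bar> < d \<Longrightarrow> s \<in> {0..t} \<Longrightarrow>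
        \<bar>X (path x) s - X (path x0) s\<bar> \<le> h"
      using cont2_uniform[OF cont2_comp[OF X_cont path_cont] h] by blast
    show ?thesis
    proof (intro exI[of _ d] conjI allI impI d(1))
      fix x s assume x: "\<bar>x - x0\<bar> < d" and s: "0 < s" "s < t"
      let ?D = "X (path x) s - X (path x0) s" let ?r = "?D - (x - x0) * J (path x0) s"
      let ?R = "Sf (z s) (X (path x) s) - Sf (z s) (X (path x0) s) + al (path x0) s * ?D"
      have D: "\<bar>?D\<bar> \<le> h" using d(2)[OF x, of s] s by simp
      have "\<bar>?D\<bar> \<le> \<bar>?r\<bar> + \<bar>(x - x0) * J (path x0) s\<bar>" by linarith
      also have "\<bar>(x - x0) * J (path x0) s\<bar> \<le> MJ * \<bar>x - x0\<bar>"
        using mult_right_mono[OF MJ(2)[of s], of "\<bar>x - x0\<bar>"] s by (simp add: abs_mult mult.commute)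
      finally have D2: "\<bar>?D\<bar> \<le> \<bar>?r\<bar> + MJ * \<bar>x - x0\<bar>" by simp
      have "\<bar>?R\<bar> \<le> norm (z s) * \<bar>?D\<bar>\<^sup>2" unfolding al_def by (rule Sf_taylor)
      also have "\<dots> \<le> B * (h * \<bar>?D\<bar>)"
        unfolding power2_eq_square using z_le[of s] s D B by (intro mult_mono) auto
      also have "\<dots> \<le> B * (h * (\<bar>?r\<bar> + MJ * \<bar>x - x0\<bar>))"
        using B h D2 by (intro mult_left_mono) auto
      finally have "K * \<bar>?R\<bar> \<le> K * (B * (h * (\<bar>?r\<bar> + MJ * \<bar>x - x0\<bar>)))"
        using K by (intro mult_left_mono) auto
      also have "\<dots> = K * B * h * \<bar>?r\<bar> + K * B * h * MJ * \<bar>x - x0\<bar>" by (simp add: algebra_simps)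
      also have "\<dots> \<le> K * B * \<bar>?r\<bar> + e * \<bar>x - x0\<bar>"
      proof (intro add_mono mult_right_mono)
        show "K * B * h \<le> K * B" using KB by (simp add: h_def mult_left_le)
        have KB1: "K * B + 1 \<noteq> 0" using KB by linarith
        have "K * B * h * MJ \<le> (K * B + 1) * (e / ((K * B + 1) * MJ)) * MJ"
          using KB MJ h by (intro mult_right_mono mult_mono) (auto simp: h_def)
        also have "(K * B + 1) * (e / ((K * B + 1) * MJ)) * MJ = e" using MJ KB1 by simp
        finally show "K * B * h * MJ \<le> e" .
      qed auto
      finally have 1: "\<bar>K * ?R\<bar> \<le> K * B * \<bar>?r\<bar> + e * \<bar>x - x0\<bar>" using K by (simp add: abs_mult)
      have 2: "\<bar>K * al (path x0) s * ?r\<bar> \<le> K * B * \<bar>?r\<bar>"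
        using K al_le[of s "path x0"] s by (auto simp: abs_mult intro!: mult_right_mono)
      have "(om + K * Sf (z s) (X (path x) s)) - (om + K * Sf (z s) (X (path x0) s))
        - (x - x0) * (- K * al (path x0) s * J (path x0) s) = K * ?R - K * al (path x0) s * ?r"
        by (simp add: algebra_simps)
      then show "\<bar>(om + K * Sf (z s) (X (path x) s)) - (om + K * Sf (z s) (X (path x0) s))
        - (x - x0) * (- K * al (path x0) s * J (path x0) s)\<bar> \<le> 2 * (K * B) * \<bar>?r\<bar> + e * \<bar>x - x0\<bar>"
        using 1 2 by linarith
    qed
  qed
  have sol: "so_sol m T (\<lambda>t. om + K * Sf (z t) (X (path x) t)) (X (path x)) (V (path x))" for x T
    using X_sol[of T "path x"] by simp
  have "2 * (K * B) \<ge> 0" using KB by simp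
  note th = so_param_deriv[OF m this sol J_sol _ _ rem]
  show "t \<ge> 0 \<Longrightarrow> ((\<lambda>x. X (path x) t) has_real_derivative J (path x0) t) (at x0)"
    "t \<ge> 0 \<Longrightarrow> ((\<lambda>x. V (path x) t) has_real_derivative W (path x0) t) (at x0)"
    using th[of t t] da by auto
qed

lemma al_deriv: "t \<ge> 0 \<Longrightarrow> ((\<lambda>x. al (path x) t) has_real_derivative si (path x0) t * J (path x0) t) (at x0)"
  and si_deriv: "t \<ge> 0 \<Longrightarrow> ((\<lambda>x. si (path x) t) has_real_derivative - al (path x0) t * J (path x0) t) (at x0)"
  unfolding al_def si_def by (rule DERIV_chain2[OF DERIV_Al X_deriv] DERIV_chain2[OF DERIV_Sf X_deriv], assumption)+

lemma aJ_cont: "cont2 (\<lambda>x t. si (path x) t * J (path x) t)"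
  using cont2_comp[OF si_cont path_cont] cont2_comp[OF J_cont path_cont]
  unfolding case_prod_unfold by (auto intro!: continuous_intros)

lemmas lin_path_deriv = lin_param_deriv[OF al_deriv aJ_cont al_le]

lemma J_deriv: "t \<ge> 0 \<Longrightarrow> ((\<lambda>x. J (path x) t) has_real_derivative Y (path x0) t) (at x0)"
  and W_deriv: "t \<ge> 0 \<Longrightarrow> ((\<lambda>x. W (path x) t) has_real_derivative Yd (path x0) t) (at x0)"
proof -
  have s1: "so_sol m T (\<lambda>t. - K * al (path x) t * J (path x) t + 0) (J (path x)) (W (path x))" for x T
    using J_sol by simp
  have s2: "so_sol m T (\<lambda>t. - K * al (path x0) t * Y (path x0) t
      + (0 - K * (si (path x0) t * J (path x0) t) * J (path x0) t)) (Y (path x0)) (Yd (path x0))" for T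
    using Y_sol[of T "path x0"] by (auto simp: eP_def power2_eq_square algebra_simps elim!: so_sol_cong)
  have c: "cont2 (\<lambda>(x::real) t. 0 :: real)" by (auto intro!: continuous_intros)
  have d: "((\<lambda>x::real. 0 :: real) has_real_derivative 0) (at x)" for x by (rule DERIV_const)
  show "t \<ge> 0 \<Longrightarrow> ((\<lambda>x. J (path x) t) has_real_derivative Y (path x0) t) (at x0)"
    "t \<ge> 0 \<Longrightarrow> ((\<lambda>x. W (path x) t) has_real_derivative Yd (path x0) t) (at x0)"
    using lin_path_deriv[OF _ _ d c s1 cont2_comp[OF J_cont path_cont] s2, where t = t] da1[of x0]
    by (auto simp: Y_def Yd_def)
qed

lemma Q_deriv: "t \<ge> 0 \<Longrightarrow> ((\<lambda>x. Q (path x) t) has_real_derivative Q1 (path x0) t) (at x0)"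
  and Qd_deriv: "t \<ge> 0 \<Longrightarrow> ((\<lambda>x. Qd (path x) t) has_real_derivative Q1d (path x0) t) (at x0)"
proof -
  have s1: "so_sol m T (\<lambda>t. - K * al (path x) t * Q (path x) t + 0) (Q (path x)) (Qd (path x))" for x T
    using Q_sol by simp
  have s2: "so_sol m T (\<lambda>t. - K * al (path x0) t * Q1 (path x0) t
      + (0 - K * (si (path x0) t * J (path x0) t) * Q (path x0) t)) (Q1 (path x0)) (Q1d (path x0))" for T
    using Q1_sol[of T "path x0"] by (auto simp: eQ1_def algebra_simps elim!: so_sol_cong)
  have c: "cont2 (\<lambda>(x::real) t. 0 :: real)" by (auto intro!: continuous_intros)
  have d: "((\<lambda>x::real. 0 :: real) has_real_derivative 0) (at x)" for x by (rule DERIV_const)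
  show "t \<ge> 0 \<Longrightarrow> ((\<lambda>x. Q (path x) t) has_real_derivative Q1 (path x0) t) (at x0)"
    "t \<ge> 0 \<Longrightarrow> ((\<lambda>x. Qd (path x) t) has_real_derivative Q1d (path x0) t) (at x0)"
    using lin_path_deriv[OF _ _ d c s1 cont2_comp[OF Q_cont path_cont] s2, where t = t] by auto
qed

lemma P_deriv: "t \<ge> 0 \<Longrightarrow> ((\<lambda>x. P (path x) t) has_real_derivative P1 (path x0) t) (at x0)"
  and Pd_deriv: "t \<ge> 0 \<Longrightarrow> ((\<lambda>x. Pd (path x) t) has_real_derivative P1d (path x0) t) (at x0)"
proof -
  have d: "((\<lambda>x. eP (path x) t) has_real_derivative eP' (path x0) t) (at x0)" if "t \<ge> 0" for x0 t
    unfolding eP_def eP'_def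
    by (auto intro!: derivative_eq_intros si_deriv J_deriv that simp: power2_eq_square power3_eq_cube algebra_simps)
  have s2: "so_sol m T (\<lambda>t. - K * al (path x0) t * P1 (path x0) t
      + (eP' (path x0) t - K * (si (path x0) t * J (path x0) t) * P (path x0) t)) (P1 (path x0)) (P1d (path x0))" for T
    using P1_sol[of T "path x0"] by (auto simp: eP1_def algebra_simps elim!: so_sol_cong)
  show "t \<ge> 0 \<Longrightarrow> ((\<lambda>x. P (path x) t) has_real_derivative P1 (path x0) t) (at x0)"
    "t \<ge> 0 \<Longrightarrow> ((\<lambda>x. Pd (path x) t) has_real_derivative P1d (path x0) t) (at x0)"
    using lin_path_deriv[OF _ _ d cont2_comp[OF eP'_cont path_cont] P_sol cont2_comp[OF P_cont path_cont] s2, where t = t]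
    by auto
qed

end

section \<open>Comparison of fields, a priori bounds and periodicity\<close>

lemma DERIV_periodic:
  fixes f f' :: "real \<Rightarrow> real"
  assumes d: "\<And>x. (f has_real_derivative f' x) (at x)" and per: "\<And>x. f (x + c) = f x + b"
  shows "f' (x + c) = f' x"
proof -
  have "((\<lambda>x. f (x + c)) has_real_derivative f' (x + c)) (at x)"
    using d[of "x + c"] by (simp add: DERIV_shift)
  moreover have "((\<lambda>x. f x + b) has_real_derivative f' x) (at x)"
    by (auto intro!: derivative_eq_intros d)
  ultimately show ?thesis unfolding per by (rule DERIV_unique)
qed

lemma so_sol_shift: "so_sol m T f y w \<Longrightarrow> so_sol m T f (\<lambda>t. y t + c) w"
  unfolding so_sol_def by (auto intro!: continuous_intros derivative_eq_intros)

lemma so_bound_abs: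
  assumes "m > 0" "L \<ge> 0" "D \<ge> 0" "so_sol m T f y w"
    and "\<And>t. 0 < t \<Longrightarrow> t < T \<Longrightarrow> \<bar>f t\<bar> \<le> L * \<bar>y t\<bar> + D" and "t \<in> {0..T}"
  shows "\<bar>y t\<bar> \<le> sqrt (so_const m L T) * (\<bar>y 0\<bar> + \<bar>w 0\<bar> + D)"
    "\<bar>w t\<bar> \<le> sqrt (so_const m L T) * (\<bar>y 0\<bar> + \<bar>w 0\<bar> + D)"
proof -
  have "(y t)\<^sup>2 + (w t)\<^sup>2 \<le> so_const m L T * ((y 0)\<^sup>2 + (w 0)\<^sup>2 + D\<^sup>2)"
    by (rule so_bound[OF assms])
  also have "\<dots> \<le> so_const m L T * (\<bar>y 0\<bar> + \<bar>w 0\<bar> + D)\<^sup>2"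
  proof (intro mult_left_mono)
    have "0 \<le> \<bar>y 0\<bar> * \<bar>w 0\<bar> + \<bar>y 0\<bar> * D + \<bar>w 0\<bar> * D" using assms by auto
    then show "(y 0)\<^sup>2 + (w 0)\<^sup>2 + D\<^sup>2 \<le> (\<bar>y 0\<bar> + \<bar>w 0\<bar> + D)\<^sup>2"
      unfolding power2_sum by (simp add: power2_eq_square algebra_simps)
  qed (use so_const_pos[OF assms(1)] in \<open>auto intro: less_imp_le\<close>)
  also have "\<dots> = (sqrt (so_const m L T) * (\<bar>y 0\<bar> + \<bar>w 0\<bar> + D))\<^sup>2"
    using so_const_pos[OF assms(1), of L T] by (simp add: power_mult_distrib)
  finally have *: "(y t)\<^sup>2 + (w t)\<^sup>2 \<le> (sqrt (so_const m L T) * (\<bar>y 0\<bar> + \<bar>w 0\<bar> + D))\<^sup>2" .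
  have "0 \<le> sqrt (so_const m L T) * (\<bar>y 0\<bar> + \<bar>w 0\<bar> + D)"
    using assms so_const_pos[OF assms(1), of L T] by (intro mult_nonneg_nonneg) auto
  moreover have "(y t)\<^sup>2 \<le> (sqrt (so_const m L T) * (\<bar>y 0\<bar> + \<bar>w 0\<bar> + D))\<^sup>2"
    "(w t)\<^sup>2 \<le> (sqrt (so_const m L T) * (\<bar>y 0\<bar> + \<bar>w 0\<bar> + D))\<^sup>2"
    using * zero_le_power2[of "y t"] zero_le_power2[of "w t"] by linarith+
  ultimately show "\<bar>y t\<bar> \<le> sqrt (so_const m L T) * (\<bar>y 0\<bar> + \<bar>w 0\<bar> + D)"
    "\<bar>w t\<bar> \<le> sqrt (so_const m L T) * (\<bar>y 0\<bar> + \<bar>w 0\<bar> + D)"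
    using power2_le_imp_le[of "\<bar>y t\<bar>"] power2_le_imp_le[of "\<bar>w t\<bar>"] by simp_all
qed

text \<open>A change of the field acts on the difference of the trajectories as a forcing of size
  \<open>K * d * exp (l * s)\<close>, so \<open>so_energy\<close> applies. The choice of
  \<open>l\<close> makes the result half of \<open>d\<close>, which is the contraction of the
  mean-field map.\<close>

lemma flow_compare:
  assumes "flow m K B z" "flow m K B z'"
    and l: "2 * l \<ge> so_rate m (K * B) + 4 * K\<^sup>2 / m" and d: "d \<ge> 0" and T: "T \<ge> 0"
    and zz: "\<And>s. s \<in> {0..T} \<Longrightarrow> norm (z s - z' s) \<le> d * exp (l * s)"
  shows "\<bar>flow.X m K z p T - flow.X m K z' p T\<bar> \<le> d / 2 * exp (l * T)"
proof -
  interpret z: flow m K B z by fact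
  interpret z': flow m K B z' by fact
  note m = z.m and K = z.K
  \<comment> \<open>The denominator in \<open>so_energy\<close>. From
    \<open>q >= 4 * K^2 / m\<close> follows \<open>(K * d)^2 / m / q <= (d / 2)^2\<close>.\<close>
  define q where "q = 2 * l - so_rate m (K * B)"
  have q: "q \<ge> 4 * K\<^sup>2 / m" "q > 0" using l K m by (auto simp: q_def) (smt (verit) divide_pos_pos zero_less_power zero_less_numeral mult_pos_pos)
  have "(z.X p T - z'.X p T)\<^sup>2 + (z.V p T - z'.V p T)\<^sup>2
    \<le> ((z.X p 0 - z'.X p 0)\<^sup>2 + (z.V p 0 - z'.V p 0)\<^sup>2 + (K * d)\<^sup>2 / m / (2 * l - so_rate m (K * B))) * exp (2 * l * T)"
  proof (rule so_energy[OF m z.KB so_sol_diff[OF z.X_sol z'.X_sol, of T p p]])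
    fix t assume t: "0 < t" "t < T"
    have "Sf (z t) (z'.X p t) - Sf (z' t) (z'.X p t) = Sf (z t - z' t) (z'.X p t)"
      by (simp add: Sf_def algebra_simps)
    then have "\<bar>Sf (z t) (z'.X p t) - Sf (z' t) (z'.X p t)\<bar> \<le> d * exp (l * t)"
      using order_trans[OF Sf_le[of "z t - z' t" "z'.X p t"] zz[of t]] t by simp
    then have "K * \<bar>Sf (z t) (z'.X p t) - Sf (z' t) (z'.X p t)\<bar> \<le> K * (d * exp (l * t))"
      using K by (intro mult_left_mono) auto
    then have "\<bar>K * Sf (z t) (z'.X p t) - K * Sf (z' t) (z'.X p t)\<bar> \<le> K * d * exp (l * t)"
      using K by (simp add: right_diff_distrib[symmetric] abs_mult)
    moreover have "\<bar>(pw p + K * Sf (z t) (z.X p t)) - (pw p + K * Sf (z t) (z'.X p t))\<bar>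
        \<le> K * B * \<bar>z.X p t - z'.X p t\<bar>" using z.zS_lip t by simp
    ultimately show "\<bar>(pw p + K * Sf (z t) (z.X p t)) - (pw p + K * Sf (z' t) (z'.X p t))\<bar>
        \<le> K * B * \<bar>z.X p t - z'.X p t\<bar> + K * d * exp (l * t)" by linarith
  qed (use q T in \<open>auto simp: q_def\<close>)
  then have 1: "(z.X p T - z'.X p T)\<^sup>2 + (z.V p T - z'.V p T)\<^sup>2 \<le> (K * d)\<^sup>2 / m / q * exp (2 * l * T)"
    by (simp add: q_def)
  have "4 * K\<^sup>2 \<le> q * m" using q(1) m by (simp add: field_simps)
  then have "d\<^sup>2 * (4 * K\<^sup>2) \<le> d\<^sup>2 * (q * m)" by (intro mult_left_mono) auto
  then have "(K * d)\<^sup>2 / m / q \<le> (d / 2)\<^sup>2" using q(2) m by (simp add: field_simps)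
  then have "(K * d)\<^sup>2 / m / q * exp (2 * l * T) \<le> (d / 2)\<^sup>2 * exp (2 * l * T)"
    by (intro mult_right_mono) auto
  also have "\<dots> = (d / 2 * exp (l * T))\<^sup>2"
    unfolding power_mult_distrib by (simp add: power2_eq_square exp_add[symmetric])
  finally have "(z.X p T - z'.X p T)\<^sup>2 \<le> (d / 2 * exp (l * T))\<^sup>2"
    using 1 zero_le_power2[of "z.V p T - z'.V p T"] by linarith
  then show ?thesis using power2_le_imp_le[of "\<bar>z.X p T - z'.X p T\<bar>" "d / 2 * exp (l * T)"] d by simp
qed

context flow
begin

lemma lin_bound:
  assumes "so_sol m T (\<lambda>t. - K * al p t * y t + e t) y w" "D \<ge> 0"
    and "\<And>t. 0 < t \<Longrightarrow> t < T \<Longrightarrow> \<bar>e t\<bar> \<le> D" "t \<in> {0..T}"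
  shows "\<bar>y t\<bar> \<le> sqrt (so_const m (K * B) T) * (\<bar>y 0\<bar> + \<bar>w 0\<bar> + D)"
    "\<bar>w t\<bar> \<le> sqrt (so_const m (K * B) T) * (\<bar>y 0\<bar> + \<bar>w 0\<bar> + D)"
proof -
  have "\<bar>- K * al p t * y t + e t\<bar> \<le> K * B * \<bar>y t\<bar> + D" if "0 < t" "t < T" for t
  proof -
    have "\<bar>K * al p t * y t\<bar> \<le> K * B * \<bar>y t\<bar>"
      using K al_le[of t p] that by (auto simp: abs_mult intro!: mult_right_mono)
    then show ?thesis using assms(3)[OF that] by (simp add: abs_le_iff)
  qed
  then show "\<bar>y t\<bar> \<le> sqrt (so_const m (K * B) T) * (\<bar>y 0\<bar> + \<bar>w 0\<bar> + D)"
    "\<bar>w t\<bar> \<le> sqrt (so_const m (K * B) T) * (\<bar>y 0\<bar> + \<bar>w 0\<bar> + D)"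
    using so_bound_abs[OF m KB assms(2,1) _ assms(4)] by auto
qed

text \<open>Subtracting the starting position leaves velocity and forcing unchanged and makes the
  initial value zero, so the bound does not depend on \<open>px p\<close>.\<close>

lemma XV_bound:
  assumes "t \<in> {0..T}"
  shows "\<bar>X p t - px p\<bar> \<le> sqrt (so_const m (K * B) T) * (\<bar>pv p\<bar> + \<bar>pw p\<bar> + K * B)"
    "\<bar>V p t\<bar> \<le> sqrt (so_const m (K * B) T) * (\<bar>pv p\<bar> + \<bar>pw p\<bar> + K * B)"
proof -
  have f: "\<bar>pw p + K * Sf (z t) (X p t)\<bar> \<le> K * B * \<bar>X p t + - px p\<bar> + (\<bar>pw p\<bar> + K * B)" if "0 < t" "t < T" for t
  proof -
    have "\<bar>K * Sf (z t) (X p t)\<bar> \<le> K * B"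
      using K si_le[of t p] that by (auto simp: abs_mult si_def intro!: mult_left_mono)
    moreover have "0 \<le> K * B * \<bar>X p t + - px p\<bar>" using KB by simp
    ultimately show ?thesis by linarith
  qed
  have D: "0 \<le> \<bar>pw p\<bar> + K * B" using KB by simp
  note b = so_bound_abs[OF m KB D so_sol_shift[OF X_sol[of T p], where c = "- px p"] f assms]
  show "\<bar>X p t - px p\<bar> \<le> sqrt (so_const m (K * B) T) * (\<bar>pv p\<bar> + \<bar>pw p\<bar> + K * B)"
    using b(1) by (simp add: add.assoc)
  show "\<bar>V p t\<bar> \<le> sqrt (so_const m (K * B) T) * (\<bar>pv p\<bar> + \<bar>pw p\<bar> + K * B)"
    using b(2) by (simp add: add.assoc)
qed

text \<open>The constant serves all positions, velocities and frequencies at once: \<open>al\<close>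
  and \<open>si\<close> are bounded by \<open>B\<close>, so only \<open>pa\<close> enters the
  lower-order bounds. Linear growth in \<open>pb\<close> comes from \<open>Y\<close> in the source
  of \<open>P1\<close>, that in \<open>pv\<close> and \<open>pw\<close> from the velocity
  itself.\<close>

lemma bounds:
  assumes M: "M \<ge> 0"
  shows "\<exists>C\<ge>1. \<forall>p t. \<bar>pa p\<bar> \<le> M \<longrightarrow> t \<in> {0..T} \<longrightarrow>
    \<bar>J p t\<bar> \<le> C \<and> \<bar>W p t\<bar> \<le> C \<and> \<bar>Q p t\<bar> \<le> C \<and> \<bar>Qd p t\<bar> \<le> C \<and> \<bar>P p t\<bar> \<le> C \<and> \<bar>Pd p t\<bar> \<le> C \<and>
    \<bar>Q1 p t\<bar> \<le> C \<and> \<bar>Q1d p t\<bar> \<le> C \<and> \<bar>P1 p t\<bar> \<le> C * (1 + \<bar>pb p\<bar>) \<and> \<bar>P1d p t\<bar> \<le> C * (1 + \<bar>pb p\<bar>) \<and>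
    \<bar>V p t\<bar> \<le> C * (1 + \<bar>pv p\<bar> + \<bar>pw p\<bar>)"
proof -
  \<comment> \<open>\<open>c\<close> is the growth factor of the linear equation; \<open>D1\<close>,
    \<open>D2\<close>, \<open>D3\<close> bound \<open>J\<close>, \<open>P\<close>, \<open>Q1\<close>
    together with their time derivatives, and \<open>E0\<close> bounds the source of
    \<open>P1\<close> relative to \<open>1 + |pb p|\<close>.\<close>
  define c where "c = sqrt (so_const m (K * B) T)"
  have c: "c \<ge> 0" using so_const_pos[OF m, of "K * B" T] by (simp add: c_def)
  define D1 where "D1 = c * (1 + M)"
  define D2 where "D2 = c * (K * B * D1\<^sup>2)"
  define D3 where "D3 = c * (K * B * D1 * c)"
  define E0 where "E0 = K * B * D1 * D2 + K * B * D1 ^ 3 + 2 * K * B * D1 * (D2 + c)"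
  define C where "C = 1 + D1 + c + D2 + D3 + c * E0 + c * (1 + K * B)"
  have D1: "D1 \<ge> 0" using c M by (simp add: D1_def)
  then have D2: "D2 \<ge> 0" and D3: "D3 \<ge> 0"
    unfolding D2_def D3_def using c KB by (auto intro!: mult_nonneg_nonneg[of c] mult_nonneg_nonneg[of "K * B"] mult_nonneg_nonneg[of "K * B * D1"])
  have KBD: "0 \<le> K * B * D1" using KB D1 by (rule mult_nonneg_nonneg)
  have "0 \<le> E0"
    using mult_nonneg_nonneg[OF KBD D2] mult_nonneg_nonneg[OF KBD, of "D2 + c"] mult_nonneg_nonneg[OF KB, of "D1 ^ 3"] c D1 D2
    unfolding E0_def by (simp add: mult.assoc)
  with D1 D2 D3 have pos: "D1 \<ge> 0" "D2 \<ge> 0" "D3 \<ge> 0" "E0 \<ge> 0" by auto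
  have Kmul: "\<bar>K * s * x\<bar> \<le> K * B * y" if "\<bar>s\<bar> \<le> B" "\<bar>x\<bar> \<le> y" for s x y
    using that K B by (auto simp: abs_mult intro!: mult_mono)
  have *: "\<bar>J p t\<bar> \<le> D1 \<and> \<bar>W p t\<bar> \<le> D1 \<and> \<bar>Q p t\<bar> \<le> c \<and> \<bar>Qd p t\<bar> \<le> c \<and> \<bar>P p t\<bar> \<le> D2 \<and> \<bar>Pd p t\<bar> \<le> D2 \<and>
    \<bar>Q1 p t\<bar> \<le> D3 \<and> \<bar>Q1d p t\<bar> \<le> D3 \<and> \<bar>P1 p t\<bar> \<le> c * (E0 * (1 + \<bar>pb p\<bar>)) \<and> \<bar>P1d p t\<bar> \<le> c * (E0 * (1 + \<bar>pb p\<bar>))"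
    if pa: "\<bar>pa p\<bar> \<le> M" and t: "t \<in> {0..T}" for p t
  proof -
    have J: "\<bar>J p s\<bar> \<le> D1" "\<bar>W p s\<bar> \<le> D1" if "s \<in> {0..T}" for s
    proof -
      have "so_sol m T (\<lambda>t. - K * al p t * J p t + 0) (J p) (W p)" using J_sol by simp
      note b = lin_bound[OF this order_refl _ that]
      have "c * (1 + \<bar>pa p\<bar>) \<le> D1" unfolding D1_def using c pa by (intro mult_left_mono) auto
      then show "\<bar>J p s\<bar> \<le> D1" "\<bar>W p s\<bar> \<le> D1" using b by (auto simp: c_def)
    qed
    have Q: "\<bar>Q p s\<bar> \<le> c" "\<bar>Qd p s\<bar> \<le> c" if "s \<in> {0..T}" for s
    proof -
      have "so_sol m T (\<lambda>t. - K * al p t * Q p t + 0) (Q p) (Qd p)" using Q_sol by simp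
      from lin_bound[OF this order_refl _ that] show "\<bar>Q p s\<bar> \<le> c" "\<bar>Qd p s\<bar> \<le> c"
        by (auto simp: c_def)
    qed
    have "\<bar>eP p s\<bar> \<le> K * B * D1\<^sup>2" if "0 < s" "s < T" for s
      using Kmul[of "si p s" "(J p s)\<^sup>2" "D1\<^sup>2"] si_le[of s p] J(1)[of s] that pos
      by (auto simp: eP_def abs_le_square_iff[symmetric])
    from lin_bound[OF P_sol _ this] have P: "\<bar>P p s\<bar> \<le> D2" "\<bar>Pd p s\<bar> \<le> D2" if "s \<in> {0..T}" for s
      using KB that by (auto simp: D2_def c_def)
    have "\<bar>eQ1 p s\<bar> \<le> K * B * (D1 * c)" if "0 < s" "s < T" for s
    proof -
      have "\<bar>J p s * Q p s\<bar> \<le> D1 * c"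
        unfolding abs_mult using J(1)[of s] Q(1)[of s] that pos by (intro mult_mono) auto
      then show ?thesis using Kmul[of "si p s" "J p s * Q p s" "D1 * c"] si_le[of s p] that
        by (auto simp: eQ1_def mult.assoc)
    qed
    from lin_bound[OF Q1_sol mult_nonneg_nonneg[OF KB mult_nonneg_nonneg[OF D1 c]] this]
    have Q1: "\<bar>Q1 p s\<bar> \<le> D3" "\<bar>Q1d p s\<bar> \<le> D3" if "s \<in> {0..T}" for s
      using that by (simp_all add: D3_def c_def mult.assoc)
    have eP1: "\<bar>eP1 p s\<bar> \<le> E0 * (1 + \<bar>pb p\<bar>)" if "0 < s" "s < T" for s
    proof -
      have s: "s \<in> {0..T}" "s \<ge> 0" using that by auto
      have "\<bar>J p s * P p s\<bar> \<le> D1 * D2"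
        unfolding abs_mult using J(1)[OF s(1)] P(1)[OF s(1)] pos by (intro mult_mono) auto
      from Kmul[OF si_le[OF s(2)] this] have 1: "\<bar>K * si p s * (J p s * P p s)\<bar> \<le> K * B * (D1 * D2)" .
      have "\<bar>J p s ^ 3\<bar> \<le> D1 ^ 3"
        unfolding power_abs using J(1)[OF s(1)] by (intro power_mono) auto
      from Kmul[OF al_le[OF s(2)] this] have 2: "\<bar>K * al p s * J p s ^ 3\<bar> \<le> K * B * D1 ^ 3" .
      have "\<bar>Y p s\<bar> \<le> D2 + c * \<bar>pb p\<bar>"
        unfolding Y_def using P(1)[OF s(1)] Q(1)[OF s(1)]
        by (intro order_trans[OF abs_triangle_ineq] add_mono) (auto simp: abs_mult intro!: mult_right_mono)
      also have "\<dots> \<le> (D2 + c) * (1 + \<bar>pb p\<bar>)" using pos c by (simp add: algebra_simps)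
      finally have "\<bar>J p s * Y p s\<bar> \<le> D1 * ((D2 + c) * (1 + \<bar>pb p\<bar>))"
        unfolding abs_mult using J(1)[OF s(1)] pos by (intro mult_mono) auto
      from Kmul[OF si_le[OF s(2)] this]
      have 3: "\<bar>K * si p s * (J p s * Y p s)\<bar> \<le> K * B * (D1 * ((D2 + c) * (1 + \<bar>pb p\<bar>)))" .
      have "\<bar>eP1 p s\<bar> \<le> K * B * (D1 * D2) + K * B * D1 ^ 3 + 2 * (K * B * (D1 * ((D2 + c) * (1 + \<bar>pb p\<bar>))))"
        using 1 2 3 unfolding eP1_def eP'_def mult.assoc mult_minus_left by linarith
      also have "\<dots> \<le> E0 * (1 + \<bar>pb p\<bar>)"
      proof -
        have "0 \<le> K * B * (D1 * D2) * \<bar>pb p\<bar>" "0 \<le> K * B * D1 ^ 3 * \<bar>pb p\<bar>"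
          using KB pos by (auto intro!: mult_nonneg_nonneg)
        then show ?thesis by (simp add: E0_def algebra_simps)
      qed
      finally show ?thesis .
    qed
    from lin_bound[OF P1_sol _ this] have "\<bar>P1 p s\<bar> \<le> c * (E0 * (1 + \<bar>pb p\<bar>))" "\<bar>P1d p s\<bar> \<le> c * (E0 * (1 + \<bar>pb p\<bar>))"
      if "s \<in> {0..T}" for s
      using pos that by (auto simp: c_def)
    then show ?thesis using J Q P Q1 t by blast
  qed
  have C: "D1 \<le> C" "c \<le> C" "D2 \<le> C" "D3 \<le> C" "c * E0 \<le> C" "c * (1 + K * B) \<le> C" "C \<ge> 1"
    using pos c KB by (auto simp: C_def)
  have V: "\<bar>V p t\<bar> \<le> C * (1 + \<bar>pv p\<bar> + \<bar>pw p\<bar>)" if t: "t \<in> {0..T}" for p t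
  proof -
    have "\<bar>pv p\<bar> + \<bar>pw p\<bar> + K * B \<le> (1 + K * B) * (1 + \<bar>pv p\<bar> + \<bar>pw p\<bar>)"
      using KB mult_nonneg_nonneg[OF KB, of "\<bar>pv p\<bar> + \<bar>pw p\<bar>"] by (simp add: algebra_simps)
    then have "c * (\<bar>pv p\<bar> + \<bar>pw p\<bar> + K * B) \<le> c * ((1 + K * B) * (1 + \<bar>pv p\<bar> + \<bar>pw p\<bar>))"
      using c by (intro mult_left_mono)
    also have "\<dots> \<le> C * (1 + \<bar>pv p\<bar> + \<bar>pw p\<bar>)"
      using C by (simp add: mult.assoc[symmetric] mult_right_mono)
    finally show ?thesis using XV_bound(2)[OF t, of p] by (simp add: c_def)
  qed
  have "c * (E0 * (1 + \<bar>pb p\<bar>)) \<le> C * (1 + \<bar>pb p\<bar>)" for p :: par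
    using C by (simp add: mult.assoc[symmetric] mult_right_mono)
  with * V C show ?thesis by (intro exI[of _ C]) (meson order_trans)
qed

end

locale flow_path_per = flow_path +
  assumes a_per: "\<And>x. a (x + 2 * pi) = a x"
begin

lemma a2_per: "a2 (x + 2 * pi) = a2 x"
proof -
  have *: "a1 (x + 2 * pi) = a1 x" for x by (rule DERIV_periodic[OF da, of _ 0]) (simp add: a_per)
  show "a2 (x + 2 * pi) = a2 x" by (rule DERIV_periodic[OF da1, of _ 0]) (simp add: *)
qed

text \<open>The force is periodic, so a trajectory shifted by a full turn solves the same equation;
  \<open>so_unique\<close> identifies it with the one started a full turn further.\<close>

lemma X_per: "t \<ge> 0 \<Longrightarrow> X (path (x + 2 * pi)) t = X (path x) t + 2 * pi"
  and V_per: "t \<ge> 0 \<Longrightarrow> V (path (x + 2 * pi)) t = V (path x) t"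
proof -
  have "X (path (x + 2 * pi)) t = X (path x) t + 2 * pi \<and> V (path (x + 2 * pi)) t = V (path x) t" if t: "t \<ge> 0"
  proof (rule so_unique[OF m KB X_sol[of t] so_sol_shift[OF X_sol[of t]]])
    fix s assume "0 < s" "s < t"
    then show "\<bar>(pw (path (x + 2 * pi)) + K * Sf (z s) (X (path (x + 2 * pi)) s)) - (pw (path x) + K * Sf (z s) (X (path x) s))\<bar>
        \<le> K * B * \<bar>X (path (x + 2 * pi)) s - (X (path x) s + 2 * pi)\<bar>"
      using zS_lip[of s om "X (path (x + 2 * pi)) s" "X (path x) s + 2 * pi"] by (simp add: Sf_periodic)
  qed (use t a_per in auto)
  then show "t \<ge> 0 \<Longrightarrow> X (path (x + 2 * pi)) t = X (path x) t + 2 * pi"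
    "t \<ge> 0 \<Longrightarrow> V (path (x + 2 * pi)) t = V (path x) t" by auto
qed

lemma J_per: "t \<ge> 0 \<Longrightarrow> J (path (x + 2 * pi)) t = J (path x) t"
  by (rule DERIV_periodic[OF X_deriv X_per])

lemma W_per: "t \<ge> 0 \<Longrightarrow> W (path (x + 2 * pi)) t = W (path x) t"
  by (rule DERIV_periodic[OF V_deriv, of _ _ 0]) (auto simp: V_per)

lemma Q_per: "t \<ge> 0 \<Longrightarrow> Q (path (x + 2 * pi)) t = Q (path x) t"
  and Qd_per: "t \<ge> 0 \<Longrightarrow> Qd (path (x + 2 * pi)) t = Qd (path x) t"
proof -
  have "Q (path (x + 2 * pi)) t = Q (path x) t \<and> Qd (path (x + 2 * pi)) t = Qd (path x) t" if t: "t \<ge> 0"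
  proof (rule so_unique[OF m KB Q_sol[of t] Q_sol[of t]])
    fix s assume "0 < s" "s < t"
    then show "\<bar>- K * al (path (x + 2 * pi)) s * Q (path (x + 2 * pi)) s - - K * al (path x) s * Q (path x) s\<bar>
        \<le> K * B * \<bar>Q (path (x + 2 * pi)) s - Q (path x) s\<bar>"
      using lin_lip[of s "path x" "Q (path (x + 2 * pi)) s" 0 "Q (path x) s"] by (simp add: al_def X_per Al_periodic)
  qed (use t in auto)
  then show "t \<ge> 0 \<Longrightarrow> Q (path (x + 2 * pi)) t = Q (path x) t"
    "t \<ge> 0 \<Longrightarrow> Qd (path (x + 2 * pi)) t = Qd (path x) t" by auto
qed

text \<open>\<open>J\<close> is periodic and therefore so is its derivative \<open>Y\<close>;
  removing the periodic part \<open>Q * a2\<close> leaves \<open>P\<close>.\<close>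

lemma P_per: "t \<ge> 0 \<Longrightarrow> P (path (x + 2 * pi)) t = P (path x) t"
  using DERIV_periodic[OF J_deriv, of t "2 * pi" 0 x] by (simp add: J_per Y_def Q_per a2_per)

lemma Pd_per: "t \<ge> 0 \<Longrightarrow> Pd (path (x + 2 * pi)) t = Pd (path x) t"
  using DERIV_periodic[OF W_deriv, of t "2 * pi" 0 x] by (simp add: W_per Yd_def Qd_per a2_per)

lemma Q1_per: "t \<ge> 0 \<Longrightarrow> Q1 (path (x + 2 * pi)) t = Q1 (path x) t"
  and Q1d_per: "t \<ge> 0 \<Longrightarrow> Q1d (path (x + 2 * pi)) t = Q1d (path x) t"
  and P1_per: "t \<ge> 0 \<Longrightarrow> P1 (path (x + 2 * pi)) t = P1 (path x) t"
  and P1d_per: "t \<ge> 0 \<Longrightarrow> P1d (path (x + 2 * pi)) t = P1d (path x) t"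
  using DERIV_periodic[OF Q_deriv, of t "2 * pi" 0 x] DERIV_periodic[OF Qd_deriv, of t "2 * pi" 0 x]
    DERIV_periodic[OF P_deriv, of t "2 * pi" 0 x] DERIV_periodic[OF Pd_deriv, of t "2 * pi" 0 x]
  by (auto simp: Q_per Qd_per P_per Pd_per)

end

section \<open>Absolutely continuous functions on the line\<close>

lemma set_integrable_mult_cont:
  fixes h c :: "real \<Rightarrow> real"
  assumes "set_integrable lborel {x..y} h" "continuous_on {x..y} c"
  shows "set_integrable lborel {x..y} (\<lambda>t. h t * c t)"
proof -
  have "bounded (c ` {x..y})" using assms(2) by (intro compact_imp_bounded compact_continuous_image) auto
  then obtain M where "\<forall>t\<in>{x..y}. \<bar>c t\<bar> \<le> M" by (auto simp: bounded_iff)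
  then have M: "\<And>t. t \<in> {x..y} \<Longrightarrow> \<bar>c t\<bar> \<le> M" by blast
  have i: "integrable lborel (\<lambda>t. M * (indicator {x..y} t *\<^sub>R h t))"
    using assms(1) unfolding set_integrable_def by (intro integrable_mult_right)
  have c: "set_borel_measurable borel {x..y} c" using assms(2) unfolding set_borel_measurable_def by (intro borel_measurable_continuous_on_indicator) auto
  have m: "(\<lambda>t. (indicator {x..y} t *\<^sub>R h t) * (indicator {x..y} t *\<^sub>R c t)) \<in> borel_measurable lborel"
    using assms(1) c unfolding set_integrable_def set_borel_measurable_def by (intro borel_measurable_times) auto
  have "integrable lborel (\<lambda>t. (indicator {x..y} t *\<^sub>R h t) * (indicator {x..y} t *\<^sub>R c t))"
  proof (rule Bochner_Integration.integrable_bound[OF i m], rule AE_I2)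
    fix t
    show "norm ((indicator {x..y} t *\<^sub>R h t) * (indicator {x..y} t *\<^sub>R c t)) \<le> norm (M * (indicator {x..y} t *\<^sub>R h t))"
    proof (cases "t \<in> {x..y}")
      case True
      have "\<bar>c t\<bar> \<le> \<bar>M\<bar>" using M[OF True] by linarith
      then have "\<bar>c t\<bar> * \<bar>h t\<bar> \<le> \<bar>M\<bar> * \<bar>h t\<bar>" by (rule mult_right_mono) simp
      then show ?thesis using True by (simp add: abs_mult mult.commute)
    qed simp
  qed
  then show ?thesis unfolding set_integrable_def
    by (rule Bochner_Integration.integrable_cong[THEN iffD1, rotated -1]) (auto simp: indicator_def)
qed

text \<open>Indefinite Lebesgue integrals with a designated density. Fixing a Borel function
  \<open>f1\<close> instead of a class lets product and chain rules be stated as pointwise formulas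
  for densities.\<close>

definition ac :: "(real \<Rightarrow> real) \<Rightarrow> (real \<Rightarrow> real) \<Rightarrow> bool" where
  "ac f f1 \<longleftrightarrow> f1 \<in> borel_measurable borel \<and>
     (\<forall>x y. x \<le> y \<longrightarrow> set_integrable lborel {x..y} f1 \<and> (LINT t:{x..y}|lborel. f1 t) = f y - f x)"

lemma ac_C1:
  assumes "\<And>x. (f has_real_derivative f' x) (at x)" "continuous_on UNIV f'"
  shows "ac f f'"
  unfolding ac_def
proof (intro conjI allI impI)
  show "f' \<in> borel_measurable borel" using assms(2) by (rule borel_measurable_continuous_onI)
  fix x y :: real assume xy: "x \<le> y"
  show "set_integrable lborel {x..y} f'"
    by (rule borel_integrable_atLeastAtMost') (rule continuous_on_subset[OF assms(2)], simp)
  have "(\<integral>t. f' t * indicator {x..y} t \<partial>lborel) = f y - f x"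
    using xy assms by (intro integral_FTC_Icc_real) (auto simp: continuous_on_eq_continuous_at)
  then show "(LINT t:{x..y}|lborel. f' t) = f y - f x"
    by (simp add: set_lebesgue_integral_def mult.commute)
qed

lemma ac_integrable: "ac f f1 \<Longrightarrow> set_integrable lborel {x..y} f1"
  by (cases "x \<le> y") (auto simp: ac_def set_integrable_def)

lemma ac_continuous:
  assumes "ac f f1"
  shows "continuous_on UNIV f"
proof -
  have "continuous (at x) f" for x
  proof -
    have i: "set_integrable lborel {x-1..x+1} f1" by (rule ac_integrable[OF assms])
    have "f1 integrable_on {x-1..x+1}" using set_borel_integral_eq_integral(1)[OF i] .
    then have "continuous_on {x-1..x+1} (\<lambda>u. integral {x-1..u} f1 + f (x-1))"
      by (intro continuous_intros indefinite_integral_continuous_1)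
    moreover have "integral {x-1..u} f1 + f (x-1) = f u" if "u \<in> {x-1..x+1}" for u
      using assms that set_borel_integral_eq_integral(2)[OF ac_integrable[OF assms], of "x-1" u] unfolding ac_def by simp
    ultimately have "continuous_on {x-1..x+1} f" by (rule continuous_on_eq) auto
    then show ?thesis
      by (rule continuous_on_interior) (auto simp: interior_atLeastAtMost_real)
  qed
  then show ?thesis by (simp add: continuous_at_imp_continuous_on)
qed

lemma ac_add: "ac f f1 \<Longrightarrow> ac g g1 \<Longrightarrow> ac (\<lambda>x. f x + g x) (\<lambda>x. f1 x + g1 x)"
  unfolding ac_def by (auto simp: set_integral_add)

lemma ac_diff: "ac f f1 \<Longrightarrow> ac g g1 \<Longrightarrow> ac (\<lambda>x. f x - g x) (\<lambda>x. f1 x - g1 x)"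
  unfolding ac_def by (auto simp: set_integral_diff)

text \<open>Fubini for \<open>f1 s * g1 t\<close> on the triangle \<open>t <= s\<close>: the two
  orders of integration produce the two halves of the product rule and the boundary terms.\<close>

lemma ac_mult:
  assumes f: "ac f f1" and g: "ac g g1"
  shows "ac (\<lambda>x. f x * g x) (\<lambda>x. f1 x * g x + f x * g1 x)"
  unfolding ac_def
proof (intro conjI allI impI)
  note cf = ac_continuous[OF f] and cg = ac_continuous[OF g]
  have [measurable]: "f1 \<in> borel_measurable borel" "g1 \<in> borel_measurable borel"
    using f g by (auto simp: ac_def)
  have [measurable]: "f \<in> borel_measurable borel" "g \<in> borel_measurable borel"
    using cf cg by (auto intro: borel_measurable_continuous_onI)
  show "(\<lambda>x. f1 x * g x + f x * g1 x) \<in> borel_measurable borel" by measurable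
  fix l r :: real assume lr: "l \<le> r"
  have i1: "set_integrable lborel {l..r} (\<lambda>t. f1 t * g t)"
    using continuous_on_subset[OF cg] by (intro set_integrable_mult_cont ac_integrable[OF f]) auto
  have i2: "set_integrable lborel {l..r} (\<lambda>t. f t * g1 t)"
    using set_integrable_mult_cont[OF ac_integrable[OF g] continuous_on_subset[OF cf], of l r] by (simp add: mult.commute)
  then show "set_integrable lborel {l..r} (\<lambda>x. f1 x * g x + f x * g1 x)" using i1 by simp
  define a where "a s = indicator {l..r} s * f1 s" for s
  define b where "b s = indicator {l..r} s * g1 s" for s
  have [measurable]: "a \<in> borel_measurable borel" "b \<in> borel_measurable borel"
    unfolding a_def b_def by measurable
  have ia: "integrable lborel a" and ib: "integrable lborel b"
    using ac_integrable[OF f, of l r] ac_integrable[OF g, of l r]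
    unfolding set_integrable_def a_def[abs_def] b_def[abs_def] by simp_all
  have ip: "integrable (lborel \<Otimes>\<^sub>M lborel) (\<lambda>(s, t). a s * b t)"
  proof (rule lborel_pair.Fubini_integrable)
    show "integrable lborel (\<lambda>s. \<integral>t. norm (case (s, t) of (s, t) \<Rightarrow> a s * b t) \<partial>lborel)"
      using ia by (simp add: abs_mult)
    show "AE s in lborel. integrable lborel (\<lambda>t. case (s, t) of (s, t) \<Rightarrow> a s * b t)"
      using ib by simp
  qed measurable
  define F where "F s t = a s * b t * (if t \<le> s then 1 else 0)" for s t :: real
  have iF: "integrable (lborel \<Otimes>\<^sub>M lborel) (\<lambda>(s, t). F s t)"
    by (rule Bochner_Integration.integrable_bound[OF ip]) (auto simp: F_def)
  have sw: "(\<integral>t. (\<integral>s. F s t \<partial>lborel) \<partial>lborel) = (\<integral>s. (\<integral>t. F s t \<partial>lborel) \<partial>lborel)"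
    by (rule lborel_pair.Fubini_integral[OF iF])
  have in_t: "(\<integral>t. F s t \<partial>lborel) = indicator {l..r} s * (f1 s * g s) - g l * a s" for s
  proof (cases "s \<in> {l..r}")
    case True
    have "(\<integral>t. F s t \<partial>lborel) = (\<integral>t. f1 s * (indicator {l..s} t *\<^sub>R g1 t) \<partial>lborel)"
      using True by (intro Bochner_Integration.integral_cong) (auto simp: F_def a_def b_def indicator_def)
    also have "\<dots> = f1 s * (LINT t:{l..s}|lborel. g1 t)" by (simp add: set_lebesgue_integral_def)
    also have "\<dots> = f1 s * (g s - g l)" using g True by (simp add: ac_def)
    finally show ?thesis using True by (simp add: a_def algebra_simps)
  qed (simp add: F_def a_def)
  have in_s: "(\<integral>s. F s t \<partial>lborel) = f r * b t - indicator {l..r} t * (f t * g1 t)" for t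
  proof (cases "t \<in> {l..r}")
    case True
    have "(\<integral>s. F s t \<partial>lborel) = (\<integral>s. g1 t * (indicator {t..r} s *\<^sub>R f1 s) \<partial>lborel)"
      using True by (intro Bochner_Integration.integral_cong) (auto simp: F_def a_def b_def indicator_def)
    also have "\<dots> = g1 t * (LINT s:{t..r}|lborel. f1 s)" by (simp add: set_lebesgue_integral_def)
    also have "\<dots> = g1 t * (f r - f t)" using f True by (simp add: ac_def)
    finally show ?thesis using True by (simp add: b_def algebra_simps)
  qed (simp add: F_def b_def)
  have A: "(\<integral>s. a s \<partial>lborel) = f r - f l" "(\<integral>s. b s \<partial>lborel) = g r - g l"
    using f g lr by (simp_all add: ac_def a_def b_def set_lebesgue_integral_def)
  have "(LINT t:{l..r}|lborel. f1 t * g t + f t * g1 t)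
      = (LINT t:{l..r}|lborel. f1 t * g t) + (LINT t:{l..r}|lborel. f t * g1 t)"
    using i1 i2 by (rule set_integral_add)
  moreover have "(LINT t:{l..r}|lborel. f1 t * g t) - g l * (f r - f l) = f r * (g r - g l) - (LINT t:{l..r}|lborel. f t * g1 t)"
    using sw unfolding in_t in_s using ia ib i1 i2 A
    by (simp add: set_lebesgue_integral_def set_integrable_def)
  ultimately show "(LINT t:{l..r}|lborel. f1 t * g t + f t * g1 t) = f r * g r - f l * g l"
    by (simp add: algebra_simps)
qed

text \<open>The positive and the negative part are densities of two measures that agree on all rays
  \<open>{a<..}\<close>, hence coincide, and densities are unique almost everywhere. The truncation
  to \<open>{- n..n}\<close> makes the measures finite.\<close>

lemma set_integrable_null_intervals:
  fixes h :: "real \<Rightarrow> real"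
  assumes h: "h \<in> borel_measurable borel" and i: "\<And>x y. set_integrable lborel {x..y} h"
    and z: "\<And>x y. x \<le> y \<Longrightarrow> (LINT t:{x..y}|lborel. h t) = 0"
  shows "AE x in lborel. h x = 0"
proof -
  note [measurable] = h
  have "AE x in lborel. indicator {- real n..real n} x * h x = 0" for n
  proof -
    define k where "k x = indicator {- real n..real n} x * h x" for x
    have [measurable]: "k \<in> borel_measurable borel" unfolding k_def by measurable
    have ik: "integrable lborel k" using i[of "- real n" "real n"] unfolding set_integrable_def k_def[abs_def] by simp
    have ik': "integrable lborel (\<lambda>x. indicator {a<..} x * k x)" for a
      using integrable_mult_indicator[OF _ ik, of "{a<..}"] by simp
    have k0: "(\<integral>x. indicator {a<..} x * k x \<partial>lborel) = 0" for a
    proof -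
      have "(\<integral>x. indicator {a<..} x * k x \<partial>lborel) = (LINT t:{max a (- real n)..real n}|lborel. h t)"
        unfolding set_lebesgue_integral_def
        by (rule integral_discrete_difference[of "{a}"]) (auto simp: k_def indicator_def)
      also have "\<dots> = 0"
        using z[of "max a (- real n)" "real n"] by (cases "max a (- real n) \<le> real n") (auto simp: set_lebesgue_integral_def)
      finally show ?thesis .
    qed
    have int_eq: "(\<integral>x. indicator {a<..} x * max 0 (k x) \<partial>lborel) = (\<integral>x. indicator {a<..} x * max 0 (- k x) \<partial>lborel)" for a
    proof -
      have "integrable lborel (\<lambda>x. indicator {a<..} x * max 0 (k x))" "integrable lborel (\<lambda>x. indicator {a<..} x * max 0 (- k x))"
        by (rule Bochner_Integration.integrable_bound[OF ik]; auto simp: indicator_def)+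
      then have "(\<integral>x. indicator {a<..} x * max 0 (k x) \<partial>lborel) - (\<integral>x. indicator {a<..} x * max 0 (- k x) \<partial>lborel)
          = (\<integral>x. indicator {a<..} x * max 0 (k x) - indicator {a<..} x * max 0 (- k x) \<partial>lborel)"
        by (rule Bochner_Integration.integral_diff[symmetric])
      also have "(\<lambda>x. indicator {a<..} x * max 0 (k x) - indicator {a<..} x * max 0 (- k x)) = (\<lambda>x. indicator {a<..} x * k x)"
        by (auto simp: indicator_def max_def)
      finally show ?thesis using k0 by simp
    qed
    have em: "emeasure (density lborel (\<lambda>x. ennreal (max 0 (q x)))) {a<..} = ennreal (\<integral>x. indicator {a<..} x * max 0 (q x) \<partial>lborel)"
      if q: "q \<in> borel_measurable borel" "integrable lborel q" for q :: "real \<Rightarrow> real" and a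
    proof -
      note [measurable] = q(1)
      have "emeasure (density lborel (\<lambda>x. ennreal (max 0 (q x)))) {a<..} = (\<integral>\<^sup>+x. ennreal (indicator {a<..} x * max 0 (q x)) \<partial>lborel)"
        by (subst emeasure_density) (auto intro!: nn_integral_cong simp: indicator_def)
      also have "\<dots> = ennreal (\<integral>x. indicator {a<..} x * max 0 (q x) \<partial>lborel)"
        by (intro nn_integral_eq_integral Bochner_Integration.integrable_bound[OF q(2)]) (auto simp: indicator_def)
      finally show ?thesis .
    qed
    have "density lborel (\<lambda>x. ennreal (max 0 (k x))) = density lborel (\<lambda>x. ennreal (max 0 (- k x)))"
      by (rule measure_eqI_lessThan) (use ik in \<open>simp_all add: em int_eq\<close>)
    then have "AE x in lborel. ennreal (max 0 (k x)) = ennreal (max 0 (- k x))"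
      by (intro sigma_finite_measure.density_unique[OF lborel.sigma_finite_measure_axioms]) auto
    then show ?thesis unfolding k_def[symmetric] by eventually_elim (auto simp: max_def split: if_splits)
  qed
  then have "AE x in lborel. \<forall>n. indicator {- real n..real n} x * h x = 0" unfolding AE_all_countable by blast
  then show ?thesis
  proof eventually_elim
    fix x assume *: "\<forall>n. indicator {- real n..real n} x * h x = 0"
    obtain n where "\<bar>x\<bar> \<le> real n" using real_arch_simple by blast
    with *[rule_format, of n] show "h x = 0" by (auto simp: indicator_def)
  qed
qed

lemma ac_unique:
  assumes "ac f f1" "ac f f2"
  shows "AE x in lborel. f1 x = f2 x"
proof -
  have d: "ac (\<lambda>x. f x - f x) (\<lambda>x. f1 x - f2 x)" by (rule ac_diff[OF assms])
  have "AE x in lborel. f1 x - f2 x = 0"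
  proof (rule set_integrable_null_intervals)
    show "(\<lambda>x. f1 x - f2 x) \<in> borel_measurable borel" using d unfolding ac_def by blast
    show "set_integrable lborel {x..y} (\<lambda>x. f1 x - f2 x)" for x y by (rule ac_integrable[OF d])
    show "x \<le> y \<Longrightarrow> (LINT t:{x..y}|lborel. f1 t - f2 t) = 0" for x y using d unfolding ac_def by simp
  qed
  then show ?thesis by eventually_elim simp
qed

text \<open>Monotone substitution in the integral of \<open>M1\<close>; the orientation of intervals
  is preserved because \<open>k'\<close> is nonnegative.\<close>

lemma ac_comp:
  assumes ac: "ac M M1" and d: "\<And>x. (k has_real_derivative k' x) (at x)" and c: "continuous_on UNIV k'"
    and pos: "\<And>x. k' x \<ge> 0"
  shows "ac (\<lambda>x. M (k x)) (\<lambda>x. M1 (k x) * k' x)"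
  unfolding ac_def
proof (intro conjI allI impI)
  have "continuous_on UNIV k" using d by (meson DERIV_continuous continuous_at_imp_continuous_on)
  then have [measurable]: "k \<in> borel_measurable borel" "k' \<in> borel_measurable borel"
    using c by (auto intro: borel_measurable_continuous_onI)
  have [measurable]: "M1 \<in> borel_measurable borel" using ac by (simp add: ac_def)
  show "(\<lambda>x. M1 (k x) * k' x) \<in> borel_measurable borel" by measurable
  fix x y :: real assume xy: "x \<le> y"
  have k: "k x \<le> k y" using DERIV_nonneg_imp_nondecreasing[OF xy] d pos by blast
  note * = integral_substitution[OF ac_integrable[OF ac] d continuous_on_subset[OF c] pos xy, simplified]
  from * show "set_integrable lborel {x..y} (\<lambda>x. M1 (k x) * k' x)" by simp
  show "(LINT t:{x..y}|lborel. M1 (k t) * k' t) = M (k y) - M (k x)"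
    using *(2) ac k by (simp add: ac_def set_lebesgue_integral_def mult.commute)
qed

lemma ac_ibp:
  assumes f: "ac f f1" and g: "ac g g1" and per: "f y * g y = f x * g x" and xy: "x \<le> y"
  shows "(LINT t:{x..y}|lborel. f t * g1 t) = - (LINT t:{x..y}|lborel. f1 t * g t)"
    "set_integrable lborel {x..y} (\<lambda>t. f t * g1 t)" "set_integrable lborel {x..y} (\<lambda>t. f1 t * g t)"
proof -
  show 1: "set_integrable lborel {x..y} (\<lambda>t. f1 t * g t)"
    by (intro set_integrable_mult_cont ac_integrable[OF f] continuous_on_subset[OF ac_continuous[OF g]]) auto
  show 2: "set_integrable lborel {x..y} (\<lambda>t. f t * g1 t)"
    using set_integrable_mult_cont[OF ac_integrable[OF g] continuous_on_subset[OF ac_continuous[OF f]], of x y]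
    by (simp add: mult.commute)
  have "(LINT t:{x..y}|lborel. f1 t * g t + f t * g1 t) = 0"
    using ac_mult[OF f g] xy per by (simp add: ac_def)
  then show "(LINT t:{x..y}|lborel. f t * g1 t) = - (LINT t:{x..y}|lborel. f1 t * g t)"
    using set_integral_add(2)[OF 1 2] by simp
qed

section \<open>Periodic functions and trigonometric test functions\<close>

lemma periodic_set_integrable:
  fixes h :: "real \<Rightarrow> real"
  assumes h: "set_integrable lborel {0..2 * pi} h" and per: "\<And>x. h (x + 2 * pi) = h x"
  shows "set_integrable lborel {x..y} h"
proof -
  have sh: "set_integrable lborel {a - c..b - c} h" if "set_integrable lborel {a..b} h" "\<And>x. h (x + c) = h x" for a b c
  proof -
    have "integrable lborel (\<lambda>x. indicator {a..b} (c + 1 * x) *\<^sub>R h (c + 1 * x))"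
      using that(1) unfolding set_integrable_def by (rule lborel_integrable_real_affine) simp
    also have "(\<lambda>x. indicator {a..b} (c + 1 * x) *\<^sub>R h (c + 1 * x)) = (\<lambda>x. indicator {a - c..b - c} x *\<^sub>R h x)"
      using that(2) by (auto simp: indicator_def fun_eq_iff add.commute)
    finally show ?thesis unfolding set_integrable_def .
  qed
  have p1: "h (x + 2 * pi * real n) = h x" for x n
  proof (induction n)
    case (Suc n)
    show ?case using per[of "x + 2 * pi * real n"] Suc by (simp add: algebra_simps)
  qed simp
  have p2: "h (x + - (2 * pi * real n)) = h x" for x n
    using p1[of "x + - (2 * pi * real n)" n] by simp
  have I: "set_integrable lborel {- (2 * pi * real n)..2 * pi * real n} h" for n
  proof (induction n)
    case 0
    show ?case by (rule set_integrable_subset[OF h]) auto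
  next
    case (Suc n)
    have 1: "set_integrable lborel {2 * pi * real n..2 * pi * real (Suc n)} h"
      using sh[OF h p2[of _ n]] by (simp add: algebra_simps)
    have 2: "set_integrable lborel {- (2 * pi * real (Suc n))..- (2 * pi * real n)} h"
      using sh[OF h p1[of _ "Suc n"]] by (simp add: algebra_simps)
    have "{- (2 * pi * real (Suc n))..2 * pi * real (Suc n)} = {- (2 * pi * real (Suc n))..- (2 * pi * real n)}
        \<union> ({- (2 * pi * real n)..2 * pi * real n} \<union> {2 * pi * real n..2 * pi * real (Suc n)})"
    proof -
      have gen: "{- (A + P)..A + P} = {- (A + P)..- A} \<union> ({- A..A} \<union> {A..A + P})" if "A \<ge> 0" "P \<ge> 0" for A P :: real
        using that by auto
      have "2 * pi * real (Suc n) = 2 * pi * real n + 2 * pi" by (simp add: algebra_simps)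
      then show ?thesis by (simp only:) (rule gen, auto)
    qed
    then show ?case using 1 2 Suc by (auto intro!: set_integrable_Un)
  qed
  obtain n where n: "\<bar>x\<bar> + \<bar>y\<bar> < real n * (2 * pi)" using reals_Archimedean3[of "2 * pi"] by auto
  show ?thesis by (rule set_integrable_subset[OF I[of n]]) (use n in \<open>auto simp: mult.commute\<close>)
qed

text \<open>The even part is a continuous function of \<open>cos x\<close>, so by Weierstrass it is
  a uniform limit of polynomials in \<open>cos x\<close>, to which \<open>G\<close> is orthogonal.
  Hence \<open>G\<close> is orthogonal to its own even part, and by reflection the even part has
  zero square integral.\<close>

lemma even_part_zero:
  fixes G :: "real \<Rightarrow> real"
  assumes c: "continuous_on UNIV G" and per: "\<And>x. G (x + 2 * pi) = G x"
    and z: "\<And>n. integral {0..2 * pi} (\<lambda>x. G x * cos x ^ n) = 0" and x: "x \<in> {0..2 * pi}"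
  shows "G x + G (- x) = 0"
proof -
  define E where "E x = G x + G (- x)" for x
  have cE: "continuous_on UNIV E"
    unfolding E_def by (intro continuous_intros continuous_on_compose2[OF c]) auto
  have ev: "E (- x) = E x" for x by (simp add: E_def)
  have pm: "G (x - 2 * pi) = G x" for x using per[of "x - 2 * pi"] by simp
  have perE: "E (x + 2 * pi) = E x" for x using per[of x] pm[of "- x"] by (simp add: E_def)
  \<comment> \<open>Evenness and periodicity make \<open>E\<close> factor through the cosine on the
    whole period, although \<open>arccos\<close> only reaches \<open>{0..pi}\<close>.\<close>
  define e where "e y = E (arccos y)" for y
  have ce: "continuous_on {-1..1} e"
    unfolding e_def by (intro continuous_on_compose2[OF cE] continuous_on_arccos') auto
  have eE: "e (cos x) = E x" if "x \<in> {0..2 * pi}" for x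
  proof (cases "x \<le> pi")
    case True then show ?thesis using that by (simp add: e_def arccos_cos)
  next
    case False
    have "e (cos x) = E (2 * pi - x)" using that False arccos_cos[of "2 * pi - x"] by (simp add: e_def)
    also have "\<dots> = E x" using perE[of "- x"] ev[of x] by (simp add: add.commute)
    finally show ?thesis .
  qed
  have ci: "continuous_on {0..2 * pi} G" using c by (rule continuous_on_subset) simp
  have cEi: "continuous_on {0..2 * pi} E" using cE by (rule continuous_on_subset) simp
  have I0: "integral {0..2 * pi} (\<lambda>x. G x * E x) = 0"
  proof -
    define I where "I = integral {0..2 * pi} (\<lambda>x. G x * E x)"
    define M where "M = integral {0..2 * pi} (\<lambda>x. \<bar>G x\<bar>)"
    have "\<bar>I\<bar> \<le> d * (M + 1)" if d: "d > 0" for d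
    proof -
      obtain g where g: "real_polynomial_function g" "\<And>x. x \<in> {-1..1} \<Longrightarrow> \<bar>e x - g x\<bar> < d"
        using Stone_Weierstrass_real_polynomial_function[OF compact_Icc ce d] by blast
      then obtain a n where ga: "g = (\<lambda>x. \<Sum>i\<le>n. a i * x ^ i)"
        unfolding real_polynomial_function_iff_sum by blast
      have cg: "continuous_on {0..2 * pi} (\<lambda>x. g (cos x))"
        unfolding ga by (intro continuous_intros)
      have "integral {0..2 * pi} (\<lambda>x. G x * g (cos x)) = integral {0..2 * pi} (\<lambda>x. \<Sum>i\<le>n. a i * (G x * cos x ^ i))"
        by (intro integral_cong) (simp add: ga sum_distrib_left algebra_simps)
      also have "\<dots> = (\<Sum>i\<le>n. integral {0..2 * pi} (\<lambda>x. a i * (G x * cos x ^ i)))"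
        by (intro integral_sum integrable_continuous_interval continuous_intros ci) auto
      also have "\<dots> = 0" by (simp add: z)
      finally have "I = integral {0..2 * pi} (\<lambda>x. G x * E x) - integral {0..2 * pi} (\<lambda>x. G x * g (cos x))"
        by (simp add: I_def)
      also have "\<dots> = integral {0..2 * pi} (\<lambda>x. G x * E x - G x * g (cos x))"
        by (intro integral_diff[symmetric] integrable_continuous_interval continuous_intros ci cEi cg)
      finally have "\<bar>I\<bar> = norm \<dots>" by simp
      also have "\<dots> \<le> integral {0..2 * pi} (\<lambda>x. d * \<bar>G x\<bar>)"
      proof (rule integral_norm_bound_integral)
        fix x assume x: "x \<in> {0..2 * pi}"
        have "\<bar>E x - g (cos x)\<bar> \<le> d" using g(2)[of "cos x"] eE[OF x] by simp
        then have "\<bar>G x\<bar> * \<bar>E x - g (cos x)\<bar> \<le> \<bar>G x\<bar> * d" by (intro mult_left_mono) auto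
        then show "norm (G x * E x - G x * g (cos x)) \<le> d * \<bar>G x\<bar>"
          unfolding right_diff_distrib[symmetric] by (simp add: abs_mult mult.commute)
      qed (intro integrable_continuous_interval continuous_intros ci cEi cg)+
      also have "\<dots> = d * M" by (simp add: M_def)
      finally show ?thesis using d by (simp add: algebra_simps)
    qed
    note le = this
    have M: "M \<ge> 0" unfolding M_def by (intro integral_nonneg integrable_continuous_interval continuous_intros ci) auto
    have "\<bar>I\<bar> \<le> 0"
    proof (rule field_le_epsilon)
      fix r :: real assume "r > 0"
      with le[of "r / (M + 1)"] M show "\<bar>I\<bar> \<le> 0 + r" by simp
    qed
    then show ?thesis by (simp add: I_def)
  qed
  have "integral {0..2 * pi} (\<lambda>x. G (- x) * E x) = integral {0..2 * pi} (\<lambda>x. (\<lambda>x. G x * E x) (- x))"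
    by (simp add: ev)
  also have "\<dots> = integral {- (2 * pi)..0} (\<lambda>x. G x * E x)"
    using Henstock_Kurzweil_Integration.integral_reflect_real[of 0 "- (2 * pi)" "\<lambda>x. G x * E x"] by simp
  also have "\<dots> = integral {0 - 2 * pi..2 * pi - 2 * pi} (\<lambda>x. G (x + 2 * pi) * E (x + 2 * pi))"
    by (simp add: per perE)
  also have "\<dots> = 0" using I0 by (subst integral_shift_real_ivl[where f = "\<lambda>x. G x * E x"]) simp
  finally have I1: "integral {0..2 * pi} (\<lambda>x. G (- x) * E x) = 0" .
  have cm: "continuous_on {0..2 * pi} (\<lambda>x. G (- x))"
    by (intro continuous_on_compose2[OF c] continuous_intros) auto
  have "integral {0..2 * pi} (\<lambda>x. G x * E x + G (- x) * E x) = 0"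
    using I0 I1 by (subst integral_add) (auto intro!: integrable_continuous_interval continuous_intros ci cEi cm)
  then have "integral {0..2 * pi} (\<lambda>x. (E x)\<^sup>2) = 0"
    by (simp add: E_def power2_eq_square distrib_right)
  moreover have "continuous_on {0..2 * pi} (\<lambda>x. (E x)\<^sup>2)" by (intro continuous_intros cEi)
  ultimately have "\<forall>x\<in>{0..2 * pi}. (E x)\<^sup>2 = 0" by (subst (asm) integral_eq_0_iff) auto
  then show ?thesis using x by (auto simp: E_def)
qed

text \<open>The previous lemma is applied to \<open>D\<close> and to \<open>D x * sin x\<close>,
  whose even part is the odd part of \<open>D\<close> times \<open>sin x\<close>. At the zeros of
  the sine, oddness and periodicity already force the odd part to vanish.\<close>

lemma trig_complete:
  fixes D :: "real \<Rightarrow> real"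
  assumes c: "continuous_on UNIV D" and per: "\<And>x. D (x + 2 * pi) = D x"
    and zc: "\<And>n. integral {0..2 * pi} (\<lambda>x. D x * cos x ^ n) = 0"
    and zs: "\<And>n. integral {0..2 * pi} (\<lambda>x. D x * (sin x * cos x ^ n)) = 0" and x: "x \<in> {0..2 * pi}"
  shows "D x = 0"
proof -
  have E: "D x + D (- x) = 0" by (rule even_part_zero[OF c per zc x])
  have "D x * sin x + D (- x) * sin (- x) = 0"
    by (rule even_part_zero[of "\<lambda>x. D x * sin x"]) (use zs x per c in \<open>auto intro!: continuous_intros simp: mult.assoc\<close>)
  then have S: "(D x - D (- x)) * sin x = 0" by (simp add: left_diff_distrib)
  have "sin x \<noteq> 0 \<or> x = 0 \<or> x = pi \<or> x = 2 * pi"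
    using sin_gt_zero[of x] sin_lt_zero[of x] x by force
  then show ?thesis
  proof (elim disjE)
    assume "x = pi" then show ?thesis using E per[of "- pi"] by simp
  next
    assume "x = 2 * pi" then show ?thesis using E per[of "- (2 * pi)"] per[of 0] by simp
  qed (use E S in auto)
qed

text \<open>Countable, so that the null sets of frequencies belonging to the single tests can be
  united, and rich enough that the derivatives together with the constants determine all
  trigonometric moments.\<close>

definition trig_tests :: "(real \<Rightarrow> real) set" where
  "trig_tests = insert (\<lambda>x. 1) (range (\<lambda>n x. cos x ^ Suc n) \<union> range (\<lambda>n x. sin x * cos x ^ n))"

lemma countable_trig_tests: "countable trig_tests"
  by (simp add: trig_tests_def)

text \<open>Closed under differentiation, so that smoothness of the tests follows by induction
  without formulas for higher derivatives.\<close>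

inductive trigpoly :: "(real \<Rightarrow> real) \<Rightarrow> bool" where
  trigpoly_const: "trigpoly (\<lambda>x. c)"
| trigpoly_sin: "trigpoly sin"
| trigpoly_cos: "trigpoly cos"
| trigpoly_add: "trigpoly f \<Longrightarrow> trigpoly g \<Longrightarrow> trigpoly (\<lambda>x. f x + g x)"
| trigpoly_mult: "trigpoly f \<Longrightarrow> trigpoly g \<Longrightarrow> trigpoly (\<lambda>x. f x * g x)"

lemma trigpoly_deriv: "trigpoly f \<Longrightarrow> trigpoly (deriv f) \<and> (\<forall>x. (f has_real_derivative deriv f x) (at x))"
proof (induction rule: trigpoly.induct)
  case (trigpoly_const c)
  have "deriv (\<lambda>x::real. c) = (\<lambda>x. 0)" by (auto simp: fun_eq_iff)
  then show ?case by (auto intro: trigpoly.intros)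
next
  case trigpoly_sin
  have "deriv sin = (cos :: real \<Rightarrow> real)" by (auto simp: fun_eq_iff intro!: DERIV_imp_deriv)
  then show ?case by (auto intro: trigpoly.intros)
next
  case trigpoly_cos
  have d: "(cos has_real_derivative (- 1) * sin x) (at x)" for x by (auto intro!: derivative_eq_intros)
  then have "deriv cos = (\<lambda>x::real. (- 1) * sin x)" by (auto simp: fun_eq_iff intro!: DERIV_imp_deriv)
  then show ?case using d trigpoly.intros(5)[OF trigpoly.intros(1)[of "- 1"] trigpoly.intros(2)] by (metis (no_types, lifting))
next
  case (trigpoly_add f g)
  then have d: "((\<lambda>x. f x + g x) has_real_derivative deriv f x + deriv g x) (at x)" for x
    by (auto intro!: derivative_eq_intros)
  then have "deriv (\<lambda>x. f x + g x) = (\<lambda>x. deriv f x + deriv g x)" by (auto simp: fun_eq_iff intro!: DERIV_imp_deriv)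
  then show ?case using d trigpoly_add.IH by (auto intro: trigpoly.intros)
next
  case (trigpoly_mult f g)
  then have d: "((\<lambda>x. f x * g x) has_real_derivative deriv f x * g x + f x * deriv g x) (at x)" for x
    by (auto intro!: derivative_eq_intros)
  then have "deriv (\<lambda>x. f x * g x) = (\<lambda>x. deriv f x * g x + f x * deriv g x)" by (auto simp: fun_eq_iff intro!: DERIV_imp_deriv)
  then show ?case using d trigpoly_mult by (auto intro: trigpoly.intros)
qed

lemma trigpoly_smooth: assumes "trigpoly f" shows "smooth_periodic f"
  unfolding smooth_periodic_def
proof (intro conjI allI)
  show "f (x + 2 * pi) = f x" for x using assms by (induction rule: trigpoly.induct) auto
  have "trigpoly ((deriv ^^ j) f)" for j by (induction j) (use assms trigpoly_deriv in auto)
  then show "(deriv ^^ j) f differentiable at x" for j x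
    using trigpoly_deriv real_differentiable_def by blast
qed

lemma trig_tests_trigpoly: "f \<in> trig_tests \<Longrightarrow> trigpoly f"
proof -
  have p: "trigpoly (\<lambda>x. cos x ^ n)" for n
  proof (induction n)
    case (Suc n) then show ?case using trigpoly_mult[OF trigpoly_cos Suc] by simp
  qed (use trigpoly_const[of 1] in simp)
  show "f \<in> trig_tests \<Longrightarrow> trigpoly f"
    unfolding trig_tests_def using p p[of "Suc _"] trigpoly_const[of 1] trigpoly_mult[OF trigpoly_sin p] by auto
qed

lemma ac_primitive:
  assumes h: "h \<in> borel_measurable borel" and ih': "\<And>x y. set_integrable lborel {x..y} h"
  shows "\<exists>H. ac H h"
proof -
  have hk: "h integrable_on {x..y}" for x y using set_borel_integral_eq_integral(1)[OF ih'] .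
  define H where "H x = integral {0..x} h - integral {x..0} h" for x
  have "ac H h"
    unfolding ac_def
  proof (intro conjI allI impI h ih')
    fix x y :: real assume xy: "x \<le> y"
    have "integral {x..y} h = H y - H x"
    proof -
      consider "0 \<le> x" | "x < 0" "0 \<le> y" | "y < 0" by linarith
      then show ?thesis
      proof cases
        case 1 then show ?thesis
          using Henstock_Kurzweil_Integration.integral_combine[OF 1 xy hk] xy by (cases "x = 0"; cases "y = 0") (auto simp: H_def)
      next
        case 2 then show ?thesis
          using Henstock_Kurzweil_Integration.integral_combine[of x 0 y h, OF _ _ hk] by (cases "y = 0") (auto simp: H_def)
      next
        case 3 then show ?thesis
          using Henstock_Kurzweil_Integration.integral_combine[of x y 0 h, OF xy _ hk] xy by (auto simp: H_def)
      qed
    qed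
    then show "(LINT t:{x..y}|lborel. h t) = H y - H x"
      using set_borel_integral_eq_integral(2)[OF ih'] by simp
  qed
  then show ?thesis by blast
qed

text \<open>Du Bois-Reymond: with \<open>H\<close> a primitive of \<open>h\<close>, the difference
  \<open>a - H\<close> is orthogonal to all derivatives of tests and therefore constant. The
  constant test shows that \<open>H\<close> is periodic, so that no boundary terms appear.\<close>

lemma ac_from_tests:
  fixes a h :: "real \<Rightarrow> real"
  assumes ca: "continuous_on UNIV a" and pa: "\<And>x. a (x + 2 * pi) = a x"
    and h: "h \<in> borel_measurable borel" and ph: "\<And>x. h (x + 2 * pi) = h x"
    and ih: "set_integrable lborel {0..2 * pi} h"
    and t: "\<And>f. f \<in> trig_tests \<Longrightarrow> (LINT x:{0..2 * pi}|lborel. a x * deriv f x + h x * f x) = 0"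
  shows "ac a h"
proof -
  have ih': "set_integrable lborel {x..y} h" for x y by (rule periodic_set_integrable[OF ih ph])
  obtain H where acH: "ac H h" using ac_primitive[OF h ih'] by blast
  have H2: "H (2 * pi) = H 0"
  proof -
    have "(LINT x:{0..2 * pi}|lborel. h x) = 0"
      using t[of "\<lambda>x. 1"] by (simp add: trig_tests_def)
    then show ?thesis using acH by (simp add: ac_def)
  qed
  have perH: "H (x + 2 * pi) = H x" for x
  proof -
    have "ac (\<lambda>x. H (x + 2 * pi)) (\<lambda>x. h (x + 2 * pi) * 1)"
      by (rule ac_comp[OF acH]) (auto intro!: derivative_eq_intros)
    from ac_diff[OF this acH] have "ac (\<lambda>x. H (x + 2 * pi) - H x) (\<lambda>x. 0)" by (simp add: ph)
    then have "x \<le> y \<Longrightarrow> 0 = H (y + 2 * pi) - H y - (H (x + 2 * pi) - H x)" for x y by (simp add: ac_def)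
    from this[of 0 x] this[of x 0] show ?thesis using H2 by (cases "0 \<le> x") auto
  qed
  define D where "D x = a x - H x" for x
  have cH: "continuous_on UNIV H" by (rule ac_continuous[OF acH])
  have cD: "continuous_on UNIV D" unfolding D_def by (intro continuous_intros ca cH)
  have pD: "D (x + 2 * pi) = D x" for x by (simp add: D_def pa perH)
  have Dt: "integral {0..2 * pi} (\<lambda>x. D x * deriv f x) = 0" if f: "f \<in> trig_tests" for f
  proof -
    note tp = trigpoly_deriv[OF trig_tests_trigpoly[OF f]]
    have cd: "continuous_on UNIV (deriv f)"
      using trigpoly_deriv[of "deriv f"] tp by (meson DERIV_continuous continuous_at_imp_continuous_on)
    have acf: "ac f (deriv f)" using tp cd by (intro ac_C1) auto
    have pf: "f (2 * pi) = f 0"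
      using trigpoly_smooth[OF trig_tests_trigpoly[OF f]] unfolding smooth_periodic_def by (metis add_0)
    note ibp = ac_ibp[OF acH acf, of "2 * pi" 0]
    have i1: "set_integrable lborel {0..2 * pi} (\<lambda>x. a x * deriv f x)"
      by (rule borel_integrable_atLeastAtMost') (intro continuous_intros continuous_on_subset[OF ca] continuous_on_subset[OF cd]; simp)
    have "(LINT x:{0..2 * pi}|lborel. D x * deriv f x) = (LINT x:{0..2 * pi}|lborel. a x * deriv f x) - (LINT x:{0..2 * pi}|lborel. H x * deriv f x)"
      unfolding D_def left_diff_distrib using i1 ibp(2) H2 pf by (intro set_integral_diff) auto
    also have "\<dots> = (LINT x:{0..2 * pi}|lborel. a x * deriv f x) + (LINT x:{0..2 * pi}|lborel. h x * f x)"
      using ibp(1) H2 pf by simp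
    also have "\<dots> = 0" using t[OF f] i1 ibp(3) H2 pf by (subst (asm) set_integral_add) auto
    finally have "(LINT x:{0..2 * pi}|lborel. D x * deriv f x) = 0" .
    moreover have "set_integrable lborel {0..2 * pi} (\<lambda>x. D x * deriv f x)"
      by (rule borel_integrable_atLeastAtMost') (intro continuous_intros continuous_on_subset[OF cD] continuous_on_subset[OF cd]; simp)
    ultimately show ?thesis using set_borel_integral_eq_integral(2) by metis
  qed
  \<comment> \<open>Derivatives of periodic functions cannot detect constants; subtracting the mean
    supplies the missing zeroth moment.\<close>
  define d where "d = integral {0..2 * pi} D / (2 * pi)"
  define D0 where "D0 x = D x - d" for x
  have cD0: "continuous_on UNIV D0" unfolding D0_def by (intro continuous_intros cD)
  have cDi: "continuous_on {0..2 * pi} D" and cD0i: "continuous_on {0..2 * pi} D0"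
    using cD cD0 by (auto intro: continuous_on_subset)
  have D0t: "integral {0..2 * pi} (\<lambda>x. D0 x * f' x) = 0"
    if f: "f \<in> trig_tests" and f': "\<And>x. (f has_real_derivative f' x) (at x)" and cf': "continuous_on {0..2 * pi} f'" for f f'
  proof -
    have df: "deriv f = f'" using f' by (auto simp: fun_eq_iff intro!: DERIV_imp_deriv)
    have pf: "f (2 * pi) = f 0"
      using trigpoly_smooth[OF trig_tests_trigpoly[OF f]] unfolding smooth_periodic_def by (metis add_0)
    have "(f' has_integral f (2 * pi) - f 0) {0..2 * pi}"
      by (rule fundamental_theorem_of_calculus)
        (auto simp: has_real_derivative_iff_has_vector_derivative[symmetric] intro: f'[THEN DERIV_subset])
    then have "integral {0..2 * pi} f' = 0" using pf by (simp add: integral_unique)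
    then have "integral {0..2 * pi} (\<lambda>x. d * f' x) = 0" by simp
    moreover have "integral {0..2 * pi} (\<lambda>x. D x * f' x) = 0" using Dt[OF f] unfolding df .
    ultimately show ?thesis unfolding D0_def left_diff_distrib
      by (subst integral_diff) (auto intro!: integrable_continuous_interval continuous_intros cf' cDi)
  qed
  have i0: "integral {0..2 * pi} D0 = 0"
    unfolding D0_def by (subst integral_diff) (auto intro!: integrable_continuous_interval cDi simp: d_def)
  have zs: "integral {0..2 * pi} (\<lambda>x. D0 x * (sin x * cos x ^ n)) = 0" for n
  proof -
    have "integral {0..2 * pi} (\<lambda>x. D0 x * (real (Suc n) * cos x ^ n * (- sin x))) = 0"
      by (rule D0t[of "\<lambda>x. cos x ^ Suc n"])
        (auto simp: trig_tests_def intro!: derivative_eq_intros continuous_intros simp del: power_Suc of_nat_Suc)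
    also have "(\<lambda>x. D0 x * (real (Suc n) * cos x ^ n * (- sin x))) = (\<lambda>x. - real (Suc n) * (D0 x * (sin x * cos x ^ n)))"
      by (auto simp: algebra_simps)
    finally show ?thesis by simp
  qed
  \<comment> \<open>Differentiating \<open>sin x * cos x ^ Suc n\<close> gives
    \<open>(n + 2) * cos x ^ (n + 2) - (n + 1) * cos x ^ n\<close>, a recursion over two steps;
    hence the induction carries two consecutive moments.\<close>
  have zc: "integral {0..2 * pi} (\<lambda>x. D0 x * cos x ^ n) = 0 \<and> integral {0..2 * pi} (\<lambda>x. D0 x * cos x ^ Suc n) = 0" for n
  proof (induction n)
    case 0
    have "integral {0..2 * pi} (\<lambda>x. D0 x * cos x) = 0"
      by (rule D0t[of "\<lambda>x. sin x * cos x ^ 0"])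
        (auto simp: trig_tests_def image_iff intro!: derivative_eq_intros continuous_intros exI[of _ 0])
    then show ?case using i0 by simp
  next
    case (Suc n)
    have eq: "cos x * cos x ^ Suc n + sin x * (real (Suc n) * cos x ^ n * (- sin x)) = real (n + 2) * cos x ^ Suc (Suc n) - real (Suc n) * cos x ^ n" for x :: real
    proof -
      define N where "N = real (Suc n)"
      have ss: "sin x * sin x = 1 - cos x * cos x" using sin_cos_squared_add[of x] by (simp add: power2_eq_square)
      have "cos x * cos x ^ Suc n + sin x * (N * cos x ^ n * (- sin x)) = cos x * cos x * cos x ^ n - N * cos x ^ n * (sin x * sin x)"
        by (simp add: algebra_simps)
      also have "\<dots> = (N + 1) * cos x ^ Suc (Suc n) - N * cos x ^ n"
        unfolding ss by (simp add: algebra_simps)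
      also have "N + 1 = real (n + 2)" by (simp add: N_def)
      finally show ?thesis by (simp only: N_def)
    qed
    have "integral {0..2 * pi} (\<lambda>x. D0 x * (cos x * cos x ^ Suc n + sin x * (real (Suc n) * cos x ^ n * (- sin x)))) = 0"
      by (rule D0t[of "\<lambda>x. sin x * cos x ^ Suc n"])
        (auto simp: trig_tests_def intro!: derivative_eq_intros continuous_intros simp del: power_Suc of_nat_Suc)
    then have "integral {0..2 * pi} (\<lambda>x. real (n + 2) * (D0 x * cos x ^ Suc (Suc n)) - real (Suc n) * (D0 x * cos x ^ n)) = 0"
      unfolding eq by (simp only: right_diff_distrib mult.left_commute)
    moreover have "integral {0..2 * pi} (\<lambda>x. real (n + 2) * (D0 x * cos x ^ Suc (Suc n)) - real (Suc n) * (D0 x * cos x ^ n))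
        = real (n + 2) * integral {0..2 * pi} (\<lambda>x. D0 x * cos x ^ Suc (Suc n)) - real (Suc n) * integral {0..2 * pi} (\<lambda>x. D0 x * cos x ^ n)"
      by (subst integral_diff) (auto intro!: integrable_continuous_interval continuous_intros cD0i simp del: power_Suc of_nat_Suc)
    ultimately show ?case using Suc by (simp del: power_Suc of_nat_Suc)
  qed
  have D0z: "D0 x = 0" if "x \<in> {0..2 * pi}" for x
    by (rule trig_complete[OF cD0 _ _ zs that]) (use zc pD in \<open>auto simp: D0_def\<close>)
  have Hx: "a x = H x + d" if "x \<in> {0..2 * pi}" for x using D0z[OF that] by (simp add: D0_def D_def)
  \<comment> \<open>On one period \<open>a\<close> and \<open>H\<close> differ by a constant;
    periodicity carries this to the whole line.\<close>
  have pn: "a (x + 2 * pi * real n) = a x \<and> H (x + 2 * pi * real n) = H x" for x n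
  proof (induction n)
    case (Suc n)
    show ?case using pa[of "x + 2 * pi * real n"] perH[of "x + 2 * pi * real n"] Suc by (simp add: algebra_simps)
  qed simp
  have "a x = H x + d" for x
  proof -
    define k where "k = \<lfloor>x / (2 * pi)\<rfloor>"
    define y where "y = x - 2 * pi * of_int k"
    have "of_int k \<le> x / (2 * pi)" "x / (2 * pi) < of_int k + 1" unfolding k_def by linarith+
    then have y: "y \<in> {0..2 * pi}" using pi_gt_zero by (auto simp: y_def field_simps)
    show ?thesis
    proof (cases "k \<ge> 0")
      case True
      then have "x = y + 2 * pi * real (nat k)" by (simp add: y_def)
      then show ?thesis using pn[of y "nat k"] Hx[OF y] by simp
    next
      case False
      then have "y = x + 2 * pi * real (nat (- k))" by (simp add: y_def)
      then show ?thesis using pn[of x "nat (- k)"] Hx[OF y] by simp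
    qed
  qed
  then have "a = (\<lambda>x. H x + d)" by auto
  then show ?thesis using acH unfolding ac_def by simp
qed

section \<open>Weak derivatives\<close>

lemma space_torus: "space torus = {0..<2 * pi}"
  by (simp add: torus_def space_restrict_space)

lemma finite_measure_torus: "finite_measure torus"
  by (rule finite_measureI) (simp add: torus_def emeasure_restrict_space space_restrict_space)

interpretation torus: finite_measure torus by (rule finite_measure_torus)
interpretation cyl: pair_sigma_finite torus lborel ..

lemma measurable_torus: "f \<in> borel_measurable borel \<Longrightarrow> f \<in> borel_measurable torus"
  unfolding torus_def by (rule measurable_restrict_space1) simp

lemma measurable_cyl:
  assumes "f \<in> borel_measurable (borel :: (real \<times> real) measure)"
  shows "f \<in> borel_measurable cyl"
proof -
  have 1: "(\<lambda>x. x) \<in> torus \<rightarrow>\<^sub>M borel" by (rule measurable_torus) simp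
  have "(\<lambda>p. (fst p, snd p)) \<in> cyl \<rightarrow>\<^sub>M borel \<Otimes>\<^sub>M borel"
    unfolding cyl_def
    by (intro measurable_Pair measurable_compose[OF measurable_fst 1]) (auto intro: measurable_snd'')
  then have "(\<lambda>p. p) \<in> cyl \<rightarrow>\<^sub>M borel" by (simp add: borel_prod)
  then show ?thesis using assms by (rule measurable_compose)
qed

lemma cyl_measurable_slice:
  assumes "cyl_measurable f"
  shows "(\<lambda>x. f x w) \<in> borel_measurable borel" "(\<lambda>w. f x w) \<in> borel_measurable borel"
proof -
  have f: "(\<lambda>(x, w). f x w) \<in> borel_measurable (borel \<Otimes>\<^sub>M borel)"
    using assms by (simp add: cyl_measurable_def borel_prod)
  show "(\<lambda>x. f x w) \<in> borel_measurable borel" "(\<lambda>w. f x w) \<in> borel_measurable borel"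
    using measurable_compose[OF measurable_Pair2' f, of w] measurable_compose[OF measurable_Pair1' f, of x] by simp_all
qed

lemma cyl_measurable_cyl: "cyl_measurable f \<Longrightarrow> (\<lambda>(x, w). f x w) \<in> borel_measurable cyl"
  unfolding cyl_measurable_def by (rule measurable_cyl)

lemma lint_torus: "(\<integral>x. f x \<partial>torus) = (LINT x:{0..2 * pi}|lborel. f x)" for f :: "real \<Rightarrow> real"
proof -
  have "(\<integral>x. f x \<partial>torus) = (\<integral>x. indicator {0..<2 * pi} x *\<^sub>R f x \<partial>lborel)"
    unfolding torus_def by (rule integral_restrict_space) simp
  also have "\<dots> = (LINT x:{0..2 * pi}|lborel. f x)"
    unfolding set_lebesgue_integral_def
    by (rule integral_discrete_difference[of "{2 * pi}"]) (auto simp: indicator_def)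
  finally show ?thesis .
qed

lemma integrable_torus: "integrable torus f \<longleftrightarrow> set_integrable lborel {0..2 * pi} f" for f :: "real \<Rightarrow> real"
proof -
  have "integrable torus f \<longleftrightarrow> integrable lborel (\<lambda>x. indicator {0..<2 * pi} x *\<^sub>R f x)"
    unfolding torus_def by (rule integrable_restrict_space) simp
  also have "\<dots> \<longleftrightarrow> set_integrable lborel {0..2 * pi} f"
    unfolding set_integrable_def
    by (rule integrable_discrete_difference[of "{2 * pi}"]) (auto simp: indicator_def)
  finally show ?thesis .
qed

lemma cyl_Fubini:
  fixes f :: "real \<Rightarrow> real \<Rightarrow> real"
  assumes "integrable cyl (\<lambda>(x, w). f x w)"
  shows "(\<integral>(x, w). f x w \<partial>cyl) = (\<integral>w. (\<integral>x. f x w \<partial>torus) \<partial>lborel)"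
    "integrable lborel (\<lambda>w. \<integral>x. f x w \<partial>torus)" "AE w in lborel. integrable torus (\<lambda>x. f x w)"
  using cyl.integral_snd[of f] cyl.integrable_snd[of f] cyl.AE_integrable_snd[of f] assms
  by (auto simp: cyl_def)

lemma integrable_cyl_snd:
  fixes h :: "real \<Rightarrow> real"
  assumes "integrable lborel h"
  shows "integrable cyl (\<lambda>(x, w). h w)"
proof -
  have "integrable (torus \<Otimes>\<^sub>M lborel) (\<lambda>(x, w). h w)"
  proof (rule cyl.Fubini_integrable)
    show "(\<lambda>(x, w). h w) \<in> borel_measurable (torus \<Otimes>\<^sub>M lborel)" using assms by measurable
  qed (use assms in auto)
  then show ?thesis by (simp add: cyl_def)
qed

text \<open>Each function is a primitive of the next, with equal values at the ends of the period so
  that integration by parts leaves no boundary term. Nothing is asked of the last function beyond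
  being a density.\<close>

fun smooth_chain :: "nat \<Rightarrow> (nat \<Rightarrow> real \<Rightarrow> real) \<Rightarrow> bool" where
  "smooth_chain k F = (\<forall>j<k. ac (F j) (F (Suc j)) \<and> F j (2 * pi) = F j 0)"

lemma smooth_periodic_deriv:
  assumes "smooth_periodic \<phi>"
  shows "ac ((deriv ^^ j) \<phi>) ((deriv ^^ Suc j) \<phi>)" "(deriv ^^ j) \<phi> (2 * pi) = (deriv ^^ j) \<phi> 0"
    "continuous_on UNIV ((deriv ^^ j) \<phi>)"
proof -
  have d: "((deriv ^^ j) \<phi> has_real_derivative (deriv ^^ Suc j) \<phi> x) (at x)" for j x
    using assms unfolding smooth_periodic_def by (auto simp: DERIV_deriv_iff_real_differentiable)
  then have c: "continuous_on UNIV ((deriv ^^ j) \<phi>)" for j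
    by (meson DERIV_continuous continuous_at_imp_continuous_on)
  show "continuous_on UNIV ((deriv ^^ j) \<phi>)" by (rule c)
  show "ac ((deriv ^^ j) \<phi>) ((deriv ^^ Suc j) \<phi>)" by (rule ac_C1[OF d c])
  have "(deriv ^^ j) \<phi> (x + 2 * pi) = (deriv ^^ j) \<phi> x" for x
  proof (induction j arbitrary: x)
    case 0 then show ?case using assms by (simp add: smooth_periodic_def)
  next
    case (Suc j)
    have d': "((\<lambda>x. (deriv ^^ j) \<phi> (x + 2 * pi)) has_real_derivative (deriv ^^ Suc j) \<phi> (x + 2 * pi)) (at x)"
      using d[of j "x + 2 * pi"] by (simp add: DERIV_shift)
    show ?case using DERIV_unique[OF d'[unfolded Suc.IH] d[of j x]] .
  qed
  from this[of 0] show "(deriv ^^ j) \<phi> (2 * pi) = (deriv ^^ j) \<phi> 0" by simp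
qed

lemma smooth_chain_ibp:
  assumes c: "smooth_chain k F" and s: "smooth_periodic \<phi>"
  shows "(LINT x:{0..2 * pi}|lborel. F 0 x * (deriv ^^ (k + n)) \<phi> x)
    = (- 1) ^ k * (LINT x:{0..2 * pi}|lborel. F k x * (deriv ^^ n) \<phi> x)"
  using c
proof (induction k arbitrary: n)
  case (Suc k)
  have "(LINT x:{0..2 * pi}|lborel. F 0 x * (deriv ^^ (Suc k + n)) \<phi> x)
    = (- 1) ^ k * (LINT x:{0..2 * pi}|lborel. F k x * (deriv ^^ (Suc n)) \<phi> x)"
    using Suc.IH[of "Suc n"] Suc.prems by simp
  also have "(LINT x:{0..2 * pi}|lborel. F k x * (deriv ^^ (Suc n)) \<phi> x) = - (LINT x:{0..2 * pi}|lborel. F (Suc k) x * (deriv ^^ n) \<phi> x)"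
    using Suc.prems smooth_periodic_deriv[OF s, of n] by (intro ac_ibp(1)) auto
  finally show ?case by simp
qed simp

text \<open>Representative modulo a full turn. It makes a weak derivative, which is tested on one
  period only, periodic on the line.\<close>

definition wrap :: "real \<Rightarrow> real" where "wrap x = x - 2 * pi * of_int \<lfloor>x / (2 * pi)\<rfloor>"

lemma wrap_range: "wrap x \<in> {0..<2 * pi}"
proof -
  define n where "n = \<lfloor>x / (2 * pi)\<rfloor>"
  have "of_int n \<le> x / (2 * pi)" "x / (2 * pi) < of_int n + 1" unfolding n_def by linarith+
  then have "of_int n * (2 * pi) \<le> x" "x < (of_int n + 1) * (2 * pi)"
    by (simp_all add: pos_le_divide_eq pos_divide_less_eq)
  then show ?thesis unfolding wrap_def n_def[symmetric] by (simp add: algebra_simps)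
qed

lemma wrap_id: "x \<in> {0..<2 * pi} \<Longrightarrow> wrap x = x"
proof -
  assume "x \<in> {0..<2 * pi}"
  then have "\<lfloor>x / (2 * pi)\<rfloor> = 0" by (simp add: floor_eq_iff)
  then show ?thesis by (simp add: wrap_def)
qed

lemma wrap_periodic: "wrap (x + 2 * pi) = wrap x"
proof -
  have "(x + 2 * pi) / (2 * pi) = x / (2 * pi) + 1" by (simp add: add_divide_distrib)
  then show ?thesis by (simp add: wrap_def algebra_simps)
qed

lemma wrap_measurable [measurable]: "wrap \<in> borel_measurable borel"
  unfolding wrap_def by measurable

lemma periodic_wrap:
  assumes "\<And>x. f (x + 2 * pi) = f x"
  shows "f (wrap x) = f x"
proof -
  have p: "f (x + 2 * pi * real n) = f x" for x n
  proof (induction n)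
    case (Suc n) then show ?case using assms[of "x + 2 * pi * real n"] by (simp add: algebra_simps)
  qed simp
  define k where "k = \<lfloor>x / (2 * pi)\<rfloor>"
  show ?thesis
  proof (cases "k \<ge> 0")
    case True
    then have "x = wrap x + 2 * pi * real (nat k)" by (simp add: wrap_def k_def[symmetric])
    then show ?thesis using p by metis
  next
    case False
    then have "wrap x = x + 2 * pi * real (nat (- k))" by (simp add: wrap_def k_def[symmetric])
    then show ?thesis using p by metis
  qed
qed

locale weight =
  fixes g :: "real \<Rightarrow> real"
  assumes g_nonneg: "\<And>w. g w \<ge> 0" and g_int: "integrable lborel g"
begin

lemma g_meas [measurable]: "g \<in> borel_measurable borel"
  using g_int by (simp add: integrable_iff_bounded)

lemma L2g_product:
  assumes "f \<in> L2g g" "h \<in> L2g g"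
  shows "integrable cyl (\<lambda>(x, w). f x w * h x w * g w)"
proof (rule Bochner_Integration.integrable_bound)
  show "integrable cyl (\<lambda>p. (\<lambda>(x, w). (f x w)\<^sup>2 * g w) p + (\<lambda>(x, w). (h x w)\<^sup>2 * g w) p)"
    using assms unfolding L2g_def by (intro Bochner_Integration.integrable_add) auto
  have "cyl_measurable f" "cyl_measurable h" using assms by (auto simp: L2g_def)
  then have "(\<lambda>(x, w). f x w) \<in> borel_measurable borel" "(\<lambda>(x, w). h x w) \<in> borel_measurable borel"
    by (auto simp: cyl_measurable_def)
  then have "(\<lambda>(x, w). f x w * h x w * g w) \<in> borel_measurable borel"
    unfolding case_prod_unfold borel_prod[symmetric] by measurable
  then show "(\<lambda>(x, w). f x w * h x w * g w) \<in> borel_measurable cyl" by (rule measurable_cyl)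
  show "AE p in cyl. norm (case p of (x, w) \<Rightarrow> f x w * h x w * g w)
      \<le> norm ((\<lambda>(x, w). (f x w)\<^sup>2 * g w) p + (\<lambda>(x, w). (h x w)\<^sup>2 * g w) p)"
  proof (rule AE_I2, clarsimp)
    fix x w
    have "2 * \<bar>f x w\<bar> * \<bar>h x w\<bar> \<le> (f x w)\<^sup>2 + (h x w)\<^sup>2"
      using sum_squares_bound[of "\<bar>f x w\<bar>" "\<bar>h x w\<bar>"] by simp
    then have "\<bar>f x w\<bar> * \<bar>h x w\<bar> \<le> (f x w)\<^sup>2 + (h x w)\<^sup>2"
      using mult_nonneg_nonneg[of "\<bar>f x w\<bar>" "\<bar>h x w\<bar>"] by (simp only: mult.assoc) linarith
    then have "\<bar>f x w\<bar> * \<bar>h x w\<bar> * g w \<le> ((f x w)\<^sup>2 + (h x w)\<^sup>2) * g w"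
      using g_nonneg by (intro mult_right_mono)
    then show "\<bar>f x w * h x w * g w\<bar> \<le> \<bar>(f x w)\<^sup>2 * g w + (h x w)\<^sup>2 * g w\<bar>"
      using g_nonneg[of w] by (simp add: abs_mult distrib_right)
  qed
qed

lemma L2g_I:
  assumes f: "cyl_measurable f" and E: "integrable cyl (\<lambda>(x, w). E x w * g w)"
    and le: "\<And>x w. x \<in> {0..<2 * pi} \<Longrightarrow> (f x w)\<^sup>2 \<le> E x w"
  shows "f \<in> L2g g"
proof -
  have "integrable cyl (\<lambda>(x, w). (f x w)\<^sup>2 * g w)"
  proof (rule Bochner_Integration.integrable_bound[OF E])
    have "(\<lambda>(x, w). f x w) \<in> borel_measurable borel" using f by (auto simp: cyl_measurable_def)
    then have "(\<lambda>(x, w). (f x w)\<^sup>2 * g w) \<in> borel_measurable borel"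
      unfolding case_prod_unfold borel_prod[symmetric] by measurable
    then show "(\<lambda>(x, w). (f x w)\<^sup>2 * g w) \<in> borel_measurable cyl" by (rule measurable_cyl)
    show "AE p in cyl. norm (case p of (x, w) \<Rightarrow> (f x w)\<^sup>2 * g w) \<le> norm (case p of (x, w) \<Rightarrow> E x w * g w)"
    proof (rule AE_I2)
      fix p assume "p \<in> space cyl"
      then obtain x w where p: "p = (x, w)" "x \<in> {0..<2 * pi}"
        by (auto simp: cyl_def space_pair_measure space_torus)
      have "(f x w)\<^sup>2 * g w \<le> E x w * g w" by (intro mult_right_mono le[OF p(2)] g_nonneg)
      then show "norm (case p of (x, w) \<Rightarrow> (f x w)\<^sup>2 * g w) \<le> norm (case p of (x, w) \<Rightarrow> E x w * g w)"
        using g_nonneg[of w] by (simp add: p)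
    qed
  qed
  with f show ?thesis by (simp add: L2g_def)
qed

lemma L2g_bounded:
  assumes "cyl_measurable f" "\<And>x w. x \<in> {0..<2 * pi} \<Longrightarrow> \<bar>f x w\<bar> \<le> M"
  shows "f \<in> L2g g"
proof (rule L2g_I[OF assms(1), of "\<lambda>x w. M\<^sup>2"])
  show "integrable cyl (\<lambda>(x, w). M\<^sup>2 * g w)" by (rule integrable_cyl_snd) (use g_int in simp)
  show "x \<in> {0..<2 * pi} \<Longrightarrow> (f x w)\<^sup>2 \<le> M\<^sup>2" for x w
    using power_mono[OF assms(2), of x w 2] by simp
qed

lemma L2g_measurable: "f \<in> L2g g \<Longrightarrow> cyl_measurable f"
  and L2g_integrable: "f \<in> L2g g \<Longrightarrow> integrable cyl (\<lambda>(x, w). (f x w)\<^sup>2 * g w)"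
  by (auto simp: L2g_def)

lemma L2g_diff:
  assumes f: "f \<in> L2g g" and h: "h \<in> L2g g"
  shows "(\<lambda>x w. f x w - h x w) \<in> L2g g"
proof (rule L2g_I[where E = "\<lambda>x w. 2 * (f x w)\<^sup>2 + 2 * (h x w)\<^sup>2"])
  show "cyl_measurable (\<lambda>x w. f x w - h x w)"
    using L2g_measurable[OF f] L2g_measurable[OF h] unfolding cyl_measurable_def case_prod_unfold by measurable
  have "integrable cyl (\<lambda>p. 2 * (\<lambda>(x, w). (f x w)\<^sup>2 * g w) p + 2 * (\<lambda>(x, w). (h x w)\<^sup>2 * g w) p)"
    using f h by (intro Bochner_Integration.integrable_add integrable_mult_right L2g_integrable)
  then show "integrable cyl (\<lambda>(x, w). (2 * (f x w)\<^sup>2 + 2 * (h x w)\<^sup>2) * g w)"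
    by (simp add: case_prod_unfold distrib_right mult.assoc)
  show "(f x w - h x w)\<^sup>2 \<le> 2 * (f x w)\<^sup>2 + 2 * (h x w)\<^sup>2" for x w
    using zero_le_power2[of "f x w + h x w"] by (simp add: power2_eq_square algebra_simps)
qed

lemma test_function_L2g:
  assumes "continuous_on UNIV \<phi>" "\<psi> \<in> borel_measurable borel" "bounded (range \<psi>)"
  shows "(\<lambda>x w. \<phi> x * \<psi> w) \<in> L2g g"
proof -
  have "bounded (\<phi> ` {0..2 * pi})"
    using assms(1) by (intro compact_imp_bounded compact_continuous_image continuous_on_subset[OF assms(1)]) auto
  then obtain M1 where M1: "\<forall>x\<in>{0..2 * pi}. \<bar>\<phi> x\<bar> \<le> M1" by (auto simp: bounded_iff)
  obtain M2 where M2: "\<And>w. \<bar>\<psi> w\<bar> \<le> M2" using assms(3) by (auto simp: bounded_iff)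
  have [measurable]: "\<phi> \<in> borel_measurable borel" "\<psi> \<in> borel_measurable borel"
    using assms by (auto intro: borel_measurable_continuous_onI)
  have "cyl_measurable (\<lambda>x w. \<phi> x * \<psi> w)"
    unfolding cyl_measurable_def case_prod_unfold borel_prod[symmetric] by measurable
  then show ?thesis
  proof (rule L2g_bounded)
    fix x w :: real assume "x \<in> {0..<2 * pi}"
    then have "\<bar>\<phi> x\<bar> \<le> M1" using M1 by auto
    then show "\<bar>\<phi> x * \<psi> w\<bar> \<le> M1 * M2" unfolding abs_mult using M2[of w] by (intro mult_mono) auto
  qed
qed

text \<open>Fubini followed by division by \<open>g w\<close>, which is why nothing is claimed at
  frequencies of weight zero. On the circle square integrability implies integrability through
  \<open>|h| <= 1 + h^2\<close>.\<close>

lemma L2g_slice: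
  assumes "h \<in> L2g g"
  shows "AE w in lborel. g w \<noteq> 0 \<longrightarrow> set_integrable lborel {0..2 * pi} (\<lambda>x. (h x w)\<^sup>2) \<and> set_integrable lborel {0..2 * pi} (\<lambda>x. h x w)"
  using cyl_Fubini(3)[OF L2g_integrable[OF assms]]
proof eventually_elim
  fix w assume i: "integrable torus (\<lambda>x. (h x w)\<^sup>2 * g w)"
  have [measurable]: "(\<lambda>x. h x w) \<in> borel_measurable torus"
    by (intro measurable_torus cyl_measurable_slice L2g_measurable assms)
  show "g w \<noteq> 0 \<longrightarrow> set_integrable lborel {0..2 * pi} (\<lambda>x. (h x w)\<^sup>2) \<and> set_integrable lborel {0..2 * pi} (\<lambda>x. h x w)"
    unfolding integrable_torus[symmetric]
  proof (intro impI conjI)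
    assume "g w \<noteq> 0"
    with i show i2: "integrable torus (\<lambda>x. (h x w)\<^sup>2)" by simp
    show "integrable torus (\<lambda>x. h x w)"
    proof (rule Bochner_Integration.integrable_bound)
      show "integrable torus (\<lambda>x. 1 + (h x w)\<^sup>2)" by (intro Bochner_Integration.integrable_add i2) simp
      show "AE x in torus. norm (h x w) \<le> norm (1 + (h x w)\<^sup>2)"
      proof (rule AE_I2)
        fix x
        have "0 \<le> (\<bar>h x w\<bar> - 1)\<^sup>2" by simp
        then show "norm (h x w) \<le> norm (1 + (h x w)\<^sup>2)"
          by (simp add: power2_eq_square algebra_simps)
      qed
    qed measurable
  qed
qed

text \<open>The test factor in the frequency localises the weak formulation to almost every slice;
  \<open>j\<close> of the \<open>k\<close> derivatives are then moved from the test to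
  \<open>f\<close> by parts.\<close>

lemma weak_dtheta_AE:
  assumes wd: "weak_dtheta g k f h"
    and chain: "\<And>w. smooth_chain j (\<lambda>i x. F i x w)" and F0: "F 0 = f" and jk: "j \<le> k" and f: "\<phi> \<in> trig_tests"
  shows "AE w in lborel. g w \<noteq> 0 \<longrightarrow>
    (- 1) ^ j * (LINT x:{0..2 * pi}|lborel. F j x w * (deriv ^^ (k - j)) \<phi> x) = (- 1) ^ k * (LINT x:{0..2 * pi}|lborel. h x w * \<phi> x)"
proof -
  have s: "smooth_periodic \<phi>" by (rule trigpoly_smooth[OF trig_tests_trigpoly[OF f]])
  have fL: "f \<in> L2g g" and hL: "h \<in> L2g g" using wd by (auto simp: weak_dtheta_def)
  define q where "q x w = f x w * (deriv ^^ k) \<phi> x - (- 1) ^ k * (h x w * \<phi> x)" for x w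
  have ii: "integrable cyl (\<lambda>(x, w). f x w * (deriv ^^ k) \<phi> x * \<psi> w * g w)" "integrable cyl (\<lambda>(x, w). h x w * \<phi> x * \<psi> w * g w)"
    if "\<psi> \<in> borel_measurable borel" "bounded (range \<psi>)" for \<psi>
    using L2g_product[OF fL test_function_L2g[OF smooth_periodic_deriv(3)[OF s, of k] that]]
      L2g_product[OF hL test_function_L2g[OF smooth_periodic_deriv(3)[OF s, of 0] that]]
    by (simp_all add: case_prod_unfold mult.assoc)
  have iq: "integrable cyl (\<lambda>(x, w). q x w * \<psi> w * g w)"
    and zq: "(\<integral>(x, w). q x w * \<psi> w * g w \<partial>cyl) = 0"
    if "\<psi> \<in> borel_measurable borel" "bounded (range \<psi>)" for \<psi>
  proof -
    have eq: "(\<lambda>(x, w). q x w * \<psi> w * g w)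
        = (\<lambda>p. (\<lambda>(x, w). f x w * (deriv ^^ k) \<phi> x * \<psi> w * g w) p - (- 1) ^ k * (\<lambda>(x, w). h x w * \<phi> x * \<psi> w * g w) p)"
      by (auto simp: q_def algebra_simps fun_eq_iff)
    show "integrable cyl (\<lambda>(x, w). q x w * \<psi> w * g w)"
      unfolding eq by (intro Bochner_Integration.integrable_diff integrable_mult_right ii that)
    show "(\<integral>(x, w). q x w * \<psi> w * g w \<partial>cyl) = 0"
      unfolding eq using wd s that
      by (subst Bochner_Integration.integral_diff) (auto simp: weak_dtheta_def intro!: ii)
  qed
  define r where "r w = (\<integral>x. q x w * g w \<partial>torus)" for w
  have b1: "(\<lambda>w. 1) \<in> borel_measurable borel" "bounded (range (\<lambda>w::real. 1::real))" by auto
  have ir: "integrable lborel r" using cyl_Fubini(2)[OF iq[OF b1]] by (simp add: r_def[abs_def])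
  have [measurable]: "r \<in> borel_measurable borel" using ir by (simp add: integrable_iff_bounded)
  \<comment> \<open>The sign of the slice defect \<open>r\<close> is an admissible test factor and
    turns the vanishing integral into the integral of the absolute value of
    \<open>r\<close>.\<close>
  define \<psi> where "\<psi> w = sgn (r w)" for w
  have \<psi>: "\<psi> \<in> borel_measurable borel" "bounded (range \<psi>)"
    unfolding \<psi>_def by (measurable, auto simp: bounded_iff abs_sgn_eq intro!: exI[of _ 1])
  have "0 = (\<integral>w. (\<integral>x. q x w * \<psi> w * g w \<partial>torus) \<partial>lborel)"
    using cyl_Fubini(1)[OF iq[OF \<psi>]] zq[OF \<psi>] by simp
  also have "\<dots> = (\<integral>w. \<bar>r w\<bar> \<partial>lborel)"
  proof (rule Bochner_Integration.integral_cong)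
    fix w
    have "(\<integral>x. q x w * \<psi> w * g w \<partial>torus) = (\<integral>x. \<psi> w * (q x w * g w) \<partial>torus)" by (simp add: mult_ac)
    also have "\<dots> = \<psi> w * r w" by (simp add: r_def)
    finally show "(\<integral>x. q x w * \<psi> w * g w \<partial>torus) = \<bar>r w\<bar>" by (simp add: \<psi>_def abs_sgn mult.commute)
  qed simp
  finally have "AE w in lborel. r w = 0"
    using integral_nonneg_eq_0_iff_AE[of lborel "\<lambda>w. \<bar>r w\<bar>"] ir by simp
  moreover note L2g_slice[OF fL] L2g_slice[OF hL]
  ultimately show ?thesis
  proof eventually_elim
    fix w assume r: "r w = 0"
      and fi: "g w \<noteq> 0 \<longrightarrow> set_integrable lborel {0..2 * pi} (\<lambda>x. (f x w)\<^sup>2) \<and> set_integrable lborel {0..2 * pi} (\<lambda>x. f x w)"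
      and hi: "g w \<noteq> 0 \<longrightarrow> set_integrable lborel {0..2 * pi} (\<lambda>x. (h x w)\<^sup>2) \<and> set_integrable lborel {0..2 * pi} (\<lambda>x. h x w)"
    show "g w \<noteq> 0 \<longrightarrow> (- 1) ^ j * (LINT x:{0..2 * pi}|lborel. F j x w * (deriv ^^ (k - j)) \<phi> x) = (- 1) ^ k * (LINT x:{0..2 * pi}|lborel. h x w * \<phi> x)"
    proof
      assume g: "g w \<noteq> 0"
      have c: "continuous_on {0..2 * pi} ((deriv ^^ i) \<phi>)" for i
        by (rule continuous_on_subset[OF smooth_periodic_deriv(3)[OF s]]) simp
      have i1: "set_integrable lborel {0..2 * pi} (\<lambda>x. f x w * (deriv ^^ k) \<phi> x)"
        using fi g by (intro set_integrable_mult_cont c) auto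
      have i2: "set_integrable lborel {0..2 * pi} (\<lambda>x. h x w * \<phi> x)"
        using hi g c[of 0] by (intro set_integrable_mult_cont) auto
      have "(\<integral>x. q x w \<partial>torus) = 0" using r g by (simp add: r_def)
      then have "(LINT x:{0..2 * pi}|lborel. f x w * (deriv ^^ k) \<phi> x) - (- 1) ^ k * (LINT x:{0..2 * pi}|lborel. h x w * \<phi> x) = 0"
        using i1 i2 by (simp add: lint_torus q_def set_integral_diff)
      then show "(- 1) ^ j * (LINT x:{0..2 * pi}|lborel. F j x w * (deriv ^^ (k - j)) \<phi> x) = (- 1) ^ k * (LINT x:{0..2 * pi}|lborel. h x w * \<phi> x)"
        using smooth_chain_ibp[OF chain s, where n = "k - j", of w] jk by (simp add: F0)
    qed
  qed
qed

text \<open>Countability of the tests gives one null set for all of them; outside it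
  \<open>ac_from_tests\<close> shows that the last classical derivative has the weak derivative as
  its density.\<close>

lemma weak_dtheta_ac:
  assumes wd: "weak_dtheta g (Suc k) f h"
    and chain: "\<And>w. smooth_chain k (\<lambda>i x. F i x w)" and F0: "F 0 = f"
    and cF: "\<And>w. continuous_on UNIV (\<lambda>x. F k x w)" and pF: "\<And>x w. F k (x + 2 * pi) w = F k x w"
  shows "AE w in lborel. g w \<noteq> 0 \<longrightarrow> ac (\<lambda>x. F k x w) (\<lambda>x. h (wrap x) w)"
proof -
  have hL: "h \<in> L2g g" using wd by (auto simp: weak_dtheta_def)
  have "AE w in lborel. \<forall>\<phi>\<in>trig_tests. g w \<noteq> 0 \<longrightarrow>
    (- 1) ^ k * (LINT x:{0..2 * pi}|lborel. F k x w * (deriv ^^ (Suc k - k)) \<phi> x) = (- 1) ^ Suc k * (LINT x:{0..2 * pi}|lborel. h x w * \<phi> x)"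
    by (intro AE_ball_countable' countable_trig_tests weak_dtheta_AE[OF wd chain F0]) auto
  moreover note L2g_slice[OF hL]
  ultimately show ?thesis
  proof (eventually_elim, intro impI)
    fix w assume t: "\<forall>\<phi>\<in>trig_tests. g w \<noteq> 0 \<longrightarrow>
      (- 1) ^ k * (LINT x:{0..2 * pi}|lborel. F k x w * (deriv ^^ (Suc k - k)) \<phi> x) = (- 1) ^ Suc k * (LINT x:{0..2 * pi}|lborel. h x w * \<phi> x)"
      and hi: "g w \<noteq> 0 \<longrightarrow> set_integrable lborel {0..2 * pi} (\<lambda>x. (h x w)\<^sup>2) \<and> set_integrable lborel {0..2 * pi} (\<lambda>x. h x w)"
      and g: "g w \<noteq> 0"
    have hm: "(\<lambda>x. h x w) \<in> borel_measurable borel" by (rule cyl_measurable_slice[OF L2g_measurable[OF hL]])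
    have hw: "set_integrable lborel {0..2 * pi} (\<lambda>x. h (wrap x) w)"
      using hi g unfolding integrable_torus[symmetric]
      by (subst Bochner_Integration.integrable_cong[OF refl, of _ _ "\<lambda>x. h x w"]) (auto simp: wrap_id space_torus)
    show "ac (\<lambda>x. F k x w) (\<lambda>x. h (wrap x) w)"
    proof (rule ac_from_tests[OF cF pF _ _ hw])
      show "(\<lambda>x. h (wrap x) w) \<in> borel_measurable borel" by (rule measurable_compose[OF wrap_measurable hm])
      show "h (wrap (x + 2 * pi)) w = h (wrap x) w" for x by (simp add: wrap_periodic)
      fix \<phi> assume p: "\<phi> \<in> trig_tests"
      have s: "smooth_periodic \<phi>" by (rule trigpoly_smooth[OF trig_tests_trigpoly[OF p]])
      have "(LINT x:{0..2 * pi}|lborel. F k x w * deriv \<phi> x) = - (LINT x:{0..2 * pi}|lborel. h x w * \<phi> x)"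
        using t p g by (auto simp: minus_one_power_iff split: if_splits)
      also have "(LINT x:{0..2 * pi}|lborel. h x w * \<phi> x) = (LINT x:{0..2 * pi}|lborel. h (wrap x) w * \<phi> x)"
        unfolding lint_torus[symmetric]
        by (rule Bochner_Integration.integral_cong) (simp_all add: wrap_id space_torus)
      finally have "(LINT x:{0..2 * pi}|lborel. F k x w * deriv \<phi> x) + (LINT x:{0..2 * pi}|lborel. h (wrap x) w * \<phi> x) = 0" by simp
      moreover have "set_integrable lborel {0..2 * pi} (\<lambda>x. F k x w * deriv \<phi> x)"
        by (rule borel_integrable_atLeastAtMost')
          (intro continuous_intros continuous_on_subset[OF cF] continuous_on_subset[OF smooth_periodic_deriv(3)[OF s, of 1, simplified]]; simp)
      moreover have "set_integrable lborel {0..2 * pi} (\<lambda>x. h (wrap x) w * \<phi> x)"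
        by (rule set_integrable_mult_cont[OF hw]) (rule continuous_on_subset[OF smooth_periodic_deriv(3)[OF s, of 0, simplified]], simp)
      ultimately show "(LINT x:{0..2 * pi}|lborel. F k x w * deriv \<phi> x + h (wrap x) w * \<phi> x) = 0"
        by (subst set_integral_add) auto
    qed
  qed
qed

text \<open>The difference of two weak derivatives is orthogonal to all tests, so it is a weak first
  derivative of the zero function. By \<open>weak_dtheta_ac\<close> it is a density of a constant on
  almost every slice of positive weight, hence zero almost everywhere there.\<close>

lemma weak_dtheta_unique:
  assumes "weak_dtheta g k f h1" "weak_dtheta g k f h2"
  shows "L2g_norm g h1 = L2g_norm g h2"
proof -
  have L: "h1 \<in> L2g g" "h2 \<in> L2g g" using assms by (auto simp: weak_dtheta_def)
  define h where "h x w = h1 x w - h2 x w" for x w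
  have hL: "h \<in> L2g g" unfolding h_def[abs_def] by (rule L2g_diff[OF L])
  have "weak_dtheta g (Suc 0) (\<lambda>x w. 0) h"
    unfolding weak_dtheta_def
  proof (intro conjI hL allI impI)
    show "(\<lambda>x w. 0) \<in> L2g g" by (rule L2g_bounded[of _ 0]) (auto simp: cyl_measurable_def case_prod_unfold)
    fix \<phi> \<psi> :: "real \<Rightarrow> real" assume t: "smooth_periodic \<phi>" "\<psi> \<in> borel_measurable borel" "bounded (range \<psi>)"
    have i: "integrable cyl (\<lambda>(x, w). h' x w * \<phi> x * \<psi> w * g w)" if "h' \<in> L2g g" for h'
      using L2g_product[OF that test_function_L2g[OF smooth_periodic_deriv(3)[OF t(1), of 0] t(2,3)]]
      by (simp add: case_prod_unfold mult.assoc)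
    have "(- 1) ^ k * (\<integral>(x, w). h1 x w * \<phi> x * \<psi> w * g w \<partial>cyl) = (- 1) ^ k * (\<integral>(x, w). h2 x w * \<phi> x * \<psi> w * g w \<partial>cyl)"
      using assms(1)[unfolded weak_dtheta_def, THEN conjunct2, THEN conjunct2, rule_format, OF t]
        assms(2)[unfolded weak_dtheta_def, THEN conjunct2, THEN conjunct2, rule_format, OF t] by (rule trans[OF sym])
    then have "(\<integral>(x, w). h1 x w * \<phi> x * \<psi> w * g w \<partial>cyl) - (\<integral>(x, w). h2 x w * \<phi> x * \<psi> w * g w \<partial>cyl) = 0" by simp
    then have "(\<integral>(x, w). h x w * \<phi> x * \<psi> w * g w \<partial>cyl) = 0"
      using i[OF L(1)] i[OF L(2)]
      by (subst (asm) Bochner_Integration.integral_diff[symmetric]) (auto simp: h_def case_prod_unfold left_diff_distrib)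
    then show "(\<integral>(x, w). 0 * (deriv ^^ Suc 0) \<phi> x * \<psi> w * g w \<partial>cyl) = (- 1) ^ Suc 0 * (\<integral>(x, w). h x w * \<phi> x * \<psi> w * g w \<partial>cyl)"
      by (simp add: case_prod_unfold)
  qed
  from weak_dtheta_ac[OF this, of "\<lambda>i x w. 0"]
  have "AE w in lborel. g w \<noteq> 0 \<longrightarrow> ac (\<lambda>x. 0) (\<lambda>x. h (wrap x) w)" by simp
  then have "AE w in lborel. (\<integral>x. (h1 x w)\<^sup>2 * g w \<partial>torus) = (\<integral>x. (h2 x w)\<^sup>2 * g w \<partial>torus)"
  proof eventually_elim
    fix w assume a: "g w \<noteq> 0 \<longrightarrow> ac (\<lambda>x. 0) (\<lambda>x. h (wrap x) w)"
    show "(\<integral>x. (h1 x w)\<^sup>2 * g w \<partial>torus) = (\<integral>x. (h2 x w)\<^sup>2 * g w \<partial>torus)"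
    proof (cases "g w = 0")
      case False
      have "ac (\<lambda>x. 0) (\<lambda>x. 0)" by (rule ac_C1) auto
      with a False have "AE x in lborel. h (wrap x) w = 0" using ac_unique by fastforce
      then have "AE x in torus. h (wrap x) w = 0"
        unfolding torus_def by (subst AE_restrict_space_iff) auto
      then have ae: "AE x in torus. (h1 x w)\<^sup>2 * g w = (h2 x w)\<^sup>2 * g w"
        by (rule AE_mp, intro AE_I2) (auto simp: wrap_id space_torus h_def)
      have "(\<lambda>x. h1 x w) \<in> borel_measurable torus" "(\<lambda>x. h2 x w) \<in> borel_measurable torus"
        by (intro measurable_torus cyl_measurable_slice L2g_measurable L)+
      then have "(\<lambda>x. (h1 x w)\<^sup>2 * g w) \<in> borel_measurable torus" "(\<lambda>x. (h2 x w)\<^sup>2 * g w) \<in> borel_measurable torus"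
        by (auto intro!: borel_measurable_times borel_measurable_power)
      then show ?thesis by (rule integral_cong_AE[OF _ _ ae])
    qed simp
  qed
  then have "(\<integral>w. (\<integral>x. (h1 x w)\<^sup>2 * g w \<partial>torus) \<partial>lborel) = (\<integral>w. (\<integral>x. (h2 x w)\<^sup>2 * g w \<partial>torus) \<partial>lborel)"
    using cyl_Fubini(2)[OF L2g_integrable[OF L(1)]] cyl_Fubini(2)[OF L2g_integrable[OF L(2)]]
    by (intro integral_cong_AE) (auto simp: integrable_iff_bounded)
  then show ?thesis
    unfolding L2g_norm_def cyl_Fubini(1)[OF L2g_integrable[OF L(1)]] cyl_Fubini(1)[OF L2g_integrable[OF L(2)]] by simp
qed

lemma weak_dtheta_norm: "weak_dtheta g k f h \<Longrightarrow> L2g_norm g (SOME h. weak_dtheta g k f h) = L2g_norm g h"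
  by (rule weak_dtheta_unique[OF someI[of "weak_dtheta g k f"]])

text \<open>The converse passage: integration by parts on almost every slice, then Fubini.\<close>

lemma weak_dtheta_chain:
  assumes fL: "f \<in> L2g g" and hL: "h \<in> L2g g"
    and chain: "AE w in lborel. g w \<noteq> 0 \<longrightarrow> (\<exists>F. smooth_chain k F \<and> F 0 = (\<lambda>x. f x w) \<and> F k = (\<lambda>x. h x w))"
  shows "weak_dtheta g k f h"
  unfolding weak_dtheta_def
proof (intro conjI fL hL allI impI)
  fix \<phi> \<psi> :: "real \<Rightarrow> real" assume s: "smooth_periodic \<phi>" and p: "\<psi> \<in> borel_measurable borel" "bounded (range \<psi>)"
  have i1: "integrable cyl (\<lambda>(x, w). f x w * (deriv ^^ k) \<phi> x * \<psi> w * g w)" and i2: "integrable cyl (\<lambda>(x, w). h x w * \<phi> x * \<psi> w * g w)"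
    using L2g_product[OF fL test_function_L2g[OF smooth_periodic_deriv(3)[OF s, of k] p]]
      L2g_product[OF hL test_function_L2g[OF smooth_periodic_deriv(3)[OF s, of 0] p]]
    by (simp_all add: case_prod_unfold mult.assoc)
  have ae: "AE w in lborel. (\<integral>x. f x w * (deriv ^^ k) \<phi> x * \<psi> w * g w \<partial>torus) = (- 1) ^ k * (\<integral>x. h x w * \<phi> x * \<psi> w * g w \<partial>torus)"
    using chain
  proof eventually_elim
    fix w assume c: "g w \<noteq> 0 \<longrightarrow> (\<exists>F. smooth_chain k F \<and> F 0 = (\<lambda>x. f x w) \<and> F k = (\<lambda>x. h x w))"
    show "(\<integral>x. f x w * (deriv ^^ k) \<phi> x * \<psi> w * g w \<partial>torus) = (- 1) ^ k * (\<integral>x. h x w * \<phi> x * \<psi> w * g w \<partial>torus)"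
    proof (cases "g w = 0")
      case False
      with c obtain F where F: "smooth_chain k F" "F 0 = (\<lambda>x. f x w)" "F k = (\<lambda>x. h x w)" by blast
      have "(\<integral>x. f x w * (deriv ^^ k) \<phi> x \<partial>torus) = (- 1) ^ k * (\<integral>x. h x w * \<phi> x \<partial>torus)"
        using smooth_chain_ibp[OF F(1) s, of 0] by (simp add: lint_torus F(2,3))
      then show ?thesis by simp
    qed simp
  qed
  have "(\<integral>w. (\<integral>x. f x w * (deriv ^^ k) \<phi> x * \<psi> w * g w \<partial>torus) \<partial>lborel) = (\<integral>w. (- 1) ^ k * (\<integral>x. h x w * \<phi> x * \<psi> w * g w \<partial>torus) \<partial>lborel)"
    using cyl_Fubini(2)[OF i1] cyl_Fubini(2)[OF i2]
    by (intro integral_cong_AE ae) (auto simp: integrable_iff_bounded)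
  then show "(\<integral>(x, w). f x w * (deriv ^^ k) \<phi> x * \<psi> w * g w \<partial>cyl) = (- 1) ^ k * (\<integral>(x, w). h x w * \<phi> x * \<psi> w * g w \<partial>cyl)"
    unfolding cyl_Fubini(1)[OF i1] cyl_Fubini(1)[OF i2] by simp
qed

end

section \<open>Transport by circle diffeomorphisms\<close>

lemma lint_period:
  assumes h: "h \<in> borel_measurable borel" and per: "\<And>x. h (x + 2 * pi) = h x"
    and i: "set_integrable lborel {0..2 * pi} h" and ac: "ac H h"
  shows "H (c + 2 * pi) - H c = (LINT x:{0..2 * pi}|lborel. h x)"
proof -
  have "ac (\<lambda>x. H (x + 2 * pi)) (\<lambda>x. h (x + 2 * pi) * 1)"
    by (rule ac_comp[OF ac]) (auto intro!: derivative_eq_intros)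
  from ac_diff[OF this ac] have "ac (\<lambda>x. H (x + 2 * pi) - H x) (\<lambda>x. 0)" by (simp add: per)
  then have "x \<le> y \<Longrightarrow> 0 = H (y + 2 * pi) - H y - (H (x + 2 * pi) - H x)" for x y by (simp add: ac_def)
  from this[of 0 c] this[of c 0] have "H (c + 2 * pi) - H c = H (2 * pi) - H 0"
    by (cases "0 \<le> c") auto
  then show ?thesis using ac by (simp add: ac_def)
qed

text \<open>A lift of degree one maps a period onto an interval of length one period, over which a
  periodic function has the same integral.\<close>

lemma torus_subst:
  fixes F k k' :: "real \<Rightarrow> real"
  assumes F: "F \<in> borel_measurable borel" "\<And>x. F (x + 2 * pi) = F x" "integrable torus F"
    and k: "\<And>x. (k has_real_derivative k' x) (at x)" "continuous_on UNIV k'" "\<And>x. k' x \<ge> 0"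
      "\<And>x. k (x + 2 * pi) = k x + 2 * pi"
  shows "integrable torus (\<lambda>x. F (k x) * k' x)" "(\<integral>x. F (k x) * k' x \<partial>torus) = (\<integral>x. F x \<partial>torus)"
proof -
  have i: "set_integrable lborel {0..2 * pi} F" using F(3) by (simp add: integrable_torus)
  obtain H where H: "ac H F" using ac_primitive[OF F(1) periodic_set_integrable[OF i F(2)]] by blast
  have c: "ac (\<lambda>x. H (k x)) (\<lambda>x. F (k x) * k' x)" by (rule ac_comp[OF H k(1-3)])
  then show "integrable torus (\<lambda>x. F (k x) * k' x)" by (simp add: integrable_torus ac_integrable)
  have "(\<integral>x. F (k x) * k' x \<partial>torus) = H (k (2 * pi)) - H (k 0)"
    using c by (simp add: lint_torus ac_def)
  also have "\<dots> = (\<integral>x. F x \<partial>torus)"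
    using k(4)[of 0] lint_period[OF F(1,2) i H, of "k 0"] by (simp add: lint_torus)
  finally show "(\<integral>x. F (k x) * k' x \<partial>torus) = (\<integral>x. F x \<partial>torus)" .
qed

text \<open>For each frequency the lift of a monotone circle map of degree one. Only
  \<open>k' >= 0\<close> is asked, so that a flow map can be used before its Jacobian is known to be
  strictly positive.\<close>

definition cyl_diffeo :: "(real \<Rightarrow> real \<Rightarrow> real) \<Rightarrow> (real \<Rightarrow> real \<Rightarrow> real) \<Rightarrow> bool" where
  "cyl_diffeo k k' \<longleftrightarrow> cyl_measurable k \<and> cyl_measurable k' \<and>
     (\<forall>x w. ((\<lambda>x. k x w) has_real_derivative k' x w) (at x)) \<and> (\<forall>w. continuous_on UNIV (\<lambda>x. k' x w)) \<and>
     (\<forall>x w. k' x w \<ge> 0) \<and> (\<forall>x w. k (x + 2 * pi) w = k x w + 2 * pi)"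

lemma cyl_measurable_comp:
  assumes "cyl_measurable F" "cyl_measurable k"
  shows "cyl_measurable (\<lambda>x w. F (k x w) w)"
proof -
  have k: "(\<lambda>p. k (fst p) (snd p)) \<in> borel_measurable (borel \<Otimes>\<^sub>M borel)"
    using assms(2) by (simp add: cyl_measurable_def case_prod_unfold borel_prod)
  have F: "(\<lambda>p. F (fst p) (snd p)) \<in> borel_measurable (borel \<Otimes>\<^sub>M borel)"
    using assms(1) by (simp add: cyl_measurable_def case_prod_unfold borel_prod)
  have "(\<lambda>p. (k (fst p) (snd p), snd p)) \<in> (borel \<Otimes>\<^sub>M borel) \<rightarrow>\<^sub>M (borel \<Otimes>\<^sub>M borel)"
    using k by measurable
  from measurable_compose[OF this F] show ?thesis
    by (simp add: cyl_measurable_def case_prod_unfold borel_prod)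
qed

lemma cyl_measurable_mult: "cyl_measurable f \<Longrightarrow> cyl_measurable h \<Longrightarrow> cyl_measurable (\<lambda>x w. f x w * h x w)"
  and cyl_measurable_add: "cyl_measurable f \<Longrightarrow> cyl_measurable h \<Longrightarrow> cyl_measurable (\<lambda>x w. f x w + h x w)"
  and cyl_measurable_diff: "cyl_measurable f \<Longrightarrow> cyl_measurable h \<Longrightarrow> cyl_measurable (\<lambda>x w. f x w - h x w)"
  and cyl_measurable_divide: "cyl_measurable f \<Longrightarrow> cyl_measurable h \<Longrightarrow> cyl_measurable (\<lambda>x w. f x w / h x w)"
  and cyl_measurable_abs: "cyl_measurable f \<Longrightarrow> cyl_measurable (\<lambda>x w. \<bar>f x w\<bar>)"
  and cyl_measurable_power: "cyl_measurable f \<Longrightarrow> cyl_measurable (\<lambda>x w. f x w ^ n)"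
  and cyl_measurable_const: "cyl_measurable (\<lambda>x w. c)"
  unfolding cyl_measurable_def case_prod_unfold
  by (auto intro!: borel_measurable_times borel_measurable_add borel_measurable_diff borel_measurable_divide
      borel_measurable_abs borel_measurable_power)

lemma cyl_measurable_snd: "h \<in> borel_measurable borel \<Longrightarrow> cyl_measurable (\<lambda>x w. h w)"
  and cyl_measurable_fst: "h \<in> borel_measurable borel \<Longrightarrow> cyl_measurable (\<lambda>x w. h x)"
  unfolding cyl_measurable_def case_prod_unfold borel_prod[symmetric]
  by (auto intro: measurable_compose[OF measurable_snd] measurable_compose[OF measurable_fst])

lemmas cyl_measurable_intros = cyl_measurable_mult cyl_measurable_add cyl_measurable_diff cyl_measurable_divide
  cyl_measurable_abs cyl_measurable_power cyl_measurable_const cyl_measurable_snd cyl_measurable_fst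

lemma AE_cyl_I: "(\<And>x w. x \<in> {0..<2 * pi} \<Longrightarrow> P x w) \<Longrightarrow> AE p in cyl. case p of (x, w) \<Rightarrow> P x w"
  by (rule AE_I2) (auto simp: cyl_def space_pair_measure space_torus)

section \<open>Change of variables in weighted integrals\<close>

context weight
begin

lemma cyl_weight_measurable: "cyl_measurable F \<Longrightarrow> (\<lambda>(x, w). F x w * g w) \<in> borel_measurable cyl"
  by (intro cyl_measurable_cyl cyl_measurable_intros g_meas)

lemma integrable_weight_bound:
  assumes "integrable cyl (\<lambda>(x, w). E x w * g w)" "cyl_measurable F"
    "\<And>x w. x \<in> {0..<2 * pi} \<Longrightarrow> \<bar>F x w\<bar> \<le> E x w"
  shows "integrable cyl (\<lambda>(x, w). F x w * g w)"
proof (rule Bochner_Integration.integrable_bound[OF assms(1) cyl_weight_measurable[OF assms(2)]])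
  have "AE p in cyl. case p of (x, w) \<Rightarrow> norm (F x w * g w) \<le> norm (E x w * g w)"
  proof (rule AE_cyl_I)
    fix x w :: real assume "x \<in> {0..<2 * pi}"
    then have "\<bar>F x w\<bar> \<le> \<bar>E x w\<bar>" using assms(3)[of x w] by linarith
    from mult_right_mono[OF this g_nonneg[of w]]
    show "norm (F x w * g w) \<le> norm (E x w * g w)" using g_nonneg[of w] by (simp add: abs_mult)
  qed
  then show "AE p in cyl. norm (case p of (x, w) \<Rightarrow> F x w * g w) \<le> norm (case p of (x, w) \<Rightarrow> E x w * g w)"
    by (simp add: case_prod_unfold)
qed

text \<open>The circle substitution on each slice. Integrability over the cylinder is not known
  beforehand; it comes from Tonelli, with the same substitution applied to absolute values.\<close>

lemma cyl_subst:
  assumes F: "cyl_measurable F" "\<And>x w. F (x + 2 * pi) w = F x w" "integrable cyl (\<lambda>(x, w). F x w * g w)"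
    and k: "cyl_diffeo k k'"
  shows "integrable cyl (\<lambda>(x, w). F (k x w) w * k' x w * g w)"
    "(\<integral>(x, w). F (k x w) w * k' x w * g w \<partial>cyl) = (\<integral>(x, w). F x w * g w \<partial>cyl)"
proof -
  have km: "cyl_measurable k" "cyl_measurable k'" using k by (auto simp: cyl_diffeo_def)
  have Fm: "(\<lambda>x. F x w) \<in> borel_measurable borel" for w by (rule cyl_measurable_slice[OF F(1)])
  have sub: "integrable torus (\<lambda>x. f (k x w) * k' x w) \<and> (\<integral>x. f (k x w) * k' x w \<partial>torus) = (\<integral>x. f x \<partial>torus)"
    if "f \<in> borel_measurable borel" "\<And>x. f (x + 2 * pi) = f x" "integrable torus f" for f w
    using torus_subst[OF that, of "\<lambda>x. k x w" "\<lambda>x. k' x w"] k unfolding cyl_diffeo_def by auto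
  have Gm: "cyl_measurable (\<lambda>x w. F (k x w) w * k' x w)"
    by (rule cyl_measurable_mult[OF cyl_measurable_comp[OF F(1) km(1)] km(2)])
  have slice: "AE w in lborel. g w \<noteq> 0 \<longrightarrow> integrable torus (\<lambda>x. F x w)"
    using cyl_Fubini(3)[OF F(3)] by eventually_elim auto
  have nn: "(\<integral>\<^sup>+p. ennreal (norm (case p of (x, w) \<Rightarrow> f x w * g w)) \<partial>cyl)
      = (\<integral>\<^sup>+w. (\<integral>\<^sup>+x. ennreal (\<bar>f x w\<bar>) * ennreal (g w) \<partial>torus) \<partial>lborel)" if "cyl_measurable f" for f
  proof -
    have "(\<lambda>p. ennreal (norm (case p of (x, w) \<Rightarrow> f x w * g w))) \<in> borel_measurable cyl"
      using cyl_weight_measurable[OF that] by measurable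
    from cyl.nn_integral_snd[of "\<lambda>p. ennreal (norm (case p of (x, w) \<Rightarrow> f x w * g w))", folded cyl_def, OF this]
    show ?thesis using g_nonneg by (simp add: abs_mult ennreal_mult)
  qed
  have ae: "AE w in lborel. (\<integral>\<^sup>+x. ennreal (\<bar>F (k x w) w * k' x w\<bar>) * ennreal (g w) \<partial>torus) = (\<integral>\<^sup>+x. ennreal (\<bar>F x w\<bar>) * ennreal (g w) \<partial>torus)"
    using slice
  proof eventually_elim
    fix w assume i: "g w \<noteq> 0 \<longrightarrow> integrable torus (\<lambda>x. F x w)"
    show "(\<integral>\<^sup>+x. ennreal (\<bar>F (k x w) w * k' x w\<bar>) * ennreal (g w) \<partial>torus) = (\<integral>\<^sup>+x. ennreal (\<bar>F x w\<bar>) * ennreal (g w) \<partial>torus)"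
    proof (cases "g w = 0")
      case False
      with i have i: "integrable torus (\<lambda>x. F x w)" by simp
      have s: "integrable torus (\<lambda>x. \<bar>F (k x w) w\<bar> * k' x w)" "(\<integral>x. \<bar>F (k x w) w\<bar> * k' x w \<partial>torus) = (\<integral>x. \<bar>F x w\<bar> \<partial>torus)"
        using sub[of "\<lambda>x. \<bar>F x w\<bar>" w] Fm[of w] F(2) i by auto
      have [measurable]: "(\<lambda>x. F x w) \<in> borel_measurable torus" "(\<lambda>x. F (k x w) w * k' x w) \<in> borel_measurable torus"
        by (intro measurable_torus Fm cyl_measurable_slice[OF Gm])+
      have k'0: "k' x w \<ge> 0" for x using k by (simp add: cyl_diffeo_def)
      have "(\<integral>\<^sup>+x. ennreal (\<bar>F (k x w) w * k' x w\<bar>) \<partial>torus) = ennreal (\<integral>x. \<bar>F (k x w) w\<bar> * k' x w \<partial>torus)"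
        using nn_integral_eq_integral[OF s(1)] k'0 by (simp add: abs_mult)
      also have "\<dots> = (\<integral>\<^sup>+x. ennreal (\<bar>F x w\<bar>) \<partial>torus)"
        unfolding s(2) by (rule nn_integral_eq_integral[symmetric]) (use i in auto)
      finally show ?thesis by (subst (1 2) nn_integral_multc) auto
    qed simp
  qed
  show int: "integrable cyl (\<lambda>(x, w). F (k x w) w * k' x w * g w)"
  proof (rule integrableI_bounded)
    show "(\<lambda>(x, w). F (k x w) w * k' x w * g w) \<in> borel_measurable cyl" by (rule cyl_weight_measurable[OF Gm])
    have "(\<integral>\<^sup>+p. ennreal (norm (case p of (x, w) \<Rightarrow> F (k x w) w * k' x w * g w)) \<partial>cyl)
        = (\<integral>\<^sup>+p. ennreal (norm (case p of (x, w) \<Rightarrow> F x w * g w)) \<partial>cyl)"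
      unfolding nn[OF Gm] nn[OF F(1)] by (rule nn_integral_cong_AE[OF ae])
    then show "(\<integral>\<^sup>+p. ennreal (norm (case p of (x, w) \<Rightarrow> F (k x w) w * k' x w * g w)) \<partial>cyl) < \<infinity>"
      using F(3) by (simp add: integrable_iff_bounded)
  qed
  have "AE w in lborel. (\<integral>x. F (k x w) w * k' x w * g w \<partial>torus) = (\<integral>x. F x w * g w \<partial>torus)"
    using slice
  proof eventually_elim
    fix w assume i: "g w \<noteq> 0 \<longrightarrow> integrable torus (\<lambda>x. F x w)"
    then show "(\<integral>x. F (k x w) w * k' x w * g w \<partial>torus) = (\<integral>x. F x w * g w \<partial>torus)"
      using sub[of "\<lambda>x. F x w" w] Fm[of w] F(2) by (cases "g w = 0") auto
  qed
  then show "(\<integral>(x, w). F (k x w) w * k' x w * g w \<partial>cyl) = (\<integral>(x, w). F x w * g w \<partial>cyl)"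
    unfolding cyl_Fubini(1)[OF int] cyl_Fubini(1)[OF F(3)]
    using cyl_Fubini(2)[OF int] cyl_Fubini(2)[OF F(3)] by (intro integral_cong_AE) (auto simp: integrable_iff_bounded)
qed

end

text \<open>Indicators are approximated by inner and outer regularity and an Urysohn function
  between a compact set and an open set; sums and dominated limits are then handled by induction
  over integrable functions.\<close>

lemma dense_continuous:
  fixes M :: "'a::euclidean_space measure" and f :: "'a \<Rightarrow> real"
  assumes sM: "sets M = sets borel" and fin: "finite_measure M" and f: "integrable M f" and e: "e > 0"
  shows "\<exists>\<phi>. continuous_on UNIV \<phi> \<and> bounded (range \<phi>) \<and> (\<integral>x. \<bar>f x - \<phi> x\<bar> \<partial>M) < e"
  using f e
proof (induction arbitrary: e rule: integrable_induct)
  interpret finite_measure M by fact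
  have cont_int: "integrable M \<phi>" if c: "continuous_on UNIV \<phi>" and b: "bounded (range \<phi>)" for \<phi> :: "'a \<Rightarrow> real"
  proof -
    obtain B where "\<And>x. \<bar>\<phi> x\<bar> \<le> B" using b by (auto simp: bounded_iff)
    moreover have "\<phi> \<in> borel_measurable M"
      using borel_measurable_continuous_onI[OF c] by (simp add: measurable_cong_sets[OF sM refl])
    ultimately show ?thesis by (intro integrable_const_bound[of _ B]) auto
  qed
  {
    case (base A c)
    \<comment> \<open>The open set exceeds the compact one by less than \<open>2 * d\<close> in
      measure, and there the error is at most the absolute value of \<open>c\<close>; the added 1
      covers \<open>c = 0\<close>.\<close>
    define d where "d = e / (2 * (\<bar>c\<bar> + 1))"
    have d: "d > 0" using base by (simp add: d_def)
    have A: "A \<in> sets borel" using base sM by simp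
    have eM: "emeasure M (space M) \<noteq> \<infinity>" using finite_emeasure_space by simp
    obtain C where C: "C \<subseteq> A" "compact C" "measure M A < measure M C + d"
    proof (cases "measure M A < d")
      case True then show ?thesis using that[of "{}"] by simp
    next
      case False
      have "ennreal (measure M A - d) < emeasure M A"
        using d False by (simp add: emeasure_eq_measure ennreal_less_iff)
      also have "\<dots> = (SUP C\<in>{C. C \<subseteq> A \<and> compact C}. emeasure M C)" by (rule inner_regular[OF sM eM A])
      finally obtain C where "C \<subseteq> A" "compact C" "ennreal (measure M A - d) < emeasure M C"
        by (auto simp: less_SUP_iff)
      then show ?thesis using False that[of C] by (simp add: emeasure_eq_measure ennreal_less_iff)
    qed
    obtain U where U: "A \<subseteq> U" "open U" "measure M U < measure M A + d"
    proof -
      have "(INF U\<in>{U. A \<subseteq> U \<and> open U}. emeasure M U) = emeasure M A" by (rule outer_regular[OF sM eM A, symmetric])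
      also have "\<dots> < ennreal (measure M A + d)" using d by (simp add: emeasure_eq_measure ennreal_less_iff)
      finally obtain U where "A \<subseteq> U" "open U" "emeasure M U < ennreal (measure M A + d)"
        by (auto simp: INF_less_iff)
      then show ?thesis using that[of U] by (simp add: emeasure_eq_measure ennreal_less_iff)
    qed
    have CU: "closedin (top_of_set UNIV) C" "closedin (top_of_set UNIV) (- U)" "C \<inter> - U = {}"
      using C U by (auto simp: compact_imp_closed)
    obtain \<phi> :: "'a \<Rightarrow> real" where \<phi>: "continuous_on UNIV \<phi>" "\<And>x. \<phi> x \<in> closed_segment c 0"
      "\<And>x. x \<in> C \<Longrightarrow> \<phi> x = c" "\<And>x. x \<in> - U \<Longrightarrow> \<phi> x = 0"
    proof (rule Urysohn_local[OF CU, of c 0])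
      fix f assume a: "continuous_on UNIV f" "\<And>x. x \<in> UNIV \<Longrightarrow> f x \<in> closed_segment c 0"
        "\<And>x. x \<in> C \<Longrightarrow> f x = c" "\<And>x. x \<in> - U \<Longrightarrow> f x = 0"
      show thesis by (rule that[OF a(1) a(2)[OF UNIV_I] a(3) a(4)])
    qed
    have \<phi>b: "\<bar>\<phi> x\<bar> \<le> \<bar>c\<bar>" "\<bar>c - \<phi> x\<bar> \<le> \<bar>c\<bar>" for x
      using \<phi>(2)[of x] by (auto simp: closed_segment_eq_real_ivl split: if_splits)
    have b: "bounded (range \<phi>)" using \<phi>b(1) by (auto simp: bounded_iff)
    have mU: "U \<in> sets M" "C \<in> sets M" using U C by (auto simp: sM compact_imp_closed)
    have "(\<integral>x. \<bar>indicator A x *\<^sub>R c - \<phi> x\<bar> \<partial>M) \<le> (\<integral>x. indicator (U - C) x *\<^sub>R \<bar>c\<bar> \<partial>M)"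
    proof (rule Bochner_Integration.integral_mono)
      show "integrable M (\<lambda>x. \<bar>indicator A x *\<^sub>R c - \<phi> x\<bar>)"
      proof -
        have "integrable M (\<lambda>x. indicator A x *\<^sub>R c)" using base by simp
        from Bochner_Integration.integrable_diff[OF this cont_int[OF \<phi>(1) b]] show ?thesis by (rule integrable_abs)
      qed
      show "integrable M (\<lambda>x. indicator (U - C) x *\<^sub>R \<bar>c\<bar>)" using mU by (simp add: emeasure_eq_measure)
      fix x
      show "\<bar>indicator A x *\<^sub>R c - \<phi> x\<bar> \<le> indicator (U - C) x *\<^sub>R \<bar>c\<bar>"
        using \<phi>b[of x] \<phi>(3,4)[of x] C(1) U(1) by (auto simp: indicator_def)
    qed
    also have "\<dots> = measure M (U - C) * \<bar>c\<bar>" using mU by simp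
    also have "measure M (U - C) = measure M U - measure M C"
      using mU C U by (intro finite_measure_Diff) auto
    also have "(measure M U - measure M C) * \<bar>c\<bar> \<le> (2 * d) * \<bar>c\<bar>"
      using C(3) U(3) by (intro mult_right_mono) auto
    also have "\<dots> < e" using base by (simp add: d_def field_simps)
    finally show ?case using \<phi>(1) b by blast
  next
    case (add f1 f2)
    obtain p1 where p1: "continuous_on UNIV p1" "bounded (range p1)" "(\<integral>x. \<bar>f1 x - p1 x\<bar> \<partial>M) < e / 2"
      using add.IH(1)[of "e / 2"] add.prems by auto
    obtain p2 where p2: "continuous_on UNIV p2" "bounded (range p2)" "(\<integral>x. \<bar>f2 x - p2 x\<bar> \<partial>M) < e / 2"
      using add.IH(2)[of "e / 2"] add.prems by auto
    have i: "integrable M (\<lambda>x. \<bar>f1 x - p1 x\<bar>)" "integrable M (\<lambda>x. \<bar>f2 x - p2 x\<bar>)"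
      using integrable_abs[OF Bochner_Integration.integrable_diff[OF add.hyps(1) cont_int[OF p1(1,2)]]]
        integrable_abs[OF Bochner_Integration.integrable_diff[OF add.hyps(2) cont_int[OF p2(1,2)]]] by auto
    obtain B1 B2 where "\<And>x. \<bar>p1 x\<bar> \<le> B1" "\<And>x. \<bar>p2 x\<bar> \<le> B2" using p1 p2 by (auto simp: bounded_iff)
    then have "\<bar>p1 x + p2 x\<bar> \<le> B1 + B2" for x using abs_triangle_ineq[of "p1 x" "p2 x"] by (smt (verit))
    then have b: "bounded (range (\<lambda>x. p1 x + p2 x))" by (auto simp: bounded_iff)
    have c: "continuous_on UNIV (\<lambda>x. p1 x + p2 x)" by (intro continuous_intros p1 p2)
    have "(\<integral>x. \<bar>f1 x + f2 x - (p1 x + p2 x)\<bar> \<partial>M) \<le> (\<integral>x. \<bar>f1 x - p1 x\<bar> + \<bar>f2 x - p2 x\<bar> \<partial>M)"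
      by (rule Bochner_Integration.integral_mono[OF integrable_abs[OF Bochner_Integration.integrable_diff[OF
          Bochner_Integration.integrable_add[OF add.hyps] cont_int[OF c b]]] Bochner_Integration.integrable_add[OF i] abs_diff_triangle_ineq])
    also have "\<dots> < e" using p1(3) p2(3) i by (subst Bochner_Integration.integral_add) auto
    finally show ?case using b c by blast
  next
    case (lim f s)
    have "(\<lambda>i. \<integral>x. \<bar>f x - s i x\<bar> \<partial>M) \<longlonglongrightarrow> (\<integral>x. 0 \<partial>M)"
    proof (rule integral_dominated_convergence)
      show "integrable M (\<lambda>x. 3 * \<bar>f x\<bar>)" using lim by auto
      show "AE x in M. (\<lambda>i. \<bar>f x - s i x\<bar>) \<longlonglongrightarrow> 0"
      proof (rule AE_I2)
        fix x assume "x \<in> space M"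
        from tendsto_diff[OF tendsto_const lim.hyps(2)[OF this], of "f x"]
        show "(\<lambda>i. \<bar>f x - s i x\<bar>) \<longlonglongrightarrow> 0" by (simp add: tendsto_rabs_zero)
      qed
      show "AE x in M. norm (\<bar>f x - s i x\<bar>) \<le> 3 * \<bar>f x\<bar>" for i
        using lim.hyps(3)[of _ i] by (intro AE_I2) fastforce
    qed (use lim.hyps in auto)
    then have "(\<lambda>i. \<integral>x. \<bar>f x - s i x\<bar> \<partial>M) \<longlonglongrightarrow> 0" by simp
    from LIMSEQ_D[OF this, of "e / 2"] lim.prems obtain i where i: "(\<integral>x. \<bar>f x - s i x\<bar> \<partial>M) < e / 2" by force
    obtain p where p: "continuous_on UNIV p" "bounded (range p)" "(\<integral>x. \<bar>s i x - p x\<bar> \<partial>M) < e / 2"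
      using lim.IH[of "e / 2" i] lim.prems by auto
    have ii: "integrable M (\<lambda>x. \<bar>f x - s i x\<bar>)" "integrable M (\<lambda>x. \<bar>s i x - p x\<bar>)"
      using integrable_abs[OF Bochner_Integration.integrable_diff[OF lim.hyps(4) lim.hyps(1)[of i]]]
        integrable_abs[OF Bochner_Integration.integrable_diff[OF lim.hyps(1)[of i] cont_int[OF p(1,2)]]] by auto
    have "(\<integral>x. \<bar>f x - p x\<bar> \<partial>M) \<le> (\<integral>x. \<bar>f x - s i x\<bar> + \<bar>s i x - p x\<bar> \<partial>M)"
    proof (rule Bochner_Integration.integral_mono[OF integrable_abs[OF Bochner_Integration.integrable_diff[OF
          lim.hyps(4) cont_int[OF p(1,2)]]] Bochner_Integration.integrable_add[OF ii]])
      show "\<bar>f x - p x\<bar> \<le> \<bar>f x - s i x\<bar> + \<bar>s i x - p x\<bar>" for x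
        using abs_triangle_ineq[of "f x - s i x" "s i x - p x"] by simp
    qed
    also have "\<dots> < e" using p(3) i ii by (subst Bochner_Integration.integral_add) auto
    finally show ?case using p by blast
  }
qed

text \<open>\<open>Arg2pi\<close> is continuous off the nonnegative reals, a closed set on which it
  is zero.\<close>

lemma Arg2pi_measurable [measurable]: "Arg2pi \<in> borel_measurable borel"
proof -
  have "closed (\<real>\<^sub>\<ge>\<^sub>0 :: complex set)" by simp
  then have b: "\<real>\<^sub>\<ge>\<^sub>0 \<in> sets (borel :: complex measure)" by (rule borel_closed)
  have "continuous_on (- \<real>\<^sub>\<ge>\<^sub>0) Arg2pi"
    by (intro continuous_at_imp_continuous_on ballI continuous_at_Arg2pi) simp
  then have "(\<lambda>z. if z \<in> \<real>\<^sub>\<ge>\<^sub>0 then 0 else Arg2pi z) \<in> borel_measurable borel"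
    by (rule borel_measurable_continuous_on_if[OF b continuous_on_const])
  also have "(\<lambda>z. if z \<in> \<real>\<^sub>\<ge>\<^sub>0 then 0 else Arg2pi z) = Arg2pi"
  proof
    fix z
    have "Arg2pi z = 0" if "z \<in> \<real>\<^sub>\<ge>\<^sub>0"
      using that Arg2pi_eq_0[of z] by (simp add: complex_nonneg_Reals_iff complex_is_Real_iff)
    then show "(if z \<in> \<real>\<^sub>\<ge>\<^sub>0 then 0 else Arg2pi z) = Arg2pi z" by simp
  qed
  finally show ?thesis .
qed

lemma Arg2pi_cis: "x \<in> {0..<2 * pi} \<Longrightarrow> Arg2pi (cis x) = x"
  by (rule Arg2pi_unique[of 1]) (auto simp: cis_conv_exp mult.commute)

section \<open>Density of periodic continuous functions and continuity of transport\<close>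

context weight
begin

text \<open>The weighted measure is pushed forward to the complex plane times the line by
  \<open>cis\<close>: continuous functions there pull back to functions that are automatically
  periodic in the angle. \<open>Arg2pi\<close> serves to carry \<open>F\<close> over to that
  space.\<close>

lemma cyl_dense:
  assumes F: "cyl_measurable F" "integrable cyl (\<lambda>(x, w). F x w * g w)" and e: "e > 0"
  shows "\<exists>\<phi> B. cyl_measurable \<phi> \<and> (\<forall>w. continuous_on UNIV (\<lambda>x. \<phi> x w)) \<and> (\<forall>x w. \<phi> (x + 2 * pi) w = \<phi> x w) \<and>
    (\<forall>x w. \<bar>\<phi> x w\<bar> \<le> B) \<and> (\<integral>(x, w). \<bar>F x w - \<phi> x w\<bar> * g w \<partial>cyl) < e"
proof -
  define p where "p = (\<lambda>(x, w). (cis x, w :: real))"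
  have pm: "p \<in> borel_measurable borel"
    unfolding p_def case_prod_unfold by (intro borel_measurable_continuous_onI continuous_intros)
  have [measurable]: "p \<in> cyl \<rightarrow>\<^sub>M borel"
  proof -
    have "(\<lambda>x. x) \<in> cyl \<rightarrow>\<^sub>M borel"
    proof -
      have "(\<lambda>p. (fst p, snd p)) \<in> cyl \<rightarrow>\<^sub>M borel \<Otimes>\<^sub>M borel"
        by (intro measurable_Pair measurable_cyl) (auto simp: borel_prod[symmetric])
      then show ?thesis by (simp add: borel_prod)
    qed
    from measurable_compose[OF this pm] show ?thesis .
  qed
  have gm [measurable]: "(\<lambda>q. g (snd q)) \<in> borel_measurable cyl"
    using cyl_measurable_cyl[OF cyl_measurable_snd[OF g_meas]] by (simp add: case_prod_unfold)
  define D where "D = density cyl (\<lambda>q. ennreal (g (snd q)))"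
  define M where "M = distr D borel p"
  have pD [measurable]: "p \<in> D \<rightarrow>\<^sub>M borel" unfolding D_def by simp
  have intD: "integrable D f \<longleftrightarrow> integrable cyl (\<lambda>(x, w). g w * f (x, w))" "(\<integral>q. f q \<partial>D) = (\<integral>(x, w). g w * f (x, w) \<partial>cyl)"
    if f: "f \<in> borel_measurable cyl" for f :: "real \<times> real \<Rightarrow> real"
  proof -
    have nn: "AE q in cyl. 0 \<le> g (snd q)" by (rule AE_I2) (rule g_nonneg)
    show "integrable D f \<longleftrightarrow> integrable cyl (\<lambda>(x, w). g w * f (x, w))"
      unfolding D_def by (subst integrable_density[OF f gm nn]) (simp add: case_prod_unfold)
    show "(\<integral>q. f q \<partial>D) = (\<integral>(x, w). g w * f (x, w) \<partial>cyl)"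
      unfolding D_def by (subst integral_density[OF f gm nn]) (simp add: case_prod_unfold)
  qed
  have fin: "finite_measure M"
  proof (rule finite_measureI)
    have "integrable cyl (\<lambda>(x, w). g w * 1)" using integrable_cyl_snd[OF g_int] by simp
    then have "integrable D (\<lambda>q. 1 :: real)" by (subst intD) auto
    then have "emeasure D (space D) < \<infinity>" by (simp add: integrable_iff_bounded)
    then show "emeasure M (space M) \<noteq> \<infinity>" by (simp add: M_def emeasure_distr)
  qed
  define f where "f = (\<lambda>(c, w). F (Arg2pi c) w)"
  have fm [measurable]: "f \<in> borel_measurable borel"
  proof -
    have F': "(\<lambda>p. F (fst p) (snd p)) \<in> borel_measurable (borel \<Otimes>\<^sub>M borel)"
      using F(1) by (simp add: cyl_measurable_def case_prod_unfold borel_prod)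
    have "(\<lambda>p. (Arg2pi (fst p), snd p)) \<in> (borel \<Otimes>\<^sub>M borel) \<rightarrow>\<^sub>M (borel \<Otimes>\<^sub>M borel)" by measurable
    from measurable_compose[OF this F'] show ?thesis
      by (simp add: f_def case_prod_unfold borel_prod)
  qed
  have fp: "f (p (x, w)) = F x w" if "x \<in> {0..<2 * pi}" for x w
    using Arg2pi_cis[OF that] by (simp add: f_def p_def)
  have "integrable M f"
  proof -
    have "integrable cyl (\<lambda>(x, w). g w * f (p (x, w)))"
      by (rule Bochner_Integration.integrable_cong[THEN iffD1, OF refl _ F(2)])
        (auto simp: cyl_def space_pair_measure space_torus fp mult.commute)
    then have "integrable D (\<lambda>q. f (p q))" by (subst intD) auto
    then show ?thesis unfolding M_def by (subst integrable_distr_eq) auto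
  qed
  from dense_continuous[OF _ fin this e] obtain \<phi> where \<phi>: "continuous_on UNIV \<phi>" "bounded (range \<phi>)" "(\<integral>x. \<bar>f x - \<phi> x\<bar> \<partial>M) < e"
    by (auto simp: M_def)
  have [measurable]: "\<phi> \<in> borel_measurable borel" by (rule borel_measurable_continuous_onI[OF \<phi>(1)])
  obtain B where B: "\<And>q. \<bar>\<phi> q\<bar> \<le> B" using \<phi>(2) by (auto simp: bounded_iff)
  show ?thesis
  proof (intro exI[of _ "\<lambda>x w. \<phi> (p (x, w))"] exI[of _ B] conjI allI)
    show "cyl_measurable (\<lambda>x w. \<phi> (p (x, w)))"
      unfolding cyl_measurable_def using measurable_compose[OF pm, of \<phi> borel] by (simp add: case_prod_unfold)
    show "continuous_on UNIV (\<lambda>x. \<phi> (p (x, w)))" for w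
      unfolding p_def by (intro continuous_on_compose2[OF \<phi>(1)] continuous_intros) (auto intro!: continuous_intros)
    show "\<phi> (p (x + 2 * pi, w)) = \<phi> (p (x, w))" for x w by (simp add: p_def cis_mult[symmetric])
    show "\<bar>\<phi> (p (x, w))\<bar> \<le> B" for x w by (rule B)
    have "(\<integral>x. \<bar>f x - \<phi> x\<bar> \<partial>M) = (\<integral>q. \<bar>f (p q) - \<phi> (p q)\<bar> \<partial>D)"
      unfolding M_def by (subst integral_distr) auto
    also have "\<dots> = (\<integral>(x, w). g w * \<bar>f (p (x, w)) - \<phi> (p (x, w))\<bar> \<partial>cyl)"
      by (subst intD) auto
    also have "\<dots> = (\<integral>(x, w). \<bar>F x w - \<phi> (p (x, w))\<bar> * g w \<partial>cyl)"
      by (rule Bochner_Integration.integral_cong) (auto simp: cyl_def space_pair_measure space_torus fp mult.commute)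
    finally show "(\<integral>(x, w). \<bar>F x w - \<phi> (p (x, w))\<bar> * g w \<partial>cyl) < e" using \<phi>(3) by simp
  qed
qed

text \<open>Since \<open>1 <= k' / c\<close>, the missing Jacobian can be inserted at the price of
  the factor \<open>1 / c\<close>.\<close>

lemma cyl_subst_bound:
  assumes F: "cyl_measurable F" "\<And>x w. F (x + 2 * pi) w = F x w" "integrable cyl (\<lambda>(x, w). F x w * g w)"
    and k: "cyl_diffeo k k'" and c: "c > 0" "\<And>x w. k' x w \<ge> c"
  shows "integrable cyl (\<lambda>(x, w). F (k x w) w * g w)"
    "(\<integral>(x, w). \<bar>F (k x w) w\<bar> * g w \<partial>cyl) \<le> 1 / c * (\<integral>(x, w). \<bar>F x w\<bar> * g w \<partial>cyl)"
proof -
  have km: "cyl_measurable k" "cyl_measurable k'" using k by (auto simp: cyl_diffeo_def)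
  have i: "integrable cyl (\<lambda>(x, w). \<bar>F x w\<bar> * g w)"
    using integrable_abs[OF F(3)] g_nonneg by (simp add: case_prod_unfold abs_mult)
  note sub = cyl_subst[OF cyl_measurable_abs[OF F(1)] _ i k]
  have s1: "integrable cyl (\<lambda>(x, w). \<bar>F (k x w) w\<bar> * k' x w * g w)" using sub(1) F(2) by simp
  have s2: "(\<integral>(x, w). \<bar>F (k x w) w\<bar> * k' x w * g w \<partial>cyl) = (\<integral>(x, w). \<bar>F x w\<bar> * g w \<partial>cyl)" using sub(2) F(2) by simp
  have s3: "integrable cyl (\<lambda>(x, w). 1 / c * (\<bar>F (k x w) w\<bar> * k' x w) * g w)"
    using integrable_mult_right[OF s1, of "1 / c"] by (simp add: case_prod_unfold)
  have le: "\<bar>F (k x w) w\<bar> \<le> 1 / c * (\<bar>F (k x w) w\<bar> * k' x w)" for x w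
  proof -
    have "\<bar>F (k x w) w\<bar> * c \<le> \<bar>F (k x w) w\<bar> * k' x w" by (intro mult_left_mono c) simp
    then show ?thesis using c(1) by (simp add: field_simps)
  qed
  show "integrable cyl (\<lambda>(x, w). F (k x w) w * g w)"
    by (rule integrable_weight_bound[OF s3 cyl_measurable_comp[OF F(1) km(1)] le])
  have "(\<integral>(x, w). \<bar>F (k x w) w\<bar> * g w \<partial>cyl) \<le> (\<integral>(x, w). 1 / c * (\<bar>F (k x w) w\<bar> * k' x w) * g w \<partial>cyl)"
  proof (rule Bochner_Integration.integral_mono[OF _ s3])
    show "integrable cyl (\<lambda>(x, w). \<bar>F (k x w) w\<bar> * g w)"
      by (rule integrable_weight_bound[OF s3 cyl_measurable_abs[OF cyl_measurable_comp[OF F(1) km(1)]]]) (use le in simp)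
    show "(case q of (x, w) \<Rightarrow> \<bar>F (k x w) w\<bar> * g w) \<le> (case q of (x, w) \<Rightarrow> 1 / c * (\<bar>F (k x w) w\<bar> * k' x w) * g w)" for q
      using mult_right_mono[OF le g_nonneg] by (cases q) simp
  qed
  also have "\<dots> = 1 / c * (\<integral>(x, w). \<bar>F (k x w) w\<bar> * k' x w * g w \<partial>cyl)"
    by (subst integral_mult_right_zero[symmetric]) (simp add: case_prod_unfold)
  finally show "(\<integral>(x, w). \<bar>F (k x w) w\<bar> * g w \<partial>cyl) \<le> 1 / c * (\<integral>(x, w). \<bar>F x w\<bar> * g w \<partial>cyl)"
    unfolding s2 .
qed

text \<open>Transport by the flow is continuous in time: strong continuity holds for bounded continuous
  functions by dominated convergence, and these are dense. The quadratic norm is reduced to the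
  linear one through \<open>(a - b)\<^sup>2 \<le> 2 \<bar>a \<bar>a\<bar> - b \<bar>b\<bar>\<bar>\<close>.\<close>

lemma square_diff_le: "(a - b)\<^sup>2 \<le> 2 * \<bar>a * \<bar>a\<bar> - b * \<bar>b\<bar>\<bar>" for a b :: real
proof -
  have *: "(a - b)\<^sup>2 \<le> 2 * \<bar>a * \<bar>a\<bar> - b * \<bar>b\<bar>\<bar>" if "b \<le> a" for a b :: real
  proof -
    consider "0 \<le> b" | "b < 0" "0 \<le> a" | "a < 0" by linarith
    then show ?thesis
    proof cases
      case 1
      then have "(a - b)\<^sup>2 \<le> (a - b) * (a + b)" unfolding power2_eq_square using that by (intro mult_left_mono) auto
      also have "\<dots> = a * a - b * b" by (simp add: algebra_simps)
      finally show ?thesis using 1 that by (simp add: abs_real_def)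
    next
      case 2
      have "0 \<le> (a + b)\<^sup>2" by simp
      moreover have "a * \<bar>a\<bar> - b * \<bar>b\<bar> = a\<^sup>2 + b\<^sup>2" using 2 by (simp add: power2_eq_square abs_real_def)
      ultimately show ?thesis by (simp add: power2_eq_square algebra_simps)
    next
      case 3
      then have "(a - b)\<^sup>2 \<le> (a - b) * (- a - b)" unfolding power2_eq_square using that by (intro mult_left_mono) auto
      also have "\<dots> = a * \<bar>a\<bar> - b * \<bar>b\<bar>" using 3 that by (simp add: algebra_simps abs_real_def)
      also have "\<dots> \<le> 2 * \<bar>a * \<bar>a\<bar> - b * \<bar>b\<bar>\<bar>" by (rule order_trans[OF abs_ge_self]) simp
      finally show ?thesis .
    qed
  qed
  show ?thesis using *[of a b] *[of b a] by (cases "b \<le> a") (auto simp: power2_commute[of a b] abs_minus_commute)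
qed

lemma transport_L1_sequentially:
  assumes F: "cyl_measurable F" "\<And>x w. F (x + 2 * pi) w = F x w" "integrable cyl (\<lambda>(x, w). F x w * g w)"
    and k: "\<And>n. cyl_diffeo (k n) (k' n)" "\<And>n x w. k' n x w \<ge> c" and l: "cyl_diffeo l l'" "\<And>x w. l' x w \<ge> c" and c: "c > 0"
    and lim: "\<And>x w. (\<lambda>n. k n x w) \<longlonglongrightarrow> l x w"
  shows "(\<lambda>n. \<integral>(x, w). \<bar>F (k n x w) w - F (l x w) w\<bar> * g w \<partial>cyl) \<longlonglongrightarrow> 0"
proof (rule LIMSEQ_I)
  fix e :: real assume e: "e > 0"
  \<comment> \<open>Composition magnifies the approximation error by at most \<open>1 / c\<close>,
    so it costs \<open>e / 4\<close> for the moving map and \<open>e / 4\<close> for the limit map;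
    the other half of \<open>e\<close> is for the continuous approximant.\<close>
  define d where "d = e * c / 4"
  have d: "d > 0" using e c by (simp add: d_def)
  from cyl_dense[OF F(1,3) d] obtain \<phi> B where \<phi>': "cyl_measurable \<phi>" "\<forall>w. continuous_on UNIV (\<lambda>x. \<phi> x w)"
    "\<forall>x w. \<phi> (x + 2 * pi) w = \<phi> x w" "\<forall>x w. \<bar>\<phi> x w\<bar> \<le> B" "(\<integral>(x, w). \<bar>F x w - \<phi> x w\<bar> * g w \<partial>cyl) < d"
    by (elim exE conjE)
  note \<phi> = \<phi>'(1) \<phi>'(2)[rule_format] \<phi>'(3)[rule_format] \<phi>'(4)[rule_format] \<phi>'(5)
  have gi: "integrable cyl (\<lambda>(x, w). b * g w)" for b using integrable_cyl_snd[of "\<lambda>w. b * g w"] g_int by simp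
  have i\<phi>: "integrable cyl (\<lambda>(x, w). \<phi> x w * g w)" using \<phi>(4) by (intro integrable_weight_bound[OF gi \<phi>(1)]) auto
  have R: "cyl_measurable (\<lambda>x w. F x w - \<phi> x w)" "integrable cyl (\<lambda>(x, w). (F x w - \<phi> x w) * g w)"
    using Bochner_Integration.integrable_diff[OF F(3) i\<phi>]
    by (auto intro!: cyl_measurable_intros F \<phi> simp: case_prod_unfold left_diff_distrib)
  have Rb: "integrable cyl (\<lambda>(x, w). (F (q x w) w - \<phi> (q x w) w) * g w)"
    "(\<integral>(x, w). \<bar>F (q x w) w - \<phi> (q x w) w\<bar> * g w \<partial>cyl) \<le> d / c" if q: "cyl_diffeo q q'" "\<And>x w. q' x w \<ge> c" for q q'
  proof -
    note b = cyl_subst_bound[OF R(1) _ R(2) q(1) c q(2)]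
    show "integrable cyl (\<lambda>(x, w). (F (q x w) w - \<phi> (q x w) w) * g w)" using b(1) F(2) \<phi>(3) by simp
    have "(\<integral>(x, w). \<bar>F (q x w) w - \<phi> (q x w) w\<bar> * g w \<partial>cyl) \<le> 1 / c * (\<integral>(x, w). \<bar>F x w - \<phi> x w\<bar> * g w \<partial>cyl)"
      using b(2) F(2) \<phi>(3) by simp
    also have "\<dots> \<le> 1 / c * d" using \<phi>(5) c by (intro mult_left_mono) auto
    finally show "(\<integral>(x, w). \<bar>F (q x w) w - \<phi> (q x w) w\<bar> * g w \<partial>cyl) \<le> d / c" by simp
  qed
  have ab: "integrable cyl (\<lambda>(x, w). \<bar>r x w\<bar> * g w)" if "integrable cyl (\<lambda>(x, w). r x w * g w)" for r
    using integrable_abs[OF that] g_nonneg by (simp add: case_prod_unfold abs_mult)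
  have km: "cyl_measurable (k n)" "cyl_measurable l" for n using k(1) l(1) by (auto simp: cyl_diffeo_def)
  have m1: "cyl_measurable (\<lambda>x w. \<phi> (k n x w) w - \<phi> (l x w) w)" for n
    by (rule cyl_measurable_diff[OF cyl_measurable_comp[OF \<phi>(1) km(1)] cyl_measurable_comp[OF \<phi>(1) km(2)]])
  have b2: "\<bar>\<phi> (k n x w) w - \<phi> (l x w) w\<bar> \<le> 2 * B" for n x w
    using \<phi>(4)[of "k n x w" w] \<phi>(4)[of "l x w" w] by linarith
  have i1: "integrable cyl (\<lambda>(x, w). \<bar>\<phi> (k n x w) w - \<phi> (l x w) w\<bar> * g w)" for n
    by (rule ab[OF integrable_weight_bound[OF gi m1 b2]])
  have "(\<lambda>n. \<integral>(x, w). \<bar>\<phi> (k n x w) w - \<phi> (l x w) w\<bar> * g w \<partial>cyl) \<longlonglongrightarrow> (\<integral>(x, w). 0 \<partial>cyl)"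
  proof (rule integral_dominated_convergence[where w = "\<lambda>(x, w). 2 * B * g w"])
    show "AE q in cyl. (\<lambda>n. case q of (x, w) \<Rightarrow> \<bar>\<phi> (k n x w) w - \<phi> (l x w) w\<bar> * g w) \<longlonglongrightarrow> (case q of (x, w) \<Rightarrow> 0)"
    proof (rule AE_I2, clarify)
      fix x w
      have "isCont (\<lambda>x. \<phi> x w) (l x w)" using \<phi>(2)[of w] by (simp add: continuous_on_eq_continuous_at)
      from isCont_tendsto_compose[OF this lim]
      have "(\<lambda>n. \<phi> (k n x w) w - \<phi> (l x w) w) \<longlonglongrightarrow> 0" by (simp add: LIM_zero)
      then have "(\<lambda>n. \<bar>\<phi> (k n x w) w - \<phi> (l x w) w\<bar> * g w) \<longlonglongrightarrow> 0"
        by (intro tendsto_mult_left_zero tendsto_rabs_zero)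
      then show "(\<lambda>n. \<bar>\<phi> (k n x w) w - \<phi> (l x w) w\<bar> * g w) \<longlonglongrightarrow> 0" .
    qed
    show "AE q in cyl. norm (case q of (x, w) \<Rightarrow> \<bar>\<phi> (k n x w) w - \<phi> (l x w) w\<bar> * g w) \<le> (case q of (x, w) \<Rightarrow> 2 * B * g w)" for n
      by (rule AE_I2) (auto simp: abs_mult g_nonneg intro!: mult_right_mono b2)
  qed (use i1 gi in auto)
  then have "(\<lambda>n. \<integral>(x, w). \<bar>\<phi> (k n x w) w - \<phi> (l x w) w\<bar> * g w \<partial>cyl) \<longlonglongrightarrow> 0" by (simp add: case_prod_unfold)
  from LIMSEQ_D[OF this, of "e / 2"] e obtain n0 where
    n0: "\<And>n. n \<ge> n0 \<Longrightarrow> \<bar>\<integral>(x, w). \<bar>\<phi> (k n x w) w - \<phi> (l x w) w\<bar> * g w \<partial>cyl\<bar> < e / 2" by auto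
  have "norm ((\<integral>(x, w). \<bar>F (k n x w) w - F (l x w) w\<bar> * g w \<partial>cyl) - 0) < e" if n: "n \<ge> n0" for n
  proof -
    let ?A = "\<lambda>(x, w). \<bar>F (k n x w) w - \<phi> (k n x w) w\<bar> * g w"
    let ?B = "\<lambda>(x, w). \<bar>\<phi> (k n x w) w - \<phi> (l x w) w\<bar> * g w"
    let ?C = "\<lambda>(x, w). \<bar>F (l x w) w - \<phi> (l x w) w\<bar> * g w"
    have iA: "integrable cyl ?A" "integrable cyl ?C" using ab[OF Rb(1)[OF k]] ab[OF Rb(1)[OF l]] by auto
    have pw: "(case q of (x, w) \<Rightarrow> \<bar>F (k n x w) w - F (l x w) w\<bar> * g w) \<le> ?A q + ?B q + ?C q" for q
    proof (cases q)
      case (Pair x w)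
      have "\<bar>F (k n x w) w - F (l x w) w\<bar> \<le> \<bar>F (k n x w) w - \<phi> (k n x w) w\<bar> + \<bar>\<phi> (k n x w) w - \<phi> (l x w) w\<bar> + \<bar>F (l x w) w - \<phi> (l x w) w\<bar>"
        by linarith
      from mult_right_mono[OF this g_nonneg[of w]] show ?thesis by (simp add: Pair distrib_right)
    qed
    have nn: "0 \<le> (case q of (x, w) \<Rightarrow> \<bar>F (k n x w) w - F (l x w) w\<bar> * g w)" for q by (cases q) (simp add: g_nonneg)
    have "(\<integral>(x, w). \<bar>F (k n x w) w - F (l x w) w\<bar> * g w \<partial>cyl) \<le> (\<integral>q. ?A q + ?B q + ?C q \<partial>cyl)"
    proof (rule integral_mono')
      show "integrable cyl (\<lambda>q. ?A q + ?B q + ?C q)"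
        by (rule Bochner_Integration.integrable_add[OF Bochner_Integration.integrable_add[OF iA(1) i1] iA(2)])
      show "0 \<le> ?A q + ?B q + ?C q" for q by (rule order_trans[OF nn pw])
    qed (rule pw)
    also have "\<dots> = (\<integral>q. ?A q \<partial>cyl) + (\<integral>q. ?B q \<partial>cyl) + (\<integral>q. ?C q \<partial>cyl)"
      using Bochner_Integration.integral_add[OF Bochner_Integration.integrable_add[OF iA(1) i1[of n]] iA(2)]
        Bochner_Integration.integral_add[OF iA(1) i1[of n]] by (simp only:)
    also have "\<dots> < d / c + e / 2 + d / c"
      using Rb(2)[OF k, of n] Rb(2)[OF l] n0[OF n] by linarith
    also have "\<dots> = e" using c by (simp add: d_def)
    finally have "(\<integral>(x, w). \<bar>F (k n x w) w - F (l x w) w\<bar> * g w \<partial>cyl) < e" .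
    moreover have "0 \<le> (\<integral>(x, w). \<bar>F (k n x w) w - F (l x w) w\<bar> * g w \<partial>cyl)"
      using nn by (rule Bochner_Integration.integral_nonneg)
    ultimately show ?thesis by simp
  qed
  then show "\<exists>n0. \<forall>n\<ge>n0. norm ((\<integral>(x, w). \<bar>F (k n x w) w - F (l x w) w\<bar> * g w \<partial>cyl) - 0) < e" by blast
qed

text \<open>Both the function and the map move with time. Inserting the time-\<open>s\<close>
  function composed with the time-\<open>t\<close> map separates the two effects: one is dominated
  convergence before composition, the other is transport of a fixed function.\<close>

lemma transport_L2_continuous:
  fixes H k k' :: "real \<Rightarrow> real \<Rightarrow> real \<Rightarrow> real"
  assumes Hm: "\<And>t. t \<in> A \<Longrightarrow> cyl_measurable (H t)" and Hp: "\<And>t x w. t \<in> A \<Longrightarrow> H t (x + 2 * pi) w = H t x w"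
    and Hc: "\<And>x w. ((\<lambda>t. H t x w) \<longlongrightarrow> H s x w) (at s within A)"
    and HE: "\<And>t x w. t \<in> A \<Longrightarrow> x \<in> {0..<2 * pi} \<Longrightarrow> (H t x w)\<^sup>2 \<le> E x w"
    and E: "integrable cyl (\<lambda>(x, w). E x w * g w)"
    and k: "\<And>t. t \<in> A \<Longrightarrow> cyl_diffeo (k t) (k' t)" "\<And>t x w. t \<in> A \<Longrightarrow> k' t x w \<ge> c" "c > 0"
    and kc: "\<And>x w. ((\<lambda>t. k t x w) \<longlongrightarrow> k s x w) (at s within A)" and s: "s \<in> A"
  shows "((\<lambda>t. L2g_norm g (\<lambda>x w. H t (k t x w) w - H s (k s x w) w)) \<longlongrightarrow> 0) (at s within A)"
  unfolding tendsto_at_iff_sequentially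
proof (intro allI impI)
  fix r :: "nat \<Rightarrow> real" assume r: "\<forall>i. r i \<in> A - {s}" and rl: "r \<longlonglongrightarrow> s"
  have rA: "r n \<in> A" for n using r by auto
  \<comment> \<open>The signed square: square integrability of \<open>H\<close> is integrability of
    \<open>G\<close>, and \<open>square_diff_le\<close> brings the estimate for \<open>G\<close>
    back to \<open>H\<close>.\<close>
  define G where "G t x w = H t x w * \<bar>H t x w\<bar>" for t x w
  have Gm: "cyl_measurable (G t)" if "t \<in> A" for t
    unfolding G_def[abs_def] by (intro cyl_measurable_intros Hm that)
  have Gp: "G t (x + 2 * pi) w = G t x w" if "t \<in> A" for t x w by (simp add: G_def Hp that)
  have GE: "\<bar>G t x w\<bar> \<le> E x w" if "t \<in> A" "x \<in> {0..<2 * pi}" for t x w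
    using HE[OF that, of w] by (simp add: G_def abs_mult power2_eq_square)
  have Gi: "integrable cyl (\<lambda>(x, w). G t x w * g w)" if "t \<in> A" for t
    by (rule integrable_weight_bound[OF E Gm[OF that] GE[OF that]])
  have ab: "integrable cyl (\<lambda>(x, w). \<bar>q x w\<bar> * g w)" if "integrable cyl (\<lambda>(x, w). q x w * g w)" for q
    using integrable_abs[OF that] g_nonneg by (simp add: case_prod_unfold abs_mult)
  have Di: "integrable cyl (\<lambda>(x, w). (G (r n) x w - G s x w) * g w)" for n
    using Bochner_Integration.integrable_diff[OF Gi[OF rA[of n]] Gi[OF s]] by (simp add: case_prod_unfold left_diff_distrib)
  have Dm: "cyl_measurable (\<lambda>x w. G (r n) x w - G s x w)" for n by (intro cyl_measurable_intros Gm rA s)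
  have "(\<lambda>n. \<integral>(x, w). \<bar>G (r n) x w - G s x w\<bar> * g w \<partial>cyl) \<longlonglongrightarrow> (\<integral>(x, w). 0 \<partial>cyl)"
  proof (rule integral_dominated_convergence[where w = "\<lambda>(x, w). 2 * (E x w * g w)"])
    show "integrable cyl (\<lambda>(x, w). 2 * (E x w * g w))" using integrable_mult_right[OF E, of 2] by (simp add: case_prod_unfold)
    show "AE q in cyl. (\<lambda>n. case q of (x, w) \<Rightarrow> \<bar>G (r n) x w - G s x w\<bar> * g w) \<longlonglongrightarrow> (case q of (x, w) \<Rightarrow> 0)"
    proof (rule AE_I2, clarify)
      fix x w
      have "(\<lambda>n. H (r n) x w) \<longlonglongrightarrow> H s x w"
        using Hc[of x w] r rl unfolding tendsto_at_iff_sequentially o_def by blast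
      then have "(\<lambda>n. G (r n) x w) \<longlonglongrightarrow> G s x w" unfolding G_def by (intro tendsto_intros)
      then show "(\<lambda>n. \<bar>G (r n) x w - G s x w\<bar> * g w) \<longlonglongrightarrow> 0"
        by (intro tendsto_mult_left_zero tendsto_rabs_zero) (simp add: LIM_zero)
    qed
    fix n
    have "AE q in cyl. case q of (x, w) \<Rightarrow> norm (\<bar>G (r n) x w - G s x w\<bar> * g w) \<le> 2 * (E x w * g w)"
    proof (rule AE_cyl_I)
      fix x w :: real assume x: "x \<in> {0..<2 * pi}"
      have "\<bar>G (r n) x w - G s x w\<bar> \<le> 2 * E x w" using GE[OF rA x, of n w] GE[OF s x, of w] by linarith
      from mult_right_mono[OF this g_nonneg[of w]]
      show "norm (\<bar>G (r n) x w - G s x w\<bar> * g w) \<le> 2 * (E x w * g w)" using g_nonneg[of w] by (simp add: abs_mult)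
    qed
    then show "AE q in cyl. norm (case q of (x, w) \<Rightarrow> \<bar>G (r n) x w - G s x w\<bar> * g w) \<le> (case q of (x, w) \<Rightarrow> 2 * (E x w * g w))"
      by (simp add: case_prod_unfold)
  qed (use ab[OF Di] in auto)
  then have I1: "(\<lambda>n. \<integral>(x, w). \<bar>G (r n) x w - G s x w\<bar> * g w \<partial>cyl) \<longlonglongrightarrow> 0" by (simp add: case_prod_unfold)
  have I2: "(\<lambda>n. \<integral>(x, w). \<bar>G s (k (r n) x w) w - G s (k s x w) w\<bar> * g w \<partial>cyl) \<longlonglongrightarrow> 0"
  proof (rule transport_L1_sequentially[OF Gm[OF s] Gp[OF s] Gi[OF s] k(1)[OF rA] k(2)[OF rA] k(1)[OF s] k(2)[OF s] k(3)])
    show "(\<lambda>n. k (r n) x w) \<longlonglongrightarrow> k s x w" for x w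
      using kc[of x w] r rl unfolding tendsto_at_iff_sequentially o_def by blast
  qed
  have km: "cyl_measurable (k t)" if "t \<in> A" for t using k(1)[OF that] by (auto simp: cyl_diffeo_def)
  have lim: "(\<lambda>n. 2 * (1 / c * (\<integral>(x, w). \<bar>G (r n) x w - G s x w\<bar> * g w \<partial>cyl)
      + (\<integral>(x, w). \<bar>G s (k (r n) x w) w - G s (k s x w) w\<bar> * g w \<partial>cyl))) \<longlonglongrightarrow> 2 * (1 / c * 0 + 0)"
    by (intro tendsto_intros I1 I2)
  have le: "(\<integral>(x, w). (H (r n) (k (r n) x w) w - H s (k s x w) w)\<^sup>2 * g w \<partial>cyl)
      \<le> 2 * (1 / c * (\<integral>(x, w). \<bar>G (r n) x w - G s x w\<bar> * g w \<partial>cyl)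
      + (\<integral>(x, w). \<bar>G s (k (r n) x w) w - G s (k s x w) w\<bar> * g w \<partial>cyl))" for n
  proof -
    note b = cyl_subst_bound[OF Dm _ Di k(1)[OF rA[of n]] k(3) k(2)[OF rA[of n]], of n]
    have b1: "integrable cyl (\<lambda>(x, w). \<bar>G (r n) (k (r n) x w) w - G s (k (r n) x w) w\<bar> * g w)"
      using ab[OF b(1)] Gp[OF rA] Gp[OF s] by simp
    have b2: "(\<integral>(x, w). \<bar>G (r n) (k (r n) x w) w - G s (k (r n) x w) w\<bar> * g w \<partial>cyl) \<le> 1 / c * (\<integral>(x, w). \<bar>G (r n) x w - G s x w\<bar> * g w \<partial>cyl)"
      using b(2) Gp[OF rA] Gp[OF s] by simp
    have c1: "integrable cyl (\<lambda>(x, w). G s (k t x w) w * g w)" if "t \<in> A" for t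
      by (rule cyl_subst_bound(1)[OF Gm[OF s] Gp[OF s] Gi[OF s] k(1)[OF that] k(3) k(2)[OF that]])
    have c2: "integrable cyl (\<lambda>(x, w). \<bar>G s (k (r n) x w) w - G s (k s x w) w\<bar> * g w)"
      using ab[of "\<lambda>x w. G s (k (r n) x w) w - G s (k s x w) w"] Bochner_Integration.integrable_diff[OF c1[OF rA[of n]] c1[OF s]]
      by (simp add: case_prod_unfold left_diff_distrib)
    let ?A = "\<lambda>(x, w). \<bar>G (r n) (k (r n) x w) w - G s (k (r n) x w) w\<bar> * g w"
    let ?B = "\<lambda>(x, w). \<bar>G s (k (r n) x w) w - G s (k s x w) w\<bar> * g w"
    have tri: "2 * \<bar>p - r\<bar> \<le> 2 * (\<bar>p - q\<bar> + \<bar>q - r\<bar>)" for p q r :: real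
      using abs_triangle_ineq[of "p - q" "q - r"] by simp
    have pw: "(case q of (x, w) \<Rightarrow> (H (r n) (k (r n) x w) w - H s (k s x w) w)\<^sup>2 * g w) \<le> 2 * (?A q + ?B q)" for q
    proof (cases q)
      case (Pair x w)
      have "(H (r n) (k (r n) x w) w - H s (k s x w) w)\<^sup>2 \<le> 2 * \<bar>G (r n) (k (r n) x w) w - G s (k s x w) w\<bar>"
        unfolding G_def by (rule square_diff_le)
      also have "\<dots> \<le> 2 * (\<bar>G (r n) (k (r n) x w) w - G s (k (r n) x w) w\<bar> + \<bar>G s (k (r n) x w) w - G s (k s x w) w\<bar>)"
        by (rule tri)
      finally have "(H (r n) (k (r n) x w) w - H s (k s x w) w)\<^sup>2
        \<le> 2 * (\<bar>G (r n) (k (r n) x w) w - G s (k (r n) x w) w\<bar> + \<bar>G s (k (r n) x w) w - G s (k s x w) w\<bar>)" .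
      from mult_right_mono[OF this g_nonneg[of w]] show ?thesis by (simp add: Pair distrib_right)
    qed
    have "(\<integral>(x, w). (H (r n) (k (r n) x w) w - H s (k s x w) w)\<^sup>2 * g w \<partial>cyl) \<le> (\<integral>q. 2 * (?A q + ?B q) \<partial>cyl)"
    proof (rule integral_mono')
      show "integrable cyl (\<lambda>q. 2 * (?A q + ?B q))" by (intro integrable_mult_right Bochner_Integration.integrable_add b1 c2)
      have "0 \<le> (case q of (x, w) \<Rightarrow> (H (r n) (k (r n) x w) w - H s (k s x w) w)\<^sup>2 * g w)" for q by (cases q) (simp add: g_nonneg)
      then show "0 \<le> 2 * (?A q + ?B q)" for q by (rule order_trans[OF _ pw])
    qed (rule pw)
    also have "\<dots> = 2 * ((\<integral>q. ?A q \<partial>cyl) + (\<integral>q. ?B q \<partial>cyl))"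
      using b1 c2 by (simp add: Bochner_Integration.integral_add)
    also have "\<dots> \<le> 2 * (1 / c * (\<integral>(x, w). \<bar>G (r n) x w - G s x w\<bar> * g w \<partial>cyl)
        + (\<integral>(x, w). \<bar>G s (k (r n) x w) w - G s (k s x w) w\<bar> * g w \<partial>cyl))"
      using b2 by (intro mult_left_mono add_mono order_refl) auto
    finally show ?thesis .
  qed
  have "(\<lambda>n. \<integral>(x, w). (H (r n) (k (r n) x w) w - H s (k s x w) w)\<^sup>2 * g w \<partial>cyl) \<longlonglongrightarrow> 0"
  proof (rule tendsto_sandwich[OF _ _ tendsto_const])
    show "\<forall>\<^sub>F n in sequentially. 0 \<le> (\<integral>(x, w). (H (r n) (k (r n) x w) w - H s (k s x w) w)\<^sup>2 * g w \<partial>cyl)"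
      by (intro always_eventually allI Bochner_Integration.integral_nonneg) (auto simp: g_nonneg)
    show "\<forall>\<^sub>F n in sequentially. (\<integral>(x, w). (H (r n) (k (r n) x w) w - H s (k s x w) w)\<^sup>2 * g w \<partial>cyl)
      \<le> 2 * (1 / c * (\<integral>(x, w). \<bar>G (r n) x w - G s x w\<bar> * g w \<partial>cyl)
      + (\<integral>(x, w). \<bar>G s (k (r n) x w) w - G s (k s x w) w\<bar> * g w \<partial>cyl))"
      by (intro always_eventually allI le)
  qed (use lim in simp)
  from tendsto_real_sqrt[OF this]
  show "((\<lambda>t. L2g_norm g (\<lambda>x w. H t (k t x w) w - H s (k s x w) w)) \<circ> r) \<longlonglongrightarrow> 0"
    by (simp add: L2g_norm_def o_def)
qed

end

section \<open>The mean field\<close>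

text \<open>By parts, the integral of \<open>f1^4\<close> is that of
  \<open>- 3 * f * f1^2 * f2\<close>. Young's inequality bounds the integrand by
  \<open>f1^4 / 2 + 9 / 2 * M^2 * f2^2\<close>, and absorbing the first term doubles
  \<open>9 / 2\<close> to 9.\<close>

lemma gagliardo_nirenberg_1d:
  fixes f f1 f2 :: "real \<Rightarrow> real"
  assumes d: "\<And>x. (f has_real_derivative f1 x) (at x)" and a1: "ac f1 f2"
    and per: "f (2 * pi) = f 0" "f1 (2 * pi) = f1 0" and M: "\<And>x. \<bar>f x\<bar> \<le> M"
    and i2: "set_integrable lborel {0..2 * pi} (\<lambda>x. (f2 x)\<^sup>2)"
  shows "(LINT x:{0..2 * pi}|lborel. (f1 x) ^ 4) \<le> 9 * M\<^sup>2 * (LINT x:{0..2 * pi}|lborel. (f2 x)\<^sup>2)"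
proof -
  have c1: "continuous_on UNIV f1" by (rule ac_continuous[OF a1])
  have af: "ac f f1" by (rule ac_C1[OF d c1])
  have a3: "ac (\<lambda>x. f1 x * f1 x * f1 x) (\<lambda>x. (f2 x * f1 x + f1 x * f2 x) * f1 x + f1 x * f1 x * f2 x)"
    by (intro ac_mult a1)
  let ?D = "\<lambda>x. (f2 x * f1 x + f1 x * f2 x) * f1 x + f1 x * f1 x * f2 x"
  note ibp = ac_ibp[OF a3 af, of "2 * pi" 0]
  have e: "(LINT x:{0..2 * pi}|lborel. (f1 x) ^ 4) = (LINT x:{0..2 * pi}|lborel. - (?D x * f x))"
  proof -
    have "(LINT x:{0..2 * pi}|lborel. (f1 x) ^ 4) = (LINT x:{0..2 * pi}|lborel. f1 x * f1 x * f1 x * f1 x)"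
      by (simp add: power4_eq_xxxx)
    then show ?thesis using ibp(1) per by (simp add: set_lebesgue_integral_def)
  qed
  have i4: "set_integrable lborel {0..2 * pi} (\<lambda>x. (f1 x) ^ 4)"
    by (rule borel_integrable_atLeastAtMost') (intro continuous_intros continuous_on_subset[OF c1], simp)
  have i5: "set_integrable lborel {0..2 * pi} (\<lambda>x. (f1 x) ^ 4 / 2 + 9 / 2 * M\<^sup>2 * (f2 x)\<^sup>2)"
    using i4 i2 by (intro set_integral_add set_integrable_divide set_integrable_mult_right) auto
  have "(LINT x:{0..2 * pi}|lborel. - (?D x * f x)) \<le> (LINT x:{0..2 * pi}|lborel. (f1 x) ^ 4 / 2 + 9 / 2 * M\<^sup>2 * (f2 x)\<^sup>2)"
  proof (rule set_integral_mono[OF _ i5])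
    show "set_integrable lborel {0..2 * pi} (\<lambda>x. - (?D x * f x))" using ibp(3) per by (simp add: set_integrable_def)
    fix x
    have "- (?D x * f x) = - (3 * (f1 x)\<^sup>2 * f2 x * f x)" by (simp add: power2_eq_square algebra_simps)
    also have "\<dots> \<le> \<bar>3 * (f1 x)\<^sup>2 * f2 x * f x\<bar>" by (rule order_trans[OF abs_ge_minus_self order_refl])
    also have "\<dots> = 3 * (f1 x)\<^sup>2 * \<bar>f2 x\<bar> * \<bar>f x\<bar>" by (simp add: abs_mult)
    also have "\<dots> \<le> 3 * (f1 x)\<^sup>2 * \<bar>f2 x\<bar> * M" by (intro mult_left_mono M) auto
    also have "\<dots> \<le> (f1 x) ^ 4 / 2 + 9 / 2 * M\<^sup>2 * (f2 x)\<^sup>2"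
    proof -
      have "0 \<le> ((f1 x)\<^sup>2 - 3 * M * \<bar>f2 x\<bar>)\<^sup>2" by simp
      also have "\<dots> = (f1 x) ^ 4 - 6 * M * (f1 x)\<^sup>2 * \<bar>f2 x\<bar> + 9 * M\<^sup>2 * (f2 x)\<^sup>2"
        by (simp add: power2_diff power_mult_distrib power_mult[symmetric])
      finally show ?thesis by (simp add: algebra_simps)
    qed
    finally show "- (?D x * f x) \<le> (f1 x) ^ 4 / 2 + 9 / 2 * M\<^sup>2 * (f2 x)\<^sup>2" .
  qed
  also have "\<dots> = (LINT x:{0..2 * pi}|lborel. (f1 x) ^ 4) / 2 + 9 / 2 * M\<^sup>2 * (LINT x:{0..2 * pi}|lborel. (f2 x)\<^sup>2)"
  proof -
    have "set_integrable lborel {0..2 * pi} (\<lambda>x. (f1 x) ^ 4 / 2)" "set_integrable lborel {0..2 * pi} (\<lambda>x. 9 / 2 * M\<^sup>2 * (f2 x)\<^sup>2)"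
      using i4 i2 by (auto intro: set_integrable_divide set_integrable_mult_right)
    from set_integral_add(2)[OF this] show ?thesis by simp
  qed
  finally show ?thesis using e by linarith
qed

lemma norm_cis_diff: "norm (cis a - cis b) \<le> \<bar>a - b\<bar>"
proof -
  have "(norm (cis a - cis b))\<^sup>2 = (cos a - cos b)\<^sup>2 + (sin a - sin b)\<^sup>2"
    by (simp add: cmod_power2)
  also have "\<dots> = 2 - 2 * cos (a - b)"
    unfolding cos_diff power2_diff using sin_cos_squared_add[of a] sin_cos_squared_add[of b] by algebra
  also have "cos (a - b) = 1 - 2 * (sin ((a - b) / 2))\<^sup>2" using cos_double_sin[of "(a - b) / 2"] by (simp only: mult_2 field_sum_of_halves)
  also have "2 - 2 * (1 - 2 * (sin ((a - b) / 2))\<^sup>2) = (2 * \<bar>sin ((a - b) / 2)\<bar>)\<^sup>2" by (simp add: power_mult_distrib)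
  also have "\<dots> \<le> \<bar>a - b\<bar>\<^sup>2"
    using abs_sin_x_le_abs_x[of "(a - b) / 2"] by (intro power_mono) auto
  finally show ?thesis by (rule power2_le_imp_le) simp
qed

text \<open>The derivative is a limit of difference quotients along the countable sequence of
  increments \<open>1 / Suc n\<close>, each of which is measurable.\<close>

lemma dtheta_measurable:
  assumes f: "cyl_measurable f" and d: "\<And>x w. ((\<lambda>x. f x w) has_real_derivative dtheta f x w) (at x)"
  shows "cyl_measurable (dtheta f)"
proof -
  have L: "(\<lambda>n. (f (x + 1 / real (Suc n)) w - f x w) / (1 / real (Suc n))) \<longlonglongrightarrow> dtheta f x w" for x w
  proof -
    have "((\<lambda>h. (f (x + h) w - f x w) / h) \<longlongrightarrow> dtheta f x w) (at 0)" using d[of w x] by (simp add: DERIV_def)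
    moreover have "filterlim (\<lambda>n. 1 / real (Suc n)) (at 0) sequentially"
      using LIMSEQ_inverse_real_of_nat by (auto simp: filterlim_at inverse_eq_divide)
    ultimately show ?thesis by (rule filterlim_compose)
  qed
  have "cyl_measurable (\<lambda>x w. (f (x + 1 / real (Suc n)) w - f x w) / (1 / real (Suc n)))" for n
    by (rule cyl_measurable_divide[OF cyl_measurable_diff[OF cyl_measurable_comp[OF f cyl_measurable_fst[of "\<lambda>x. x + 1 / real (Suc n)"]] f] cyl_measurable_const]) simp
  then show ?thesis
    unfolding cyl_measurable_def case_prod_unfold by (rule borel_measurable_LIMSEQ_real[OF L])
qed

lemma theta_C_deriv:
  assumes "theta_C k f" "j < k"
  shows "((\<lambda>x. (dtheta ^^ j) f x w) has_real_derivative (dtheta ^^ Suc j) f x w) (at x)"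
proof -
  have "(\<lambda>x. (dtheta ^^ j) f x w) differentiable (at x)" using assms by (simp add: theta_C_def)
  then show ?thesis by (simp add: dtheta_def DERIV_deriv_iff_real_differentiable)
qed

lemma theta_C_smooth_chain:
  assumes C: "theta_C k f" and per: "theta_periodic f" and j: "j \<le> k"
  shows "smooth_chain j (\<lambda>i x. (dtheta ^^ i) f x w)"
    "(dtheta ^^ j) f (x + 2 * pi) w = (dtheta ^^ j) f x w" "continuous_on UNIV (\<lambda>x. (dtheta ^^ j) f x w)"
proof -
  have P: "(dtheta ^^ i) f (x + 2 * pi) w = (dtheta ^^ i) f x w" if "i \<le> k" for i x
    using that
  proof (induction i arbitrary: x)
    case 0 then show ?case using per by (simp add: theta_periodic_def)
  next
    case (Suc i)
    show ?case by (rule DERIV_periodic[OF theta_C_deriv[OF C], where b = 0]) (use Suc in auto)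
  qed
  show "(dtheta ^^ j) f (x + 2 * pi) w = (dtheta ^^ j) f x w" by (rule P[OF j])
  have c: "continuous_on UNIV (\<lambda>x. (dtheta ^^ i) f x w)" if "i \<le> k" for i
  proof (cases "i = k")
    case True then show ?thesis using C by (simp add: theta_C_def)
  next
    case False
    then show ?thesis using theta_C_deriv[OF C, of i w] that
      by (intro continuous_at_imp_continuous_on ballI DERIV_isCont) auto
  qed
  show "continuous_on UNIV (\<lambda>x. (dtheta ^^ j) f x w)" by (rule c[OF j])
  show "smooth_chain j (\<lambda>i x. (dtheta ^^ i) f x w)"
    using j P[of _ 0] by (auto intro!: ac_C1 theta_C_deriv[OF C] c simp del: funpow.simps)
qed

lemma measurable_of_par:
  assumes F: "cont2 F" and t: "t \<ge> 0"
    and q: "cyl_measurable q1" "cyl_measurable q2" "cyl_measurable q3" "cyl_measurable q4" "cyl_measurable q5"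
  shows "cyl_measurable (\<lambda>x w. F (q1 x w, q2 x w, q3 x w, q4 x w, q5 x w :: real) t)"
proof -
  have "continuous_on UNIV (\<lambda>p. (\<lambda>(p, t). F p t) (p, t))"
    by (rule continuous_on_compose2[OF F]) (use t in \<open>auto intro!: continuous_intros\<close>)
  then have [measurable]: "(\<lambda>p. F p t) \<in> borel_measurable borel" by (simp add: borel_measurable_continuous_onI)
  have "(\<lambda>p. (q1 (fst p) (snd p), q2 (fst p) (snd p), q3 (fst p) (snd p), q4 (fst p) (snd p), q5 (fst p) (snd p)))
      \<in> borel \<rightarrow>\<^sub>M borel \<Otimes>\<^sub>M (borel \<Otimes>\<^sub>M (borel \<Otimes>\<^sub>M (borel \<Otimes>\<^sub>M borel)))"
    using q unfolding cyl_measurable_def case_prod_unfold by (intro measurable_Pair)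
  then have "(\<lambda>p. (q1 (fst p) (snd p), q2 (fst p) (snd p), q3 (fst p) (snd p), q4 (fst p) (snd p), q5 (fst p) (snd p)))
      \<in> borel \<rightarrow>\<^sub>M borel" by (simp add: borel_prod)
  from measurable_compose[OF this, of "\<lambda>p. F p t" borel] show ?thesis
    unfolding cyl_measurable_def case_prod_unfold by simp
qed

context weight
begin

lemma integrable_const_weight: "integrable cyl (\<lambda>(x, w). C * g w)"
  using integrable_cyl_snd[of "\<lambda>w. C * g w"] g_int by simp

lemma integrable_bounded_weight:
  assumes "cyl_measurable F" "\<And>x w. \<bar>F x w\<bar> \<le> C"
  shows "integrable cyl (\<lambda>(x, w). F x w * g w)"
  by (rule integrable_weight_bound[OF integrable_const_weight assms])

text \<open>Tonelli for a nonnegative function: an estimate of slice integrals, needed only where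
  the weight is nonzero, yields integrability on the cylinder.\<close>

lemma integrable_by_slices:
  assumes f: "cyl_measurable f" "\<And>x w. f x w \<ge> 0" and h: "integrable cyl (\<lambda>(x, w). h x w * g w)"
    and fi: "\<And>w. set_integrable lborel {0..2 * pi} (\<lambda>x. f x w)" and C: "C \<ge> 0"
    and le: "AE w in lborel. g w \<noteq> 0 \<longrightarrow> (LINT x:{0..2 * pi}|lborel. f x w) \<le> C * (LINT x:{0..2 * pi}|lborel. h x w)"
  shows "integrable cyl (\<lambda>(x, w). f x w * g w)"
proof (rule integrableI_bounded)
  show m: "(\<lambda>(x, w). f x w * g w) \<in> borel_measurable cyl" by (rule cyl_weight_measurable[OF f(1)])
  have "(\<lambda>p. ennreal (norm (case p of (x, w) \<Rightarrow> f x w * g w))) \<in> borel_measurable cyl" using m by measurable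
  from cyl.nn_integral_snd[of "\<lambda>p. ennreal (norm (case p of (x, w) \<Rightarrow> f x w * g w))", folded cyl_def, OF this]
  have "(\<integral>\<^sup>+p. ennreal (norm (case p of (x, w) \<Rightarrow> f x w * g w)) \<partial>cyl) = (\<integral>\<^sup>+w. (\<integral>\<^sup>+x. ennreal (f x w * g w) \<partial>torus) \<partial>lborel)"
    using g_nonneg f(2) by (simp add: abs_mult)
  also have "\<dots> = (\<integral>\<^sup>+w. ennreal ((LINT x:{0..2 * pi}|lborel. f x w) * g w) \<partial>lborel)"
  proof (rule nn_integral_cong)
    fix w
    have "(\<integral>\<^sup>+x. ennreal (f x w * g w) \<partial>torus) = ennreal (\<integral>x. f x w * g w \<partial>torus)"
      using fi[of w] f(2) g_nonneg by (intro nn_integral_eq_integral) (auto simp: integrable_torus[symmetric])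
    then show "(\<integral>\<^sup>+x. ennreal (f x w * g w) \<partial>torus) = ennreal ((LINT x:{0..2 * pi}|lborel. f x w) * g w)"
      by (simp add: lint_torus[symmetric])
  qed
  also have "\<dots> \<le> (\<integral>\<^sup>+w. ennreal (norm (C * (\<integral>x. h x w * g w \<partial>torus))) \<partial>lborel)"
  proof (rule nn_integral_mono_AE, use le in eventually_elim)
    fix w assume l: "g w \<noteq> 0 \<longrightarrow> (LINT x:{0..2 * pi}|lborel. f x w) \<le> C * (LINT x:{0..2 * pi}|lborel. h x w)"
    show "ennreal ((LINT x:{0..2 * pi}|lborel. f x w) * g w) \<le> ennreal (norm (C * (\<integral>x. h x w * g w \<partial>torus)))"
    proof (cases "g w = 0")
      case False
      with l have "(LINT x:{0..2 * pi}|lborel. f x w) * g w \<le> C * (LINT x:{0..2 * pi}|lborel. h x w) * g w"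
        using g_nonneg by (intro mult_right_mono) auto
      also have "\<dots> = C * (\<integral>x. h x w * g w \<partial>torus)" by (simp add: lint_torus)
      finally show ?thesis by (intro ennreal_leI) (auto intro: order_trans[OF _ abs_ge_self])
    qed simp
  qed
  also have "\<dots> < \<infinity>"
    by (rule integrable_mult_right[OF cyl_Fubini(2)[OF h], of C, unfolded integrable_iff_bounded, THEN conjunct2])
  finally show "(\<integral>\<^sup>+p. ennreal (norm (case p of (x, w) \<Rightarrow> f x w * g w)) \<partial>cyl) < \<infinity>" .
qed

end

lemma weak_dtheta_L2g: "weak_dtheta g k f h \<Longrightarrow> f \<in> L2g g" "weak_dtheta g k f h \<Longrightarrow> h \<in> L2g g"
  by (auto simp: weak_dtheta_def)

locale kdata = weight g for g +
  fixes m K :: real and rho0 u0 :: "real \<Rightarrow> real \<Rightarrow> real"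
  assumes m: "m > 0" and K: "K > 0"
    and g_mass: "(\<integral>w. g w \<partial>lborel) = 1"
    and g_moment: "integrable lborel (\<lambda>w. w\<^sup>2 * g w)"
    and data: "(rho0, u0) \<in> state_space g"
    and mass: "\<And>w. (\<integral>x. rho0 x w \<partial>torus) = 1"
    and pos: "\<And>x w. rho0 x w > 0"
begin

definition u1 where "u1 = dtheta u0"
definition u2 where "u2 = dtheta u1"
definition r1 where "r1 = dtheta rho0"
text \<open>A weak third derivative of \<open>u0\<close>, extended periodically from one period,
  because composition with the flow leaves the period on which it is determined. The same is done
  for the second derivative of \<open>rho0\<close> in \<open>r2\<close>.\<close>

definition h3 where "h3 = (\<lambda>x w. (SOME h. weak_dtheta g 3 u0 h) (wrap x) w)"
definition r2 where "r2 = (\<lambda>x w. (SOME h. weak_dtheta g 2 rho0 h) (wrap x) w)"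

lemma u0_Hg: "theta_periodic u0" "cyl_measurable u0" "theta_C 2 u0" "\<exists>h. weak_dtheta g 3 u0 h"
  and rho0_Hg: "theta_periodic rho0" "cyl_measurable rho0" "theta_C 1 rho0" "\<exists>h. weak_dtheta g 2 rho0 h"
  and u1_Linf: "u1 \<in> Linf" and rho0_Linf: "rho0 \<in> Linf"
  using data by (auto simp: state_space_def Hg_def u1_def)

lemma u0_deriv: "((\<lambda>x. u0 x w) has_real_derivative u1 x w) (at x)"
  and u1_deriv: "((\<lambda>x. u1 x w) has_real_derivative u2 x w) (at x)"
  and u2_cont: "continuous_on UNIV (\<lambda>x. u2 x w)"
  and rho0_deriv: "((\<lambda>x. rho0 x w) has_real_derivative r1 x w) (at x)"
  and r1_cont: "continuous_on UNIV (\<lambda>x. r1 x w)"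
  using theta_C_deriv[OF u0_Hg(3), of 0] theta_C_deriv[OF u0_Hg(3), of 1] theta_C_smooth_chain(3)[OF u0_Hg(3,1), of 2]
    theta_C_deriv[OF rho0_Hg(3), of 0] theta_C_smooth_chain(3)[OF rho0_Hg(3,1), of 1]
  by (simp_all add: u1_def u2_def r1_def numeral_2_eq_2)

lemma data_periodic: "u0 (x + 2 * pi) w = u0 x w" "u1 (x + 2 * pi) w = u1 x w" "u2 (x + 2 * pi) w = u2 x w"
  "rho0 (x + 2 * pi) w = rho0 x w" "r1 (x + 2 * pi) w = r1 x w" "h3 (x + 2 * pi) w = h3 x w" "r2 (x + 2 * pi) w = r2 x w"
  using theta_C_smooth_chain(2)[OF u0_Hg(3,1), of 0] theta_C_smooth_chain(2)[OF u0_Hg(3,1), of 1] theta_C_smooth_chain(2)[OF u0_Hg(3,1), of 2]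
    theta_C_smooth_chain(2)[OF rho0_Hg(3,1), of 0] theta_C_smooth_chain(2)[OF rho0_Hg(3,1), of 1]
  by (simp_all add: u1_def u2_def r1_def numeral_2_eq_2 h3_def r2_def wrap_periodic)

lemma weak_u0: "weak_dtheta g 3 u0 (SOME h. weak_dtheta g 3 u0 h)"
  and weak_rho0: "weak_dtheta g 2 rho0 (SOME h. weak_dtheta g 2 rho0 h)"
  using someI_ex[OF u0_Hg(4)] someI_ex[OF rho0_Hg(4)] by auto

lemma L2g_wrap: "f \<in> L2g g \<Longrightarrow> (\<lambda>x w. f (wrap x) w) \<in> L2g g"
proof (rule L2g_I)
  assume f: "f \<in> L2g g"
  show "cyl_measurable (\<lambda>x w. f (wrap x) w)"
    by (rule cyl_measurable_comp[OF L2g_measurable[OF f] cyl_measurable_fst[OF wrap_measurable]])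
  show "integrable cyl (\<lambda>(x, w). (f x w)\<^sup>2 * g w)" by (rule L2g_integrable[OF f])
qed (simp add: wrap_id)

lemma h3_L2g: "h3 \<in> L2g g" and r2_L2g: "r2 \<in> L2g g" and u0_L2g: "u0 \<in> L2g g"
proof -
  show "h3 \<in> L2g g" unfolding h3_def by (rule L2g_wrap[OF weak_dtheta_L2g(2)[OF weak_u0]])
  show "r2 \<in> L2g g" unfolding r2_def by (rule L2g_wrap[OF weak_dtheta_L2g(2)[OF weak_rho0]])
  show "u0 \<in> L2g g" by (rule weak_dtheta_L2g(1)[OF weak_u0])
qed

text \<open>The bridge from the Sobolev hypothesis to the densities used along characteristics; only
  this last order is weak, the orders below are classical by \<open>theta_C\<close>.\<close>

lemma ac_u2: "AE w in lborel. g w \<noteq> 0 \<longrightarrow> ac (\<lambda>x. u2 x w) (\<lambda>x. h3 x w)"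
  and ac_r1: "AE w in lborel. g w \<noteq> 0 \<longrightarrow> ac (\<lambda>x. r1 x w) (\<lambda>x. r2 x w)"
proof -
  have "weak_dtheta g (Suc 2) u0 (SOME h. weak_dtheta g 3 u0 h)" using weak_u0 by simp
  from weak_dtheta_ac[OF this, of "\<lambda>i. (dtheta ^^ i) u0"] theta_C_smooth_chain[OF u0_Hg(3,1), of 2]
  show "AE w in lborel. g w \<noteq> 0 \<longrightarrow> ac (\<lambda>x. u2 x w) (\<lambda>x. h3 x w)"
    by (simp add: h3_def u1_def u2_def numeral_2_eq_2 del: smooth_chain.simps)
  have "weak_dtheta g (Suc 1) rho0 (SOME h. weak_dtheta g 2 rho0 h)" using weak_rho0 by (simp add: numeral_2_eq_2)
  from weak_dtheta_ac[OF this, of "\<lambda>i. (dtheta ^^ i) rho0"] theta_C_smooth_chain[OF rho0_Hg(3,1), of 1]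
  show "AE w in lborel. g w \<noteq> 0 \<longrightarrow> ac (\<lambda>x. r1 x w) (\<lambda>x. r2 x w)"
    by (simp add: r2_def r1_def del: smooth_chain.simps)
qed

lemma data_measurable: "cyl_measurable u0" "cyl_measurable u1" "cyl_measurable u2" "cyl_measurable rho0" "cyl_measurable r1"
  "cyl_measurable h3" "cyl_measurable r2"
proof -
  show u0: "cyl_measurable u0" by (rule u0_Hg)
  show u1: "cyl_measurable u1" using dtheta_measurable[OF u0] u0_deriv by (simp add: u1_def)
  show u2: "cyl_measurable u2" using dtheta_measurable[OF u1] u1_deriv by (simp add: u2_def)
  show r0: "cyl_measurable rho0" by (rule rho0_Hg)
  show "cyl_measurable r1" using dtheta_measurable[OF r0] rho0_deriv by (simp add: r1_def)
  show "cyl_measurable h3" "cyl_measurable r2" using h3_L2g r2_L2g by (auto intro: L2g_measurable)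
qed

definition M :: real where "M = (SOME M. M \<ge> 1 \<and> (\<forall>x w. \<bar>u1 x w\<bar> \<le> M) \<and> (\<forall>x w. \<bar>rho0 x w\<bar> \<le> M))"

lemma M: "M \<ge> 1" "\<bar>u1 x w\<bar> \<le> M" "\<bar>rho0 x w\<bar> \<le> M"
proof -
  obtain M1 where M1: "\<forall>x w. \<bar>u1 x w\<bar> \<le> M1" using u1_Linf by (auto simp: Linf_def)
  obtain M2 where M2: "\<forall>x w. \<bar>rho0 x w\<bar> \<le> M2" using rho0_Linf by (auto simp: Linf_def)
  have "max 1 (max M1 M2) \<ge> 1 \<and> (\<forall>x w. \<bar>u1 x w\<bar> \<le> max 1 (max M1 M2)) \<and> (\<forall>x w. \<bar>rho0 x w\<bar> \<le> max 1 (max M1 M2))"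
    using M1 M2 by (auto simp: le_max_iff_disj)
  from someI[of "\<lambda>M. M \<ge> 1 \<and> (\<forall>x w. \<bar>u1 x w\<bar> \<le> M) \<and> (\<forall>x w. \<bar>rho0 x w\<bar> \<le> M)", OF this]
  show "M \<ge> 1" "\<bar>u1 x w\<bar> \<le> M" "\<bar>rho0 x w\<bar> \<le> M" unfolding M_def by blast+
qed

text \<open>Dominates, up to a constant, every function that has to be placed in the weighted space.\<close>

definition S where "S x w = 1 + \<bar>u0 x w\<bar> + \<bar>w\<bar> + (u2 x w)\<^sup>2 + (r1 x w)\<^sup>2 + \<bar>h3 x w\<bar> + \<bar>r2 x w\<bar>"

lemma S_ge: "S x w \<ge> 1" "\<bar>u0 x w\<bar> \<le> S x w" "\<bar>w\<bar> \<le> S x w" "(u2 x w)\<^sup>2 \<le> S x w" "(r1 x w)\<^sup>2 \<le> S x w"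
  "\<bar>h3 x w\<bar> \<le> S x w" "\<bar>r2 x w\<bar> \<le> S x w" "1 + \<bar>u0 x w\<bar> + \<bar>w\<bar> \<le> S x w"
  by (simp_all add: S_def)

lemma S_ge': "\<bar>u2 x w\<bar> \<le> S x w" "\<bar>r1 x w\<bar> \<le> S x w"
proof -
  have *: "\<bar>a\<bar> \<le> 1 + a\<^sup>2" for a :: real
    using zero_le_power2[of "\<bar>a\<bar> - 1"] by (simp add: power2_eq_square algebra_simps)
  have "0 \<le> (u2 x w)\<^sup>2" "0 \<le> (r1 x w)\<^sup>2" by simp_all
  then show "\<bar>u2 x w\<bar> \<le> S x w" "\<bar>r1 x w\<bar> \<le> S x w"
    unfolding S_def using *[of "u2 x w"] *[of "r1 x w"] by linarith+
qed

text \<open>\<open>u1\<close> and \<open>rho0\<close> are bounded, so the interpolation inequality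
  lifts their derivatives to fourth powers. This places products such as \<open>Y^2\<close> and
  \<open>r1 * Y\<close>, which occur at top order, in the weighted space.\<close>

lemma u2_fourth: "integrable cyl (\<lambda>(x, w). (u2 x w) ^ 4 * g w)" and r1_fourth: "integrable cyl (\<lambda>(x, w). (r1 x w) ^ 4 * g w)"
proof -
  show "integrable cyl (\<lambda>(x, w). (u2 x w) ^ 4 * g w)"
  proof (rule integrable_by_slices[OF _ _ L2g_integrable[OF h3_L2g], where C = "9 * M\<^sup>2"])
    show "AE w in lborel. g w \<noteq> 0 \<longrightarrow> (LINT x:{0..2 * pi}|lborel. (u2 x w) ^ 4) \<le> 9 * M\<^sup>2 * (LINT x:{0..2 * pi}|lborel. (h3 x w)\<^sup>2)"
      using ac_u2 L2g_slice[OF h3_L2g]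
      by eventually_elim (use data_periodic[of 0] in \<open>auto intro!: gagliardo_nirenberg_1d[OF u1_deriv] M\<close>)
    show "set_integrable lborel {0..2 * pi} (\<lambda>x. (u2 x w) ^ 4)" for w
      by (rule borel_integrable_atLeastAtMost') (intro continuous_intros continuous_on_subset[OF u2_cont], simp)
  qed (auto intro!: cyl_measurable_intros data_measurable)
  show "integrable cyl (\<lambda>(x, w). (r1 x w) ^ 4 * g w)"
  proof (rule integrable_by_slices[OF _ _ L2g_integrable[OF r2_L2g], where C = "9 * M\<^sup>2"])
    show "AE w in lborel. g w \<noteq> 0 \<longrightarrow> (LINT x:{0..2 * pi}|lborel. (r1 x w) ^ 4) \<le> 9 * M\<^sup>2 * (LINT x:{0..2 * pi}|lborel. (r2 x w)\<^sup>2)"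
      using ac_r1 L2g_slice[OF r2_L2g]
      by eventually_elim (use data_periodic[of 0] in \<open>auto intro!: gagliardo_nirenberg_1d[OF rho0_deriv] M\<close>)
    show "set_integrable lborel {0..2 * pi} (\<lambda>x. (r1 x w) ^ 4)" for w
      by (rule borel_integrable_atLeastAtMost') (intro continuous_intros continuous_on_subset[OF r1_cont], simp)
  qed (auto intro!: cyl_measurable_intros data_measurable)
qed

lemma S_measurable: "cyl_measurable S"
  unfolding S_def[abs_def] by (intro cyl_measurable_intros data_measurable) measurable

lemma S_integrable: "integrable cyl (\<lambda>(x, w). (S x w)\<^sup>2 * g w)"
proof (rule integrable_weight_bound)
  let ?E = "\<lambda>x w. 7 * (1 + (u0 x w)\<^sup>2 + w\<^sup>2 + (u2 x w) ^ 4 + (r1 x w) ^ 4 + (h3 x w)\<^sup>2 + (r2 x w)\<^sup>2)"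
  have "integrable cyl (\<lambda>q. 7 * ((\<lambda>(x, w). g w) q + (\<lambda>(x, w). (u0 x w)\<^sup>2 * g w) q + (\<lambda>(x, w). w\<^sup>2 * g w) q
      + (\<lambda>(x, w). (u2 x w) ^ 4 * g w) q + (\<lambda>(x, w). (r1 x w) ^ 4 * g w) q + (\<lambda>(x, w). (h3 x w)\<^sup>2 * g w) q + (\<lambda>(x, w). (r2 x w)\<^sup>2 * g w) q))"
    by (intro integrable_mult_right Bochner_Integration.integrable_add integrable_cyl_snd g_int g_moment
        L2g_integrable u0_L2g h3_L2g r2_L2g u2_fourth r1_fourth)
  then show "integrable cyl (\<lambda>(x, w). ?E x w * g w)"
    by (simp add: case_prod_unfold distrib_right mult.assoc)
  show "cyl_measurable (\<lambda>x w. (S x w)\<^sup>2)" by (intro cyl_measurable_intros S_measurable)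
  fix x w :: real
  \<comment> \<open>The factor 7 is the number of summands; the difference of the two sides is the
    sum of all squared pairwise differences.\<close>
  have *: "(a + b + c + d + e + f + h)\<^sup>2 \<le> 7 * (a\<^sup>2 + b\<^sup>2 + c\<^sup>2 + d\<^sup>2 + e\<^sup>2 + f\<^sup>2 + h\<^sup>2)" for a b c d e f h :: real
  proof -
    have "0 \<le> (a-b)\<^sup>2 + (a-c)\<^sup>2 + (a-d)\<^sup>2 + (a-e)\<^sup>2 + (a-f)\<^sup>2 + (a-h)\<^sup>2 + (b-c)\<^sup>2 + (b-d)\<^sup>2 + (b-e)\<^sup>2 + (b-f)\<^sup>2 + (b-h)\<^sup>2
      + (c-d)\<^sup>2 + (c-e)\<^sup>2 + (c-f)\<^sup>2 + (c-h)\<^sup>2 + (d-e)\<^sup>2 + (d-f)\<^sup>2 + (d-h)\<^sup>2 + (e-f)\<^sup>2 + (e-h)\<^sup>2 + (f-h)\<^sup>2" by simp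
    then show ?thesis by (simp add: power2_eq_square algebra_simps)
  qed
  have "(S x w)\<^sup>2 \<le> 7 * (1\<^sup>2 + \<bar>u0 x w\<bar>\<^sup>2 + \<bar>w\<bar>\<^sup>2 + ((u2 x w)\<^sup>2)\<^sup>2 + ((r1 x w)\<^sup>2)\<^sup>2 + \<bar>h3 x w\<bar>\<^sup>2 + \<bar>r2 x w\<bar>\<^sup>2)"
    unfolding S_def by (rule *)
  then show "\<bar>(S x w)\<^sup>2\<bar> \<le> ?E x w" by (simp add: power_mult[symmetric])
qed

definition par where "par x w = (x, u0 x w, w, u1 x w, u2 x w)"

lemma par_measurable: "cont2 F \<Longrightarrow> t \<ge> 0 \<Longrightarrow> cyl_measurable (\<lambda>x w. F (par x w) t)"
  unfolding par_def by (rule measurable_of_par) (auto intro!: cyl_measurable_fst cyl_measurable_snd data_measurable)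

lemma rho0_g: "integrable cyl (\<lambda>(x, w). rho0 x w * g w)" "(\<integral>(x, w). rho0 x w * g w \<partial>cyl) = 1"
proof -
  from integrable_bounded_weight[OF data_measurable(4) M(3)]
  show i: "integrable cyl (\<lambda>(x, w). rho0 x w * g w)" .
  show "(\<integral>(x, w). rho0 x w * g w \<partial>cyl) = 1"
    unfolding cyl_Fubini(1)[OF i] by (simp add: mass g_mass)
qed

text \<open>The mean field pulled back to the starting points by conservation of mass. No Jacobian
  appears, so the map is defined whether or not the characteristics have crossed.\<close>

definition mf :: "(real \<Rightarrow> complex) \<Rightarrow> real \<Rightarrow> complex" where
  "mf z t = (\<integral>(x, w). (rho0 x w * g w) *\<^sub>R cis (flow.X m K z (par x w) t) \<partial>cyl)"

lemma mf_integrable: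
  assumes z: "flow m K B z" and t: "t \<ge> 0"
  shows "integrable cyl (\<lambda>(x, w). (rho0 x w * g w) *\<^sub>R cis (flow.X m K z (par x w) t))"
proof -
  interpret f: flow m K B z by fact
  have "(\<lambda>(x, w). (rho0 x w * g w) *\<^sub>R cis (f.X (par x w) t)) \<in> borel_measurable cyl"
  proof (intro measurable_cyl)
    have [measurable]: "cis \<in> borel_measurable borel" by (intro borel_measurable_continuous_onI continuous_intros)
    have "(\<lambda>p. rho0 (fst p) (snd p) * g (snd p)) \<in> borel_measurable borel" "(\<lambda>p. f.X (par (fst p) (snd p)) t) \<in> borel_measurable borel"
      using cyl_measurable_mult[OF data_measurable(4) cyl_measurable_snd[OF g_meas]] par_measurable[OF f.X_cont t]
      by (simp_all add: cyl_measurable_def case_prod_unfold)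
    then show "(\<lambda>(x, w). (rho0 x w * g w) *\<^sub>R cis (f.X (par x w) t)) \<in> borel_measurable borel"
      unfolding case_prod_unfold by measurable
  qed
  then show ?thesis
    by (rule Bochner_Integration.integrable_bound[OF rho0_g(1)]) (auto simp: case_prod_unfold)
qed

lemma mf_norm_le: "norm (mf z t) \<le> 1"
proof -
  have "norm (mf z t) \<le> (\<integral>q. norm (case q of (x, w) \<Rightarrow> (rho0 x w * g w) *\<^sub>R cis (flow.X m K z (par x w) t)) \<partial>cyl)"
    unfolding mf_def by (rule integral_norm_bound)
  also have "\<dots> = (\<integral>(x, w). rho0 x w * g w \<partial>cyl)"
    using less_imp_le[OF pos] g_nonneg by (intro Bochner_Integration.integral_cong) (auto simp: abs_mult)
  finally show ?thesis by (simp add: rho0_g)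
qed

lemma mf_continuous:
  assumes z: "flow m K B z" shows "continuous_on {0..} (mf z)"
  unfolding continuous_on_def
proof
  interpret f: flow m K B z by fact
  fix s :: real assume s: "s \<in> {0..}"
  show "(mf z \<longlongrightarrow> mf z s) (at s within {0..})"
    unfolding tendsto_at_iff_sequentially
  proof (intro allI impI)
    fix r :: "nat \<Rightarrow> real" assume r: "\<forall>i. r i \<in> {0..} - {s}" and rl: "r \<longlonglongrightarrow> s"
    show "(mf z \<circ> r) \<longlonglongrightarrow> mf z s"
      unfolding mf_def o_def
    proof (rule integral_dominated_convergence[OF _ _ rho0_g(1)])
      show "(\<lambda>(x, w). (rho0 x w * g w) *\<^sub>R cis (f.X (par x w) s)) \<in> borel_measurable cyl"
        using mf_integrable[OF z] s by (auto simp: integrable_iff_bounded)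
      show "(\<lambda>(x, w). (rho0 x w * g w) *\<^sub>R cis (f.X (par x w) (r n))) \<in> borel_measurable cyl" for n
        using mf_integrable[OF z, of "r n"] r by (auto simp: integrable_iff_bounded)
      show "AE q in cyl. (\<lambda>n. case q of (x, w) \<Rightarrow> (rho0 x w * g w) *\<^sub>R cis (f.X (par x w) (r n))) \<longlonglongrightarrow> (case q of (x, w) \<Rightarrow> (rho0 x w * g w) *\<^sub>R cis (f.X (par x w) s))"
      proof (rule AE_I2, clarify)
        fix x w
        have "(f.X (par x w) \<longlongrightarrow> f.X (par x w) s) (at s within {0..})"
          using cont2_slice[OF f.X_cont, of "par x w"] s by (auto simp: continuous_on_def)
        then have "(\<lambda>n. f.X (par x w) (r n)) \<longlonglongrightarrow> f.X (par x w) s"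
          using r rl unfolding tendsto_at_iff_sequentially o_def by blast
        moreover have "continuous_on UNIV cis" by (intro continuous_intros)
        then have "isCont cis (f.X (par x w) s)" by (simp add: continuous_on_eq_continuous_at)
        ultimately have "(\<lambda>n. cis (f.X (par x w) (r n))) \<longlonglongrightarrow> cis (f.X (par x w) s)" by (rule isCont_tendsto_compose[rotated])
        then show "(\<lambda>n. (rho0 x w * g w) *\<^sub>R cis (f.X (par x w) (r n))) \<longlonglongrightarrow> (rho0 x w * g w) *\<^sub>R cis (f.X (par x w) s)"
          by (rule tendsto_scaleR[OF tendsto_const])
      qed
      show "AE q in cyl. norm (case q of (x, w) \<Rightarrow> (rho0 x w * g w) *\<^sub>R cis (f.X (par x w) (r n))) \<le> (case q of (x, w) \<Rightarrow> rho0 x w * g w)" for n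
        using less_imp_le[OF pos] g_nonneg by (intro AE_I2) (auto simp: abs_mult)
    qed
  qed
qed

text \<open>The exponential is 1-Lipschitz in the angle and the total mass is 1, so the ratio 1/2 of
  \<open>flow_compare\<close> passes to the field.\<close>

lemma mf_contract:
  assumes z: "flow m K B z" "flow m K B z'" and l: "2 * l \<ge> so_rate m (K * B) + 4 * K\<^sup>2 / m" and d: "d \<ge> 0" and t: "t \<ge> 0"
    and zz: "\<And>s. s \<in> {0..t} \<Longrightarrow> norm (z s - z' s) \<le> d * exp (l * s)"
  shows "norm (mf z t - mf z' t) \<le> d / 2 * exp (l * t)"
proof -
  note i = mf_integrable[OF z(1) t] mf_integrable[OF z(2) t]
  have "norm (mf z t - mf z' t) = norm (\<integral>(x::real, w::real). (rho0 x w * g w) *\<^sub>R (cis (flow.X m K z (par x w) t) - cis (flow.X m K z' (par x w) t)) \<partial>cyl)"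
    unfolding mf_def using i by (subst Bochner_Integration.integral_diff[symmetric]) (auto simp: case_prod_unfold scaleR_diff_right)
  also have "\<dots> \<le> (\<integral>q. norm (case q of (x::real, w::real) \<Rightarrow> (rho0 x w * g w) *\<^sub>R (cis (flow.X m K z (par x w) t) - cis (flow.X m K z' (par x w) t))) \<partial>cyl)"
    by (rule integral_norm_bound)
  also have "\<dots> \<le> (\<integral>q. (d / 2 * exp (l * t)) * (case q of (x, w) \<Rightarrow> rho0 x w * g w) \<partial>cyl)"
  proof (rule integral_mono')
    show "integrable cyl (\<lambda>q. (d / 2 * exp (l * t)) * (case q of (x, w) \<Rightarrow> rho0 x w * g w))" by (intro integrable_mult_right rho0_g)
    fix q :: "real \<times> real"
    obtain x w :: real where q: "q = (x, w)" by (cases q)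
    have "norm (cis (flow.X m K z (par x w) t) - cis (flow.X m K z' (par x w) t)) \<le> d / 2 * exp (l * t)"
      by (rule order_trans[OF norm_cis_diff flow_compare[OF z l d t zz]])
    then have "rho0 x w * g w * norm (cis (flow.X m K z (par x w) t) - cis (flow.X m K z' (par x w) t)) \<le> rho0 x w * g w * (d / 2 * exp (l * t))"
      using less_imp_le[OF pos] g_nonneg by (intro mult_left_mono) auto
    then show "norm (case q of (x, w) \<Rightarrow> (rho0 x w * g w) *\<^sub>R (cis (flow.X m K z (par x w) t) - cis (flow.X m K z' (par x w) t)))
      \<le> (d / 2 * exp (l * t)) * (case q of (x, w) \<Rightarrow> rho0 x w * g w)"
      using less_imp_le[OF pos[of x w]] g_nonneg[of w] by (simp add: q abs_mult mult_ac)
  qed (use d less_imp_le[OF pos] g_nonneg in auto)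
  also have "\<dots> = d / 2 * exp (l * t)" by (simp add: rho0_g)
  finally show ?thesis .
qed

lemma mf_fixed: "\<exists>z. continuous_on {0..} z \<and> (\<forall>t\<ge>0. norm (z t) \<le> 1) \<and> (\<forall>t\<ge>0. mf z t = z t)"
proof -
  define l where "l = (so_rate m (K * 1) + 4 * K\<^sup>2 / m) / 2"
  have l: "l \<ge> 0" using m K by (auto simp: l_def so_rate_def add_nonneg_nonneg)
  have l2: "2 * l \<ge> so_rate m (K * 1) + 4 * K\<^sup>2 / m" by (simp add: l_def)
  have fl: "flow m K 1 z" if "continuous_on {0..} z" "\<And>t. t \<ge> 0 \<Longrightarrow> z t \<in> cball 0 1" for z
    by unfold_locales (use m K that in auto)
  have "\<exists>z. continuous_on {0..} z \<and> (\<forall>t\<ge>0. z t \<in> cball 0 1 \<and> mf z t = z t)"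
  proof (rule causal_fixed_point[of "cball 0 1" 0 l])
    fix z :: "real \<Rightarrow> complex" assume z: "continuous_on {0..} z" "\<And>t. t \<ge> 0 \<Longrightarrow> z t \<in> cball 0 1"
    show "continuous_on {0..} (mf z) \<and> (\<forall>t\<ge>0. mf z t \<in> cball 0 1)"
      using mf_continuous[OF fl[OF z]] mf_norm_le by auto
  next
    fix z z' :: "real \<Rightarrow> complex" and t d :: real
    assume *: "continuous_on {0..} z" "\<And>t. t \<ge> 0 \<Longrightarrow> z t \<in> cball 0 1" "continuous_on {0..} z'" "\<And>t. t \<ge> 0 \<Longrightarrow> z' t \<in> cball 0 1"
      "0 \<le> t" "0 \<le> d" "\<And>s. s \<in> {0..t} \<Longrightarrow> dist (z s) (z' s) \<le> d * exp (l * s)"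
    show "dist (mf z t) (mf z' t) \<le> d / 2 * exp (l * t)"
      using mf_contract[OF fl fl l2] * by (simp add: dist_norm)
  qed (use l in auto)
  then show ?thesis by auto
qed

text \<open>Both fields are fixed only up to \<open>T\<close>. At a maximum point of the weighted
  distance on the compact interval, the contraction shows that the maximum is at most half of
  itself.\<close>

lemma mf_unique:
  assumes z: "flow m K B z" "flow m K B z'" and T: "T \<ge> 0"
    and fp: "\<And>t. t \<in> {0..T} \<Longrightarrow> mf z t = z t" "\<And>t. t \<in> {0..T} \<Longrightarrow> mf z' t = z' t" and t: "t \<in> {0..T}"
  shows "z t = z' t"
proof -
  define l where "l = (so_rate m (K * B) + 4 * K\<^sup>2 / m) / 2"
  have l: "2 * l \<ge> so_rate m (K * B) + 4 * K\<^sup>2 / m" by (simp add: l_def)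
  have c: "continuous_on {0..T} z" "continuous_on {0..T} z'"
    using flow.z_cont[OF z(1)] flow.z_cont[OF z(2)] by (auto intro: continuous_on_subset)
  have "continuous_on {0..T} (\<lambda>s. norm (z s - z' s) * exp (- l * s))" by (intro continuous_intros c)
  from continuous_attains_sup[OF compact_Icc _ this] T
  obtain s where s: "s \<in> {0..T}" "\<And>r. r \<in> {0..T} \<Longrightarrow> norm (z r - z' r) * exp (- l * r) \<le> norm (z s - z' s) * exp (- l * s)" by auto
  define d where "d = norm (z s - z' s) * exp (- l * s)"
  have d: "d \<ge> 0" by (simp add: d_def)
  have b: "norm (z r - z' r) \<le> d * exp (l * r)" if "r \<in> {0..T}" for r
  proof -
    have "norm (z r - z' r) = norm (z r - z' r) * exp (- l * r) * exp (l * r)" by (simp add: exp_minus)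
    also have "\<dots> \<le> d * exp (l * r)" using s(2)[OF that] by (simp add: d_def)
    finally show ?thesis .
  qed
  have "norm (mf z s - mf z' s) \<le> d / 2 * exp (l * s)"
    using s(1) b by (intro mf_contract[OF z l d]) auto
  then have "d \<le> d / 2" using fp[OF s(1)] by (simp add: d_def exp_minus field_simps)
  then have "d = 0" using d by simp
  then show ?thesis using b[OF t] by simp
qed

end

section \<open>Inverse flow and quotients\<close>

text \<open>The mean value theorem in \<open>y\<close>, at each time separately, replaces joint
  differentiability: the quotient \<open>q\<close> tends to the partial derivative because the
  intermediate points are squeezed towards \<open>k t0\<close>.\<close>

lemma mvt_quotient:
  fixes f fy :: "real \<Rightarrow> real \<Rightarrow> real" and k :: "real \<Rightarrow> real"
  assumes S: "open S" "t0 \<in> S"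
    and d: "\<And>t y. t \<in> S \<Longrightarrow> (f t has_real_derivative fy t y) (at y)"
    and c: "continuous_on (S \<times> UNIV) (\<lambda>(t, y). fy t y)" and k: "isCont k t0"
  shows "\<exists>q. (\<forall>t\<in>S. f t (k t) - f t (k t0) = q t * (k t - k t0)) \<and> (q \<longlongrightarrow> fy t0 (k t0)) (at t0)"
proof -
  have "\<exists>y. \<bar>y - k t0\<bar> \<le> \<bar>k t - k t0\<bar> \<and> f t (k t) - f t (k t0) = fy t y * (k t - k t0)" if t: "t \<in> S" for t
  proof -
    consider "k t = k t0" | "k t0 < k t" | "k t < k t0" by linarith
    then show ?thesis
    proof cases
      case 2
      from MVT2[OF this, of "f t" "fy t"] d[OF t] obtain y where "k t0 < y" "y < k t" "f t (k t) - f t (k t0) = (k t - k t0) * fy t y" by blast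
      then show ?thesis by (intro exI[of _ y]) (auto simp: mult.commute)
    next
      case 3
      from MVT2[OF this, of "f t" "fy t"] d[OF t] obtain y where "k t < y" "y < k t0" "f t (k t0) - f t (k t) = (k t0 - k t) * fy t y" by blast
      then show ?thesis by (intro exI[of _ y]) (auto simp: algebra_simps)
    qed (auto intro: exI[of _ "k t0"])
  qed
  then obtain y where y: "\<And>t. t \<in> S \<Longrightarrow> \<bar>y t - k t0\<bar> \<le> \<bar>k t - k t0\<bar>"
    "\<And>t. t \<in> S \<Longrightarrow> f t (k t) - f t (k t0) = fy t (y t) * (k t - k t0)" by metis
  have kl: "(k \<longlongrightarrow> k t0) (at t0)" using k by (simp add: isCont_def)
  have S': "\<forall>\<^sub>F t in at t0. t \<in> S" using S by (rule eventually_at_in_open')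
  have "((\<lambda>t. y t - k t0) \<longlongrightarrow> 0) (at t0)"
  proof (rule Lim_null_comparison)
    show "\<forall>\<^sub>F t in at t0. norm (y t - k t0) \<le> \<bar>k t - k t0\<bar>" using S' by eventually_elim (use y in auto)
    show "((\<lambda>t. \<bar>k t - k t0\<bar>) \<longlongrightarrow> 0) (at t0)" using kl by (intro tendsto_rabs_zero) (simp add: LIM_zero)
  qed
  then have yl: "(y \<longlongrightarrow> k t0) (at t0)" by (rule LIM_zero_cancel)
  have "continuous (at (t0, k t0)) (\<lambda>(t, y). fy t y)"
    by (rule continuous_on_interior[OF c]) (use S in \<open>auto simp: interior_Times interior_open\<close>)
  then have "isCont (\<lambda>(t, y). fy t y) (t0, k t0)" .
  from isCont_tendsto_compose[OF this tendsto_Pair[OF tendsto_ident_at yl]]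
  have "((\<lambda>t. fy t (y t)) \<longlongrightarrow> fy t0 (k t0)) (at t0)" by simp
  then show ?thesis using y(2) by (intro exI[of _ "\<lambda>t. fy t (y t)"]) auto
qed

text \<open>A chain rule that needs the time derivative only at the one point \<open>k t0\<close>,
  the partial derivative in \<open>y\<close> being jointly continuous.\<close>

lemma DERIV_along_curve:
  fixes f fy :: "real \<Rightarrow> real \<Rightarrow> real"
  assumes S: "open S" "t0 \<in> S"
    and d: "\<And>t y. t \<in> S \<Longrightarrow> (f t has_real_derivative fy t y) (at y)"
    and c: "continuous_on (S \<times> UNIV) (\<lambda>(t, y). fy t y)"
    and ft: "((\<lambda>t. f t (k t0)) has_real_derivative ft) (at t0)" and k: "(k has_real_derivative k') (at t0)"
  shows "((\<lambda>t. f t (k t)) has_real_derivative ft + fy t0 (k t0) * k') (at t0)"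
proof -
  obtain q where q: "\<And>t. t \<in> S \<Longrightarrow> f t (k t) - f t (k t0) = q t * (k t - k t0)" "(q \<longlongrightarrow> fy t0 (k t0)) (at t0)"
    using mvt_quotient[OF S d c DERIV_isCont[OF k]] by blast
  have S': "\<forall>\<^sub>F t in at t0. t \<in> S" using S by (rule eventually_at_in_open')
  have "((\<lambda>t. (f t (k t0) - f t0 (k t0)) / (t - t0) + q t * ((k t - k t0) / (t - t0))) \<longlongrightarrow> ft + fy t0 (k t0) * k') (at t0)"
    using ft k by (intro tendsto_intros q) (simp_all add: has_field_derivative_iff)
  then have "((\<lambda>t. (f t (k t) - f t0 (k t0)) / (t - t0)) \<longlongrightarrow> ft + fy t0 (k t0) * k') (at t0)"
  proof (rule Lim_transform_eventually)
    show "\<forall>\<^sub>F t in at t0. (f t (k t0) - f t0 (k t0)) / (t - t0) + q t * ((k t - k t0) / (t - t0)) = (f t (k t) - f t0 (k t0)) / (t - t0)"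
      using S'
    proof eventually_elim
      fix t assume "t \<in> S"
      from q(1)[OF this] have "f t (k t) - f t0 (k t0) = (f t (k t0) - f t0 (k t0)) + q t * (k t - k t0)" by simp
      then show "(f t (k t0) - f t0 (k t0)) / (t - t0) + q t * ((k t - k t0) / (t - t0)) = (f t (k t) - f t0 (k t0)) / (t - t0)"
        by (simp only: add_divide_distrib times_divide_eq_right)
    qed
  qed
  then show ?thesis by (simp add: has_field_derivative_iff)
qed

text \<open>The same quotient solved for the increment of \<open>k\<close>, which is possible
  because \<open>q\<close> stays away from zero near \<open>t0\<close>.\<close>

lemma DERIV_implicit:
  fixes f fy :: "real \<Rightarrow> real \<Rightarrow> real"
  assumes S: "open S" "t0 \<in> S"
    and d: "\<And>t y. t \<in> S \<Longrightarrow> (f t has_real_derivative fy t y) (at y)"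
    and c: "continuous_on (S \<times> UNIV) (\<lambda>(t, y). fy t y)"
    and ft: "((\<lambda>t. f t (k t0)) has_real_derivative ft) (at t0)" and k: "isCont k t0"
    and eq: "\<And>t. t \<in> S \<Longrightarrow> f t (k t) = a" and nz: "fy t0 (k t0) \<noteq> 0"
  shows "(k has_real_derivative - ft / fy t0 (k t0)) (at t0)"
proof -
  obtain q where q: "\<And>t. t \<in> S \<Longrightarrow> f t (k t) - f t (k t0) = q t * (k t - k t0)" "(q \<longlongrightarrow> fy t0 (k t0)) (at t0)"
    using mvt_quotient[OF S d c k] by blast
  have S': "\<forall>\<^sub>F t in at t0. t \<in> S" using S by (rule eventually_at_in_open')
  have q0: "\<forall>\<^sub>F t in at t0. q t \<noteq> 0" using q(2) nz by (rule tendsto_imp_eventually_ne)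
  have "((\<lambda>t. - ((f t (k t0) - f t0 (k t0)) / (t - t0)) / q t) \<longlongrightarrow> - ft / fy t0 (k t0)) (at t0)"
    using ft by (intro tendsto_intros q nz) (simp_all add: has_field_derivative_iff)
  then have "((\<lambda>t. (k t - k t0) / (t - t0)) \<longlongrightarrow> - ft / fy t0 (k t0)) (at t0)"
  proof (rule Lim_transform_eventually)
    show "\<forall>\<^sub>F t in at t0. - ((f t (k t0) - f t0 (k t0)) / (t - t0)) / q t = (k t - k t0) / (t - t0)"
      using S' q0
    proof eventually_elim
      fix t assume t: "t \<in> S" and qt: "q t \<noteq> 0"
      have "f t (k t0) - f t0 (k t0) = - (q t * (k t - k t0))" using q(1)[OF t] eq[OF t] eq[OF S(2)] by simp
      then show "- ((f t (k t0) - f t0 (k t0)) / (t - t0)) / q t = (k t - k t0) / (t - t0)" using qt by simp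
    qed
  qed
  then show ?thesis by (simp add: has_field_derivative_iff)
qed

text \<open>A derivative of at least \<open>e\<close> makes \<open>f\<close> expand distances, so it
  is injective with a Lipschitz inverse; \<open>f\<close> moves by a full turn per period, so the
  intermediate value theorem makes it surjective.\<close>

lemma circle_lift:
  fixes f f' :: "real \<Rightarrow> real"
  assumes d: "\<And>x. (f has_real_derivative f' x) (at x)" and e: "e > 0" "\<And>x. f' x \<ge> e"
    and per: "\<And>x. f (x + 2 * pi) = f x + 2 * pi"
  shows "f (inv f x) = x" "inv f (f x) = x" "e * \<bar>x - y\<bar> \<le> \<bar>f x - f y\<bar>" "x \<le> y \<longleftrightarrow> f x \<le> f y"
    "(inv f has_real_derivative 1 / f' (inv f x)) (at x)" "inv f (x + 2 * pi) = inv f x + 2 * pi"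
proof -
  have exp: "e * (y - x) \<le> f y - f x" if "x \<le> y" for x y
  proof (cases "x = y")
    case False
    with that have "x < y" by simp
    from MVT2[OF this, of f f'] d obtain z where "f y - f x = (y - x) * f' z" by blast
    then show ?thesis using that e(2)[of z] by (simp add: mult.commute[of e] mult_left_mono)
  qed simp
  show ex: "e * \<bar>x - y\<bar> \<le> \<bar>f x - f y\<bar>" for x y
    using exp[of x y] exp[of y x] by (cases "x \<le> y") auto
  have mono: "f x < f y" if "x < y" for x y
    using exp[of x y] that e(1) mult_pos_pos[of e "y - x"] by linarith
  show le: "x \<le> y \<longleftrightarrow> f x \<le> f y" for x y
    using mono[of x y] mono[of y x] by (metis less_le_not_le linorder_le_less_linear order_le_less)
  have inj: "inj f" by (rule injI) (metis le order_antisym order_refl)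
  have cf: "continuous_on UNIV f" using d by (meson DERIV_isCont continuous_at_imp_continuous_on)
  have p: "f (x + 2 * pi * real n) = f x + 2 * pi * real n" for x n
  proof (induction n)
    case (Suc n) then show ?case using per[of "x + 2 * pi * real n"] by (simp add: algebra_simps)
  qed simp
  have "surj f"
    unfolding surj_def
  proof
    fix y
    obtain n where n: "\<bar>y - f 0\<bar> < real n * (2 * pi)" using reals_Archimedean3[of "2 * pi"] by auto
    have "f (- (2 * pi * real n)) \<le> y" "y \<le> f (2 * pi * real n)"
      using n p[of 0 n] p[of "- (2 * pi * real n)" n] by (auto simp: abs_less_iff mult.commute)
    then show "\<exists>x. y = f x"
      using IVT'[of f "- (2 * pi * real n)" y "2 * pi * real n"] continuous_on_subset[OF cf] by fastforce
  qed
  then show fi: "f (inv f x) = x" for x by (rule surj_f_inv_f)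
  show if': "inv f (f x) = x" for x using inj by simp
  have "isCont (inv f) x"
  proof -
    have "(inv f \<longlongrightarrow> inv f x) (at x)"
    proof (rule LIM_zero_cancel, rule Lim_null_comparison)
      show "\<forall>\<^sub>F y in at x. norm (inv f y - inv f x) \<le> \<bar>y - x\<bar> / e"
        using ex[of "inv f _" "inv f x"] e(1) by (intro always_eventually) (auto simp: fi field_simps)
      have "((\<lambda>y. \<bar>y - x\<bar> / e) \<longlongrightarrow> \<bar>x - x\<bar> / e) (at x)" by (intro tendsto_intros) (use e in auto)
      then show "((\<lambda>y. \<bar>y - x\<bar> / e) \<longlongrightarrow> 0) (at x)" by simp
    qed
    then show ?thesis by (simp add: isCont_def)
  qed
  then have "(inv f has_real_derivative inverse (f' (inv f x))) (at x)"
    using DERIV_inverse_function[of f "f' (inv f x)" "inv f" x "x - 1" "x + 1"] d e(2)[of "inv f x"] e(1) fi by auto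
  then show "(inv f has_real_derivative 1 / f' (inv f x)) (at x)" by (simp add: inverse_eq_divide)
  show "inv f (x + 2 * pi) = inv f x + 2 * pi"
    using if'[of "inv f x + 2 * pi"] by (simp add: per fi)
qed

text \<open>The first two derivatives of \<open>n / J\<close> composed with the inverse of \<open>X\<close>, where \<open>X' = J\<close>;
  the arguments are the values of \<open>n\<close>, \<open>n'\<close>, \<open>n''\<close>, \<open>J\<close>, \<open>J'\<close>, \<open>J''\<close>.\<close>

definition D1 :: "real \<Rightarrow> real \<Rightarrow> real \<Rightarrow> real \<Rightarrow> real" where
  "D1 n n1 j y = n1 / j\<^sup>2 - n * y / j ^ 3"
definition D2 :: "real \<Rightarrow> real \<Rightarrow> real \<Rightarrow> real \<Rightarrow> real \<Rightarrow> real \<Rightarrow> real" where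
  "D2 n n1 n2 j y z = (n2 / j\<^sup>2 - 3 * n1 * y / j ^ 3 - n * z / j ^ 3 + 3 * n * y\<^sup>2 / j ^ 4) / j"

text \<open>\<open>D1\<close> is the derivative with respect to the end point \<open>X\<close>; the
  factor \<open>J x\<close> converts it to the starting point.\<close>

lemma quotient_deriv:
  assumes "(n has_real_derivative n1) (at x)" "(J has_real_derivative y) (at x)" "J x > (0::real)"
  shows "((\<lambda>x. n x / J x) has_real_derivative D1 (n x) n1 (J x) y * J x) (at x)"
proof -
  have "((\<lambda>x. n x / J x) has_real_derivative (n1 * J x - n x * y) / (J x * J x)) (at x)"
    using assms by (intro DERIV_divide) auto
  also have "(n1 * J x - n x * y) / (J x * J x) = D1 (n x) n1 (J x) y * J x"
    using assms(3) by (simp add: D1_def field_simps power2_eq_square power3_eq_cube)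
  finally show ?thesis .
qed

text \<open>Only \<open>n1\<close> and \<open>Y\<close> are merely absolutely continuous; each is
  multiplied by a coefficient of class C1, so the product rule for densities is enough.\<close>

lemma D1_ac:
  assumes n: "\<And>x. (n has_real_derivative n1 x) (at x)" and n1: "ac n1 n2"
    and J: "\<And>x. (J has_real_derivative Y x) (at x)" and Y: "ac Y Z" and pos: "\<And>x. J x > 0"
  shows "ac (\<lambda>x. D1 (n x) (n1 x) (J x) (Y x)) (\<lambda>x. D2 (n x) (n1 x) (n2 x) (J x) (Y x) (Z x) * J x)"
proof -
  have c: "continuous_on UNIV n" "continuous_on UNIV J" "continuous_on UNIV n1" "continuous_on UNIV Y"
    using n J ac_continuous[OF n1] ac_continuous[OF Y] by (auto intro!: continuous_at_imp_continuous_on DERIV_isCont)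
  have nz: "J x \<noteq> 0" for x using pos[of x] by simp
  have a1: "ac (\<lambda>x. 1 / (J x)\<^sup>2) (\<lambda>x. - 2 * Y x / J x ^ 3)"
  proof (rule ac_C1)
    show "((\<lambda>x. 1 / (J x)\<^sup>2) has_real_derivative - 2 * Y x / J x ^ 3) (at x)" for x
      using nz[of x] by (auto intro!: derivative_eq_intros J simp: field_simps power2_eq_square power3_eq_cube)
    show "continuous_on UNIV (\<lambda>x. - 2 * Y x / J x ^ 3)" by (intro continuous_intros c) (use nz in auto)
  qed
  have a2: "ac (\<lambda>x. n x / J x ^ 3) (\<lambda>x. n1 x / J x ^ 3 - 3 * n x * Y x / J x ^ 4)"
  proof (rule ac_C1)
    show "((\<lambda>x. n x / J x ^ 3) has_real_derivative n1 x / J x ^ 3 - 3 * n x * Y x / J x ^ 4) (at x)" for x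
      using nz[of x] by (auto intro!: derivative_eq_intros J n simp: field_simps eval_nat_numeral)
    show "continuous_on UNIV (\<lambda>x. n1 x / J x ^ 3 - 3 * n x * Y x / J x ^ 4)" by (intro continuous_intros c) (use nz in auto)
  qed
  have "ac (\<lambda>x. n1 x * (1 / (J x)\<^sup>2) - Y x * (n x / J x ^ 3))
    (\<lambda>x. (n2 x * (1 / (J x)\<^sup>2) + n1 x * (- 2 * Y x / J x ^ 3)) - (Z x * (n x / J x ^ 3) + Y x * (n1 x / J x ^ 3 - 3 * n x * Y x / J x ^ 4)))"
    by (intro ac_diff ac_mult n1 Y a1 a2)
  also have "(\<lambda>x. n1 x * (1 / (J x)\<^sup>2) - Y x * (n x / J x ^ 3)) = (\<lambda>x. D1 (n x) (n1 x) (J x) (Y x))"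
    by (auto simp: D1_def mult.commute)
  also have "(\<lambda>x. (n2 x * (1 / (J x)\<^sup>2) + n1 x * (- 2 * Y x / J x ^ 3)) - (Z x * (n x / J x ^ 3) + Y x * (n1 x / J x ^ 3 - 3 * n x * Y x / J x ^ 4)))
    = (\<lambda>x. D2 (n x) (n1 x) (n2 x) (J x) (Y x) (Z x) * J x)"
  proof
    fix x
    show "(n2 x * (1 / (J x)\<^sup>2) + n1 x * (- 2 * Y x / J x ^ 3)) - (Z x * (n x / J x ^ 3) + Y x * (n1 x / J x ^ 3 - 3 * n x * Y x / J x ^ 4))
      = D2 (n x) (n1 x) (n2 x) (J x) (Y x) (Z x) * J x"
    proof -
      have "D2 (n x) (n1 x) (n2 x) (J x) (Y x) (Z x) * J x
        = n2 x / (J x)\<^sup>2 - 3 * n1 x * Y x / J x ^ 3 - n x * Z x / J x ^ 3 + 3 * n x * (Y x)\<^sup>2 / J x ^ 4"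
        by (simp add: D2_def nz)
      then show ?thesis by (simp add: algebra_simps power2_eq_square)
    qed
  qed
  finally show ?thesis .
qed

text \<open>All bounds are linear in \<open>S\<close>: the quadratic terms \<open>n1 * y\<close> and
  \<open>y^2\<close> are assumed to be bounded as products, which is where the fourth-power
  estimates enter. The powers of \<open>e\<close> match those of \<open>j\<close>.\<close>

lemma D_bounds:
  assumes S: "S \<ge> 1" and N: "N \<ge> 0" and e: "e > 0" "j \<ge> e" and b: "\<bar>n\<bar> \<le> N" "\<bar>n1\<bar> \<le> N * S" "\<bar>n2\<bar> \<le> N * S" "\<bar>y\<bar> \<le> N * S"
    "\<bar>n1 * y\<bar> \<le> N * S" "y\<^sup>2 \<le> N * S" "\<bar>z\<bar> \<le> N * S"
  shows "\<bar>n / j\<bar> \<le> N / e * S" "\<bar>D1 n n1 j y\<bar> \<le> (N / e\<^sup>2 + N * N / e ^ 3) * S"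
    "\<bar>D2 n n1 n2 j y z\<bar> \<le> (N / e ^ 3 + 3 * N / e ^ 4 + N * N / e ^ 4 + 3 * (N * N) / e ^ 5) * S"
proof -
  have j: "j > 0" using e by linarith
  have dv: "\<bar>a / j ^ k\<bar> \<le> c / e ^ k" if "\<bar>a\<bar> \<le> c" for a c :: real and k
  proof -
    have "\<bar>a / j ^ k\<bar> = \<bar>a\<bar> / j ^ k" using j by (simp add: abs_divide)
    also have "\<dots> \<le> c / e ^ k" using that e j by (intro frac_le power_mono) auto
    finally show ?thesis .
  qed
  have NS: "0 \<le> N * S" using N S by simp
  have ny: "\<bar>n * y\<bar> \<le> N * (N * S)" "\<bar>n * z\<bar> \<le> N * (N * S)" "\<bar>n * y\<^sup>2\<bar> \<le> N * (N * S)"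
    using b N by (auto simp: abs_mult intro!: mult_mono)
  have n3: "\<bar>3 * (n1 * y)\<bar> \<le> 3 * (N * S)" "\<bar>3 * (n * y\<^sup>2)\<bar> \<le> 3 * (N * (N * S))"
    unfolding abs_mult[of 3] using b(5) ny(3) by simp_all
  have "N * 1 \<le> N * S" using N S by (intro mult_left_mono)
  then have "\<bar>n\<bar> \<le> N * S" using b(1) by linarith
  from dv[OF this, of 1] show "\<bar>n / j\<bar> \<le> N / e * S" by simp
  have "\<bar>D1 n n1 j y\<bar> \<le> \<bar>n1 / j ^ 2\<bar> + \<bar>n * y / j ^ 3\<bar>" unfolding D1_def by (rule abs_triangle_ineq4)
  also have "\<dots> \<le> N * S / e ^ 2 + N * (N * S) / e ^ 3" by (intro add_mono dv b ny)
  finally show "\<bar>D1 n n1 j y\<bar> \<le> (N / e\<^sup>2 + N * N / e ^ 3) * S" by (simp add: algebra_simps)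
  have "D2 n n1 n2 j y z = n2 / j ^ 3 - 3 * (n1 * y) / j ^ 4 - n * z / j ^ 4 + 3 * (n * y\<^sup>2) / j ^ 5"
    using j by (simp add: D2_def diff_divide_distrib add_divide_distrib eval_nat_numeral)
  also have "\<bar>\<dots>\<bar> \<le> \<bar>n2 / j ^ 3\<bar> + \<bar>3 * (n1 * y) / j ^ 4\<bar> + \<bar>n * z / j ^ 4\<bar> + \<bar>3 * (n * y\<^sup>2) / j ^ 5\<bar>"
  proof -
    have "\<bar>p - q - r + s\<bar> \<le> \<bar>p\<bar> + \<bar>q\<bar> + \<bar>r\<bar> + \<bar>s\<bar>" for p q r s :: real by linarith
    then show ?thesis .
  qed
  also have "\<dots> \<le> N * S / e ^ 3 + 3 * (N * S) / e ^ 4 + N * (N * S) / e ^ 4 + 3 * (N * (N * S)) / e ^ 5"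
    by (intro add_mono dv b ny n3)
  finally show "\<bar>D2 n n1 n2 j y z\<bar> \<le> (N / e ^ 3 + 3 * N / e ^ 4 + N * N / e ^ 4 + 3 * (N * N) / e ^ 5) * S"
    by (simp add: algebra_simps)
qed

section \<open>From chains of derivatives to Sobolev membership and continuity\<close>

context weight
begin

lemma Hg_from_chain:
  assumes s: "s \<ge> 1" and per: "theta_periodic (f 0)" and C: "theta_C (s - 1) (f 0)"
    and L: "\<And>k. k \<le> s \<Longrightarrow> f k \<in> L2g g" and chain: "AE w in lborel. g w \<noteq> 0 \<longrightarrow> smooth_chain s (\<lambda>k x. f k x w)"
  shows "f 0 \<in> Hg g s" "k \<le> s \<Longrightarrow> weak_dtheta g k (f 0) (f k)"
proof -
  have wd: "weak_dtheta g k (f 0) (f k)" if k: "k \<le> s" for k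
  proof (rule weak_dtheta_chain[OF L L[OF k]])
    show "AE w in lborel. g w \<noteq> 0 \<longrightarrow> (\<exists>F. smooth_chain k F \<and> F 0 = (\<lambda>x. f 0 x w) \<and> F k = (\<lambda>x. f k x w))"
      using chain
    proof eventually_elim
      fix w assume "g w \<noteq> 0 \<longrightarrow> smooth_chain s (\<lambda>k x. f k x w)"
      then show "g w \<noteq> 0 \<longrightarrow> (\<exists>F. smooth_chain k F \<and> F 0 = (\<lambda>x. f 0 x w) \<and> F k = (\<lambda>x. f k x w))"
        using k by (intro impI exI[of _ "\<lambda>k x. f k x w"]) auto
    qed
  qed simp
  then show "k \<le> s \<Longrightarrow> weak_dtheta g k (f 0) (f k)" .
  show "f 0 \<in> Hg g s" using wd per C L2g_measurable[OF L] by (auto simp: Hg_def)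
qed

text \<open>Differences of chains are chains, so the weak derivative selected in
  \<open>Hg_norm\<close> may be replaced by the explicit difference at each order; the norm is then
  a finite sum of controlled terms.\<close>

lemma continuous_in_Hg_from_chain:
  assumes s: "s \<ge> 1" and per: "\<And>t. t \<in> {0..<T} \<Longrightarrow> theta_periodic (f t 0)" and C: "\<And>t. t \<in> {0..<T} \<Longrightarrow> theta_C (s - 1) (f t 0)"
    and L: "\<And>t k. t \<in> {0..<T} \<Longrightarrow> k \<le> s \<Longrightarrow> f t k \<in> L2g g"
    and chain: "\<And>t. t \<in> {0..<T} \<Longrightarrow> AE w in lborel. g w \<noteq> 0 \<longrightarrow> smooth_chain s (\<lambda>k x. f t k x w)"
    and lim: "\<And>t k. t \<in> {0..<T} \<Longrightarrow> k \<le> s \<Longrightarrow> ((\<lambda>r. L2g_norm g (\<lambda>x w. f r k x w - f t k x w)) \<longlongrightarrow> 0) (at t within {0..<T})"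
  shows "continuous_in_Hg g s T (\<lambda>t. f t 0)"
  unfolding continuous_in_Hg_def
proof (intro ballI conjI)
  fix t assume t: "t \<in> {0..<T}"
  show "f t 0 \<in> Hg g s" by (rule Hg_from_chain(1)[OF s per[OF t] C[OF t] L[OF t] chain[OF t]])
  have wd: "weak_dtheta g k (\<lambda>x w. f r 0 x w - f t 0 x w) (\<lambda>x w. f r k x w - f t k x w)" if r: "r \<in> {0..<T}" and k: "k \<le> s" for r k
  proof (rule weak_dtheta_chain)
    show "AE w in lborel. g w \<noteq> 0 \<longrightarrow> (\<exists>F. smooth_chain k F \<and> F 0 = (\<lambda>x. f r 0 x w - f t 0 x w) \<and> F k = (\<lambda>x. f r k x w - f t k x w))"
      using chain[OF r] chain[OF t]
    proof eventually_elim
      fix w assume "g w \<noteq> 0 \<longrightarrow> smooth_chain s (\<lambda>k x. f r k x w)" "g w \<noteq> 0 \<longrightarrow> smooth_chain s (\<lambda>k x. f t k x w)"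
      then show "g w \<noteq> 0 \<longrightarrow> (\<exists>F. smooth_chain k F \<and> F 0 = (\<lambda>x. f r 0 x w - f t 0 x w) \<and> F k = (\<lambda>x. f r k x w - f t k x w))"
        using k by (intro impI exI[of _ "\<lambda>k x. f r k x w - f t k x w"]) (auto intro!: ac_diff)
    qed
  qed (use k in \<open>auto intro!: L2g_diff L r t\<close>)
  have ev: "\<forall>\<^sub>F r in at t within {0..<T}. r \<in> {0..<T}" by (simp add: eventually_at_filter)
  have "((\<lambda>r. sqrt (\<Sum>k\<le>s. (L2g_norm g (\<lambda>x w. f r k x w - f t k x w))\<^sup>2)) \<longlongrightarrow> sqrt (\<Sum>k\<le>s. 0\<^sup>2)) (at t within {0..<T})"
    by (intro tendsto_intros lim t) auto
  then have "((\<lambda>r. sqrt (\<Sum>k\<le>s. (L2g_norm g (\<lambda>x w. f r k x w - f t k x w))\<^sup>2)) \<longlongrightarrow> 0) (at t within {0..<T})" by simp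
  then show "((\<lambda>r. Hg_norm g s (\<lambda>x w. f r 0 x w - f t 0 x w)) \<longlongrightarrow> 0) (at t within {0..<T})"
  proof (rule Lim_transform_eventually)
    show "\<forall>\<^sub>F r in at t within {0..<T}. sqrt (\<Sum>k\<le>s. (L2g_norm g (\<lambda>x w. f r k x w - f t k x w))\<^sup>2) = Hg_norm g s (\<lambda>x w. f r 0 x w - f t 0 x w)"
      using ev by eventually_elim (auto simp: Hg_norm_def weak_dtheta_norm[OF wd] intro!: sum.cong)
  qed
qed

end

section \<open>Eulerian fields\<close>

locale kflow = kdata g m K rho0 u0 + fl: flow m K B z for g m K rho0 u0 B z
begin

definition lag :: "(par \<Rightarrow> real \<Rightarrow> real) \<Rightarrow> real \<Rightarrow> real \<Rightarrow> real \<Rightarrow> real" where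
  "lag F t x w = F (par x w) t"

abbreviation "jX \<equiv> lag fl.X"
abbreviation "jV \<equiv> lag fl.V"
abbreviation "jJ \<equiv> lag fl.J"
abbreviation "jW \<equiv> lag fl.W"
abbreviation "jY \<equiv> lag fl.Y"
abbreviation "jYd \<equiv> lag fl.Yd"

lemma lag_measurable: "cont2 F \<Longrightarrow> t \<ge> 0 \<Longrightarrow> cyl_measurable (lag F t)"
  unfolding lag_def[abs_def] by (rule par_measurable)

lemma par_path: "flow_path_per m K B z (\<lambda>x. u0 x w) (\<lambda>x. u1 x w) (\<lambda>x. u2 x w)"
  by unfold_locales (simp_all add: u0_deriv u1_deriv u2_cont data_periodic)

lemma lag_derivs:
  assumes t: "t \<ge> 0"
  shows "((\<lambda>x. jX t x w) has_real_derivative jJ t x w) (at x)" "((\<lambda>x. jV t x w) has_real_derivative jW t x w) (at x)"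
    "((\<lambda>x. jJ t x w) has_real_derivative jY t x w) (at x)" "((\<lambda>x. jW t x w) has_real_derivative jYd t x w) (at x)"
    "((\<lambda>x. lag fl.P t x w) has_real_derivative lag fl.P1 t x w) (at x)" "((\<lambda>x. lag fl.Pd t x w) has_real_derivative lag fl.P1d t x w) (at x)"
    "((\<lambda>x. lag fl.Q t x w) has_real_derivative lag fl.Q1 t x w) (at x)" "((\<lambda>x. lag fl.Qd t x w) has_real_derivative lag fl.Q1d t x w) (at x)"
proof -
  interpret p: flow_path_per m K B z "\<lambda>x. u0 x w" "\<lambda>x. u1 x w" "\<lambda>x. u2 x w" w by (rule par_path)
  have [simp]: "p.path x = par x w" for x by (simp add: p.path_def par_def)
  show "((\<lambda>x. jX t x w) has_real_derivative jJ t x w) (at x)" "((\<lambda>x. jV t x w) has_real_derivative jW t x w) (at x)"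
    "((\<lambda>x. jJ t x w) has_real_derivative jY t x w) (at x)" "((\<lambda>x. jW t x w) has_real_derivative jYd t x w) (at x)"
    "((\<lambda>x. lag fl.P t x w) has_real_derivative lag fl.P1 t x w) (at x)" "((\<lambda>x. lag fl.Pd t x w) has_real_derivative lag fl.P1d t x w) (at x)"
    "((\<lambda>x. lag fl.Q t x w) has_real_derivative lag fl.Q1 t x w) (at x)" "((\<lambda>x. lag fl.Qd t x w) has_real_derivative lag fl.Q1d t x w) (at x)"
    using p.X_deriv[OF t] p.V_deriv[OF t] p.J_deriv[OF t] p.W_deriv[OF t] p.P_deriv[OF t] p.Pd_deriv[OF t] p.Q_deriv[OF t] p.Qd_deriv[OF t]
    by (simp_all add: lag_def)
qed

lemma lag_per:
  assumes t: "t \<ge> 0"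
  shows "jX t (x + 2 * pi) w = jX t x w + 2 * pi" "jV t (x + 2 * pi) w = jV t x w" "jJ t (x + 2 * pi) w = jJ t x w"
    "jW t (x + 2 * pi) w = jW t x w" "jY t (x + 2 * pi) w = jY t x w" "jYd t (x + 2 * pi) w = jYd t x w"
    "lag fl.P1 t (x + 2 * pi) w = lag fl.P1 t x w" "lag fl.P1d t (x + 2 * pi) w = lag fl.P1d t x w"
    "lag fl.Q t (x + 2 * pi) w = lag fl.Q t x w" "lag fl.Qd t (x + 2 * pi) w = lag fl.Qd t x w"
    "lag fl.Q1 t (x + 2 * pi) w = lag fl.Q1 t x w" "lag fl.Q1d t (x + 2 * pi) w = lag fl.Q1d t x w"
proof -
  interpret p: flow_path_per m K B z "\<lambda>x. u0 x w" "\<lambda>x. u1 x w" "\<lambda>x. u2 x w" w by (rule par_path)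
  have [simp]: "p.path x = par x w" for x by (simp add: p.path_def par_def)
  show *: "jX t (x + 2 * pi) w = jX t x w + 2 * pi" "jV t (x + 2 * pi) w = jV t x w" "jJ t (x + 2 * pi) w = jJ t x w"
    "jW t (x + 2 * pi) w = jW t x w"
    "lag fl.P1 t (x + 2 * pi) w = lag fl.P1 t x w" "lag fl.P1d t (x + 2 * pi) w = lag fl.P1d t x w"
    "lag fl.Q t (x + 2 * pi) w = lag fl.Q t x w" "lag fl.Qd t (x + 2 * pi) w = lag fl.Qd t x w"
    "lag fl.Q1 t (x + 2 * pi) w = lag fl.Q1 t x w" "lag fl.Q1d t (x + 2 * pi) w = lag fl.Q1d t x w"
    using p.X_per[OF t, of x] p.V_per[OF t, of x] p.J_per[OF t, of x] p.W_per[OF t, of x] p.P1_per[OF t, of x] p.P1d_per[OF t, of x]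
      p.Q_per[OF t, of x] p.Qd_per[OF t, of x] p.Q1_per[OF t, of x] p.Q1d_per[OF t, of x] by (simp_all add: lag_def)
  show "jY t (x + 2 * pi) w = jY t x w" "jYd t (x + 2 * pi) w = jYd t x w"
    using p.P_per[OF t, of x] p.Pd_per[OF t, of x] p.Q_per[OF t, of x] p.Qd_per[OF t, of x] data_periodic(3)[of x w]
    by (simp_all add: lag_def fl.Y_def fl.Yd_def par_def)
qed

lemma lag_cont: "cont2 F \<Longrightarrow> continuous_on ({0..} \<times> UNIV) (\<lambda>p. lag F (fst p) (snd p) w)"
proof -
  assume F: "cont2 F"
  interpret p: flow_path_per m K B z "\<lambda>x. u0 x w" "\<lambda>x. u1 x w" "\<lambda>x. u2 x w" w by (rule par_path)
  have [simp]: "p.path x = par x w" for x by (simp add: p.path_def par_def)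
  have "continuous_on ({0..} \<times> UNIV) (\<lambda>q. (\<lambda>(x, t). F (p.path x) t) (snd q, fst q))"
    by (rule continuous_on_compose2[OF cont2_comp[OF F p.path_cont]]) (auto intro!: continuous_intros)
  then show ?thesis by (simp add: lag_def)
qed

lemma lag_tcont: "cont2 F \<Longrightarrow> continuous_on {0..} (\<lambda>t. lag F t x w)"
  unfolding lag_def by (rule cont2_slice)

lemma lag_xcont: "cont2 F \<Longrightarrow> t \<ge> 0 \<Longrightarrow> continuous_on UNIV (\<lambda>x. lag F t x w)"
proof -
  assume F: "cont2 F" and t: "t \<ge> 0"
  have "continuous_on UNIV (\<lambda>x. (\<lambda>p. lag F (fst p) (snd p) w) (t, x))"
    by (rule continuous_on_compose2[OF lag_cont[OF F]]) (use t in \<open>auto intro!: continuous_intros\<close>)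
  then show ?thesis by simp
qed

lemma lag_time_deriv:
  assumes "t > 0"
  shows "((\<lambda>t. jX t x w) has_real_derivative jV t x w) (at t)"
    "((\<lambda>t. jV t x w) has_real_derivative (w + K * Sf (z t) (jX t x w) - jV t x w) / m) (at t)"
    "((\<lambda>t. jJ t x w) has_real_derivative jW t x w) (at t)"
    "((\<lambda>t. jW t x w) has_real_derivative (- K * Al (z t) (jX t x w) * jJ t x w - jW t x w) / m) (at t)"
  using fl.time_deriv[OF assms, of "par x w"] by (simp_all add: lag_def par_def fl.al_def)

lemma lag_0: "jX 0 x w = x" "jV 0 x w = u0 x w" "jJ 0 x w = 1" "jW 0 x w = u1 x w"
  by (simp_all add: lag_def par_def)

text \<open>The density of \<open>Y\<close> in the starting point, by the product rule on
  \<open>P + Q * u2\<close>; the merely almost-everywhere function \<open>h3\<close> enters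
  linearly.\<close>

definition jZ where "jZ t x w = lag fl.P1 t x w + (lag fl.Q1 t x w * u2 x w + lag fl.Q t x w * h3 x w)"
definition jZd where "jZd t x w = lag fl.P1d t x w + (lag fl.Q1d t x w * u2 x w + lag fl.Qd t x w * h3 x w)"

lemma ac_jY:
  assumes t: "t \<ge> 0"
  shows "AE w in lborel. g w \<noteq> 0 \<longrightarrow> ac (\<lambda>x. jY t x w) (\<lambda>x. jZ t x w) \<and> ac (\<lambda>x. jYd t x w) (\<lambda>x. jZd t x w)"
  using ac_u2
proof (eventually_elim, intro impI)
  fix w assume u: "g w \<noteq> 0 \<longrightarrow> ac (\<lambda>x. u2 x w) (\<lambda>x. h3 x w)" and g: "g w \<noteq> 0"
  have y: "(\<lambda>x. jY t x w) = (\<lambda>x. lag fl.P t x w + lag fl.Q t x w * u2 x w)" "(\<lambda>x. jYd t x w) = (\<lambda>x. lag fl.Pd t x w + lag fl.Qd t x w * u2 x w)"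
    by (simp_all add: lag_def fl.Y_def fl.Yd_def par_def)
  show "ac (\<lambda>x. jY t x w) (\<lambda>x. jZ t x w) \<and> ac (\<lambda>x. jYd t x w) (\<lambda>x. jZd t x w)"
    unfolding y jZ_def jZd_def
    by (intro conjI ac_add ac_mult u[rule_format, OF g] ac_C1[OF lag_derivs(5)[OF t] lag_xcont[OF fl.P1_cont t]]
        ac_C1[OF lag_derivs(6)[OF t] lag_xcont[OF fl.P1d_cont t]] ac_C1[OF lag_derivs(7)[OF t] lag_xcont[OF fl.Q1_cont t]]
        ac_C1[OF lag_derivs(8)[OF t] lag_xcont[OF fl.Q1d_cont t]])
qed

lemma lag_bounds:
  "\<exists>C\<ge>1. \<forall>t\<in>{0..T}. \<forall>x w. \<bar>jJ t x w\<bar> \<le> C \<and> \<bar>jW t x w\<bar> \<le> C \<and> \<bar>jV t x w\<bar> \<le> C * S x w \<and>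
    \<bar>jY t x w\<bar> \<le> C * S x w \<and> \<bar>jYd t x w\<bar> \<le> C * S x w \<and> \<bar>jZ t x w\<bar> \<le> C * S x w \<and> \<bar>jZd t x w\<bar> \<le> C * S x w \<and>
    (jY t x w)\<^sup>2 \<le> C * S x w \<and> \<bar>jYd t x w * jY t x w\<bar> \<le> C * S x w \<and> \<bar>r1 x w * jY t x w\<bar> \<le> C * S x w"
proof -
  have "0 \<le> M" using M(1) by simp
  from fl.bounds[OF this, of T] obtain c where c: "c \<ge> 1" and b: "\<And>p t. \<bar>pa p\<bar> \<le> M \<Longrightarrow> t \<in> {0..T} \<Longrightarrow>
    \<bar>fl.J p t\<bar> \<le> c \<and> \<bar>fl.W p t\<bar> \<le> c \<and> \<bar>fl.Q p t\<bar> \<le> c \<and> \<bar>fl.Qd p t\<bar> \<le> c \<and> \<bar>fl.P p t\<bar> \<le> c \<and> \<bar>fl.Pd p t\<bar> \<le> c \<and>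
    \<bar>fl.Q1 p t\<bar> \<le> c \<and> \<bar>fl.Q1d p t\<bar> \<le> c \<and> \<bar>fl.P1 p t\<bar> \<le> c * (1 + \<bar>pb p\<bar>) \<and> \<bar>fl.P1d p t\<bar> \<le> c * (1 + \<bar>pb p\<bar>) \<and>
    \<bar>fl.V p t\<bar> \<le> c * (1 + \<bar>pv p\<bar> + \<bar>pw p\<bar>)" by blast
  show ?thesis
  \<comment> \<open>Products of two quantities growing like \<open>c * (1 + |u2|)\<close> cost
    \<open>c * c\<close>, and the square of \<open>1 + |u2|\<close> is at most \<open>4 * S\<close>;
    the linear bounds fit below the same constant.\<close>
  proof (intro exI[of _ "4 * (c * c)"] conjI ballI allI)
    have cc: "c \<le> c * c" "1 \<le> c * c" using c mult_mono[of 1 c 1 c] by auto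
    then show "1 \<le> 4 * (c * c)" by simp
    fix t x w assume t: "t \<in> {0..T}"
    have "\<bar>pa (par x w)\<bar> \<le> M" using M(2) by (simp add: par_def)
    note B = b[OF this t, simplified par_def, simplified, folded par_def]
    have BJ: "\<bar>jJ t x w\<bar> \<le> c" "\<bar>jW t x w\<bar> \<le> c" "\<bar>jV t x w\<bar> \<le> c * (1 + \<bar>u0 x w\<bar> + \<bar>w\<bar>)"
      using B by (simp_all add: lag_def)
    show "\<bar>jJ t x w\<bar> \<le> 4 * (c * c)" "\<bar>jW t x w\<bar> \<le> 4 * (c * c)" using BJ(1,2) cc by linarith+
    have S0: "S x w \<ge> 1" by (rule S_ge)
    have "c * (1 + \<bar>u0 x w\<bar> + \<bar>w\<bar>) \<le> c * S x w" using c S_ge(8) by (intro mult_left_mono) auto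
    then have Vb: "\<bar>jV t x w\<bar> \<le> c * S x w" by (rule order_trans[OF BJ(3)])
    have up: "r \<le> 4 * (c * c) * S x w" if "r \<le> c * S x w" for r
    proof -
      have "c * S x w \<le> 4 * (c * c) * S x w" using cc S0 c by (intro mult_right_mono) auto
      then show ?thesis using that by linarith
    qed
    show "\<bar>jV t x w\<bar> \<le> 4 * (c * c) * S x w" by (rule up[OF Vb])
    have Ysum: "\<bar>p + q * u2 x w\<bar> \<le> c * (1 + \<bar>u2 x w\<bar>)" if "\<bar>p\<bar> \<le> c" "\<bar>q\<bar> \<le> c" for p q
    proof -
      have "\<bar>q * u2 x w\<bar> \<le> c * \<bar>u2 x w\<bar>" unfolding abs_mult using that by (intro mult_right_mono) auto
      then show ?thesis using that abs_triangle_ineq[of p "q * u2 x w"] by (simp add: algebra_simps)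
    qed
    have Y: "\<bar>jY t x w\<bar> \<le> c * (1 + \<bar>u2 x w\<bar>)" "\<bar>jYd t x w\<bar> \<le> c * (1 + \<bar>u2 x w\<bar>)"
      using B Ysum by (simp_all add: lag_def fl.Y_def fl.Yd_def par_def)
    have u2S: "1 + \<bar>u2 x w\<bar> \<le> 2 * S x w" using S0 S_ge'(1)[of x w] by linarith
    have cS: "c * r \<le> c * (k * S x w)" if "r \<le> k * S x w" for r k using that c by (intro mult_left_mono) auto
    have c4: "c * (k * S x w) \<le> 4 * (c * c) * S x w" if "k \<le> 4" "0 \<le> k" for k
    proof -
      have "k * c \<le> 4 * (c * c)" using cc that c by (intro mult_mono) auto
      then have "k * c * S x w \<le> 4 * (c * c) * S x w" using S0 by (intro mult_right_mono) auto
      then show ?thesis by (simp add: mult_ac)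
    qed
    show "\<bar>jY t x w\<bar> \<le> 4 * (c * c) * S x w" "\<bar>jYd t x w\<bar> \<le> 4 * (c * c) * S x w"
      using Y cS[OF u2S] c4[of 2] by linarith+
    have Zb: "\<bar>p + (q * u2 x w + r * h3 x w)\<bar> \<le> 4 * (c * c) * S x w"
      if "\<bar>p\<bar> \<le> c * (1 + \<bar>u2 x w\<bar>)" "\<bar>q\<bar> \<le> c" "\<bar>r\<bar> \<le> c" for p q r
    proof -
      have 1: "\<bar>q * u2 x w\<bar> \<le> c * \<bar>u2 x w\<bar>" "\<bar>r * h3 x w\<bar> \<le> c * \<bar>h3 x w\<bar>" unfolding abs_mult using that by (intro mult_right_mono; simp)+
      have "\<bar>p + (q * u2 x w + r * h3 x w)\<bar> \<le> \<bar>p\<bar> + (\<bar>q * u2 x w\<bar> + \<bar>r * h3 x w\<bar>)"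
        by (rule order_trans[OF abs_triangle_ineq add_left_mono[OF abs_triangle_ineq]])
      also have "\<dots> \<le> c * (1 + \<bar>u2 x w\<bar>) + (c * \<bar>u2 x w\<bar> + c * \<bar>h3 x w\<bar>)" using that(1) 1 by (intro add_mono)
      also have "\<dots> = c * (1 + 2 * \<bar>u2 x w\<bar> + \<bar>h3 x w\<bar>)" by (simp add: algebra_simps)
      also have "\<dots> \<le> c * (4 * S x w)" using c S0 S_ge'(1)[of x w] S_ge(6)[of x w] by (intro mult_left_mono) auto
      finally show ?thesis using c4[of 4] by linarith
    qed
    show "\<bar>jZ t x w\<bar> \<le> 4 * (c * c) * S x w" "\<bar>jZd t x w\<bar> \<le> 4 * (c * c) * S x w"
      unfolding jZ_def jZd_def using B by (intro Zb; simp add: lag_def par_def)+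
    have sq: "(1 + \<bar>u2 x w\<bar>) * (1 + \<bar>u2 x w\<bar>) \<le> 4 * S x w"
    proof -
      have "0 \<le> (\<bar>u2 x w\<bar> - 1)\<^sup>2" by simp
      then have "(1 + \<bar>u2 x w\<bar>) * (1 + \<bar>u2 x w\<bar>) \<le> 2 + 2 * (u2 x w)\<^sup>2" by (simp add: power2_eq_square algebra_simps)
      then show ?thesis using S0 S_ge(4)[of x w] by linarith
    qed
    have prod: "\<bar>p * q\<bar> \<le> 4 * (c * c) * S x w" if "\<bar>p\<bar> \<le> c * (1 + \<bar>u2 x w\<bar>)" "\<bar>q\<bar> \<le> c * (1 + \<bar>u2 x w\<bar>)" for p q
    proof -
      have "\<bar>p * q\<bar> \<le> (c * (1 + \<bar>u2 x w\<bar>)) * (c * (1 + \<bar>u2 x w\<bar>))" unfolding abs_mult using that c by (intro mult_mono) auto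
      also have "\<dots> = (c * c) * ((1 + \<bar>u2 x w\<bar>) * (1 + \<bar>u2 x w\<bar>))" by (simp add: mult_ac)
      also have "\<dots> \<le> (c * c) * (4 * S x w)" using sq by (intro mult_left_mono) auto
      finally show ?thesis by simp
    qed
    show "(jY t x w)\<^sup>2 \<le> 4 * (c * c) * S x w" using prod[OF Y(1) Y(1)] by (simp add: power2_eq_square)
    show "\<bar>jYd t x w * jY t x w\<bar> \<le> 4 * (c * c) * S x w" by (rule prod[OF Y(2,1)])
    have "\<bar>r1 x w * jY t x w\<bar> \<le> \<bar>r1 x w\<bar> * (c * (1 + \<bar>u2 x w\<bar>))" unfolding abs_mult using Y by (intro mult_left_mono) auto
    also have "\<dots> = c * (\<bar>r1 x w\<bar> * (1 + \<bar>u2 x w\<bar>))" by simp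
    also have "\<dots> \<le> c * (4 * S x w)"
    proof (intro mult_left_mono)
      have "0 \<le> (\<bar>r1 x w\<bar> - (1 + \<bar>u2 x w\<bar>))\<^sup>2" by simp
      then have "2 * (\<bar>r1 x w\<bar> * (1 + \<bar>u2 x w\<bar>)) \<le> (r1 x w)\<^sup>2 + (1 + \<bar>u2 x w\<bar>) * (1 + \<bar>u2 x w\<bar>)"
        by (simp add: power2_eq_square algebra_simps)
      then show "\<bar>r1 x w\<bar> * (1 + \<bar>u2 x w\<bar>) \<le> 4 * S x w" using sq S_ge(5)[of x w] S0 by linarith
    qed (use c in auto)
    finally show "\<bar>r1 x w * jY t x w\<bar> \<le> 4 * (c * c) * S x w" using c4[of 4] by linarith
  qed
qed

text \<open>The starting point of the characteristic that is at \<open>x\<close> at time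
  \<open>t\<close>; it has this meaning while the flow map is invertible, as ensured in
  \<open>kpos\<close>.\<close>

definition xi where "xi t x w = inv (\<lambda>y. jX t y w) x"

text \<open>The \<open>k\<close>-th \<open>\<theta>\<close>-derivatives of the density and of the velocity, first as functions of
  the starting point of the characteristic, then of its end point.\<close>

definition GR :: "nat \<Rightarrow> real \<Rightarrow> real \<Rightarrow> real \<Rightarrow> real" where
  "GR k t x w = (if k = 0 then rho0 x w / jJ t x w else if k = 1 then D1 (rho0 x w) (r1 x w) (jJ t x w) (jY t x w)
     else D2 (rho0 x w) (r1 x w) (r2 x w) (jJ t x w) (jY t x w) (jZ t x w))"

definition GU :: "nat \<Rightarrow> real \<Rightarrow> real \<Rightarrow> real \<Rightarrow> real" where
  "GU k t x w = (if k = 0 then jV t x w else if k = 1 then jW t x w / jJ t x w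
     else if k = 2 then D1 (jW t x w) (jYd t x w) (jJ t x w) (jY t x w)
     else D2 (jW t x w) (jYd t x w) (jZd t x w) (jJ t x w) (jY t x w) (jZ t x w))"

definition fR where "fR t k x w = GR k t (xi t x w) w"
definition fU where "fU t k x w = GU k t (xi t x w) w"

lemma lagrange_cont_intros:
  "continuous_on ({0..} \<times> UNIV) (\<lambda>p. jX (fst p) (snd p) w)" "continuous_on ({0..} \<times> UNIV) (\<lambda>p. jV (fst p) (snd p) w)"
  "continuous_on ({0..} \<times> UNIV) (\<lambda>p. jJ (fst p) (snd p) w)" "continuous_on ({0..} \<times> UNIV) (\<lambda>p. jW (fst p) (snd p) w)"
  "continuous_on ({0..} \<times> UNIV) (\<lambda>p. jY (fst p) (snd p) w)" "continuous_on ({0..} \<times> UNIV) (\<lambda>p. jYd (fst p) (snd p) w)"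
  by (intro lag_cont fl.X_cont fl.V_cont fl.J_cont fl.W_cont fl.Y_cont fl.Yd_cont)+

lemma data_cont: "continuous_on UNIV (\<lambda>x. rho0 x w)" "continuous_on UNIV (\<lambda>x. r1 x w)"
  using rho0_deriv r1_cont by (auto intro!: continuous_at_imp_continuous_on DERIV_isCont)

end

text \<open>Positivity of \<open>J\<close> is required uniformly on the cylinder up to every time
  before \<open>T\<close>: in the noncompact frequency variable pointwise positivity would bound
  neither the density nor the slope of the velocity.\<close>

locale kpos = kflow g m K rho0 u0 B z for g m K rho0 u0 B z +
  fixes T :: real
  assumes Jpos: "\<And>\<tau>. 0 \<le> \<tau> \<Longrightarrow> \<tau> < T \<Longrightarrow> \<exists>e>0. \<forall>t\<in>{0..\<tau>}. \<forall>x w. jJ t x w \<ge> e"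
begin

lemma J_pos: "t \<in> {0..<T} \<Longrightarrow> jJ t x w > 0"
  using Jpos[of t] by (metis atLeastAtMost_iff atLeastLessThan_iff less_le_trans order_refl)

lemma xi_facts:
  assumes t: "t \<in> {0..<T}"
  shows "jX t (xi t x w) w = x" "xi t (jX t x w) w = x" "xi t x w \<le> a \<longleftrightarrow> x \<le> jX t a w"
    "((\<lambda>x. xi t x w) has_real_derivative 1 / jJ t (xi t x w) w) (at x)" "xi t (x + 2 * pi) w = xi t x w + 2 * pi"
proof -
  have t0: "t \<ge> 0" using t by simp
  obtain e where e: "e > 0" "\<And>x. jJ t x w \<ge> e" using Jpos[of t] t by auto
  note c = circle_lift[OF lag_derivs(1)[OF t0] e lag_per(1)[OF t0]]
  show 1: "jX t (xi t x w) w = x" unfolding xi_def by (rule c(1))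
  show "xi t (jX t x w) w = x" unfolding xi_def by (rule c(2))
  show "xi t x w \<le> a \<longleftrightarrow> x \<le> jX t a w" using c(4)[of "xi t x w" a] 1 by simp
  show "((\<lambda>x. xi t x w) has_real_derivative 1 / jJ t (xi t x w) w) (at x)"
    using c(5)[of x] by (simp add: xi_def[abs_def])
  show "xi t (x + 2 * pi) w = xi t x w + 2 * pi" unfolding xi_def by (rule c(6))
qed

lemma xi_cont: "continuous_on ({0..<T} \<times> UNIV) (\<lambda>p. xi (fst p) (snd p) w)"
  unfolding continuous_on_def
proof
  fix p assume p: "p \<in> {0..<T} \<times> (UNIV :: real set)"
  obtain t0 x0 where p0: "p = (t0, x0)" by (cases p)
  with p have t0: "t0 \<in> {0..<T}" by auto
  define \<tau> where "\<tau> = (t0 + T) / 2"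
  have tau: "0 \<le> \<tau>" "t0 < \<tau>" "\<tau> < T" using t0 by (auto simp: \<tau>_def)
  obtain e where e: "e > 0" "\<And>t x. t \<in> {0..\<tau>} \<Longrightarrow> jJ t x w \<ge> e" using Jpos[OF tau(1,3)] by auto
  define y0 where "y0 = xi t0 x0 w"
  \<comment> \<open>The expansion property at time \<open>t\<close> compares the moving preimage
    with the fixed point \<open>y0\<close>, so joint continuity of \<open>xi\<close> reduces to
    continuity in time of one trajectory.\<close>
  have b: "\<bar>xi t x w - y0\<bar> \<le> \<bar>x - jX t y0 w\<bar> / e" if t: "t \<in> {0..\<tau>}" for t x
  proof -
    have tt: "t \<ge> 0" "t \<in> {0..<T}" using t tau by auto
    have "e * \<bar>xi t x w - y0\<bar> \<le> \<bar>jX t (xi t x w) w - jX t y0 w\<bar>"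
      by (rule circle_lift(3)[OF lag_derivs(1)[OF tt(1)] e(1) e(2)[OF t] lag_per(1)[OF tt(1)]])
    then show ?thesis using e(1) by (simp add: xi_facts(1)[OF tt(2)] field_simps)
  qed
  have l: "((\<lambda>q. jX (fst q) y0 w) \<longlongrightarrow> jX t0 y0 w) (at p within {0..<T} \<times> UNIV)"
  proof -
    have "continuous_on ({0..<T} \<times> UNIV) (\<lambda>q. (\<lambda>q. jX (fst q) (snd q) w) (fst q, y0))"
      by (rule continuous_on_compose2[OF lagrange_cont_intros(1)]) (auto intro!: continuous_intros)
    then show ?thesis using p p0 unfolding continuous_on_def by auto
  qed
  have "((\<lambda>q. \<bar>snd q - jX (fst q) y0 w\<bar> / e) \<longlongrightarrow> \<bar>snd p - jX t0 y0 w\<bar> / e) (at p within {0..<T} \<times> UNIV)"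
    by (intro tendsto_intros l) (use e in auto)
  then have lim: "((\<lambda>q. \<bar>snd q - jX (fst q) y0 w\<bar> / e) \<longlongrightarrow> 0) (at p within {0..<T} \<times> UNIV)"
    using xi_facts(1)[OF t0, of x0 w] by (simp add: p0 y0_def)
  have "open ({..<\<tau>} \<times> (UNIV :: real set))" "p \<in> {..<\<tau>} \<times> UNIV" using p0 tau by (auto intro: open_Times)
  then have ev: "\<forall>\<^sub>F q in at p within {0..<T} \<times> UNIV. q \<in> {..<\<tau>} \<times> UNIV \<and> q \<in> {0..<T} \<times> UNIV"
    unfolding eventually_at_topological by (intro exI[of _ "{..<\<tau>} \<times> UNIV"]) auto
  have "((\<lambda>q. xi (fst q) (snd q) w - y0) \<longlongrightarrow> 0) (at p within {0..<T} \<times> UNIV)"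
    by (rule Lim_null_comparison[OF _ lim], use ev in eventually_elim) (auto intro!: b)
  then show "((\<lambda>q. xi (fst q) (snd q) w) \<longlongrightarrow> xi (fst p) (snd p) w) (at p within {0..<T} \<times> UNIV)"
    by (simp add: LIM_zero_iff p0 y0_def)
qed

lemma comp_xi_cont:
  assumes "continuous_on ({0..<T} \<times> UNIV) (\<lambda>p. F (fst p) (snd p))"
  shows "continuous_on ({0..<T} \<times> UNIV) (\<lambda>p. F (fst p) (xi (fst p) (snd p) w))"
proof -
  have "continuous_on ({0..<T} \<times> UNIV) (\<lambda>p. (\<lambda>p. F (fst p) (snd p)) (fst p, xi (fst p) (snd p) w))"
    by (rule continuous_on_compose2[OF assms]) (auto intro!: continuous_intros xi_cont)
  then show ?thesis by simp
qed

lemma slice_tcont: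
  assumes "continuous_on ({0..<T} \<times> UNIV) (\<lambda>p. F (fst p) (snd p))"
  shows "continuous_on {0..<T} (\<lambda>t. F t (x :: real))"
proof -
  have "continuous_on {0..<T} (\<lambda>t. (\<lambda>p. F (fst p) (snd p)) (t, x))"
    by (rule continuous_on_compose2[OF assms]) (auto intro!: continuous_intros)
  then show ?thesis by simp
qed

lemma slice_xcont:
  assumes "continuous_on ({0..<T} \<times> UNIV) (\<lambda>p. F (fst p) (snd p))" "t \<in> {0..<T}"
  shows "continuous_on UNIV (\<lambda>x. F t (x :: real))"
proof -
  have "continuous_on UNIV (\<lambda>x. (\<lambda>p. F (fst p) (snd p)) (t, x))"
    by (rule continuous_on_compose2[OF assms(1)]) (use assms(2) in \<open>auto intro!: continuous_intros\<close>)
  then show ?thesis by simp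
qed

text \<open>Monotonicity of the flow map describes the sublevel sets of \<open>xi\<close> through
  \<open>jX t a\<close>, which is measurable in the frequency.\<close>

lemma xi_measurable: assumes t: "t \<in> {0..<T}" shows "cyl_measurable (xi t)"
  unfolding cyl_measurable_def
proof (rule borel_measurableI_le)
  fix a
  have X: "cyl_measurable (jX t)" using lag_measurable[OF fl.X_cont] t by simp
  have [measurable]: "(\<lambda>p :: real \<times> real. jX t a (snd p)) \<in> borel_measurable borel"
    using cyl_measurable_snd[OF cyl_measurable_slice(2)[OF X, of a]] by (simp add: cyl_measurable_def case_prod_unfold)
  have "(\<lambda>p. fst p :: real) \<in> borel_measurable (borel :: (real \<times> real) measure)"
    by (intro borel_measurable_continuous_onI continuous_intros)
  from borel_measurable_le[OF this, of "\<lambda>p. jX t a (snd p)"]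
  have "{p \<in> space (borel :: (real \<times> real) measure). fst p \<le> jX t a (snd p)} \<in> sets borel" by measurable
  then show "{p \<in> space borel. (case p of (x, w) \<Rightarrow> xi t x w) \<le> a} \<in> sets borel"
    using xi_facts(3)[OF t] by (simp add: case_prod_unfold)
qed

lemma J_cont: "continuous_on ({0..<T} \<times> UNIV) (\<lambda>p. jJ (fst p) (snd p) w)"
  by (rule continuous_on_subset[OF lagrange_cont_intros(3)]) auto

lemma xi_diffeo: assumes t: "t \<in> {0..<T}" shows "cyl_diffeo (xi t) (\<lambda>x w. 1 / jJ t (xi t x w) w)"
  unfolding cyl_diffeo_def
proof (intro conjI allI)
  show "cyl_measurable (xi t)" by (rule xi_measurable[OF t])
  show "cyl_measurable (\<lambda>x w. 1 / jJ t (xi t x w) w)"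
    by (rule cyl_measurable_divide[OF cyl_measurable_const cyl_measurable_comp[OF lag_measurable[OF fl.J_cont] xi_measurable[OF t]]])
      (use t in simp)
  show "((\<lambda>x. xi t x w) has_real_derivative 1 / jJ t (xi t x w) w) (at x)" for x w by (rule xi_facts(4)[OF t])
  show "continuous_on UNIV (\<lambda>x. 1 / jJ t (xi t x w) w)" for w
    using J_pos[OF t] by (intro continuous_intros slice_xcont[OF comp_xi_cont[OF J_cont] t]) (auto simp: less_imp_neq[symmetric])
  show "0 \<le> 1 / jJ t (xi t x w) w" for x w using J_pos[OF t, of "xi t x w" w] by simp
  show "xi t (x + 2 * pi) w = xi t x w + 2 * pi" for x w by (rule xi_facts(5)[OF t])
qed

text \<open>The derivative \<open>1 / J\<close> of \<open>xi\<close> cancels the factor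
  \<open>J\<close>, turning derivatives in the starting point into derivatives in the end
  point.\<close>

lemma comp_xi_deriv:
  assumes "t \<in> {0..<T}" "((\<lambda>x. F x) has_real_derivative d * jJ t (xi t x w) w) (at (xi t x w))"
  shows "((\<lambda>x. F (xi t x w)) has_real_derivative d) (at x)"
  using DERIV_chain2[OF assms(2) xi_facts(4)[OF assms(1)]] J_pos[OF assms(1), of "xi t x w" w] by simp

lemma GR_deriv: "t \<in> {0..<T} \<Longrightarrow> ((\<lambda>x. GR 0 t x w) has_real_derivative GR 1 t x w * jJ t x w) (at x)"
  unfolding GR_def using quotient_deriv[OF rho0_deriv lag_derivs(3) J_pos] by simp

lemma GU_deriv: "t \<in> {0..<T} \<Longrightarrow> ((\<lambda>x. GU 0 t x w) has_real_derivative GU 1 t x w * jJ t x w) (at x)"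
  "t \<in> {0..<T} \<Longrightarrow> ((\<lambda>x. GU 1 t x w) has_real_derivative GU 2 t x w * jJ t x w) (at x)"
  unfolding GU_def using quotient_deriv[OF lag_derivs(4) lag_derivs(3) J_pos] lag_derivs(2)[of t w x] J_pos[of t x w] by auto

lemma fR_deriv: "t \<in> {0..<T} \<Longrightarrow> ((\<lambda>x. fR t 0 x w) has_real_derivative fR t 1 x w) (at x)"
  and fU_deriv: "t \<in> {0..<T} \<Longrightarrow> ((\<lambda>x. fU t 0 x w) has_real_derivative fU t 1 x w) (at x)"
    "t \<in> {0..<T} \<Longrightarrow> ((\<lambda>x. fU t 1 x w) has_real_derivative fU t 2 x w) (at x)"
  unfolding fR_def fU_def by (rule comp_xi_deriv, assumption, rule GR_deriv GU_deriv, assumption)+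

lemma D1_cont [continuous_intros]:
  "continuous_on A a \<Longrightarrow> continuous_on A b \<Longrightarrow> continuous_on A j \<Longrightarrow> continuous_on A y \<Longrightarrow> (\<And>x. x \<in> A \<Longrightarrow> j x \<noteq> 0) \<Longrightarrow>
   continuous_on A (\<lambda>x. D1 (a x) (b x) (j x) (y x))"
  unfolding D1_def by (intro continuous_intros) auto

lemma J_nz: "p \<in> {0..<T} \<times> UNIV \<Longrightarrow> jJ (fst p) (snd p) w \<noteq> 0"
  using J_pos[of "fst p" "snd p" w] by auto

lemma G_cont:
  shows "continuous_on ({0..<T} \<times> UNIV) (\<lambda>p. GR 0 (fst p) (snd p) w)" "continuous_on ({0..<T} \<times> UNIV) (\<lambda>p. GR 1 (fst p) (snd p) w)"
    "continuous_on ({0..<T} \<times> UNIV) (\<lambda>p. GU 0 (fst p) (snd p) w)" "continuous_on ({0..<T} \<times> UNIV) (\<lambda>p. GU 1 (fst p) (snd p) w)"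
    "continuous_on ({0..<T} \<times> UNIV) (\<lambda>p. GU 2 (fst p) (snd p) w)"
proof -
  have sub: "{0..<T} \<times> UNIV \<subseteq> {0..} \<times> (UNIV :: real set)" by auto
  note c = lagrange_cont_intros[THEN continuous_on_subset, OF sub]
  have d: "continuous_on ({0..<T} \<times> UNIV) (\<lambda>p. rho0 (snd p) w)" "continuous_on ({0..<T} \<times> UNIV) (\<lambda>p. r1 (snd p) w)"
    by (rule continuous_on_compose2[OF data_cont(1)] continuous_on_compose2[OF data_cont(2)]; auto intro!: continuous_intros)+
  show "continuous_on ({0..<T} \<times> UNIV) (\<lambda>p. GR 0 (fst p) (snd p) w)" "continuous_on ({0..<T} \<times> UNIV) (\<lambda>p. GR 1 (fst p) (snd p) w)"
    "continuous_on ({0..<T} \<times> UNIV) (\<lambda>p. GU 0 (fst p) (snd p) w)" "continuous_on ({0..<T} \<times> UNIV) (\<lambda>p. GU 1 (fst p) (snd p) w)"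
    "continuous_on ({0..<T} \<times> UNIV) (\<lambda>p. GU 2 (fst p) (snd p) w)"
    unfolding GR_def GU_def by (simp_all, (intro continuous_intros c d ballI J_nz; assumption)+)
qed

lemma f_cont:
  "continuous_on ({0..<T} \<times> UNIV) (\<lambda>p. fR (fst p) 0 (snd p) w)" "continuous_on ({0..<T} \<times> UNIV) (\<lambda>p. fR (fst p) 1 (snd p) w)"
  "continuous_on ({0..<T} \<times> UNIV) (\<lambda>p. fU (fst p) 0 (snd p) w)" "continuous_on ({0..<T} \<times> UNIV) (\<lambda>p. fU (fst p) 1 (snd p) w)"
  "continuous_on ({0..<T} \<times> UNIV) (\<lambda>p. fU (fst p) 2 (snd p) w)"
  unfolding fR_def fU_def
  by (rule comp_xi_cont[OF G_cont(1)] comp_xi_cont[OF G_cont(2)] comp_xi_cont[OF G_cont(3)] comp_xi_cont[OF G_cont(4)] comp_xi_cont[OF G_cont(5)])+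

lemma G_per:
  assumes t: "t \<in> {0..<T}"
  shows "GR k t (x + 2 * pi) w = GR k t x w" "GU k t (x + 2 * pi) w = GU k t x w"
  using t by (simp_all add: GR_def GU_def lag_per data_periodic jZ_def jZd_def)

lemma f_per:
  assumes t: "t \<in> {0..<T}"
  shows "fR t k (x + 2 * pi) w = fR t k x w" "fU t k (x + 2 * pi) w = fU t k x w"
  by (simp_all add: fR_def fU_def xi_facts(5)[OF t] G_per[OF t])

lemma comp_xi_ac:
  assumes t: "t \<in> {0..<T}" and "ac F (\<lambda>x. d x * jJ t x w)"
  shows "ac (\<lambda>x. F (xi t x w)) (\<lambda>x. d (xi t x w))"
proof -
  have k: "continuous_on UNIV (\<lambda>x. 1 / jJ t (xi t x w) w)" "\<And>x. 0 \<le> 1 / jJ t (xi t x w) w"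
    using xi_diffeo[OF t] unfolding cyl_diffeo_def by auto
  have nz: "jJ t x w \<noteq> 0" for x using J_pos[OF t, of x w] by simp
  from ac_comp[OF assms(2) xi_facts(4)[OF t] k] show ?thesis by (simp add: nz)
qed

lemma f_chain:
  assumes t: "t \<in> {0..<T}"
  shows "AE w in lborel. g w \<noteq> 0 \<longrightarrow> smooth_chain 2 (\<lambda>k x. fR t k x w)"
    "AE w in lborel. g w \<noteq> 0 \<longrightarrow> smooth_chain 3 (\<lambda>k x. fU t k x w)"
proof -
  have t0: "t \<ge> 0" using t by simp
  have p: "fR t k (2 * pi) w = fR t k 0 w" "fU t k (2 * pi) w = fU t k 0 w" for k w
    using f_per[OF t, of k 0 w] by simp_all
  have a: "ac (\<lambda>x. fR t 0 x w) (\<lambda>x. fR t (Suc 0) x w)" "ac (\<lambda>x. fU t 0 x w) (\<lambda>x. fU t (Suc 0) x w)" "ac (\<lambda>x. fU t (Suc 0) x w) (\<lambda>x. fU t 2 x w)" for w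
    using ac_C1[OF fR_deriv[OF t] slice_xcont[OF f_cont(2) t]] ac_C1[OF fU_deriv(1)[OF t] slice_xcont[OF f_cont(4) t]]
      ac_C1[OF fU_deriv(2)[OF t] slice_xcont[OF f_cont(5) t]] by simp_all
  show "AE w in lborel. g w \<noteq> 0 \<longrightarrow> smooth_chain 2 (\<lambda>k x. fR t k x w)"
    using ac_jY[OF t0] ac_r1
  proof (eventually_elim, intro impI)
    fix w assume "g w \<noteq> 0 \<longrightarrow> ac (\<lambda>x. jY t x w) (\<lambda>x. jZ t x w) \<and> ac (\<lambda>x. jYd t x w) (\<lambda>x. jZd t x w)"
      "g w \<noteq> 0 \<longrightarrow> ac (\<lambda>x. r1 x w) (\<lambda>x. r2 x w)" "g w \<noteq> 0"
    then have "ac (\<lambda>x. GR 1 t x w) (\<lambda>x. GR 2 t x w * jJ t x w)"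
      using D1_ac[OF rho0_deriv _ lag_derivs(3)[OF t0] _ J_pos[OF t]] by (simp add: GR_def)
    from comp_xi_ac[OF t this] have "ac (\<lambda>x. fR t (Suc 0) x w) (\<lambda>x. fR t 2 x w)" by (simp add: fR_def)
    then show "smooth_chain 2 (\<lambda>k x. fR t k x w)" using a(1) p by (auto simp: numeral_2_eq_2 less_Suc_eq)
  qed
  show "AE w in lborel. g w \<noteq> 0 \<longrightarrow> smooth_chain 3 (\<lambda>k x. fU t k x w)"
    using ac_jY[OF t0]
  proof (eventually_elim, intro impI)
    fix w assume "g w \<noteq> 0 \<longrightarrow> ac (\<lambda>x. jY t x w) (\<lambda>x. jZ t x w) \<and> ac (\<lambda>x. jYd t x w) (\<lambda>x. jZd t x w)" "g w \<noteq> 0"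
    then have "ac (\<lambda>x. GU 2 t x w) (\<lambda>x. GU 3 t x w * jJ t x w)"
      using D1_ac[OF lag_derivs(4)[OF t0] _ lag_derivs(3)[OF t0] _ J_pos[OF t]] by (simp add: GU_def)
    from comp_xi_ac[OF t this] have "ac (\<lambda>x. fU t 2 x w) (\<lambda>x. fU t 3 x w)" by (simp add: fU_def)
    then show "smooth_chain 3 (\<lambda>k x. fU t k x w)" using a(2,3) p by (auto simp: numeral_2_eq_2 numeral_3_eq_3 less_Suc_eq)
  qed
qed

lemma G_bounds:
  assumes tau: "0 \<le> \<tau>" "\<tau> < T"
  shows "\<exists>C\<ge>0. \<forall>t\<in>{0..\<tau>}. \<forall>x w k. \<bar>GR k t x w\<bar> \<le> C * S x w \<and> \<bar>GU k t x w\<bar> \<le> C * S x w"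
proof -
  obtain e where e: "e > 0" "\<And>t x w. t \<in> {0..\<tau>} \<Longrightarrow> jJ t x w \<ge> e" using Jpos[OF tau] by auto
  obtain c where c: "c \<ge> 1" and b: "\<And>t x w. t \<in> {0..\<tau>} \<Longrightarrow> \<bar>jJ t x w\<bar> \<le> c \<and> \<bar>jW t x w\<bar> \<le> c \<and> \<bar>jV t x w\<bar> \<le> c * S x w \<and>
    \<bar>jY t x w\<bar> \<le> c * S x w \<and> \<bar>jYd t x w\<bar> \<le> c * S x w \<and> \<bar>jZ t x w\<bar> \<le> c * S x w \<and> \<bar>jZd t x w\<bar> \<le> c * S x w \<and>
    (jY t x w)\<^sup>2 \<le> c * S x w \<and> \<bar>jYd t x w * jY t x w\<bar> \<le> c * S x w \<and> \<bar>r1 x w * jY t x w\<bar> \<le> c * S x w"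
    using lag_bounds[of \<tau>] by blast
  define N where "N = c + M"
  have N: "N \<ge> 0" "c \<le> N" "M \<le> N" "1 \<le> N" using c M(1) by (auto simp: N_def)
  define A1 where "A1 = N / e"
  define A2 where "A2 = N / e\<^sup>2 + N * N / e ^ 3"
  define A3 where "A3 = N / e ^ 3 + 3 * N / e ^ 4 + N * N / e ^ 4 + 3 * (N * N) / e ^ 5"
  have A: "A1 \<ge> 0" "A2 \<ge> 0" "A3 \<ge> 0" using N e by (auto simp: A1_def A2_def A3_def intro!: add_nonneg_nonneg)
  show ?thesis
  proof (intro exI[of _ "A1 + A2 + A3 + N"] conjI ballI allI)
    show "0 \<le> A1 + A2 + A3 + N" using A N by simp
    fix t x w and k :: nat assume t: "t \<in> {0..\<tau>}"
    have S0: "S x w \<ge> 1" by (rule S_ge)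
    have up: "r \<le> N * S x w" if "r \<le> c * S x w" for r
    proof -
      have "c * S x w \<le> N * S x w" using N S0 by (intro mult_right_mono) auto
      then show ?thesis using that by linarith
    qed
    have up1: "r \<le> N * S x w" if "r \<le> S x w" for r
    proof -
      have "1 * S x w \<le> N * S x w" using N S0 by (intro mult_right_mono) auto
      then show ?thesis using that by linarith
    qed
    have fin: "r \<le> (A1 + A2 + A3 + N) * S x w" if "r \<le> q * S x w" "q \<le> A1 + A2 + A3 + N" for r q
    proof -
      have "q * S x w \<le> (A1 + A2 + A3 + N) * S x w" using that(2) S0 by (intro mult_right_mono) auto
      then show ?thesis using that(1) by linarith
    qed
    note B = b[OF t, of x w]
    have 1: "\<bar>rho0 x w\<bar> \<le> N" using M(3)[of x w] N by linarith
    note R = D_bounds[OF S0 N(1) e(1) e(2)[OF t] 1 up1[OF S_ge'(2)] up1[OF S_ge(7)], of "jY t x w" "jZ t x w"]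
    have R': "\<bar>rho0 x w / jJ t x w\<bar> \<le> A1 * S x w" "\<bar>D1 (rho0 x w) (r1 x w) (jJ t x w) (jY t x w)\<bar> \<le> A2 * S x w"
      "\<bar>D2 (rho0 x w) (r1 x w) (r2 x w) (jJ t x w) (jY t x w) (jZ t x w)\<bar> \<le> A3 * S x w"
      unfolding A1_def A2_def A3_def using R B up by blast+
    show "\<bar>GR k t x w\<bar> \<le> (A1 + A2 + A3 + N) * S x w"
      unfolding GR_def using fin[OF R'(1)] fin[OF R'(2)] fin[OF R'(3)] A N by auto
    have 2: "\<bar>jW t x w\<bar> \<le> N" by (rule order_trans[OF _ N(2)]) (use B in blast)
    note U = D_bounds[OF S0 N(1) e(1) e(2)[OF t] 2, of "jYd t x w" "jZd t x w" "jY t x w" "jZ t x w"]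
    have U': "\<bar>jW t x w / jJ t x w\<bar> \<le> A1 * S x w" "\<bar>D1 (jW t x w) (jYd t x w) (jJ t x w) (jY t x w)\<bar> \<le> A2 * S x w"
      "\<bar>D2 (jW t x w) (jYd t x w) (jZd t x w) (jJ t x w) (jY t x w) (jZ t x w)\<bar> \<le> A3 * S x w"
      unfolding A1_def A2_def A3_def using U B up by blast+
    have U0: "\<bar>jV t x w\<bar> \<le> N * S x w" using B up by blast
    have "N \<le> A1 + A2 + A3 + N" "A1 \<le> A1 + A2 + A3 + N" "A2 \<le> A1 + A2 + A3 + N" "A3 \<le> A1 + A2 + A3 + N" using A N by auto
    note F = fin[OF U0 this(1)] fin[OF U'(1) this(2)] fin[OF U'(2) this(3)] fin[OF U'(3) this(4)]
    show "\<bar>GU k t x w\<bar> \<le> (A1 + A2 + A3 + N) * S x w"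
      unfolding GU_def by (split if_split)+ (use F in blast)
  qed
qed

lemma G_measurable: "t \<ge> 0 \<Longrightarrow> cyl_measurable (GR k t)" "t \<ge> 0 \<Longrightarrow> cyl_measurable (GU k t)"
proof -
  assume t: "t \<ge> 0"
  note l = lag_measurable[OF _ t]
  have Z: "cyl_measurable (jZ t)" "cyl_measurable (jZd t)"
    unfolding jZ_def[abs_def] jZd_def[abs_def]
    by (intro cyl_measurable_add cyl_measurable_mult data_measurable l fl.P1_cont fl.Q1_cont fl.Q_cont fl.P1d_cont fl.Q1d_cont fl.Qd_cont)+
  note I = cyl_measurable_mult cyl_measurable_add cyl_measurable_diff cyl_measurable_divide cyl_measurable_power cyl_measurable_const
    data_measurable Z l fl.J_cont fl.W_cont fl.Y_cont fl.Yd_cont fl.V_cont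
  show "cyl_measurable (GR k t)"
  proof (cases "k = 0")
    case False
    show ?thesis using False by (cases "k = 1") (simp_all add: GR_def[abs_def] D1_def D2_def, (intro I)+)
  qed (simp add: GR_def[abs_def], intro I)
  consider "k = 0" | "k = 1" | "k = 2" | "k \<noteq> 0" "k \<noteq> 1" "k \<noteq> 2" by blast
  then show "cyl_measurable (GU k t)"
    by cases (simp_all add: GU_def[abs_def] D1_def D2_def, (intro I)+)
qed

lemma G_tcont:
  assumes s: "s \<in> {0..<T}" and A: "A \<subseteq> {0..}"
  shows "((\<lambda>t. GR k t x w) \<longlongrightarrow> GR k s x w) (at s within A)" "((\<lambda>t. GU k t x w) \<longlongrightarrow> GU k s x w) (at s within A)"
proof -
  have l: "((\<lambda>t. lag F t x w) \<longlongrightarrow> lag F s x w) (at s within A)" if "cont2 F" for F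
    using continuous_on_subset[OF lag_tcont[OF that] A] lag_tcont[OF that, of x w] s A
    by (auto simp: continuous_on_def intro: tendsto_within_subset)
  have nz: "jJ s x w \<noteq> 0" using J_pos[OF s, of x w] by simp
  have Z: "((\<lambda>t. jZ t x w) \<longlongrightarrow> jZ s x w) (at s within A)" "((\<lambda>t. jZd t x w) \<longlongrightarrow> jZd s x w) (at s within A)"
    unfolding jZ_def jZd_def
    by (intro tendsto_intros l fl.P1_cont fl.Q1_cont fl.Q_cont fl.P1d_cont fl.Q1d_cont fl.Qd_cont)+
  show "((\<lambda>t. GR k t x w) \<longlongrightarrow> GR k s x w) (at s within A)"
    by (cases "k = 0"; cases "k = 1") (simp_all add: GR_def D1_def D2_def,
      (intro tendsto_intros l fl.J_cont fl.Y_cont Z nz; simp add: nz)+)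
  consider "k = 0" | "k = 1" | "k = 2" | "k \<noteq> 0" "k \<noteq> 1" "k \<noteq> 2" by blast
  then show "((\<lambda>t. GU k t x w) \<longlongrightarrow> GU k s x w) (at s within A)"
    by cases (simp_all add: GU_def D1_def D2_def,
      (intro tendsto_intros l fl.J_cont fl.Y_cont fl.Yd_cont fl.V_cont fl.W_cont Z nz; simp add: nz)+)
qed

text \<open>An upper bound on \<open>J\<close> keeps the Jacobian of \<open>xi\<close> away from
  zero, as the composition estimates in the weighted norm require.\<close>

lemma xi_lower:
  assumes tau: "0 \<le> \<tau>" "\<tau> < T"
  shows "\<exists>c>0. \<forall>t\<in>{0..\<tau>}. \<forall>x w. 1 / jJ t (xi t x w) w \<ge> c"
proof -
  obtain c where c: "c \<ge> 1" and b: "\<And>t x w. t \<in> {0..\<tau>} \<Longrightarrow> \<bar>jJ t x w\<bar> \<le> c"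
    using lag_bounds[of \<tau>] by blast
  show ?thesis
  proof (intro exI[of _ "1 / c"] conjI ballI allI)
    fix t x w assume t: "t \<in> {0..\<tau>}"
    then have "t \<in> {0..<T}" using tau by auto
    from J_pos[OF this, of "xi t x w" w] b[OF t, of "xi t x w" w] c
    show "1 / c \<le> 1 / jJ t (xi t x w) w" by (intro divide_left_mono) auto
  qed (use c in auto)
qed

lemma f_L2g:
  assumes t: "t \<in> {0..<T}"
  shows "fR t k \<in> L2g g" "fU t k \<in> L2g g"
proof -
  have tt: "0 \<le> t" "t < T" using t by auto
  obtain C where C: "C \<ge> 0" "\<And>x w k. \<bar>GR k t x w\<bar> \<le> C * S x w \<and> \<bar>GU k t x w\<bar> \<le> C * S x w"
    using G_bounds[OF tt] tt by auto
  obtain c where c: "c > 0" "\<And>x w. 1 / jJ t (xi t x w) w \<ge> c" using xi_lower[OF tt] tt by auto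
  have E: "integrable cyl (\<lambda>(x, w). (C\<^sup>2 * (S x w)\<^sup>2) * g w)"
    using integrable_mult_right[OF S_integrable, of "C\<^sup>2"] by (simp add: case_prod_unfold mult.assoc)
  have L: "(\<lambda>x w. F (xi t x w) w) \<in> L2g g"
    if Fm: "cyl_measurable F" and Fp: "\<And>x w. F (x + 2 * pi) w = F x w" and Fb: "\<And>x w. \<bar>F x w\<bar> \<le> C * S x w" for F
  proof -
    have m2: "cyl_measurable (\<lambda>x w. (F x w)\<^sup>2)" by (rule cyl_measurable_power[OF Fm])
    have i: "integrable cyl (\<lambda>(x, w). (F x w)\<^sup>2 * g w)"
    proof (rule integrable_weight_bound[OF E m2])
      show "\<bar>(F x w)\<^sup>2\<bar> \<le> C\<^sup>2 * (S x w)\<^sup>2" for x w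
        using power_mono[OF Fb, of x w 2] by (simp add: power_mult_distrib)
    qed
    have "integrable cyl (\<lambda>(x, w). (F (xi t x w) w)\<^sup>2 * g w)"
      using cyl_subst_bound(1)[OF m2 _ i xi_diffeo[OF t] c] Fp by simp
    then show ?thesis using cyl_measurable_comp[OF Fm xi_measurable[OF t]] by (simp add: L2g_def)
  qed
  show "fR t k \<in> L2g g" "fU t k \<in> L2g g"
    unfolding fR_def[abs_def] fU_def[abs_def]
    using L[OF G_measurable(1)[OF tt(1)] G_per(1)[OF t]] L[OF G_measurable(2)[OF tt(1)] G_per(2)[OF t]] C(2) by blast+
qed

lemma f_L2_cont:
  assumes s: "s \<in> {0..<T}"
  shows "((\<lambda>r. L2g_norm g (\<lambda>x w. fR r k x w - fR s k x w)) \<longlongrightarrow> 0) (at s within {0..<T})"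
    "((\<lambda>r. L2g_norm g (\<lambda>x w. fU r k x w - fU s k x w)) \<longlongrightarrow> 0) (at s within {0..<T})"
proof -
  \<comment> \<open>A compact interval reaching beyond \<open>s\<close> but not to \<open>T\<close>:
    the uniform bounds hold there and limits at \<open>s\<close> are unaffected.\<close>
  define \<tau> where "\<tau> = (s + T) / 2"
  have tau: "0 \<le> \<tau>" "s < \<tau>" "\<tau> < T" using s by (auto simp: \<tau>_def)
  have eq: "at s within {0..<T} = at s within {0..\<tau>}"
    by (rule at_within_nhd[of _ "{..<\<tau>}"]) (use tau s in auto)
  have sub: "t \<in> {0..<T}" "t \<ge> 0" if "t \<in> {0..\<tau>}" for t using that tau by auto
  obtain C where C: "C \<ge> 0" "\<And>t x w k. t \<in> {0..\<tau>} \<Longrightarrow> \<bar>GR k t x w\<bar> \<le> C * S x w \<and> \<bar>GU k t x w\<bar> \<le> C * S x w"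
    using G_bounds[OF tau(1,3)] by auto
  obtain c where c: "c > 0" "\<And>t x w. t \<in> {0..\<tau>} \<Longrightarrow> 1 / jJ t (xi t x w) w \<ge> c" using xi_lower[OF tau(1,3)] by auto
  have E: "integrable cyl (\<lambda>(x, w). (C\<^sup>2 * (S x w)\<^sup>2) * g w)"
    using integrable_mult_right[OF S_integrable, of "C\<^sup>2"] by (simp add: case_prod_unfold mult.assoc)
  have sq: "(GR k t x w)\<^sup>2 \<le> C\<^sup>2 * (S x w)\<^sup>2" "(GU k t x w)\<^sup>2 \<le> C\<^sup>2 * (S x w)\<^sup>2" if "t \<in> {0..\<tau>}" for t x w
    using C(2)[OF that, of k x w] power_mono[of "\<bar>GR k t x w\<bar>" "C * S x w" 2] power_mono[of "\<bar>GU k t x w\<bar>" "C * S x w" 2]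
    by (simp_all add: power_mult_distrib)
  have xl: "((\<lambda>t. xi t x w) \<longlongrightarrow> xi s x w) (at s within {0..\<tau>})" for x w
    using slice_tcont[OF xi_cont, of x w] s unfolding eq[symmetric] continuous_on_def by blast
  have sA: "s \<in> {0..\<tau>}" using s tau by auto
  have A: "{0..\<tau>} \<subseteq> {0..}" by auto
  have tr: "((\<lambda>t. L2g_norm g (\<lambda>x w. H t (xi t x w) w - H s (xi s x w) w)) \<longlongrightarrow> 0) (at s within {0..\<tau>})"
    if H: "\<And>t. t \<in> {0..\<tau>} \<Longrightarrow> cyl_measurable (H t)" "\<And>t x w. t \<in> {0..\<tau>} \<Longrightarrow> H t (x + 2 * pi) w = H t x w"
      "\<And>x w. ((\<lambda>t. H t x w) \<longlongrightarrow> H s x w) (at s within {0..\<tau>})" "\<And>t x w. t \<in> {0..\<tau>} \<Longrightarrow> (H t x w)\<^sup>2 \<le> C\<^sup>2 * (S x w)\<^sup>2" for H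
    by (rule transport_L2_continuous[OF H(1-3) _ E xi_diffeo[OF sub(1)] c(2) c(1) xl sA]) (assumption | rule H(4))+
  show "((\<lambda>r. L2g_norm g (\<lambda>x w. fR r k x w - fR s k x w)) \<longlongrightarrow> 0) (at s within {0..<T})"
    unfolding eq fR_def by (rule tr[OF G_measurable(1)[OF sub(2)] G_per(1)[OF sub(1)] G_tcont(1)[OF s A] sq(1)])
  show "((\<lambda>r. L2g_norm g (\<lambda>x w. fU r k x w - fU s k x w)) \<longlongrightarrow> 0) (at s within {0..<T})"
    unfolding eq fU_def by (rule tr[OF G_measurable(2)[OF sub(2)] G_per(2)[OF sub(1)] G_tcont(2)[OF s A] sq(2)])
qed

end

section \<open>Mean field of a transported density\<close>

context kflow
begin

text \<open>Change of variables along the flow. The density \<open>r\<close> is arbitrary apart from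
  carrying the initial mass, because the same computation is used for the constructed solution and
  for a competing one.\<close>

lemma mf_eq_integral:
  assumes t: "t \<ge> 0" and h: "h \<in> borel_measurable borel" "\<And>x. h (x + 2 * pi) = h x" "\<And>x. \<bar>h x\<bar> \<le> 1"
    and r: "cyl_measurable r" "\<And>x w. r (x + 2 * pi) w = r x w" "\<And>x w. \<bar>r x w\<bar> \<le> C"
    and J: "\<And>x w. jJ t x w \<ge> 0" and rJ: "\<And>x w. r (jX t x w) w * jJ t x w = rho0 x w"
  shows "(\<integral>(x, w). rho0 x w * h (jX t x w) * g w \<partial>cyl) = (\<integral>(x, w). h x * r x w * g w \<partial>cyl)"
proof -
  have d: "cyl_diffeo (jX t) (jJ t)"
    unfolding cyl_diffeo_def using lag_measurable[OF fl.X_cont t] lag_measurable[OF fl.J_cont t] lag_derivs(1)[OF t]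
      lag_xcont[OF fl.J_cont t] J lag_per(1)[OF t] by blast
  have m: "cyl_measurable (\<lambda>x w. h x * r x w)" by (rule cyl_measurable_mult[OF cyl_measurable_fst[OF h(1)] r(1)])
  have "\<bar>h x * r x w\<bar> \<le> C" for x w
  proof -
    have "\<bar>h x * r x w\<bar> \<le> 1 * \<bar>r x w\<bar>" unfolding abs_mult using h(3) by (intro mult_right_mono) auto
    then show ?thesis using r(3)[of x w] by simp
  qed
  from cyl_subst(2)[OF m _ integrable_bounded_weight[OF m this] d] h(2) r(2)
  have "(\<integral>(x, w). h x * r x w * g w \<partial>cyl) = (\<integral>(x, w). h (jX t x w) * r (jX t x w) w * jJ t x w * g w \<partial>cyl)" by simp
  also have "\<dots> = (\<integral>(x, w). rho0 x w * h (jX t x w) * g w \<partial>cyl)"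
    by (simp add: rJ mult.assoc mult.commute[of "rho0 _ _"])
  finally show ?thesis by simp
qed

lemma mf_parts:
  assumes t: "t \<ge> 0"
  shows "Re (mf z t) = (\<integral>(x, w). rho0 x w * cos (jX t x w) * g w \<partial>cyl)"
    "Im (mf z t) = (\<integral>(x, w). rho0 x w * sin (jX t x w) * g w \<partial>cyl)"
  using integral_Re[OF mf_integrable[OF fl.flow_axioms t]] integral_Im[OF mf_integrable[OF fl.flow_axioms t]]
  by (simp_all add: mf_def lag_def case_prod_unfold mult_ac)

lemma mf_of_density:
  assumes t: "t \<ge> 0" and r: "cyl_measurable r" "\<And>x w. r (x + 2 * pi) w = r x w" "\<And>x w. \<bar>r x w\<bar> \<le> C"
    and J: "\<And>x w. jJ t x w \<ge> 0" and rJ: "\<And>x w. r (jX t x w) w * jJ t x w = rho0 x w"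
  shows "Re (mf z t) = (\<integral>(x, w). cos x * r x w * g w \<partial>cyl)" "Im (mf z t) = (\<integral>(x, w). sin x * r x w * g w \<partial>cyl)"
  unfolding mf_parts[OF t] by (rule mf_eq_integral[OF t _ _ _ r J rJ]; simp)+

end

context weight
begin

text \<open>The addition formula for the sine reduces the convolution in the momentum equation to
  two moments.\<close>

lemma sin_moment:
  assumes r: "cyl_measurable r" "\<And>x w. \<bar>r x w\<bar> \<le> C"
    and c: "Re c = (\<integral>(x, w). cos x * r x w * g w \<partial>cyl)" "Im c = (\<integral>(x, w). sin x * r x w * g w \<partial>cyl)"
  shows "(\<integral>(x, w). sin (x - y) * r x w * g w \<partial>cyl) = Sf c y"
proof -
  have i: "integrable cyl (\<lambda>(x, w). h x * r x w * g w)" if h: "h \<in> borel_measurable borel" "\<And>x. \<bar>h x\<bar> \<le> 1" for h :: "real \<Rightarrow> real"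
  proof (rule integrable_bounded_weight[OF cyl_measurable_mult[OF cyl_measurable_fst[OF h(1)] r(1)]])
    fix x w
    have "\<bar>h x * r x w\<bar> \<le> 1 * \<bar>r x w\<bar>" unfolding abs_mult using h(2) by (intro mult_right_mono) auto
    then show "\<bar>h x * r x w\<bar> \<le> C" using r(2)[of x w] by simp
  qed
  have i1: "integrable cyl (\<lambda>(x, w). sin x * r x w * g w)" and i2: "integrable cyl (\<lambda>(x, w). cos x * r x w * g w)"
    by (rule i; simp)+
  have "(\<integral>(x, w). sin (x - y) * r x w * g w \<partial>cyl)
      = (\<integral>p. cos y * (case p of (x, w) \<Rightarrow> sin x * r x w * g w) - sin y * (case p of (x, w) \<Rightarrow> cos x * r x w * g w) \<partial>cyl)"
    by (intro Bochner_Integration.integral_cong) (auto simp: sin_diff algebra_simps)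
  also have "\<dots> = cos y * Im c - sin y * Re c"
    using i1 i2 by (subst Bochner_Integration.integral_diff) (simp_all add: c)
  finally show ?thesis by (simp add: Sf_eq mult.commute)
qed

end

section \<open>The Eulerian fields solve the system\<close>

context kpos
begin

lemma f_dtheta:
  assumes t: "t \<in> {0..<T}"
  shows "dtheta (fR t 0) = fR t 1" "dtheta (fU t 0) = fU t 1" "dtheta (fU t 1) = fU t 2"
  using DERIV_imp_deriv[OF fR_deriv[OF t]] DERIV_imp_deriv[OF fU_deriv(1)[OF t]] DERIV_imp_deriv[OF fU_deriv(2)[OF t]]
  by (simp_all add: dtheta_def fun_eq_iff)

lemma f_bounds:
  assumes tau: "0 \<le> \<tau>" "\<tau> < T"
  shows "\<exists>C. \<forall>t\<in>{0..\<tau>}. \<forall>x w. \<bar>fR t 0 x w\<bar> \<le> C \<and> \<bar>fU t 1 x w\<bar> \<le> C"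
proof -
  obtain e where e: "e > 0" "\<And>t x w. t \<in> {0..\<tau>} \<Longrightarrow> jJ t x w \<ge> e" using Jpos[OF tau] by auto
  obtain c where c: "c \<ge> 1" and b: "\<And>t x w. t \<in> {0..\<tau>} \<Longrightarrow> \<bar>jW t x w\<bar> \<le> c" using lag_bounds[of \<tau>] by blast
  have q: "\<bar>a / jJ t x w\<bar> \<le> (c + M) / e" if "t \<in> {0..\<tau>}" "\<bar>a\<bar> \<le> c + M" for a t x w
  proof -
    have "\<bar>a / jJ t x w\<bar> = \<bar>a\<bar> / jJ t x w" using e(1) e(2)[OF that(1), of x w] by (simp add: abs_divide)
    also have "\<dots> \<le> (c + M) / e" using that e(1) e(2)[OF that(1), of x w] by (intro frac_le) auto
    finally show ?thesis .
  qed
  show ?thesis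
  proof (intro exI[of _ "(c + M) / e"] ballI allI conjI)
    fix t x w assume t: "t \<in> {0..\<tau>}"
    show "\<bar>fR t 0 x w\<bar> \<le> (c + M) / e" unfolding fR_def GR_def using q[OF t, of "rho0 (xi t x w) w" "xi t x w" w] M(3)[of "xi t x w" w] c by simp
    show "\<bar>fU t 1 x w\<bar> \<le> (c + M) / e" unfolding fU_def GU_def using q[OF t, of "jW t (xi t x w) w" "xi t x w" w] b[OF t, of "xi t x w" w] M(1) by simp
  qed
qed

lemma f_locally_Linf: "locally_Linf T (\<lambda>t. fR t 0)" "locally_Linf T (\<lambda>t. fU t 1)"
  unfolding locally_Linf_def Linf_def using f_bounds L2g_measurable[OF f_L2g(1)] L2g_measurable[OF f_L2g(2)]
  by (auto; meson atLeastAtMost_iff order_refl)+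

text \<open>Implicit differentiation of \<open>jX t (xi t x w) w = x\<close> in time.\<close>

lemma xi_t_deriv:
  assumes t: "t \<in> {0<..<T}"
  shows "((\<lambda>t. xi t x w) has_real_derivative - jV t (xi t x w) w / jJ t (xi t x w) w) (at t)"
proof (rule DERIV_implicit[where f = "\<lambda>t y. jX t y w" and fy = "\<lambda>t y. jJ t y w" and S = "{0<..<T}" and a = x])
  show "continuous_on ({0<..<T} \<times> UNIV) (\<lambda>(t, y). jJ t y w)"
    unfolding case_prod_unfold by (rule continuous_on_subset[OF J_cont]) auto
  show "((\<lambda>s. jX s (xi t x w) w) has_real_derivative jV t (xi t x w) w) (at t)" using lag_time_deriv(1) t by simp
  show "isCont (\<lambda>t. xi t x w) t"
    using continuous_on_interior[OF slice_tcont[OF xi_cont, of x w], of t] t by simp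
  show "jX s (xi s x w) w = x" if "s \<in> {0<..<T}" for s using xi_facts(1)[of s x w] that by simp
  show "jJ t (xi t x w) w \<noteq> 0" using J_pos[of t "xi t x w" w] t by simp
  show "((\<lambda>y. jX s y w) has_real_derivative jJ s y w) (at y)" if "s \<in> {0<..<T}" for s y using lag_derivs(1)[of s w y] that by simp
qed (use t in auto)

text \<open>At a fixed end point the starting point moves with velocity \<open>- V / J\<close>;
  derivatives in the starting point carry a factor \<open>J\<close>, which cancels and leaves the
  advection term.\<close>

lemma f_t_deriv:
  assumes t: "t \<in> {0<..<T}"
  shows "((\<lambda>t. fR t 0 x w) has_real_derivative - (fR t 1 x w * fU t 0 x w + fR t 0 x w * fU t 1 x w)) (at t)"
    "((\<lambda>t. fU t 0 x w) has_real_derivative (w - fU t 0 x w + K * Sf (z t) x) / m - fU t 0 x w * fU t 1 x w) (at t)"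
proof -
  let ?y = "xi t x w"
  have t': "t \<in> {0..<T}" "t > 0" using t by auto
  have J: "jJ t ?y w > 0" by (rule J_pos[OF t'(1)])
  have sub: "{0<..<T} \<times> UNIV \<subseteq> {0..<T} \<times> (UNIV :: real set)" by auto
  have "((\<lambda>s. GR 0 s (xi s x w) w) has_real_derivative
      - rho0 ?y w * jW t ?y w / (jJ t ?y w * jJ t ?y w) + GR 1 t ?y w * jJ t ?y w * (- jV t ?y w / jJ t ?y w)) (at t)"
  proof (rule DERIV_along_curve[where f = "\<lambda>t y. GR 0 t y w" and fy = "\<lambda>t y. GR 1 t y w * jJ t y w" and S = "{0<..<T}"])
    show "continuous_on ({0<..<T} \<times> UNIV) (\<lambda>(t, y). GR 1 t y w * jJ t y w)"
      using continuous_on_subset[OF continuous_on_mult[OF G_cont(2) J_cont] sub, of w w] by (simp add: case_prod_unfold)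
    have "((\<lambda>s. rho0 ?y w / jJ s ?y w) has_real_derivative (0 * jJ t ?y w - rho0 ?y w * jW t ?y w) / (jJ t ?y w * jJ t ?y w)) (at t)"
      using J by (intro DERIV_divide DERIV_const lag_time_deriv t') simp
    then show "((\<lambda>s. GR 0 s ?y w) has_real_derivative - rho0 ?y w * jW t ?y w / (jJ t ?y w * jJ t ?y w)) (at t)"
      by (simp add: GR_def)
  qed (use t xi_t_deriv GR_deriv in auto)
  then show "((\<lambda>t. fR t 0 x w) has_real_derivative - (fR t 1 x w * fU t 0 x w + fR t 0 x w * fU t 1 x w)) (at t)"
    using J by (simp add: fR_def fU_def GU_def GR_def[of 0] add.commute)
  have "((\<lambda>s. GU 0 s (xi s x w) w) has_real_derivative
      (w + K * Sf (z t) (jX t ?y w) - jV t ?y w) / m + GU 1 t ?y w * jJ t ?y w * (- jV t ?y w / jJ t ?y w)) (at t)"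
  proof (rule DERIV_along_curve[where f = "\<lambda>t y. GU 0 t y w" and fy = "\<lambda>t y. GU 1 t y w * jJ t y w" and S = "{0<..<T}"])
    show "continuous_on ({0<..<T} \<times> UNIV) (\<lambda>(t, y). GU 1 t y w * jJ t y w)"
      using continuous_on_subset[OF continuous_on_mult[OF G_cont(4) J_cont] sub, of w w] by (simp add: case_prod_unfold)
    show "((\<lambda>s. GU 0 s ?y w) has_real_derivative (w + K * Sf (z t) (jX t ?y w) - jV t ?y w) / m) (at t)"
      using lag_time_deriv(2)[OF t'(2)] by (simp add: GU_def)
  qed (use t xi_t_deriv GU_deriv(1) in auto)
  moreover have "(w + K * Sf (z t) (jX t ?y w) - jV t ?y w) / m + GU 1 t ?y w * jJ t ?y w * (- jV t ?y w / jJ t ?y w)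
      = (w - fU t 0 x w + K * Sf (z t) x) / m - fU t 0 x w * fU t 1 x w"
    using J unfolding xi_facts(1)[OF t'(1)] by (simp add: fU_def GU_def add.commute add_diff_eq diff_add_eq)
  ultimately show "((\<lambda>t. fU t 0 x w) has_real_derivative (w - fU t 0 x w + K * Sf (z t) x) / m - fU t 0 x w * fU t 1 x w) (at t)"
    by (simp add: fU_def)
qed

lemma f_pointwise_regular: "pointwise_regular T (\<lambda>t. fR t 0)" "pointwise_regular T (\<lambda>t. fU t 0)"
proof -
  have c: "continuous_on ({0..<T} \<times> UNIV) (\<lambda>(t, x). dtheta (fR t 0) x w)" "continuous_on ({0..<T} \<times> UNIV) (\<lambda>(t, x). dtheta (fU t 0) x w)" for w
    by (rule continuous_on_eq[OF f_cont(2)] continuous_on_eq[OF f_cont(4)]; auto simp: f_dtheta)+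
  show "pointwise_regular T (\<lambda>t. fR t 0)" "pointwise_regular T (\<lambda>t. fU t 0)"
    unfolding pointwise_regular_def using f_cont(1,3) c f_t_deriv real_differentiable_def
    by (auto simp: case_prod_unfold; meson greaterThanLessThan_iff real_differentiable_def)+
qed

lemma f_continuous_in_Hg: "continuous_in_Hg g 2 T (\<lambda>t. fR t 0)" "continuous_in_Hg g 3 T (\<lambda>t. fU t 0)"
proof -
  have per: "theta_periodic (fR t 0)" "theta_periodic (fU t 0)" if "t \<in> {0..<T}" for t
    using f_per[OF that] by (simp_all add: theta_periodic_def)
  have C: "theta_C (2 - 1) (fR t 0)" "theta_C (3 - 1) (fU t 0)" if t: "t \<in> {0..<T}" for t
  proof -
    have "(\<lambda>x. fR t 0 x w) differentiable (at x)" "(\<lambda>x. fU t 0 x w) differentiable (at x)" "(\<lambda>x. fU t 1 x w) differentiable (at x)" for x w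
      using fR_deriv[OF t, of w x] fU_deriv[OF t, of w x] unfolding real_differentiable_def by blast+
    then show "theta_C (2 - 1) (fR t 0)" "theta_C (3 - 1) (fU t 0)"
      using slice_xcont[OF f_cont(2) t] slice_xcont[OF f_cont(5) t]
      by (auto simp: theta_C_def less_Suc_eq numeral_2_eq_2 numeral_3_eq_3 f_dtheta[OF t, simplified])
  qed
  show "continuous_in_Hg g 2 T (\<lambda>t. fR t 0)"
    by (rule continuous_in_Hg_from_chain[where f = fR, OF _ per(1) C(1) f_L2g(1) f_chain(1) f_L2_cont(1)]) auto
  show "continuous_in_Hg g 3 T (\<lambda>t. fU t 0)"
    by (rule continuous_in_Hg_from_chain[where f = fU, OF _ per(2) C(2) f_L2g(2) f_chain(2) f_L2_cont(2)]) auto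
qed

lemma eulerian_strong_solution:
  assumes T: "T > 0" and mfz: "\<And>t. t \<in> {0..<T} \<Longrightarrow> mf z t = z t"
  shows "strong_solution g m K rho0 u0 T (\<lambda>t. fR t 0) (\<lambda>t. fU t 0)"
  unfolding strong_solution_def
proof (intro conjI)
  have "xi 0 x w = x" for x w using xi_facts(2)[of 0 x w] T by (simp add: lag_0)
  then show "fR 0 0 = rho0" "fU 0 0 = u0" by (simp_all add: fR_def fU_def GR_def GU_def lag_0 fun_eq_iff)
  show "locally_Linf T (\<lambda>t. dtheta (fU t 0))"
    using f_locally_Linf(2) unfolding locally_Linf_def by (auto simp: f_dtheta)
  show "continuity_eq T (\<lambda>t. fR t 0) (\<lambda>t. fU t 0)"
    unfolding continuity_eq_def
  proof (intro ballI allI)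
    fix t x w assume t: "t \<in> {0<..<T}"
    then have t': "t \<in> {0..<T}" by auto
    have "((\<lambda>x. fR t 0 x w * fU t 0 x w) has_real_derivative fR t 1 x w * fU t 0 x w + fR t 0 x w * fU t 1 x w) (at x)"
      by (rule DERIV_cong[OF DERIV_mult[OF fR_deriv[OF t'] fU_deriv(1)[OF t']]]) simp
    then show "deriv (\<lambda>r. fR r 0 x w) t + dtheta (\<lambda>x w. fR t 0 x w * fU t 0 x w) x w = 0"
      unfolding dtheta_def using DERIV_imp_deriv[OF f_t_deriv(1)[OF t]] by (simp add: DERIV_imp_deriv)
  qed
  show "momentum_eq g m K T (\<lambda>t. fR t 0) (\<lambda>t. fU t 0)"
    unfolding momentum_eq_def
  proof (intro ballI allI)
    fix t x w assume t: "t \<in> {0<..<T}"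
    then have t': "t \<in> {0..<T}" "t \<ge> 0" "t < T" by auto
    obtain C where "\<forall>s\<in>{0..t}. \<forall>x w. \<bar>fR s 0 x w\<bar> \<le> C \<and> \<bar>fU s 1 x w\<bar> \<le> C" using f_bounds[OF t'(2,3)] by blast
    then have C: "\<bar>fR t 0 x w\<bar> \<le> C" for x w using t' by auto
    \<comment> \<open>Conservation of mass in Lagrangian form. Together with the fixed-point
      property it identifies the integral in the momentum equation with the field that generated the
      flow.\<close>
    have rJ: "fR t 0 (jX t x w) w * jJ t x w = rho0 x w" for x w
      using J_pos[OF t'(1), of x w] by (simp add: fR_def GR_def xi_facts(2)[OF t'(1)])
    note fm = L2g_measurable[OF f_L2g(1)[OF t'(1)]]
    have Sfz: "(\<integral>(x', w'). sin (x' - x) * fR t 0 x' w' * g w' \<partial>cyl) = Sf (z t) x"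
      by (rule sin_moment[OF fm C])
        (use mf_of_density[OF t'(2) fm f_per(1)[OF t'(1)] C less_imp_le[OF J_pos[OF t'(1)]] rJ] mfz[OF t'(1)] in simp_all)
    have "((\<lambda>x. fR t 0 x w * (fU t 0 x w)\<^sup>2) has_real_derivative fR t 1 x w * (fU t 0 x w)\<^sup>2 + fR t 0 x w * (2 * fU t 0 x w * fU t 1 x w)) (at x)"
      by (auto intro!: derivative_eq_intros fR_deriv fU_deriv t')
    then have d1: "dtheta (\<lambda>x w. fR t 0 x w * (fU t 0 x w)\<^sup>2) x w = fR t 1 x w * (fU t 0 x w)\<^sup>2 + fR t 0 x w * (2 * fU t 0 x w * fU t 1 x w)"
      unfolding dtheta_def by (rule DERIV_imp_deriv)
    have d2: "deriv (\<lambda>r. fR r 0 x w * fU r 0 x w) t = - (fR t 1 x w * fU t 0 x w + fR t 0 x w * fU t 1 x w) * fU t 0 x w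
      + ((w - fU t 0 x w + K * Sf (z t) x) / m - fU t 0 x w * fU t 1 x w) * fR t 0 x w"
      by (rule DERIV_imp_deriv[OF DERIV_mult[OF f_t_deriv(1)[OF t] f_t_deriv(2)[OF t]]])
    show "deriv (\<lambda>r. fR r 0 x w * fU r 0 x w) t + dtheta (\<lambda>x w. fR t 0 x w * (fU t 0 x w)\<^sup>2) x w
      = 1 / m * (- fR t 0 x w * fU t 0 x w + fR t 0 x w * w + K * fR t 0 x w * (\<integral>(x', w'). sin (x' - x) * fR t 0 x' w' * g w' \<partial>cyl))"
      unfolding d1 d2 Sfz using kdata_axioms by (simp add: field_simps power2_eq_square)
  qed
qed (rule f_continuous_in_Hg f_locally_Linf f_pointwise_regular)+

end

section \<open>Comparison for the linearised characteristics\<close>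

lemma first_zero:
  fixes f :: "real \<Rightarrow> real"
  assumes c: "continuous_on {0..} f" and f0: "f 0 > 0" and t: "t \<ge> 0" "f t \<le> 0"
  shows "\<exists>s\<in>{0<..t}. f s = 0 \<and> (\<forall>r\<in>{0..<s}. f r > 0)"
proof -
  define Z where "Z = {0..t} \<inter> f -` {..0}"
  have "closed Z" unfolding Z_def
    by (rule continuous_closed_preimage) (auto intro: continuous_on_subset[OF c])
  moreover have Z: "Z \<noteq> {}" "bdd_below Z" using t by (auto simp: Z_def)
  ultimately have s: "Inf Z \<in> Z" by (metis closed_contains_Inf)
  have before: "f r > 0" if "r \<in> {0..<Inf Z}" for r
    using that s cInf_lower[OF _ Z(2), of r] by (fastforce simp: Z_def not_le[symmetric])
  have "f (Inf Z) = 0"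
  proof -
    have "\<exists>r\<ge>0. r \<le> Inf Z \<and> f r = 0"
      by (rule IVT2') (use s f0 in \<open>auto simp: Z_def intro: continuous_on_subset[OF c]\<close>)
    then obtain r where "0 \<le> r" "r \<le> Inf Z" "f r = 0" by blast
    then show ?thesis using before[of r] by (cases "r = Inf Z") auto
  qed
  moreover have "Inf Z \<noteq> 0" using s f0 by (auto simp: Z_def)
  ultimately show ?thesis using s before by (intro bexI[of _ "Inf Z"]) (auto simp: Z_def)
qed

text \<open>\<open>D^2 * exp (- 2 * L * t)\<close> is nonincreasing, nonnegative, and zero
  initially.\<close>

lemma zero_of_linear_ode:
  fixes D b :: "real \<Rightarrow> real"
  assumes c: "continuous_on {0..T} D" and D0: "D 0 = 0"
    and d: "\<And>t. 0 < t \<Longrightarrow> t < T \<Longrightarrow> (D has_real_derivative b t * D t) (at t)" and b: "\<And>t. 0 < t \<Longrightarrow> t < T \<Longrightarrow> b t \<le> L"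
    and t: "t \<in> {0..T}"
  shows "D t = 0"
proof -
  have "- (D 0)\<^sup>2 * exp (- 2 * L * 0) \<le> - (D t)\<^sup>2 * exp (- 2 * L * t)"
  proof (rule DERIV_nonneg_imp_increasing_open[where f = "\<lambda>s. - (D s)\<^sup>2 * exp (- 2 * L * s)"])
    show "continuous_on {0..t} (\<lambda>s. - (D s)\<^sup>2 * exp (- 2 * L * s))"
      by (intro continuous_intros continuous_on_subset[OF c]) (use t in auto)
    fix s assume s: "0 < s" "s < t"
    then have s': "s < T" using t by auto
    have "((\<lambda>s. - (D s)\<^sup>2 * exp (- 2 * L * s)) has_real_derivative 2 * (L - b s) * (D s)\<^sup>2 * exp (- 2 * L * s)) (at s)"
      by (auto intro!: derivative_eq_intros d s s' simp: algebra_simps power2_eq_square)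
    moreover have "0 \<le> 2 * (L - b s) * (D s)\<^sup>2 * exp (- 2 * L * s)" using b[OF s(1) s'] by simp
    ultimately show "\<exists>y. ((\<lambda>s. - (D s)\<^sup>2 * exp (- 2 * L * s)) has_real_derivative y) (at s) \<and> 0 \<le> y" by blast
  qed (use t in auto)
  then have "(D t)\<^sup>2 * exp (- 2 * L * t) \<le> 0" using D0 by simp
  then have "(D t)\<^sup>2 \<le> 0" by (simp add: mult_le_0_iff)
  then show ?thesis by simp
qed

text \<open>The combination \<open>W + l J\<close> with \<open>l\<close> a root of \<open>m l\<^sup>2 - l \<plusminus> K\<close> removes \<open>W\<close> from the
  linearised characteristic system up to a multiple of itself, leaving a signed multiple of \<open>J\<close>.\<close>

lemma riccati_subcritical:
  fixes J W a :: "real \<Rightarrow> real"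
  assumes m: "m > 0" and K: "K > 0" and c: "continuous_on {0..} J" "continuous_on {0..} W"
    and dJ: "\<And>t. t > 0 \<Longrightarrow> (J has_real_derivative W t) (at t)"
    and dW: "\<And>t. t > 0 \<Longrightarrow> (W has_real_derivative (- K * a t * J t - W t) / m) (at t)"
    and a: "\<And>t. t > 0 \<Longrightarrow> a t \<le> 1" and J0: "J 0 = 1" and W0: "W 0 + l \<ge> 0"
    and l: "K = l - m * l\<^sup>2" and t: "t \<ge> 0"
  shows "J t \<ge> exp (- l * t)"
proof -
  \<comment> \<open>With the root \<open>l\<close>, the sum \<open>E = W + l * J\<close> satisfies
    \<open>E' = - q * E + K / m * (1 - a) * J\<close>; the factor \<open>exp (q * t)\<close>
    therefore makes it nondecreasing while \<open>J > 0\<close>.\<close>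
  define q where "q = 1 / m - l"
  have c': "continuous_on {0..s} J" "continuous_on {0..s} W" for s using c by (auto intro: continuous_on_subset)
  have lower: "1 \<le> J t * exp (l * t)" if t: "t \<ge> 0" and pos: "\<And>s. s \<in> {0..<t} \<Longrightarrow> J s > 0" for t
  proof -
    have E: "W s + l * J s \<ge> 0" if s: "s \<in> {0..t}" for s
    proof -
      have "(W 0 + l * J 0) * exp (q * 0) \<le> (W s + l * J s) * exp (q * s)"
      proof (rule DERIV_nonneg_imp_increasing_open[where f = "\<lambda>r. (W r + l * J r) * exp (q * r)"])
        show "continuous_on {0..s} (\<lambda>r. (W r + l * J r) * exp (q * r))" by (intro continuous_intros c')
        fix r assume r: "0 < r" "r < s"
        have e: "(- K * a r * J r - W r) / m + l * W r + q * (W r + l * J r) = K / m * (1 - a r) * J r"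
          unfolding q_def l using m by (simp add: field_simps power2_eq_square)
        have "((\<lambda>r. (W r + l * J r) * exp (q * r)) has_real_derivative
            ((- K * a r * J r - W r) / m + l * W r + q * (W r + l * J r)) * exp (q * r)) (at r)"
          using r by (auto intro!: derivative_eq_intros dJ dW simp: algebra_simps)
        moreover have "0 \<le> K / m * (1 - a r) * J r * exp (q * r)" using m K a[OF r(1)] pos[of r] r s by simp
        ultimately show "\<exists>y. ((\<lambda>r. (W r + l * J r) * exp (q * r)) has_real_derivative y) (at r) \<and> 0 \<le> y" unfolding e by blast
      qed (use s in auto)
      then have "0 \<le> (W s + l * J s) * exp (q * s)" using J0 W0 by simp
      then show ?thesis by (simp add: zero_le_mult_iff)
    qed
    have "J 0 * exp (l * 0) \<le> J t * exp (l * t)"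
    proof (rule DERIV_nonneg_imp_increasing_open[where f = "\<lambda>r. J r * exp (l * r)"])
      show "continuous_on {0..t} (\<lambda>r. J r * exp (l * r))" by (intro continuous_intros c')
      fix r assume r: "0 < r" "r < t"
      have "((\<lambda>r. J r * exp (l * r)) has_real_derivative (W r + l * J r) * exp (l * r)) (at r)"
        using r by (auto intro!: derivative_eq_intros dJ simp: algebra_simps)
      moreover have "0 \<le> (W r + l * J r) * exp (l * r)" using E[of r] r by simp
      ultimately show "\<exists>y. ((\<lambda>r. J r * exp (l * r)) has_real_derivative y) (at r) \<and> 0 \<le> y" by blast
    qed (use t in auto)
    then show ?thesis using J0 by simp
  qed
  \<comment> \<open>At a first zero the bound \<open>lower\<close>, which uses positivity strictly
    before that time only, would read \<open>1 <= 0\<close>.\<close>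
  have "J s > 0" if "s \<ge> 0" for s
  proof (rule ccontr)
    assume "\<not> J s > 0"
    with first_zero[OF c(1) _ that] J0 obtain r where r: "r > 0" "J r = 0" "\<And>s. s \<in> {0..<r} \<Longrightarrow> J s > 0" by auto
    from lower[of r] r show False by simp
  qed
  from lower[OF t this] show ?thesis by (simp add: exp_minus field_simps)
qed

text \<open>If \<open>J\<close> never vanished, \<open>W + l * J\<close> would stay below its
  negative initial value, so \<open>J\<close> would decrease at least linearly and reach zero in
  finite time.\<close>

lemma riccati_supercritical:
  fixes J W a :: "real \<Rightarrow> real"
  assumes m: "m > 0" and K: "K > 0" and c: "continuous_on {0..} J" "continuous_on {0..} W"
    and dJ: "\<And>t. t > 0 \<Longrightarrow> (J has_real_derivative W t) (at t)"
    and dW: "\<And>t. t > 0 \<Longrightarrow> (W has_real_derivative (- K * a t * J t - W t) / m) (at t)"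
    and a: "\<And>t. t > 0 \<Longrightarrow> - 1 \<le> a t" and J0: "J 0 = 1" and W0: "W 0 + l < 0"
    and l: "K = m * l\<^sup>2 - l" "l > 0"
  shows "\<exists>t\<ge>0. J t \<le> 0"
proof (rule ccontr)
  assume "\<not> ?thesis"
  then have pos: "J t > 0" if "t \<ge> 0" for t using that by auto
  define q where "q = l - 1 / m"
  have "l * (m * l - 1) > 0" using K l(1) by (simp add: algebra_simps power2_eq_square)
  then have "m * l > 1" using l(2) by (simp add: zero_less_mult_iff)
  then have q: "q > 0" using m by (simp add: q_def field_simps)
  have c': "continuous_on {0..s} J" "continuous_on {0..s} W" for s using c by (auto intro: continuous_on_subset)
  define E0 where "E0 = W 0 + l"
  have E: "W s + l * J s \<le> E0" if s: "s \<ge> 0" for s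
  proof -
    have "- ((W 0 + l * J 0) * exp (- q * 0)) \<le> - ((W s + l * J s) * exp (- q * s))"
    proof (rule DERIV_nonneg_imp_increasing_open[where f = "\<lambda>r. - ((W r + l * J r) * exp (- q * r))"])
      show "continuous_on {0..s} (\<lambda>r. - ((W r + l * J r) * exp (- q * r)))" by (intro continuous_intros c')
      fix r assume r: "0 < r" "r < s"
      have e: "- ((- K * a r * J r - W r) / m + l * W r - q * (W r + l * J r)) = K / m * (1 + a r) * J r"
        unfolding q_def l(1) using m by (simp add: field_simps power2_eq_square)
      have "((\<lambda>r. - ((W r + l * J r) * exp (- q * r))) has_real_derivative
          - ((- K * a r * J r - W r) / m + l * W r - q * (W r + l * J r)) * exp (- q * r)) (at r)"
        using r by (auto intro!: derivative_eq_intros dJ dW simp: algebra_simps)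
      moreover have "0 \<le> K / m * (1 + a r) * J r * exp (- q * r)" using m K a[OF r(1)] pos[of r] r s by simp
      ultimately show "\<exists>y. ((\<lambda>r. - ((W r + l * J r) * exp (- q * r))) has_real_derivative y) (at r) \<and> 0 \<le> y" unfolding e by blast
    qed (use s in auto)
    then have "(W s + l * J s) * exp (- q * s) \<le> E0" using J0 by (simp add: E0_def)
    then have "W s + l * J s \<le> E0 * exp (q * s)" by (simp add: exp_minus field_simps)
    also have "\<dots> \<le> E0 * 1" using W0 q s by (intro mult_left_mono_neg) (auto simp: E0_def)
    finally show ?thesis by simp
  qed
  \<comment> \<open>The time at which the line \<open>1 + E0 * t\<close>, which dominates
    \<open>J\<close>, reaches zero.\<close>
  define t where "t = - 1 / E0"
  have t: "t > 0" "E0 * t = - 1" using W0 by (auto simp: t_def E0_def divide_less_0_iff)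
  have "E0 * 0 - J 0 \<le> E0 * t - J t"
  proof (rule DERIV_nonneg_imp_increasing_open[where f = "\<lambda>r. E0 * r - J r"])
    show "continuous_on {0..t} (\<lambda>r. E0 * r - J r)" by (intro continuous_intros c')
    fix r assume r: "0 < r" "r < t"
    have "((\<lambda>r. E0 * r - J r) has_real_derivative E0 - W r) (at r)" using r by (auto intro!: derivative_eq_intros dJ)
    moreover have "0 < l * J r" using pos[of r] l(2) r by simp
    then have "0 \<le> E0 - W r" using E[of r] r by linarith
    ultimately show "\<exists>y. ((\<lambda>r. E0 * r - J r) has_real_derivative y) (at r) \<and> 0 \<le> y" by blast
  qed (use t in auto)
  then have "J t \<le> 0" using t J0 by simp
  then show False using pos[of t] t by simp
qed

text \<open>The energy \<open>J\<^sup>2 + W\<^sup>2\<close> grows at a bounded exponential rate, so a bound on the quotient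
  \<open>W / J\<close> at one time prevents \<open>J\<close> from vanishing for a time that depends only on that bound.\<close>

lemma linear_ode_persists:
  fixes J W a :: "real \<Rightarrow> real"
  assumes m: "m > 0" and K: "K > 0" and c: "continuous_on {0..} J" "continuous_on {0..} W"
    and dJ: "\<And>t. t > 0 \<Longrightarrow> (J has_real_derivative W t) (at t)"
    and dW: "\<And>t. t > 0 \<Longrightarrow> (W has_real_derivative (- K * a t * J t - W t) / m) (at t)"
    and a: "\<And>t. t > 0 \<Longrightarrow> \<bar>a t\<bar> \<le> 1" and t: "t \<ge> 0" and J: "J t > 0" and W: "\<bar>W t\<bar> \<le> R * J t"
    and C: "C = sqrt ((1 + R\<^sup>2) * exp (1 + K / m))" and s: "t \<le> s" "C * (s - t) \<le> 1 / 2"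
  shows "J s \<ge> J t / 2"
proof -
  define k where "k = 1 + K / m"
  have c': "continuous_on {t..s} J" "continuous_on {t..s} W" for s using c t by (auto intro: continuous_on_subset)
  \<comment> \<open>\<open>C >= 1\<close> forces \<open>s - t <= 1\<close>, so the growth of the
    energy over this time is at most \<open>exp k\<close>, the factor already contained in
    \<open>C\<close>.\<close>
  have "1 * 1 \<le> (1 + R\<^sup>2) * exp (1 + K / m)" using m K by (intro mult_mono) auto
  then have C1: "C \<ge> 1" "C\<^sup>2 = (1 + R\<^sup>2) * exp k" using C by (auto simp: k_def)
  have "1 * (s - t) \<le> C * (s - t)" using C1 s by (intro mult_right_mono) auto
  then have st: "s - t \<le> 1" using s by simp
  have Wr: "\<bar>W r\<bar> \<le> C * J t" if r: "r \<in> {t..s}" for r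
  proof -
    have "- (((J t)\<^sup>2 + (W t)\<^sup>2) * exp (- k * t)) \<le> - (((J r)\<^sup>2 + (W r)\<^sup>2) * exp (- k * r))"
    proof (rule DERIV_nonneg_imp_increasing_open[where f = "\<lambda>r. - (((J r)\<^sup>2 + (W r)\<^sup>2) * exp (- k * r))"])
      show "continuous_on {t..r} (\<lambda>r. - (((J r)\<^sup>2 + (W r)\<^sup>2) * exp (- k * r)))" by (intro continuous_intros c')
      fix y assume y: "t < y" "y < r"
      then have y0: "y > 0" using t by simp
      have "((\<lambda>r. - (((J r)\<^sup>2 + (W r)\<^sup>2) * exp (- k * r))) has_real_derivative
          (k * ((J y)\<^sup>2 + (W y)\<^sup>2) - 2 * J y * W y - 2 * W y * ((- K * a y * J y - W y) / m)) * exp (- k * y)) (at y)"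
        by (auto intro!: derivative_eq_intros dJ dW y0 simp: algebra_simps)
      moreover have "0 \<le> (k * ((J y)\<^sup>2 + (W y)\<^sup>2) - 2 * J y * W y - 2 * W y * ((- K * a y * J y - W y) / m)) * exp (- k * y)"
      proof -
        have 0: "0 \<le> (\<bar>J y\<bar> - \<bar>W y\<bar>)\<^sup>2" "0 \<le> (J y - W y)\<^sup>2" by simp_all
        then have 1: "2 * \<bar>J y * W y\<bar> \<le> (J y)\<^sup>2 + (W y)\<^sup>2" "2 * (J y * W y) \<le> (J y)\<^sup>2 + (W y)\<^sup>2"
          by (simp_all add: power2_diff abs_mult)
        have "- (2 * (a y * (J y * W y))) \<le> 2 * (\<bar>a y\<bar> * \<bar>J y * W y\<bar>)" unfolding abs_mult[symmetric] by linarith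
        also have "\<bar>a y\<bar> * \<bar>J y * W y\<bar> \<le> 1 * \<bar>J y * W y\<bar>" using a[OF y0] by (intro mult_right_mono) auto
        finally have "0 \<le> (J y)\<^sup>2 + (W y)\<^sup>2 + 2 * (a y * (J y * W y))" using 1 by linarith
        then have 2: "0 \<le> K / m * ((J y)\<^sup>2 + (W y)\<^sup>2 + 2 * (a y * (J y * W y)))" using m K by simp
        have 3: "0 \<le> 2 * (W y)\<^sup>2 / m" using m by simp
        have "k * ((J y)\<^sup>2 + (W y)\<^sup>2) - 2 * J y * W y - 2 * W y * ((- K * a y * J y - W y) / m)
          = ((J y)\<^sup>2 + (W y)\<^sup>2 - 2 * (J y * W y)) + K / m * ((J y)\<^sup>2 + (W y)\<^sup>2 + 2 * (a y * (J y * W y))) + 2 * (W y)\<^sup>2 / m"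
          unfolding k_def using m by (simp add: field_simps power2_eq_square)
        then show ?thesis using 1 2 3 by simp
      qed
      ultimately show "\<exists>z. ((\<lambda>r. - (((J r)\<^sup>2 + (W r)\<^sup>2) * exp (- k * r))) has_real_derivative z) (at y) \<and> 0 \<le> z" by blast
    qed (use r in auto)
    then have "(J r)\<^sup>2 + (W r)\<^sup>2 \<le> ((J t)\<^sup>2 + (W t)\<^sup>2) * exp (k * (r - t))"
      by (simp add: exp_minus exp_diff right_diff_distrib field_simps)
    also have "\<dots> \<le> ((J t)\<^sup>2 + (R * J t)\<^sup>2) * exp (k * 1)"
    proof -
      have "k * (r - t) \<le> k * 1" using r st m K by (intro mult_left_mono) (auto simp: k_def)
      then show ?thesis using power_mono[OF W, of 2] by (intro mult_mono add_mono) auto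
    qed
    also have "\<dots> = (C * J t)\<^sup>2" unfolding power_mult_distrib C1(2) by (simp add: algebra_simps)
    finally have "\<bar>W r\<bar>\<^sup>2 \<le> (C * J t)\<^sup>2" using zero_le_power2[of "J r"] by (simp only: power2_abs)
    then show ?thesis by (rule power2_le_imp_le) (use C1 J in simp)
  qed
  \<comment> \<open>\<open>J\<close> loses at most \<open>C * J t\<close> per unit of time, hence at
    most half of \<open>J t\<close> by time \<open>s\<close>.\<close>
  have "J t + C * J t * t \<le> J s + C * J t * s"
  proof (rule DERIV_nonneg_imp_increasing_open[where f = "\<lambda>r. J r + C * J t * r"])
    show "continuous_on {t..s} (\<lambda>r. J r + C * J t * r)" by (intro continuous_intros c')
    fix y assume y: "t < y" "y < s"
    then have y0: "y > 0" using t by simp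
    have "((\<lambda>r. J r + C * J t * r) has_real_derivative W y + C * J t) (at y)"
      by (auto intro!: derivative_eq_intros dJ y0)
    moreover have "0 \<le> W y + C * J t" using Wr[of y] y by auto
    ultimately show "\<exists>z. ((\<lambda>r. J r + C * J t * r) has_real_derivative z) (at y) \<and> 0 \<le> z" by blast
  qed (use s in auto)
  moreover have "C * (s - t) * J t \<le> 1 / 2 * J t" using s J by (intro mult_right_mono) auto
  ultimately show ?thesis by (simp add: algebra_simps)
qed

section \<open>Uniqueness\<close>

lemma at_within_Ico: "s \<in> {0..<T} \<Longrightarrow> at s within {0..<T} = at s within {0..(s + T) / 2}" for s T :: real
  by (rule at_within_nhd[of _ "{..<(s + T) / 2}"]) auto

locale ksol = kdata g m K rho0 u0 for g m K rho0 u0 +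
  fixes Ts :: real and r v :: "real \<Rightarrow> real \<Rightarrow> real \<Rightarrow> real"
  assumes sol: "strong_solution g m K rho0 u0 Ts r v"
begin

definition "rx t = dtheta (r t)"
definition "vx t = dtheta (v t)"

lemma initial: "r 0 = rho0" "v 0 = u0"
  using sol by (simp_all add: strong_solution_def)

lemma r_Hg: "t \<in> {0..<Ts} \<Longrightarrow> theta_periodic (r t) \<and> cyl_measurable (r t) \<and> theta_C 1 (r t)"
  and v_Hg: "t \<in> {0..<Ts} \<Longrightarrow> theta_periodic (v t) \<and> cyl_measurable (v t) \<and> theta_C 2 (v t)"
  using sol by (simp_all add: strong_solution_def continuous_in_Hg_def Hg_def)

lemma r_deriv: "t \<in> {0..<Ts} \<Longrightarrow> ((\<lambda>x. r t x w) has_real_derivative rx t x w) (at x)"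
  and v_deriv: "t \<in> {0..<Ts} \<Longrightarrow> ((\<lambda>x. v t x w) has_real_derivative vx t x w) (at x)"
  using theta_C_deriv[of 1 "r t" 0] theta_C_deriv[of 2 "v t" 0] r_Hg v_Hg by (simp_all add: rx_def vx_def)

lemma r_per: "t \<in> {0..<Ts} \<Longrightarrow> r t (x + 2 * pi) w = r t x w"
  using r_Hg by (simp add: theta_periodic_def)

lemma sol_cont:
  "continuous_on ({0..<Ts} \<times> UNIV) (\<lambda>(t, x). r t x w)" "continuous_on ({0..<Ts} \<times> UNIV) (\<lambda>(t, x). rx t x w)"
  "continuous_on ({0..<Ts} \<times> UNIV) (\<lambda>(t, x). v t x w)" "continuous_on ({0..<Ts} \<times> UNIV) (\<lambda>(t, x). vx t x w)"
  using sol by (simp_all add: strong_solution_def pointwise_regular_def rx_def vx_def)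

lemma sol_bounds: "\<exists>L. \<forall>t\<in>{0..\<tau>}. \<forall>x w. \<bar>r t x w\<bar> \<le> L \<and> \<bar>vx t x w\<bar> \<le> L" if "\<tau> \<in> {0..<Ts}"
proof -
  have "locally_Linf Ts r" "locally_Linf Ts (\<lambda>t. dtheta (v t))" using sol by (simp_all add: strong_solution_def)
  then have "\<exists>C. \<forall>t\<in>{0..\<tau>}. \<forall>x w. \<bar>r t x w\<bar> \<le> C" "\<exists>C. \<forall>t\<in>{0..\<tau>}. \<forall>x w. \<bar>vx t x w\<bar> \<le> C"
    using that by (simp_all add: locally_Linf_def vx_def)
  then obtain M1 M2 where "\<forall>t\<in>{0..\<tau>}. \<forall>x w. \<bar>r t x w\<bar> \<le> M1" "\<forall>t\<in>{0..\<tau>}. \<forall>x w. \<bar>vx t x w\<bar> \<le> M2" by blast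
  then show ?thesis by (intro exI[of _ "max M1 M2"]) (auto simp: le_max_iff_disj)
qed

lemma r_t_deriv:
  assumes t: "t \<in> {0<..<Ts}"
  shows "((\<lambda>t. r t x w) has_real_derivative - (rx t x w * v t x w + r t x w * vx t x w)) (at t)"
proof -
  have t': "t \<in> {0..<Ts}" using t by auto
  have "(\<lambda>t. r t x w) differentiable (at t)" using sol t by (simp add: strong_solution_def pointwise_regular_def)
  then have "((\<lambda>t. r t x w) has_real_derivative deriv (\<lambda>t. r t x w) t) (at t)" by (simp add: DERIV_deriv_iff_real_differentiable)
  moreover have "dtheta (\<lambda>x w. r t x w * v t x w) x w = rx t x w * v t x w + r t x w * vx t x w"
    unfolding dtheta_def by (rule DERIV_imp_deriv[OF DERIV_cong[OF DERIV_mult[OF r_deriv[OF t'] v_deriv[OF t']]]]) simp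
  moreover have "deriv (\<lambda>t. r t x w) t + dtheta (\<lambda>x w. r t x w * v t x w) x w = 0"
    using sol t by (simp add: strong_solution_def continuity_eq_def)
  ultimately show ?thesis by (simp only: eq_neg_iff_add_eq_0[symmetric])
qed

text \<open>Maximum principle: at the first point where \<open>e\<^sup>l\<^sup>t\<rho>\<close> has dropped to half its initial minimum,
  the \<open>\<theta>\<close>-derivative vanishes, and for \<open>l\<close> above the bound on \<open>\<partial>\<^sub>\<theta> u\<close> the time derivative is positive.\<close>

lemma r_pos:
  assumes t: "t \<in> {0..<Ts}"
  shows "r t x w > 0"
proof (rule ccontr)
  assume neg: "\<not> r t x w > 0"
  obtain L where L: "\<And>s x. s \<in> {0..t} \<Longrightarrow> \<bar>vx s x w\<bar> \<le> L" using sol_bounds[OF t] by blast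
  define l where "l = L + 1"
  define f where "f s y = r s y w * exp (l * s)" for s y
  have fper: "f s (y + 2 * pi) = f s y" if "s \<in> {0..t}" for s y using r_per[of s y w] that t by (simp add: f_def)
  have rc: "continuous_on ({0..t} \<times> UNIV) (\<lambda>p. r (fst p) (snd p) w)"
    by (rule continuous_on_subset[OF sol_cont(1)[unfolded case_prod_unfold]]) (use t in auto)
  have fc: "continuous_on ({0..t} \<times> UNIV) (\<lambda>p. f (fst p) (snd p))"
    unfolding f_def by (intro continuous_intros rc)
  have "continuous_on {0..2 * pi} (\<lambda>y. rho0 y w)"
    using rho0_deriv by (auto intro!: continuous_at_imp_continuous_on DERIV_isCont)
  from continuous_attains_inf[OF compact_Icc _ this] obtain y0 where "\<forall>y\<in>{0..2 * pi}. rho0 y0 w \<le> rho0 y w"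
    by auto
  then have y0: "rho0 y0 w \<le> rho0 y w" if "y \<in> {0..2 * pi}" for y using that by blast
  define c where "c = rho0 y0 w / 2"
  have c: "c > 0" using pos[of y0 w] by (simp add: c_def)
  define Z where "Z = ({0..t} \<times> {0..2 * pi}) \<inter> (\<lambda>p. f (fst p) (snd p)) -` {..c}"
  have "closed Z" unfolding Z_def
    by (rule continuous_closed_preimage[OF continuous_on_subset[OF fc]]) (auto intro: closed_Times)
  moreover have "bounded ({0..t} \<times> {0..2 * pi})" by (intro bounded_Times) auto
  then have "bounded Z" by (rule bounded_subset) (auto simp: Z_def)
  ultimately have "compact Z" by (simp add: compact_eq_bounded_closed)
  \<comment> \<open>Periodicity brings every point into a compact rectangle, so that an earliest
    time exists in \<open>Z\<close> although the angle ranges over the line.\<close>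
  have wr: "f s (wrap y) = f s y" if "s \<in> {0..t}" for s y using periodic_wrap[of "f s" y] fper[OF that] by simp
  have wr': "wrap y \<in> {0..2 * pi}" for y using wrap_range[of y] by auto
  have "f t x \<le> 0" using neg by (simp add: f_def mult_le_0_iff not_less)
  then have "(t, wrap x) \<in> Z" using wr[of t x] wr' t c by (auto simp: Z_def)
  then have "Z \<noteq> {}" by blast
  from continuous_attains_inf[OF \<open>compact Z\<close> this continuous_on_fst[OF continuous_on_id]]
  obtain p where p: "p \<in> Z" "\<forall>q\<in>Z. fst p \<le> fst q" by blast
  define s y where "s = fst p" and "y = snd p"
  have sy: "s \<in> {0..t}" "f s y \<le> c" using p(1) by (auto simp: Z_def s_def y_def)
  have before: "f q z > c" if "q \<in> {0..<s}" for q z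
  proof (rule ccontr)
    assume "\<not> f q z > c"
    then have "(q, wrap z) \<in> Z" using wr[of q z] wr' that sy by (auto simp: Z_def)
    from bspec[OF p(2) this] that show False by (simp add: s_def)
  qed
  have s0: "s > 0"
  proof (rule ccontr)
    assume "\<not> s > 0"
    then have "s = 0" using sy by simp
    then have "rho0 (wrap y) w \<le> c" using sy wr[of 0 y] t by (simp add: f_def initial)
    then show False using y0[OF wr'[of y]] c by (simp add: c_def)
  qed
  have s': "s \<in> {0..<Ts}" "s \<in> {0<..<Ts}" using sy t s0 by auto
  \<comment> \<open>Continuity from the left: at time \<open>s\<close> the function is still at
    least \<open>c\<close> everywhere, so \<open>y\<close> is a minimum in space.\<close>
  have fs: "f s z \<ge> c" for z
  proof (rule tendsto_lowerbound)
    have "continuous_on {0..s} (\<lambda>q. (\<lambda>p. f (fst p) (snd p)) (q, z))"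
      by (rule continuous_on_compose2[OF fc]) (use sy in \<open>auto intro!: continuous_intros\<close>)
    then have "((\<lambda>q. f q z) \<longlongrightarrow> f s z) (at s within {0..s})" using s0 by (auto simp: continuous_on_def)
    then show "((\<lambda>q. f q z) \<longlongrightarrow> f s z) (at_left s)"
      by (rule filterlim_mono[OF _ order_refl]) (metis at_within_Icc_at_left s0 order_refl)
    show "\<forall>\<^sub>F q in at_left s. c \<le> f q z"
      using eventually_at_left_real[OF s0] by eventually_elim (use before[of _ z] in \<open>auto simp: less_imp_le\<close>)
  qed simp
  then have fy: "f s y = c" using sy by (simp add: order_antisym)
  have "((\<lambda>y. f s y) has_real_derivative rx s y w * exp (l * s)) (at y)"
    unfolding f_def by (intro DERIV_cmult_right r_deriv s')
  from DERIV_local_min[OF this zero_less_one] fs fy have rx0: "rx s y w = 0" by simp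
  have "((\<lambda>s. f s y) has_real_derivative - (rx s y w * v s y w + r s y w * vx s y w) * exp (l * s) + exp (l * s) * l * r s y w) (at s)"
    unfolding f_def by (auto intro!: derivative_eq_intros r_t_deriv s')
  moreover have "- (rx s y w * v s y w + r s y w * vx s y w) * exp (l * s) + exp (l * s) * l * r s y w = c * (l - vx s y w)"
    unfolding fy[symmetric] by (simp add: rx0 f_def algebra_simps)
  ultimately have d: "((\<lambda>s. f s y) has_real_derivative c * (l - vx s y w)) (at s)" by simp
  \<comment> \<open>An increase in time at \<open>s\<close> means values below \<open>c\<close>
    shortly before \<open>s\<close>, contrary to \<open>before\<close>.\<close>
  have "0 < c * (l - vx s y w)" using L[OF sy(1), of y] c by (simp add: l_def)
  from DERIV_pos_inc_left[OF d this] obtain e where e: "e > 0" "\<And>h. h > 0 \<Longrightarrow> h < e \<Longrightarrow> f (s - h) y < f s y" by blast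
  define h where "h = min (e / 2) (s / 2)"
  have "f (s - h) y < f s y" using e s0 by (intro e(2)) (auto simp: h_def)
  moreover have "f (s - h) y > c" using e(1) s0 by (intro before) (auto simp: h_def)
  ultimately show False using fy by simp
qed

definition zr :: "real \<Rightarrow> complex" where
  "zr t = Complex (\<integral>(x, w). cos x * r t x w * g w \<partial>cyl) (\<integral>(x, w). sin x * r t x w * g w \<partial>cyl)"

text \<open>The momentum equation minus \<open>v\<close> times the continuity equation is
  \<open>r\<close> times this equation; \<open>r_pos\<close> permits the division.\<close>

lemma v_t_deriv:
  assumes t: "t \<in> {0<..<Ts}"
  shows "((\<lambda>t. v t x w) has_real_derivative (w - v t x w + K * Sf (zr t) x) / m - v t x w * vx t x w) (at t)"
proof -
  have t': "t \<in> {0..<Ts}" "t \<in> {0..t}" using t by auto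
  obtain L where L: "\<And>x w. \<bar>r t x w\<bar> \<le> L" using sol_bounds[OF t'(1)] t'(2) by blast
  define a where "a = deriv (\<lambda>t. v t x w) t"
  have "(\<lambda>t. v t x w) differentiable (at t)" using sol t by (simp add: strong_solution_def pointwise_regular_def)
  then have a: "((\<lambda>t. v t x w) has_real_derivative a) (at t)" by (simp add: a_def DERIV_deriv_iff_real_differentiable)
  have "((\<lambda>x. r t x w * (v t x w)\<^sup>2) has_real_derivative rx t x w * (v t x w)\<^sup>2 + r t x w * (2 * v t x w * vx t x w)) (at x)"
    by (auto intro!: derivative_eq_intros r_deriv v_deriv t')
  then have 1: "dtheta (\<lambda>x w. r t x w * (v t x w)\<^sup>2) x w = rx t x w * (v t x w)\<^sup>2 + r t x w * (2 * v t x w * vx t x w)"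
    unfolding dtheta_def by (rule DERIV_imp_deriv)
  have 2: "deriv (\<lambda>s. r s x w * v s x w) t = - (rx t x w * v t x w + r t x w * vx t x w) * v t x w + a * r t x w"
    by (rule DERIV_imp_deriv[OF DERIV_mult[OF r_t_deriv[OF t] a]])
  have 3: "(\<integral>(x', w'). sin (x' - x) * r t x' w' * g w' \<partial>cyl) = Sf (zr t) x"
    by (rule sin_moment[OF _ L]) (use r_Hg[OF t'(1)] in \<open>simp_all add: zr_def\<close>)
  have "deriv (\<lambda>s. r s x w * v s x w) t + dtheta (\<lambda>x w. r t x w * (v t x w)\<^sup>2) x w
      = 1 / m * (- r t x w * v t x w + r t x w * w + K * r t x w * (\<integral>(x', w'). sin (x' - x) * r t x' w' * g w' \<partial>cyl))"
    using sol t by (simp add: strong_solution_def momentum_eq_def)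
  then have "r t x w * (a + v t x w * vx t x w) = r t x w * ((w - v t x w + K * Sf (zr t) x) / m)"
    unfolding 1 2 3 using m by (simp add: field_simps power2_eq_square)
  then have "a + v t x w * vx t x w = (w - v t x w + K * Sf (zr t) x) / m"
    using r_pos[OF t'(1), of x w] by (simp only: mult_cancel_left) simp
  then show ?thesis using a by (simp add: eq_diff_eq[symmetric])
qed

lemma moment_cont:
  assumes h: "h \<in> borel_measurable borel" "\<And>x. \<bar>h x\<bar> \<le> 1"
  shows "continuous_on {0..<Ts} (\<lambda>t. \<integral>(x, w). h x * r t x w * g w \<partial>cyl)"
  unfolding continuous_on_def
proof
  fix s assume s: "s \<in> {0..<Ts}"
  define \<tau> where "\<tau> = (s + Ts) / 2"
  have tau: "\<tau> \<in> {0..<Ts}" "s \<in> {0..\<tau>}" using s by (auto simp: \<tau>_def)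
  obtain L where L: "\<And>t x w. t \<in> {0..\<tau>} \<Longrightarrow> \<bar>r t x w\<bar> \<le> L" using sol_bounds[OF tau(1)] by blast
  have sub: "t \<in> {0..<Ts}" if "t \<in> {0..\<tau>}" for t using that tau by auto
  have m: "(\<lambda>(x, w). h x * r t x w * g w) \<in> borel_measurable cyl" if "t \<in> {0..\<tau>}" for t
    using r_Hg[OF sub[OF that]] by (intro cyl_weight_measurable cyl_measurable_mult cyl_measurable_fst h) auto
  show "((\<lambda>t. \<integral>(x, w). h x * r t x w * g w \<partial>cyl) \<longlongrightarrow> (\<integral>(x, w). h x * r s x w * g w \<partial>cyl)) (at s within {0..<Ts})"
    unfolding at_within_Ico[OF s] \<tau>_def[symmetric] tendsto_at_iff_sequentially o_def
  proof (intro allI impI)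
    fix q :: "nat \<Rightarrow> real" assume q: "\<forall>i. q i \<in> {0..\<tau>} - {s}" and ql: "q \<longlonglongrightarrow> s"
    have qA: "q n \<in> {0..\<tau>}" for n using q by auto
    show "(\<lambda>n. \<integral>(x, w). h x * r (q n) x w * g w \<partial>cyl) \<longlonglongrightarrow> (\<integral>(x, w). h x * r s x w * g w \<partial>cyl)"
    proof (rule integral_dominated_convergence[OF m[OF tau(2)] m[OF qA], where w = "\<lambda>(x, w). L * g w"])
      show "integrable cyl (\<lambda>(x, w). L * g w)" by (rule integrable_const_weight)
      show "AE p in cyl. (\<lambda>n. case p of (x, w) \<Rightarrow> h x * r (q n) x w * g w) \<longlonglongrightarrow> (case p of (x, w) \<Rightarrow> h x * r s x w * g w)"
      proof (rule AE_I2, clarify)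
        fix x w :: real
        have "continuous_on {0..\<tau>} (\<lambda>t. (\<lambda>(t, x). r t x w) (t, x))"
          by (rule continuous_on_compose2[OF sol_cont(1)]) (use sub in \<open>auto intro!: continuous_intros\<close>)
        then have "((\<lambda>t. r t x w) \<longlongrightarrow> r s x w) (at s within {0..\<tau>})" using tau(2) by (auto simp: continuous_on_def)
        then have "(\<lambda>n. r (q n) x w) \<longlonglongrightarrow> r s x w" using q ql unfolding tendsto_at_iff_sequentially o_def by blast
        then show "(\<lambda>n. h x * r (q n) x w * g w) \<longlonglongrightarrow> h x * r s x w * g w" by (intro tendsto_intros)
      qed
      show "AE p in cyl. norm (case p of (x, w) \<Rightarrow> h x * r (q n) x w * g w) \<le> (case p of (x, w) \<Rightarrow> L * g w)" for n
      proof (rule AE_I2, clarify)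
        fix x w :: real
        have "\<bar>h x * r (q n) x w\<bar> \<le> 1 * L" unfolding abs_mult using h(2) L[OF qA] by (intro mult_mono) auto
        then show "norm (h x * r (q n) x w * g w) \<le> L * g w"
          using g_nonneg[of w] mult_right_mono[of "\<bar>h x * r (q n) x w\<bar>" L "g w"] by (simp add: abs_mult)
      qed
    qed
  qed
qed

lemma zr_cont: "continuous_on {0..<Ts} zr"
proof -
  have "continuous_on {0..<Ts} (\<lambda>t. Complex (\<integral>(x, w). cos x * r t x w * g w \<partial>cyl) (\<integral>(x, w). sin x * r t x w * g w \<partial>cyl))"
    by (intro continuous_intros moment_cont) auto
  then show ?thesis by (simp add: zr_def[abs_def])
qed

end

text \<open>The characteristics of a field that agrees up to \<open>\<tau>\<close> with the one
  carried by the given solution; whether that field is a fixed point of \<open>mf\<close> is not yet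
  known.\<close>

locale kmatch = kflow g m K rho0 u0 B z + ksol g m K rho0 u0 Ts r v for g m K rho0 u0 B z Ts r v +
  fixes \<tau> :: real
  assumes tau: "\<tau> \<in> {0..<Ts}" and match: "\<And>t. t \<in> {0..\<tau>} \<Longrightarrow> z t = zr t"
begin

lemma along_cont:
  assumes "continuous_on ({0..<Ts} \<times> UNIV) (\<lambda>(t, x). f t x)"
  shows "continuous_on {0..\<tau>} (\<lambda>t. f t (jX t y w))"
proof -
  have "continuous_on {0..\<tau>} (\<lambda>t. (\<lambda>(t, x). f t x) (t, jX t y w))"
    by (rule continuous_on_compose2[OF assms])
      (use tau in \<open>auto intro!: continuous_intros continuous_on_subset[OF lag_tcont[OF fl.X_cont]]\<close>)
  then show ?thesis by simp
qed

lemma along_deriv: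
  assumes t: "0 < t" "t < \<tau>"
  shows "((\<lambda>t. r t (jX t y w) w) has_real_derivative
      - (rx t (jX t y w) w * v t (jX t y w) w + r t (jX t y w) w * vx t (jX t y w) w) + rx t (jX t y w) w * jV t y w) (at t)"
    "((\<lambda>t. v t (jX t y w) w) has_real_derivative
      (w - v t (jX t y w) w + K * Sf (zr t) (jX t y w)) / m - v t (jX t y w) w * vx t (jX t y w) w + vx t (jX t y w) w * jV t y w) (at t)"
proof -
  have t': "t \<in> {0<..<Ts}" using t tau by auto
  have sub: "{0<..<Ts} \<times> UNIV \<subseteq> {0..<Ts} \<times> (UNIV :: real set)" by auto
  have d: "((\<lambda>x. r s x w) has_real_derivative rx s x w) (at x)" "((\<lambda>x. v s x w) has_real_derivative vx s x w) (at x)" if "s \<in> {0<..<Ts}" for s x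
    using that by (auto intro!: r_deriv v_deriv)
  show "((\<lambda>t. r t (jX t y w) w) has_real_derivative
      - (rx t (jX t y w) w * v t (jX t y w) w + r t (jX t y w) w * vx t (jX t y w) w) + rx t (jX t y w) w * jV t y w) (at t)"
    by (rule DERIV_along_curve[where f = "\<lambda>t x. r t x w" and fy = "\<lambda>t x. rx t x w" and k = "\<lambda>t. jX t y w",
        OF open_greaterThanLessThan t' d(1) continuous_on_subset[OF sol_cont(2) sub] r_t_deriv[OF t'] lag_time_deriv(1)[OF t(1)]])
  show "((\<lambda>t. v t (jX t y w) w) has_real_derivative
      (w - v t (jX t y w) w + K * Sf (zr t) (jX t y w)) / m - v t (jX t y w) w * vx t (jX t y w) w + vx t (jX t y w) w * jV t y w) (at t)"
    by (rule DERIV_along_curve[where f = "\<lambda>t x. v t x w" and fy = "\<lambda>t x. vx t x w" and k = "\<lambda>t. jX t y w",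
        OF open_greaterThanLessThan t' d(2) continuous_on_subset[OF sol_cont(4) sub] v_t_deriv[OF t'] lag_time_deriv(1)[OF t(1)]])
qed

text \<open>Both velocities feel the same force, so their difference along the trajectory solves a
  homogeneous linear equation with coefficient \<open>- 1 / m - vx\<close> and vanishes
  initially.\<close>

lemma v_along:
  assumes t: "t \<in> {0..\<tau>}"
  shows "v t (jX t y w) w = jV t y w"
proof -
  obtain L where L: "\<And>t x w. t \<in> {0..\<tau>} \<Longrightarrow> \<bar>vx t x w\<bar> \<le> L" using sol_bounds[OF tau] by blast
  have "jV t y w - v t (jX t y w) w = 0"
  proof (rule zero_of_linear_ode[where T = \<tau> and D = "\<lambda>t. jV t y w - v t (jX t y w) w" and b = "\<lambda>t. - 1 / m - vx t (jX t y w) w" and L = L])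
    show "continuous_on {0..\<tau>} (\<lambda>t. jV t y w - v t (jX t y w) w)"
      by (intro continuous_intros along_cont[OF sol_cont(3)] continuous_on_subset[OF lag_tcont[OF fl.V_cont]]) auto
    show "jV 0 y w - v 0 (jX 0 y w) w = 0" by (simp add: lag_0 initial)
    fix t assume s: "0 < t" "t < \<tau>"
    have "((\<lambda>t. jV t y w - v t (jX t y w) w) has_real_derivative (w + K * Sf (z t) (jX t y w) - jV t y w) / m
      - ((w - v t (jX t y w) w + K * Sf (zr t) (jX t y w)) / m - v t (jX t y w) w * vx t (jX t y w) w + vx t (jX t y w) w * jV t y w)) (at t)"
      by (intro DERIV_diff lag_time_deriv along_deriv s)
    moreover have "(w + K * Sf (z t) (jX t y w) - jV t y w) / m
      - ((w - v t (jX t y w) w + K * Sf (zr t) (jX t y w)) / m - v t (jX t y w) w * vx t (jX t y w) w + vx t (jX t y w) w * jV t y w)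
      = (- 1 / m - vx t (jX t y w) w) * (jV t y w - v t (jX t y w) w)"
      using match[of t] s fl.m by (simp add: field_simps)
    ultimately show "((\<lambda>t. jV t y w - v t (jX t y w) w) has_real_derivative (- 1 / m - vx t (jX t y w) w) * (jV t y w - v t (jX t y w) w)) (at t)" by simp
    have "\<bar>vx t (jX t y w) w\<bar> \<le> L" by (rule L) (use s in auto)
    moreover have "- 1 / m \<le> 0" using fl.m by simp
    ultimately show "- 1 / m - vx t (jX t y w) w \<le> L" by linarith
  qed (rule t)
  then show ?thesis by simp
qed

text \<open>The identity \<open>v_along\<close> differentiated in the starting point.\<close>

lemma W_along:
  assumes t: "t \<in> {0..\<tau>}"
  shows "jW t y w = vx t (jX t y w) w * jJ t y w"
proof -
  have t': "t \<in> {0..<Ts}" "t \<ge> 0" using t tau by auto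
  have "((\<lambda>y. v t (jX t y w) w) has_real_derivative vx t (jX t y w) w * jJ t y w) (at y)"
    by (rule DERIV_chain2[OF v_deriv[OF t'(1)] lag_derivs(1)[OF t'(2)]])
  then show ?thesis unfolding v_along[OF t] using lag_derivs(2)[OF t'(2), of w y] by (simp add: DERIV_unique)
qed

text \<open>By the continuity equation the logarithmic rates of \<open>r\<close> and
  \<open>J\<close> along the trajectory are \<open>- vx\<close> and \<open>vx\<close>, so the
  product is constant in time.\<close>

lemma r_along:
  assumes t: "t \<in> {0..\<tau>}"
  shows "r t (jX t y w) w * jJ t y w = rho0 y w"
proof (cases "t = 0")
  case False
  have "r t (jX t y w) w * jJ t y w = r 0 (jX 0 y w) w * jJ 0 y w"
  proof (rule DERIV_isconst_end[where f = "\<lambda>t. r t (jX t y w) w * jJ t y w"])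
    show "0 < t" using False t by simp
    show "continuous_on {0..t} (\<lambda>t. r t (jX t y w) w * jJ t y w)"
      by (intro continuous_intros continuous_on_subset[OF along_cont[OF sol_cont(1)]] continuous_on_subset[OF lag_tcont[OF fl.J_cont]]) (use t in auto)
    fix s assume s: "0 < s" "s < t"
    then have s': "s < \<tau>" "s \<in> {0..\<tau>}" using t by auto
    have "((\<lambda>t. r t (jX t y w) w * jJ t y w) has_real_derivative
        (- (rx s (jX s y w) w * v s (jX s y w) w + r s (jX s y w) w * vx s (jX s y w) w) + rx s (jX s y w) w * jV s y w) * jJ s y w
        + jW s y w * r s (jX s y w) w) (at s)"
      by (intro DERIV_mult along_deriv lag_time_deriv s s')
    then show "((\<lambda>t. r t (jX t y w) w * jJ t y w) has_real_derivative 0) (at s)"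
      by (simp add: v_along[OF s'(2)] W_along[OF s'(2)] algebra_simps)
  qed
  then show ?thesis by (simp add: lag_0 initial)
qed (simp add: lag_0 initial)

text \<open>The field of any strong solution satisfies the fixed-point equation. That
  \<open>J\<close> is nonnegative, as the change of variables requires, follows from
  \<open>r_along\<close> and the positivity of both densities.\<close>

lemma mf_match:
  assumes t: "t \<in> {0..\<tau>}"
  shows "mf z t = zr t"
proof -
  have t': "t \<in> {0..<Ts}" "t \<ge> 0" using t tau by auto
  obtain L where L: "\<And>x w. \<bar>r t x w\<bar> \<le> L" using sol_bounds[OF tau] t by blast
  have "jJ t y w \<ge> 0" for y w
    using r_along[OF t, of y w] r_pos[OF t'(1), of "jX t y w" w] pos[of y w] by (metis less_imp_le zero_less_mult_pos)
  from mf_of_density[OF t'(2) _ r_per[OF t'(1)] L this r_along[OF t]] r_Hg[OF t'(1)]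
  show ?thesis by (simp add: complex_eq_iff zr_def)
qed

end

locale kunique = kpos g m K rho0 u0 B z T + ksol g m K rho0 u0 Ts r v for g m K rho0 u0 B z T Ts r v +
  assumes mfz: "\<And>t. t \<ge> 0 \<Longrightarrow> mf z t = z t"
begin

lemma field_unique:
  assumes t: "t \<in> {0..<Ts}"
  shows "zr t = z t"
proof -
  \<comment> \<open>The field of the solution is frozen after \<open>t\<close>, since flows are
    built from fields on the whole half-line; causality makes the continuation harmless.\<close>
  define y where "y s = zr (min s t)" for s
  have "compact (zr ` {0..t})"
    by (rule compact_continuous_image[OF continuous_on_subset[OF zr_cont]]) (use t in auto)
  then obtain b where "\<forall>y\<in>zr ` {0..t}. norm y \<le> b" using compact_imp_bounded bounded_iff by metis
  then have b: "norm (zr s) \<le> b" if "s \<in> {0..t}" for s using that by blast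
  \<comment> \<open>A common bound for both fields, as \<open>mf_unique\<close> compares two flows
    with the same \<open>B\<close>.\<close>
  define B' where "B' = max B b"
  have B': "B' \<ge> B" "B' \<ge> b" "B' \<ge> 0" using fl.B by (auto simp: B'_def)
  have yc: "continuous_on {0..} y"
    unfolding y_def by (rule continuous_on_compose2[OF zr_cont]) (use t in \<open>auto intro!: continuous_intros\<close>)
  have "norm (y s) \<le> B'" if "s \<ge> 0" for s using b[of "min s t"] that t B' by (simp add: y_def)
  then interpret y: flow m K B' y by unfold_locales (use fl.m fl.K B' yc in auto)
  have "norm (z s) \<le> B'" if "s \<ge> 0" for s using fl.z_le[OF that] B' by simp
  then interpret z: flow m K B' z by unfold_locales (use fl.m fl.K B' fl.z_cont in auto)
  interpret y: kmatch g m K rho0 u0 B' y Ts r v t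
    by unfold_locales (use t in \<open>auto simp: y_def\<close>)
  have "y t = z t"
    by (rule mf_unique[OF y.flow_axioms z.flow_axioms, of t]) (use t y.mf_match mfz in \<open>auto simp: y_def\<close>)
  then show ?thesis by (simp add: y_def)
qed

lemma solution_unique:
  assumes t: "t \<in> {0..<T}" "t \<in> {0..<Ts}"
  shows "r t = fR t 0" "v t = fU t 0"
proof -
  interpret k: kmatch g m K rho0 u0 B z Ts r v t
    by unfold_locales (use t field_unique in auto)
  have tt: "t \<in> {0..t}" using t by simp
  show "v t = fU t 0"
    using k.v_along[OF tt, of "xi t x w" w for x w] by (simp add: fun_eq_iff fU_def GU_def xi_facts(1)[OF t(1)])
  show "r t = fR t 0"
  proof (intro ext)
    fix x w
    show "r t x w = fR t 0 x w"
      using k.r_along[OF tt, of "xi t x w" w] J_pos[OF t(1), of "xi t x w" w]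
      by (simp add: fR_def GR_def xi_facts(1)[OF t(1)] field_simps)
  qed
qed

end

section \<open>Global existence and blow-up\<close>

lemma Linf_norm_upper: "f \<in> Linf \<Longrightarrow> \<bar>f x w\<bar> \<le> Linf_norm f"
proof -
  assume "f \<in> Linf"
  then obtain C where "\<And>x w. \<bar>f x w\<bar> \<le> C" by (auto simp: Linf_def)
  then have "bdd_above (range (\<lambda>(x, w). \<bar>f x w\<bar>))" by (intro bdd_aboveI[of _ C]) auto
  from cSUP_upper[OF UNIV_I this, of "(x, w)"] show ?thesis by (simp add: Linf_norm_def)
qed

lemma Hg_norm_nonneg: "Hg_norm g s f \<ge> 0"
  unfolding Hg_norm_def by (intro real_sqrt_ge_zero sum_nonneg) auto

lemma state_norm_ge:
  assumes "f \<in> Linf"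
  shows "Linf_norm (dtheta h) \<le> state_norm g f h"
  using Linf_norm_upper[OF assms, of 0 0] Hg_norm_nonneg[of g 2 f] Hg_norm_nonneg[of g 3 h] unfolding state_norm_def by linarith

locale kmean = kflow g m K rho0 u0 B z for g m K rho0 u0 B z +
  assumes mfz: "\<And>t. t \<ge> 0 \<Longrightarrow> mf z t = z t" and z1: "\<And>t. t \<ge> 0 \<Longrightarrow> norm (z t) \<le> 1"
begin

lemma Al_z: "t > 0 \<Longrightarrow> \<bar>Al (z t) x\<bar> \<le> 1"
  using Al_le[of "z t" x] z1[of t] by linarith

text \<open>The rate is the larger root of \<open>m * l^2 - l + K\<close>, real because
  \<open>1 >= 4 * K * m\<close>; the threshold on \<open>u1\<close> says that
  \<open>W + l * J\<close> starts nonnegative.\<close>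

lemma J_subcritical:
  assumes d: "1 \<ge> 4 * K * m" and u: "u1 x w \<ge> (- 1 - sqrt (1 - 4 * K * m)) / (2 * m)" and t: "t \<ge> 0"
  shows "jJ t x w \<ge> exp (- ((1 + sqrt (1 - 4 * K * m)) / (2 * m)) * t)"
proof (rule riccati_subcritical[OF fl.m fl.K lag_tcont[OF fl.J_cont] lag_tcont[OF fl.W_cont] lag_time_deriv(3,4) _ _ _ _ t])
  define q where "q = sqrt (1 - 4 * K * m)"
  have q: "q\<^sup>2 = 1 - 4 * K * m" using d by (simp add: q_def)
  have "(1 + q) / (2 * m) - m * ((1 + q) / (2 * m))\<^sup>2 = (1 - q\<^sup>2) / (4 * m)"
    using fl.m by (simp add: field_simps power2_eq_square)
  then show "K = (1 + sqrt (1 - 4 * K * m)) / (2 * m) - m * ((1 + sqrt (1 - 4 * K * m)) / (2 * m))\<^sup>2"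
    unfolding q_def[symmetric] using fl.m q by simp
  show "Al (z s) (jX s x w) \<le> 1" if "s > 0" for s using Al_z[OF that, of "jX s x w"] by simp
  have "(- 1 - q) / (2 * m) = - ((1 + q) / (2 * m))" by (simp add: minus_divide_left[symmetric] diff_divide_distrib add_divide_distrib)
  then show "0 \<le> jW 0 x w + (1 + sqrt (1 - 4 * K * m)) / (2 * m)" using u by (simp add: lag_0 q_def[symmetric])
qed (simp_all add: lag_0)

lemma J_supercritical:
  assumes u: "u1 x w < (- 1 - sqrt (1 + 4 * K * m)) / (2 * m)"
  shows "\<exists>t\<ge>0. jJ t x w \<le> 0"
proof (rule riccati_supercritical[OF fl.m fl.K lag_tcont[OF fl.J_cont] lag_tcont[OF fl.W_cont] lag_time_deriv(3,4),
      where l = "(1 + sqrt (1 + 4 * K * m)) / (2 * m)"])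
  define q where "q = sqrt (1 + 4 * K * m)"
  have q: "q\<^sup>2 = 1 + 4 * K * m" "q \<ge> 0" using fl.m fl.K by (simp_all add: q_def)
  have "m * ((1 + q) / (2 * m))\<^sup>2 - (1 + q) / (2 * m) = (q\<^sup>2 - 1) / (4 * m)"
    using fl.m by (simp add: field_simps power2_eq_square)
  then show "K = m * ((1 + sqrt (1 + 4 * K * m)) / (2 * m))\<^sup>2 - (1 + sqrt (1 + 4 * K * m)) / (2 * m)"
    unfolding q_def[symmetric] using fl.m q by simp
  show "0 < (1 + sqrt (1 + 4 * K * m)) / (2 * m)" unfolding q_def[symmetric] using fl.m q by simp
  show "- 1 \<le> Al (z s) (jX s x w)" if "s > 0" for s using Al_z[OF that, of "jX s x w"] by simp
  have "(- 1 - q) / (2 * m) = - ((1 + q) / (2 * m))" by (simp add: minus_divide_left[symmetric] diff_divide_distrib add_divide_distrib)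
  then show "jW 0 x w + (1 + sqrt (1 + 4 * K * m)) / (2 * m) < 0" using u by (simp add: lag_0 q_def[symmetric])
qed (simp_all add: lag_0)

theorem subcritical:
  assumes d: "1 \<ge> 4 * K * m" and u: "\<And>x w. u1 x w \<ge> (- 1 - sqrt (1 - 4 * K * m)) / (2 * m)" and T: "T > 0"
  shows "strong_solution g m K rho0 u0 T (\<lambda>t. fR t 0) (\<lambda>t. fU t 0)"
proof -
  define l where "l = (1 + sqrt (1 - 4 * K * m)) / (2 * m)"
  have l: "l \<ge> 0" using fl.m d by (simp add: l_def)
  interpret kpos g m K rho0 u0 B z T
  proof
    fix \<tau> :: real assume "0 \<le> \<tau>" "\<tau> < T"
    show "\<exists>e>0. \<forall>t\<in>{0..\<tau>}. \<forall>x w. e \<le> jJ t x w"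
    proof (intro exI[of _ "exp (- l * \<tau>)"] conjI ballI allI)
      fix t x w assume t: "t \<in> {0..\<tau>}"
      then have "l * t \<le> l * \<tau>" using l by (intro mult_left_mono) auto
      then have "exp (- l * \<tau>) \<le> exp (- l * t)" by simp
      also have "\<dots> \<le> jJ t x w" unfolding l_def using t by (intro J_subcritical d u) auto
      finally show "exp (- l * \<tau>) \<le> jJ t x w" .
    qed simp
  qed
  show ?thesis by (rule eulerian_strong_solution[OF T]) (simp add: mfz)
qed

text \<open>The time \<open>d\<close> depends only on \<open>R\<close>, \<open>m\<close> and
  \<open>K\<close>, hence is common to all points of the cylinder; this makes the extension of the
  uniform lower bound possible.\<close>

lemma J_persists:
  "\<exists>d>0. \<forall>t\<ge>0. (\<forall>x w. jJ t x w > 0 \<and> \<bar>jW t x w\<bar> \<le> R * jJ t x w) \<longrightarrow> (\<forall>s\<in>{t..t + d}. \<forall>x w. jJ s x w \<ge> jJ t x w / 2)"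
proof -
  define C where "C = sqrt ((1 + R\<^sup>2) * exp (1 + K / m))"
  have "(1 + R\<^sup>2) * exp (1 + K / m) > 0" by (simp add: add_pos_nonneg)
  then have C: "C > 0" by (simp add: C_def)
  show ?thesis
  proof (intro exI[of _ "1 / (2 * C)"] conjI allI impI ballI)
    fix t s x w assume t: "t \<ge> 0" and J: "\<forall>x w. jJ t x w > 0 \<and> \<bar>jW t x w\<bar> \<le> R * jJ t x w" and s: "s \<in> {t..t + 1 / (2 * C)}"
    have "C * (s - t) \<le> C * (1 / (2 * C))" using s C by (intro mult_left_mono) auto
    then have Cs: "C * (s - t) \<le> 1 / 2" using C by simp
    show "jJ t x w / 2 \<le> jJ s x w"
      by (rule linear_ode_persists[OF fl.m fl.K lag_tcont[OF fl.J_cont] lag_tcont[OF fl.W_cont] lag_time_deriv(3,4) Al_z t _ _ C_def])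
        (use J s Cs in auto)
  qed (use C in simp)
qed

text \<open>Defined through the uniform lower bound and not through the first zero of
  \<open>J\<close>: for infinitely many frequencies the infimum may tend to zero before any single
  \<open>J\<close> vanishes.\<close>

definition lifespan :: "real set" where
  "lifespan = {t. t \<ge> 0 \<and> (\<exists>e>0. \<forall>s\<in>{0..t}. \<forall>x w. jJ s x w \<ge> e)}"

theorem supercritical:
  assumes u: "u1 x0 w0 < (- 1 - sqrt (1 + 4 * K * m)) / (2 * m)"
  shows "solution_blows_up g m K rho0 u0"
proof -
  define Tb where "Tb = Sup lifespan"
  obtain t0 where t0: "t0 \<ge> 0" "jJ t0 x0 w0 \<le> 0" using J_supercritical[OF u] by blast
  have bdd: "bdd_above lifespan"
  proof (rule bdd_aboveI[of _ t0])
    fix t assume "t \<in> lifespan"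
    then obtain e where "e > 0" "\<And>s x w. s \<in> {0..t} \<Longrightarrow> jJ s x w \<ge> e" by (auto simp: lifespan_def)
    then show "t \<le> t0" using t0 by (metis atLeastAtMost_iff linorder_le_cases not_le order_trans)
  qed
  \<comment> \<open>A bound \<open>e\<close> up to \<open>t\<close> and a loss of at most one half
    until \<open>t + d\<close> give the bound \<open>e / 2\<close> on the longer interval.\<close>
  have extend: "t + d \<le> Tb" if t: "t \<ge> 0" and e: "e > 0" "\<And>s x w. s \<in> {0..t} \<Longrightarrow> jJ s x w \<ge> e" and d: "d > 0"
    and J: "\<And>s x w. s \<in> {t..t + d} \<Longrightarrow> jJ s x w \<ge> jJ t x w / 2" for t e d
  proof -
    have "e / 2 \<le> jJ s x w" if "s \<in> {0..t + d}" for s x w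
    proof (cases "s \<le> t")
      case True
      then show ?thesis using e(2)[of s x w] e(1) that by auto
    next
      case False
      then show ?thesis using J[of s x w] e(2)[of t x w] that t by auto
    qed
    then have "t + d \<in> lifespan" using t d e(1) by (auto simp: lifespan_def intro!: exI[of _ "e / 2"])
    then show ?thesis unfolding Tb_def by (rule cSup_upper[OF _ bdd])
  qed
  have Tb0: "Tb > 0"
  proof -
    \<comment> \<open>At time 0 the quotient \<open>W / J\<close> is \<open>u1\<close>, which is
      bounded by \<open>M\<close>; so the flow persists for a positive time.\<close>
    obtain d where d: "d > 0" "\<And>s x w. s \<in> {0..d} \<Longrightarrow> jJ s x w \<ge> 1 / 2"
      using J_persists[of M] M(2) by (auto simp: lag_0)
    have "0 + d \<le> Tb" by (rule extend[of 0 1]) (use d in \<open>auto simp: lag_0\<close>)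
    then show ?thesis using d by simp
  qed
  have ne: "lifespan \<noteq> {}"
  proof -
    have "0 \<in> lifespan" by (auto simp: lifespan_def lag_0 intro!: exI[of _ 1])
    then show ?thesis by blast
  qed
  interpret kpos g m K rho0 u0 B z Tb
  proof
    fix \<tau> assume tau: "0 \<le> \<tau>" "\<tau> < Tb"
    then obtain t where "t \<in> lifespan" "\<tau> < t" unfolding Tb_def using less_cSup_iff[OF ne bdd] by blast
    then obtain e where e: "e > 0" "\<forall>s\<in>{0..t}. \<forall>x w. e \<le> jJ s x w" by (auto simp: lifespan_def)
    with \<open>\<tau> < t\<close> show "\<exists>e>0. \<forall>t\<in>{0..\<tau>}. \<forall>x w. e \<le> jJ t x w" by (intro exI[of _ e]) auto
  qed
  show ?thesis
    unfolding solution_blows_up_def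
  proof (rule exI[of _ Tb], rule conjI[OF Tb0], rule exI[of _ "\<lambda>t. fR t 0"], rule exI[of _ "\<lambda>t. fU t 0"], intro conjI allI impI)
    show "strong_solution g m K rho0 u0 Tb (\<lambda>t. fR t 0) (\<lambda>t. fU t 0)"
      by (rule eulerian_strong_solution[OF Tb0]) (simp add: mfz)
    fix T :: real and r v t assume "T > 0" and r: "strong_solution g m K rho0 u0 T r v" and t: "0 \<le> t \<and> t < min T Tb"
    interpret un: kunique g m K rho0 u0 B z Tb T r v by unfold_locales (use r mfz in auto)
    show "r t = fR t 0" "v t = fU t 0" using un.solution_unique[of t] t by auto
  next
    show "filterlim (\<lambda>t. state_norm g (fR t 0) (fU t 0)) at_top (at_left Tb)"
      unfolding filterlim_at_top
    proof
      fix R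
      obtain d where d: "d > 0" and pers: "\<And>t s x w. t \<ge> 0 \<Longrightarrow> (\<And>x w. jJ t x w > 0 \<and> \<bar>jW t x w\<bar> \<le> R * jJ t x w) \<Longrightarrow>
          s \<in> {t..t + d} \<Longrightarrow> jJ s x w \<ge> jJ t x w / 2" using J_persists[of R] by blast
      \<comment> \<open>If the norm were below \<open>R\<close> less than \<open>d\<close> before
        \<open>Tb\<close>, the slope \<open>W / J\<close> would be bounded by \<open>R\<close> and
        the lower bound would extend beyond \<open>Tb\<close>.\<close>
      have "R \<le> state_norm g (fR t 0) (fU t 0)" if t: "max 0 (Tb - d) < t" "t < Tb" for t
      proof (rule ccontr)
        have tt: "t \<in> {0..<Tb}" "0 \<le> t" using t by auto
        have Li: "fR t 0 \<in> Linf" "fU t 1 \<in> Linf" using f_locally_Linf tt unfolding locally_Linf_def by auto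
        assume "\<not> R \<le> state_norm g (fR t 0) (fU t 0)"
        then have L: "Linf_norm (fU t 1) < R" using state_norm_ge[OF Li(1), of "fU t 0" g] by (simp add: f_dtheta(1,2)[OF tt(1)])
        have W: "\<bar>jW t x w\<bar> \<le> R * jJ t x w" for x w
        proof -
          have "\<bar>jW t x w / jJ t x w\<bar> \<le> R"
            using Linf_norm_upper[OF Li(2), of "jX t x w" w] L by (simp add: fU_def GU_def xi_facts(2)[OF tt(1)])
          then show ?thesis using J_pos[OF tt(1), of x w] by (simp add: abs_divide field_simps)
        qed
        obtain e where e: "e > 0" "\<And>s x w. s \<in> {0..t} \<Longrightarrow> jJ s x w \<ge> e" using Jpos[OF tt(2) t(2)] by auto
        have "t + d \<le> Tb" by (rule extend[OF tt(2) e d pers[OF tt(2)]]) (use J_pos[OF tt(1)] W in auto)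
        then show False using t by simp
      qed
      then show "\<forall>\<^sub>F t in at_left Tb. R \<le> state_norm g (fR t 0) (fU t 0)"
        using Tb0 d by (intro eventually_at_left_field[THEN iffD2] exI[of _ "max 0 (Tb - d)"]) auto
    qed
  qed
qed

end

theorem theorem5p2:
  fixes g :: "real \<Rightarrow> real" and m K N :: real
    and \<rho>0 u0 :: "real \<Rightarrow> real \<Rightarrow> real"
  assumes m: "m > 0" and K: "K > 0"
    and g_nonneg: "\<And>\<Omega>. g \<Omega> \<ge> 0"
    and g_integrable: "integrable lborel g"
    and g_mass: "(\<integral>\<Omega>. g \<Omega> \<partial>lborel) = 1"
    and g_moment: "integrable lborel (\<lambda>\<Omega>. \<Omega>\<^sup>2 * g \<Omega>)"
    and data: "(\<rho>0, u0) \<in> state_space g"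
    and N: "N > 0" and data_bound: "state_norm g \<rho>0 u0 < N"
    and mass: "\<And>\<Omega>. (\<integral>\<theta>. \<rho>0 \<theta> \<Omega> \<partial>torus) = 1"
    and pos: "\<And>\<theta> \<Omega>. \<rho>0 \<theta> \<Omega> > 0"
  shows "(1 \<ge> 4 * K * m \<and>
           (\<forall>\<theta> \<Omega>. dtheta u0 \<theta> \<Omega> \<ge> (- 1 - sqrt (1 - 4 * K * m)) / (2 * m)) \<longrightarrow>
           (\<exists>\<rho> u. \<forall>T>0. strong_solution g m K \<rho>0 u0 T \<rho> u)) \<and>
         ((\<exists>\<theta> \<Omega>. dtheta u0 \<theta> \<Omega> < (- 1 - sqrt (1 + 4 * K * m)) / (2 * m)) \<longrightarrow>
           solution_blows_up g m K \<rho>0 u0)"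
proof -
  interpret kdata g m K \<rho>0 u0
    by unfold_locales (fact g_nonneg g_integrable m K g_mass g_moment data mass pos)+
  obtain z where z: "continuous_on {0..} z" "\<And>t. t \<ge> 0 \<Longrightarrow> norm (z t) \<le> 1" "\<And>t. t \<ge> 0 \<Longrightarrow> mf z t = z t"
    using mf_fixed by blast
  interpret kmean g m K \<rho>0 u0 1 z by unfold_locales (use m K z in auto)
  \<comment> \<open>The fields \<open>fR\<close> and \<open>fU\<close> do not depend on
    \<open>T\<close>, so in the subcritical case one pair serves every time horizon.\<close>
  show ?thesis
    using subcritical supercritical unfolding u1_def by blast
qed

end
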